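(* Let $T>0$, let $g:[0,1]\to\mathbb R$ be non-decreasing and càdlàg with $\int_0^1|g(u)|^p\,\mathrm du<\infty$ for some $p>2$, and let $\sigma>0$ and $\varepsilon>0$. Then the map $\psi:\mathcal M\to\mathcal M$ defined by $$\psi(z)(\omega,u,t):=g(u)+\int_0^t\int_0^1\frac{\varphi_\sigma(z(\omega,u,s)-z(\omega,u',s))}{\varepsilon+m_\sigma(\omega,u,s)}\,\mathrm dw(\omega,u',s),\qquad m_\sigma(\omega,u,s)=\int_0^1\varphi_\sigma^2(z(\omega,u,s)-z(\omega,v,s))\,\mathrm dv,$$ has a unique fixed point in $\mathcal M$.
   Context: $(\Omega,\mathcal F,\mathbb P)$ is a probability space carrying a Brownian sheet $w$ on $[0,1]\times[0,T]$ (that is, $w(u,t)=W((0,u]\times(0,t])$ for a white noise $W$ based on Lebesgue measure), and $\mathcal G_t=\sigma(w(u,s),u\in[0,1],s\le t)$, completed so that $\mathcal G_0$ contains all $\mathbb P$-null sets and assumed right-continuous. Integrals $\int\int f\,\mathrm dw$ are stochastic integrals of $(\mathcal G_t)$-progressively measurable integrands. $\varphi_\sigma:\mathbb R\to\mathbb R$ is a fixed smooth even function, bounded by $1$, equal to $1$ on $[0,\frac\sigma3]$ and to $0$ on $[\frac\sigma2,+\infty)$. $\mathcal M$ is the set of random variables $z\in L_2(\Omega,\mathcal C([0,T],L_2(0,1)))$ such that $(z(\omega,\cdot,t))_{t\in[0,T]}$ is a $(\mathcal G_t)_{t\in[0,T]}$-progressively measurable process with values in $L_2(0,1)$, with norm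 $\|z\|_{\mathcal M}=\mathbb E\left[\sup_{t\le T}\int_0^1|z(u,t)|^2\,\mathrm du\right]^{1/2}$. *)

theory Defs
  imports "HOL-Probability.Probability"
begin

abbreviation leb01 :: "real measure" where
  "leb01 \<equiv> restrict_space lborel {0..1}"

text \<open>A white noise on \<open>[0,1] \<times> [0,T]\<close> based on Lebesgue measure: a family of centred Gaussian
  variables with variance equal to the Lebesgue measure, independent and a.s. additive on disjoint
  sets. The degenerate law \<open>N(0,0)\<close> has no Lebesgue density and is treated separately.\<close>

definition white_noise_sets :: "real \<Rightarrow> (real \<times> real) set set" where
  "white_noise_sets T = {A \<in> sets borel. A \<subseteq> {0..1} \<times> {0..T}}"

definition white_noise :: "'a measure \<Rightarrow> real \<Rightarrow> ((real \<times> real) set \<Rightarrow> 'a \<Rightarrow> real) \<Rightarrow> bool" where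
  "white_noise P T W \<longleftrightarrow>
     (\<forall>A\<in>white_noise_sets T. W A \<in> borel_measurable P \<and>
        (if measure lborel A = 0 then AE \<omega> in P. W A \<omega> = 0
         else distributed P lborel (W A) (normal_density 0 (sqrt (measure lborel A))))) \<and>
     (\<forall>\<A>. finite \<A> \<and> \<A> \<subseteq> white_noise_sets T \<and> disjoint \<A> \<longrightarrow>
        prob_space.indep_vars P (\<lambda>_. borel) W \<A>) \<and>
     (\<forall>A\<in>white_noise_sets T. \<forall>B\<in>white_noise_sets T. A \<inter> B = {} \<longrightarrow>
        (AE \<omega> in P. W (A \<union> B) \<omega> = W A \<omega> + W B \<omega>))"

definition brownian_sheet ::
    "((real \<times> real) set \<Rightarrow> 'a \<Rightarrow> real) \<Rightarrow> real \<Rightarrow> real \<Rightarrow> 'a \<Rightarrow> real" where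
  "brownian_sheet W u t = W ({0<..u} \<times> {0<..t})"

definition sheet_filtration ::
    "'a measure \<Rightarrow> (real \<Rightarrow> real \<Rightarrow> 'a \<Rightarrow> real) \<Rightarrow> real \<Rightarrow> 'a measure" where
  "sheet_filtration P w t =
     sigma (space P)
       ({w u s -` B \<inter> space P | u s B. u \<in> {0..1} \<and> s \<in> {0..t} \<and> B \<in> sets borel} \<union> null_sets P)"

definition right_continuous_filtration :: "real \<Rightarrow> (real \<Rightarrow> 'a measure) \<Rightarrow> bool" where
  "right_continuous_filtration T G \<longleftrightarrow>
     (\<forall>t\<in>{0..<T}. sets (G t) = (\<Inter>s\<in>{t<..T}. sets (G s)))"

text \<open>Elements of \<open>L\<^sub>2(0,1)\<close> are represented by functions; open sets are those of the
  \<open>L\<^sub>2\<close> seminorm, hence saturated for almost everywhere equality, so that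
  \<open>L2_borel\<close> is the Borel \<open>\<sigma>\<close>-algebra of \<open>L\<^sub>2(0,1)\<close> pulled back to representatives.\<close>

definition L2_funs :: "(real \<Rightarrow> real) set" where
  "L2_funs = {f \<in> borel_measurable leb01. integrable leb01 (\<lambda>u. (f u)\<^sup>2)}"

definition L2_norm :: "(real \<Rightarrow> real) \<Rightarrow> real" where
  "L2_norm f = sqrt (\<integral>u. (f u)\<^sup>2 \<partial>leb01)"

definition L2_open :: "(real \<Rightarrow> real) set \<Rightarrow> bool" where
  "L2_open U \<longleftrightarrow> U \<subseteq> L2_funs \<and>
     (\<forall>f\<in>U. \<exists>r>0. \<forall>h\<in>L2_funs. L2_norm (\<lambda>u. h u - f u) < r \<longrightarrow> h \<in> U)"

definition L2_borel :: "(real \<Rightarrow> real) measure" where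
  "L2_borel = sigma L2_funs {U. L2_open U}"

text \<open>The arguments of a process are \<open>(\<omega>,u,t)\<close>, in this order.\<close>

type_synonym 'a field_process = "'a \<Rightarrow> real \<Rightarrow> real \<Rightarrow> real"

definition L2_progressive :: "real \<Rightarrow> (real \<Rightarrow> 'a measure) \<Rightarrow> 'a field_process \<Rightarrow> bool" where
  "L2_progressive T G z \<longleftrightarrow>
     (\<forall>t\<in>{0..T}. (\<lambda>(s, \<omega>). (\<lambda>u. z \<omega> u s))
        \<in> measurable (restrict_space borel {0..t} \<Otimes>\<^sub>M G t) L2_borel)"

definition L2_continuous :: "real \<Rightarrow> (real \<Rightarrow> real \<Rightarrow> real) \<Rightarrow> bool" where
  "L2_continuous T x \<longleftrightarrow>
     (\<forall>t\<in>{0..T}. (\<lambda>u. x u t) \<in> L2_funs \<and>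
        ((\<lambda>s. L2_norm (\<lambda>u. x u s - x u t)) \<longlongrightarrow> 0) (at t within {0..T}))"

definition M_norm_sq :: "'a measure \<Rightarrow> real \<Rightarrow> 'a field_process \<Rightarrow> ennreal" where
  "M_norm_sq P T z =
     (\<integral>\<^sup>+ \<omega>. (SUP t\<in>{0..T}. \<integral>\<^sup>+ u. ennreal ((z \<omega> u t)\<^sup>2) \<partial>leb01) \<partial>P)"

text \<open>Measurability of \<open>\<omega> \<mapsto> z(\<omega>)\<close> into \<open>C([0,T], L\<^sub>2(0,1))\<close> follows from progressive
  measurability and path continuity.\<close>

definition M_processes ::
    "'a measure \<Rightarrow> real \<Rightarrow> (real \<Rightarrow> 'a measure) \<Rightarrow> 'a field_process set" where
  "M_processes P T G =
     {z. (\<forall>\<omega>\<in>space P. L2_continuous T (z \<omega>)) \<and> L2_progressive T G z \<and> M_norm_sq P T z < \<infinity>}"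

text \<open>Equality of elements of \<open>L\<^sub>2(\<Omega>, C([0,T], L\<^sub>2(0,1)))\<close>.\<close>

definition M_eq ::
    "'a measure \<Rightarrow> real \<Rightarrow> (real \<Rightarrow> 'a measure) \<Rightarrow> ('a field_process \<times> 'a field_process) set" where
  "M_eq P T G =
     {(z, z'). z \<in> M_processes P T G \<and> z' \<in> M_processes P T G \<and>
        (AE \<omega> in P. \<forall>t\<in>{0..T}. AE u in leb01. z \<omega> u t = z' \<omega> u t)}"

definition M_space ::
    "'a measure \<Rightarrow> real \<Rightarrow> (real \<Rightarrow> 'a measure) \<Rightarrow> 'a field_process set set" where
  "M_space P T G = M_processes P T G // M_eq P T G"

definition jointly_progressive :: "real \<Rightarrow> (real \<Rightarrow> 'a measure) \<Rightarrow> 'a field_process \<Rightarrow> bool" where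
  "jointly_progressive T G f \<longleftrightarrow>
     (\<forall>t\<in>{0..T}. (\<lambda>(s, \<omega>, u). f \<omega> u s)
        \<in> borel_measurable (restrict_space borel {0..t} \<Otimes>\<^sub>M (G t \<Otimes>\<^sub>M leb01)))"

text \<open>A list entry \<open>(X, a, b, c, d)\<close> stands for the elementary integrand
  \<open>X(\<omega>) 1\<^bsub>(c,d]\<^esub>(u) 1\<^bsub>(a,b]\<^esub>(s)\<close>.\<close>

type_synonym 'a simple_data = "(('a \<Rightarrow> real) \<times> real \<times> real \<times> real \<times> real) list"

definition simple_integrand ::
    "'a measure \<Rightarrow> real \<Rightarrow> (real \<Rightarrow> 'a measure) \<Rightarrow> 'a simple_data \<Rightarrow> bool" where
  "simple_integrand P T G F \<longleftrightarrow>
     (\<forall>(X, a, b, c, d)\<in>set F.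
        0 \<le> a \<and> a \<le> b \<and> b \<le> T \<and> 0 \<le> c \<and> c \<le> d \<and> d \<le> 1 \<and>
        X \<in> borel_measurable (G a) \<and> (\<exists>K. \<forall>\<omega>\<in>space P. \<bar>X \<omega>\<bar> \<le> K))"

definition simple_eval :: "'a simple_data \<Rightarrow> 'a field_process" where
  "simple_eval F \<omega> u s =
     (\<Sum>(X, a, b, c, d)\<leftarrow>F. X \<omega> * indicator {c<..d} u * indicator {a<..b} s)"

definition simple_integral ::
    "(real \<Rightarrow> real \<Rightarrow> 'a \<Rightarrow> real) \<Rightarrow> 'a simple_data \<Rightarrow> real \<Rightarrow> 'a \<Rightarrow> real" where
  "simple_integral w F t \<omega> =
     (\<Sum>(X, a, b, c, d)\<leftarrow>F. X \<omega> *
        (w d (min b t) \<omega> - w c (min b t) \<omega> - w d (min a t) \<omega> + w c (min a t) \<omega>))"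

text \<open>\<open>Y\<close> is a version of the stochastic integral
  \<open>\<integral>\<^sub>0\<^sup>t \<integral>\<^sub>0\<^sup>1 f(\<omega>,u,s) dw(\<omega>,u,s)\<close>, the \<open>L\<^sub>2\<close>-limit of integrals of simple integrands
  converging to \<open>f\<close> in \<open>L\<^sub>2(\<Omega> \<times> [0,1] \<times> [0,t])\<close>.\<close>

definition has_sheet_integral ::
    "'a measure \<Rightarrow> real \<Rightarrow> (real \<Rightarrow> 'a measure) \<Rightarrow> (real \<Rightarrow> real \<Rightarrow> 'a \<Rightarrow> real) \<Rightarrow>
     'a field_process \<Rightarrow> real \<Rightarrow> ('a \<Rightarrow> real) \<Rightarrow> bool" where
  "has_sheet_integral P T G w f t Y \<longleftrightarrow>
     jointly_progressive T G f \<and> Y \<in> borel_measurable P \<and>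
     (\<exists>F. (\<forall>n. simple_integrand P T G (F n)) \<and>
        (\<lambda>n. \<integral>\<^sup>+ \<omega>. (\<integral>\<^sup>+ s. (\<integral>\<^sup>+ u. ennreal ((simple_eval (F n) \<omega> u s - f \<omega> u s)\<^sup>2) \<partial>leb01)
               \<partial>restrict_space lborel {0..t}) \<partial>P) \<longlonglongrightarrow> 0 \<and>
        (\<lambda>n. \<integral>\<^sup>+ \<omega>. ennreal ((simple_integral w (F n) t \<omega> - Y \<omega>)\<^sup>2) \<partial>P) \<longlonglongrightarrow> 0)"

definition smooth_cutoff :: "real \<Rightarrow> (real \<Rightarrow> real) \<Rightarrow> bool" where
  "smooth_cutoff \<sigma> \<phi> \<longleftrightarrow>
     (\<forall>n x. ((deriv ^^ n) \<phi>) differentiable (at x)) \<and>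
     (\<forall>x. \<phi> (- x) = \<phi> x) \<and> (\<forall>x. \<bar>\<phi> x\<bar> \<le> 1) \<and>
     (\<forall>x\<in>{0..\<sigma>/3}. \<phi> x = 1) \<and> (\<forall>x\<in>{\<sigma>/2..}. \<phi> x = 0)"

definition cadlag01 :: "(real \<Rightarrow> real) \<Rightarrow> bool" where
  "cadlag01 g \<longleftrightarrow>
     (\<forall>u\<in>{0..<1}. continuous (at_right u) g) \<and> (\<forall>u\<in>{0<..1}. \<exists>l. (g \<longlongrightarrow> l) (at_left u))"

definition mass :: "(real \<Rightarrow> real) \<Rightarrow> 'a field_process \<Rightarrow> 'a field_process" where
  "mass \<phi> z \<omega> u s = (\<integral>v. (\<phi> (z \<omega> u s - z \<omega> v s))\<^sup>2 \<partial>leb01)"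

definition psi_integrand ::
    "(real \<Rightarrow> real) \<Rightarrow> real \<Rightarrow> 'a field_process \<Rightarrow> real \<Rightarrow> 'a field_process" where
  "psi_integrand \<phi> \<epsilon> z u \<omega> u' s = \<phi> (z \<omega> u s - z \<omega> u' s) / (\<epsilon> + mass \<phi> z \<omega> u s)"

text \<open>The map acts on classes. Its formula is pointwise in \<open>u\<close>, so it is evaluated on jointly
  progressive representatives, which exist in every class. As
  elements of \<open>L\<^sub>2(0,1)\<close> and stochastic integrals are defined almost everywhere only, the formula is
  imposed, for every \<open>t\<close>, at almost every \<open>u\<close>, almost surely; by path continuity
  this determines the class.\<close>

definition psi ::
    "'a measure \<Rightarrow> real \<Rightarrow> (real \<Rightarrow> 'a measure) \<Rightarrow> (real \<Rightarrow> real \<Rightarrow> 'a \<Rightarrow> real) \<Rightarrow>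
     (real \<Rightarrow> real) \<Rightarrow> real \<Rightarrow> (real \<Rightarrow> real) \<Rightarrow> 'a field_process set \<Rightarrow> 'a field_process set" where
  "psi P T G w \<phi> \<epsilon> g Z =
     {y. \<exists>z\<in>Z. \<exists>y'. jointly_progressive T G z \<and> jointly_progressive T G y' \<and>
        (y', y) \<in> M_eq P T G \<and>
        (\<forall>t\<in>{0..T}. AE u in leb01.
           has_sheet_integral P T G w (psi_integrand \<phi> \<epsilon> z u) t (\<lambda>\<omega>. y' \<omega> u t - g u))}"

end

theory Submission
  imports Defs
begin

text \<open>With an exponential weight in time, the map is a contraction for the mean square norm in which the
  supremum over time stands outside the expectation, and stochastic integration always produces a process
  with continuous paths. So the fixed point is found in the weaker norm, and continuity of its paths comes
  from the equation; no maximal inequality for martingales is involved.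

  \<^bold>\<open>Contraction.\<close> Since \<open>\<phi>\<close> is bounded by \<open>1\<close> and Lipschitz, and the denominator is at least \<open>\<epsilon>\<close>, the kernel
  \<open>\<phi>(z(u) - z(u')) / (\<epsilon> + m(u))\<close> is Lipschitz in \<open>z\<close> as a map from \<open>L\<^sub>2(0,1)\<close> to \<open>L\<^sub>2((0,1)\<^sup>2)\<close>
  (\<open>kernel_lipschitz\<close>). The isometry of the stochastic integral (\<open>simple_isometry\<close>,
  \<open>has_sheet_integral_stability\<close>) then gives, for the mean square distances \<open>d\<close>,
  \<open>d(\<psi>(z),\<psi>(z'))(t) \<le> C \<integral>\<^sub>0\<^sup>t d(z,z')(s) ds\<close> (\<open>psi_value_stability\<close>). Iterating with the weight
  \<open>exp(4Ct)\<close> yields a factor \<open>1/4\<close> per step (\<open>volterra_iterate\<close>). Hence two fixed points agree in mean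
  square at every time, and by path continuity they are indistinguishable (\<open>M_eqI\<close>). For existence, the
  Picard iterates converge so fast that they converge pointwise almost everywhere; the pointwise limit is
  progressive, its image under \<open>\<psi>\<close> agrees with it at every time, and this image is the fixed point.

  \<^bold>\<open>Existence of the integrals.\<close> A bounded progressive integrand is approximated by its averages over grid
  cells, each delayed by one time column so that the coefficient is known when its cell starts
  (\<open>lag_avg_converges\<close>). The coefficients are explicit integrals, so they depend measurably on the
  parameter \<open>u\<close>, and the limit is a measurable field in \<open>(\<omega>,u)\<close> for each \<open>t\<close>.

  \<^bold>\<open>Continuity.\<close> The noise has no continuous paths given in advance. The increments of the integral of an
  integrand bounded by \<open>K\<close> satisfy \<open>E(Y\<^sub>t - Y\<^sub>s)\<^sup>4 \<le> 3 K\<^sup>4 (t - s)\<^sup>2\<close> (\<open>simple_fourth_moment\<close>), so Kolmogorov's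
  argument on the grids of mesh \<open>T / 32\<^sup>n\<close> applies to the \<open>L\<^sub>2(0,1)\<close>-valued process
  (\<open>continuous_version\<close>). It also bounds the supremum of the norm by an integrable variable, which is
  what membership in \<open>\<M>\<close> requires.

  \<^bold>\<open>Representatives.\<close> The map acts on classes, but its formula needs jointly progressive representatives.
  Both directions between joint measurability and measurability into \<open>L\<^sub>2(0,1)\<close> come from a countable
  dense set of step functions (\<open>measurable_L2_borel\<close>, \<open>repr_jointly_measurable\<close>).\<close>

section \<open>Independence of white noise on disjoint sets\<close>

locale sheet_noise = prob_space P for P :: "'a measure" +
  fixes W :: "(real \<times> real) set \<Rightarrow> 'a \<Rightarrow> real" and T :: real
  assumes T_pos: "T > 0" and noise: "white_noise P T W"
begin

abbreviation "cells \<equiv> white_noise_sets T"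

abbreviation "w \<equiv> brownian_sheet W"

abbreviation "G \<equiv> sheet_filtration P w"

lemma noise_measurable [measurable]: "A \<in> cells \<Longrightarrow> W A \<in> borel_measurable P"
  using noise by (auto simp: white_noise_def)

lemma noise_null: "A \<in> cells \<Longrightarrow> measure lborel A = 0 \<Longrightarrow> AE \<omega> in P. W A \<omega> = 0"
  using noise unfolding white_noise_def by presburger

lemma noise_normal:
  "A \<in> cells \<Longrightarrow> measure lborel A \<noteq> 0 \<Longrightarrow>
     distributed P lborel (W A) (normal_density 0 (sqrt (measure lborel A)))"
  using noise unfolding white_noise_def by presburger

lemma noise_indep:
  "finite \<A> \<Longrightarrow> \<A> \<subseteq> cells \<Longrightarrow> disjoint \<A> \<Longrightarrow> indep_vars (\<lambda>_. borel) W \<A>"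
  using noise by (auto simp: white_noise_def)

lemma noise_add:
  "A \<in> cells \<Longrightarrow> B \<in> cells \<Longrightarrow> A \<inter> B = {} \<Longrightarrow> AE \<omega> in P. W (A \<union> B) \<omega> = W A \<omega> + W B \<omega>"
  using noise by (auto simp: white_noise_def)

lemma cells_empty [simp]: "{} \<in> cells"
  by (auto simp: white_noise_sets_def)

lemma cells_Un: "A \<in> cells \<Longrightarrow> B \<in> cells \<Longrightarrow> A \<union> B \<in> cells"
  by (auto simp: white_noise_sets_def)

lemma cells_Diff: "A \<in> cells \<Longrightarrow> B \<in> cells \<Longrightarrow> A - B \<in> cells"
  by (auto simp: white_noise_sets_def)

lemma cells_Int: "A \<in> cells \<Longrightarrow> B \<in> cells \<Longrightarrow> A \<inter> B \<in> cells"
  by (auto simp: white_noise_sets_def)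

lemma cells_Union: "finite \<A> \<Longrightarrow> \<A> \<subseteq> cells \<Longrightarrow> \<Union>\<A> \<in> cells"
  by (induction \<A> rule: finite_induct) (auto intro: cells_Un)

lemma cells_fmeasurable: "A \<in> cells \<Longrightarrow> A \<in> fmeasurable lborel"
proof -
  assume A: "A \<in> cells"
  have "bounded A"
    by (rule bounded_subset[of "{0..1} \<times> {0..T}"])
      (use A in \<open>auto simp: white_noise_sets_def intro: bounded_Times\<close>)
  then show ?thesis using A by (auto simp: white_noise_sets_def intro: fmeasurableI emeasure_bounded_finite)
qed

text \<open>The white noise is additive only almost surely and only for two sets at a time; finite families are
  enough for the atoms of a finite algebra of sets.\<close>

lemma noise_Union:
  assumes "finite \<A>" "\<A> \<subseteq> cells" "disjoint \<A>"
  shows "AE \<omega> in P. W (\<Union>\<A>) \<omega> = (\<Sum>A\<in>\<A>. W A \<omega>)"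
  using assms
proof (induction \<A> rule: finite_induct)
  case empty
  show ?case using noise_null[of "{}"] by simp
next
  case (insert A \<A>)
  have dj: "A \<inter> \<Union>\<A> = {}"
    using insert.prems insert.hyps by (auto simp: disjoint_def)
  have "disjoint \<A>" using insert.prems by (auto simp: disjoint_def)
  then have "AE \<omega> in P. W (\<Union>\<A>) \<omega> = (\<Sum>A\<in>\<A>. W A \<omega>)" using insert by auto
  moreover have "AE \<omega> in P. W (A \<union> \<Union>\<A>) \<omega> = W A \<omega> + W (\<Union>\<A>) \<omega>"
    using insert.prems insert.hyps dj by (intro noise_add cells_Union) auto
  ultimately show ?case
  proof eventually_elim
    case (elim \<omega>)
    then show ?case using insert.hyps by simp
  qed
qed

text \<open>The \<open>\<sigma>\<close>-algebra of the noise off \<open>C\<close>. It contains the past of any set lying after a given time, and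
  also the noise in other cells of the same time column, so that the cells of a grid can be revealed one
  by one.\<close>

definition outside :: "(real \<times> real) set \<Rightarrow> 'a measure" where
  "outside C = sigma (space P)
     ({W A -` B \<inter> space P | A B. A \<in> cells \<and> A \<inter> C = {} \<and> B \<in> sets borel} \<union> null_sets P)"

lemma outside_gen_sub:
  "{W A -` B \<inter> space P | A B. A \<in> cells \<and> A \<inter> C = {} \<and> B \<in> sets borel} \<union> null_sets P \<subseteq> sets P"
  by (auto intro: measurable_sets[OF noise_measurable])

lemma space_outside [simp]: "space (outside C) = space P"
  unfolding outside_def using sets.space_closed[of P] outside_gen_sub[of C]
  by (intro space_measure_of) blast

lemma sets_outside: "sets (outside C) = sigma_sets (space P)
     ({W A -` B \<inter> space P | A B. A \<in> cells \<and> A \<inter> C = {} \<and> B \<in> sets borel} \<union> null_sets P)"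
  unfolding outside_def using sets.space_closed[of P] outside_gen_sub[of C]
  by (intro sets_measure_of) blast

lemma sets_outside_sub: "sets (outside C) \<subseteq> sets P"
  unfolding sets_outside using outside_gen_sub by (rule sets.sigma_sets_subset)

lemma measurable_from_sub:
  assumes "space M = space N" "sets M \<subseteq> sets N" "f \<in> measurable M L"
  shows "f \<in> measurable N L"
  using assms by (auto simp: measurable_def)

lemma outside_measurable: "f \<in> measurable (outside C) L \<Longrightarrow> f \<in> measurable P L"
  by (rule measurable_from_sub[OF _ sets_outside_sub]) auto

lemma noise_outside: "A \<in> cells \<Longrightarrow> A \<inter> C = {} \<Longrightarrow> W A \<in> borel_measurable (outside C)"
  by (rule measurableI) (auto simp: sets_outside)

text \<open>The sets of \<open>\<A>\<close> may overlap, while independence is given for disjoint families only. Each \<open>A \<in> \<A>\<close>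
  is the disjoint union of atoms of the algebra generated by \<open>\<A>\<close>, and \<open>W A\<close> is almost surely the sum of
  the noise of these atoms.\<close>

lemma indep_finite_family:
  assumes C: "C \<in> cells" "C \<noteq> {}" and fin: "finite \<A>" and sub: "\<A> \<subseteq> cells"
    and dj: "\<And>A. A \<in> \<A> \<Longrightarrow> A \<inter> C = {}" and S: "\<And>A. S A \<in> sets borel" and B: "B \<in> sets borel"
  shows "prob ({\<omega>\<in>space P. \<forall>A\<in>\<A>. W A \<omega> \<in> S A} \<inter> (W C -` B \<inter> space P)) =
     prob {\<omega>\<in>space P. \<forall>A\<in>\<A>. W A \<omega> \<in> S A} * prob (W C -` B \<inter> space P)"
proof -
  \<comment> \<open>the points of the union that lie in exactly the members of \<open>S\<close>\<close>
  define atom where "atom S = {x\<in>\<Union>\<A>. \<forall>A\<in>\<A>. x \<in> A \<longleftrightarrow> A \<in> S}" for S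
  define \<B> where "\<B> = atom ` Pow \<A>"
  have atom_cell: "atom S \<in> cells" for S
  proof -
    have "atom S = \<Union>\<A> \<inter> {x\<in>space borel. \<forall>A\<in>\<A>. x \<in> A \<longleftrightarrow> A \<in> S}"
      by (auto simp: atom_def)
    also have "\<dots> \<in> sets borel"
    proof (rule sets.Int)
      show "\<Union>\<A> \<in> sets borel" using cells_Union[OF fin sub] by (auto simp: white_noise_sets_def)
      show "{x\<in>space borel. \<forall>A\<in>\<A>. x \<in> A \<longleftrightarrow> A \<in> S} \<in> sets borel"
      proof (rule sets.sets_Collect_finite_All[OF _ fin])
        fix A assume "A \<in> \<A>"
        then have [measurable]: "A \<in> sets borel" using sub by (auto simp: white_noise_sets_def)
        show "{x\<in>space borel. x \<in> A \<longleftrightarrow> A \<in> S} \<in> sets borel" by measurable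
      qed
    qed
    finally show ?thesis
      using cells_Union[OF fin sub] by (auto simp: white_noise_sets_def atom_def)
  qed
  have fB: "finite \<B>" using fin by (auto simp: \<B>_def)
  have BC: "\<B> \<subseteq> cells" using atom_cell by (auto simp: \<B>_def)
  have djB: "disjoint \<B>" by (auto simp: \<B>_def disjoint_def atom_def)
  have B_C: "E \<inter> C = {}" if "E \<in> \<B>" for E using that dj by (auto simp: \<B>_def atom_def)
  have nC: "C \<notin> \<B>" using B_C C by auto
  have djBC: "disjoint (insert C \<B>)" using djB B_C by (auto simp: disjoint_def)
  have A_Un: "A = \<Union>{E\<in>\<B>. E \<subseteq> A}" if A: "A \<in> \<A>" for A
  proof (intro equalityI subsetI)
    fix x assume x: "x \<in> A"
    have "x \<in> atom {D\<in>\<A>. x \<in> D}" using x A by (auto simp: atom_def)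
    moreover have "atom {D\<in>\<A>. x \<in> D} \<subseteq> A" using x A by (auto simp: atom_def)
    ultimately show "x \<in> \<Union>{E\<in>\<B>. E \<subseteq> A}" by (auto simp: \<B>_def)
  qed auto
  have A_sum: "AE \<omega> in P. W A \<omega> = (\<Sum>E\<in>{E\<in>\<B>. E \<subseteq> A}. W E \<omega>)" if A: "A \<in> \<A>" for A
  proof -
    have "AE \<omega> in P. W (\<Union>{E\<in>\<B>. E \<subseteq> A}) \<omega> = (\<Sum>E\<in>{E\<in>\<B>. E \<subseteq> A}. W E \<omega>)"
      using fB BC djB by (intro noise_Union) (auto simp: disjoint_def)
    then show ?thesis using A_Un[OF A] by simp
  qed
  define Ev where "Ev = {\<omega>\<in>space P. \<forall>A\<in>\<A>. (\<Sum>E\<in>{E\<in>\<B>. E \<subseteq> A}. W E \<omega>) \<in> S A}"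
  define gen where "gen E = {W E -` S \<inter> space P | S. S \<in> sets borel}" for E
  have "indep_vars (\<lambda>_. borel) W (insert C \<B>)"
    using fB BC C djBC by (intro noise_indep) auto
  then have ind: "indep_sets gen (insert C \<B>)" unfolding gen_def indep_vars_def2 by auto
  define I where "I b = (if b then \<B> else {C})" for b
  have I_un: "insert C \<B> = (\<Union>b\<in>UNIV. I b)" by (auto simp: I_def split: if_splits)
  have ind2: "indep_sets (\<lambda>b. sigma_sets (space P) (\<Union>i\<in>I b. gen i)) UNIV"
  proof (rule indep_sets_collect_sigma)
    show "indep_sets gen (\<Union>b\<in>UNIV. I b)" using ind I_un by simp
    show "Int_stable (gen i)" for i
    proof (unfold gen_def, rule Int_stableI, safe)
      fix S T :: "real set" assume "S \<in> sets borel" "T \<in> sets borel"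
      then show "\<exists>U. W i -` S \<inter> space P \<inter> (W i -` T \<inter> space P) = W i -` U \<inter> space P \<and> U \<in> sets borel"
        by (intro exI[of _ "S \<inter> T"]) auto
    qed
    show "disjoint_family_on I UNIV" using nC by (auto simp: disjoint_family_on_def I_def)
  qed
  define \<F> where "\<F> = sigma (space P) (\<Union>E\<in>\<B>. gen E)"
  have gsub: "(\<Union>E\<in>\<B>. gen E) \<subseteq> Pow (space P)" by (auto simp: gen_def)
  have sF: "space \<F> = space P" "sets \<F> = sigma_sets (space P) (\<Union>E\<in>\<B>. gen E)"
    using gsub by (auto simp: \<F>_def space_measure_of sets_measure_of)
  have [measurable]: "W E \<in> borel_measurable \<F>" if "E \<in> \<B>" for E
    using that by (intro measurableI) (auto simp: sF gen_def intro!: sigma_sets.Basic)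
  have "Ev \<in> sets \<F>"
  proof -
    have "{\<omega>\<in>space \<F>. \<forall>A\<in>\<A>. (\<Sum>E\<in>{E\<in>\<B>. E \<subseteq> A}. W E \<omega>) \<in> S A} \<in> sets \<F>"
    proof (rule sets.sets_Collect_finite_All[OF _ fin])
      fix A assume "A \<in> \<A>"
      have [measurable]: "S A \<in> sets borel" by (rule S)
      have [measurable]: "(\<lambda>\<omega>. \<Sum>E\<in>{E\<in>\<B>. E \<subseteq> A}. W E \<omega>) \<in> borel_measurable \<F>"
        by (rule borel_measurable_sum) auto
      show "{\<omega>\<in>space \<F>. (\<Sum>E\<in>{E\<in>\<B>. E \<subseteq> A}. W E \<omega>) \<in> S A} \<in> sets \<F>" by measurable
    qed
    then show ?thesis by (simp add: Ev_def sF)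
  qed
  then have EvS: "Ev \<in> sigma_sets (space P) (\<Union>i\<in>I True. gen i)" by (simp add: sF I_def)
  have FS: "W C -` B \<inter> space P \<in> sigma_sets (space P) (\<Union>i\<in>I False. gen i)"
    using B by (intro sigma_sets.Basic) (auto simp: I_def gen_def)
  have prod: "prob (Ev \<inter> (W C -` B \<inter> space P)) = prob Ev * prob (W C -` B \<inter> space P)"
    using indep_setsD[OF ind2, of UNIV "\<lambda>b. if b then Ev else W C -` B \<inter> space P"] EvS FS
    by (simp add: UNIV_bool ac_simps)
  have AEv: "AE \<omega> in P. \<omega> \<in> {\<omega>\<in>space P. \<forall>A\<in>\<A>. W A \<omega> \<in> S A} \<longleftrightarrow> \<omega> \<in> Ev"
  proof -
    have "AE \<omega> in P. \<forall>A\<in>\<A>. W A \<omega> = (\<Sum>E\<in>{E\<in>\<B>. E \<subseteq> A}. W E \<omega>)"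
      using A_sum fin by (subst AE_finite_all) auto
    then show ?thesis by eventually_elim (auto simp: Ev_def)
  qed
  have m1[measurable]: "{\<omega>\<in>space P. \<forall>A\<in>\<A>. W A \<omega> \<in> S A} \<in> events"
  proof (rule sets.sets_Collect_finite_All[OF _ fin])
    fix A assume "A \<in> \<A>"
    have [measurable]: "S A \<in> sets borel" by (rule S)
    have [measurable]: "W A \<in> borel_measurable P" using \<open>A \<in> \<A>\<close> sub by auto
    show "{\<omega>\<in>space P. W A \<omega> \<in> S A} \<in> events" by measurable
  qed
  have m2[measurable]: "Ev \<in> events"
    using indep_setsD[OF ind2] ind2 EvS unfolding indep_sets_def by blast
  have m3[measurable]: "W C -` B \<inter> space P \<in> events" using C B by measurable
  have "prob {\<omega>\<in>space P. \<forall>A\<in>\<A>. W A \<omega> \<in> S A} = prob Ev"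
    using AEv by (intro measure_eq_AE) auto
  moreover have "prob ({\<omega>\<in>space P. \<forall>A\<in>\<A>. W A \<omega> \<in> S A} \<inter> (W C -` B \<inter> space P)) = prob (Ev \<inter> (W C -` B \<inter> space P))"
    using AEv by (intro measure_eq_AE) auto
  ultimately show ?thesis using prod by simp
qed

text \<open>The events of the previous lemma together with the null sets are stable under intersection and
  generate \<open>outside C\<close>.\<close>

lemma indep_outside:
  assumes C: "C \<in> cells" "C \<noteq> {}"
  shows "indep_set (sets (outside C)) {W C -` B \<inter> space P | B. B \<in> sets borel}"
proof -
  define \<I> where "\<I> = {{\<omega>\<in>space P. \<forall>A\<in>\<A>. W A \<omega> \<in> S A} | \<A> S.
      finite \<A> \<and> \<A> \<subseteq> cells \<and> (\<forall>A\<in>\<A>. A \<inter> C = {}) \<and> (\<forall>A. S A \<in> sets borel)} \<union> null_sets P"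
  define \<J> where "\<J> = {W C -` B \<inter> space P | B. B \<in> sets (borel :: real measure)}"
  have Iev: "\<I> \<subseteq> events"
  proof
    fix E assume "E \<in> \<I>"
    then consider "E \<in> null_sets P" | \<A> S where "E = {\<omega>\<in>space P. \<forall>A\<in>\<A>. W A \<omega> \<in> S A}" "finite \<A>" "\<A> \<subseteq> cells" "\<And>A. S A \<in> sets borel"
      by (auto simp: \<I>_def)
    then show "E \<in> events"
    proof cases
      case 2
      show ?thesis unfolding 2(1)
      proof (rule sets.sets_Collect_finite_All[OF _ 2(2)])
        fix A assume "A \<in> \<A>"
        have [measurable]: "S A \<in> sets borel" by (rule 2)
        have [measurable]: "W A \<in> borel_measurable P" using \<open>A \<in> \<A>\<close> 2 by auto
        show "{\<omega>\<in>space P. W A \<omega> \<in> S A} \<in> events" by measurable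
      qed
    qed auto
  qed
  have Jev: "\<J> \<subseteq> events" using C by (auto simp: \<J>_def intro: measurable_sets[OF noise_measurable])
  have "indep_set \<I> \<J>"
    unfolding indep_sets2_eq
  proof (intro conjI ballI Iev Jev)
    fix E F assume E: "E \<in> \<I>" and F: "F \<in> \<J>"
    from F obtain B where B: "B \<in> sets borel" "F = W C -` B \<inter> space P" by (auto simp: \<J>_def)
    from E consider "E \<in> null_sets P" | \<A> S where "E = {\<omega>\<in>space P. \<forall>A\<in>\<A>. W A \<omega> \<in> S A}"
      "finite \<A>" "\<A> \<subseteq> cells" "\<forall>A\<in>\<A>. A \<inter> C = {}" "\<And>A. S A \<in> sets borel"
      by (auto simp: \<I>_def)
    then show "prob (E \<inter> F) = prob E * prob F"
    proof cases
      case 1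
      then have "E \<inter> F \<in> null_sets P" using F Jev by (auto intro: null_set_Int2)
      with 1 show ?thesis by (simp add: null_sets_def measure_def)
    next
      case 2
      then show ?thesis unfolding 2(1) B using indep_finite_family[OF C 2(2) 2(3) _ _ B(1), of S] by auto
    qed
  qed
  moreover have "Int_stable \<I>"
  proof (rule Int_stableI)
    fix E F assume E: "E \<in> \<I>" and F: "F \<in> \<I>"
    show "E \<inter> F \<in> \<I>"
    proof (cases "E \<in> null_sets P \<or> F \<in> null_sets P")
      case True
      then have "E \<inter> F \<in> null_sets P"
        using Iev E F by (metis Int_commute null_set_Int2 subsetD)
      then show ?thesis by (auto simp: \<I>_def)
    next
      case False
      then obtain \<A> S \<A>' S' where *: "E = {\<omega>\<in>space P. \<forall>A\<in>\<A>. W A \<omega> \<in> S A}"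
          "finite \<A>" "\<A> \<subseteq> cells" "\<forall>A\<in>\<A>. A \<inter> C = {}" "\<And>A. S A \<in> sets borel"
          "F = {\<omega>\<in>space P. \<forall>A\<in>\<A>'. W A \<omega> \<in> S' A}"
          "finite \<A>'" "\<A>' \<subseteq> cells" "\<forall>A\<in>\<A>'. A \<inter> C = {}" "\<And>A. S' A \<in> sets borel"
        using E F by (auto simp: \<I>_def)
      define R where "R A = (if A \<in> \<A> then S A else UNIV) \<inter> (if A \<in> \<A>' then S' A else UNIV)" for A
      have "E \<inter> F = {\<omega>\<in>space P. \<forall>A\<in>\<A> \<union> \<A>'. W A \<omega> \<in> R A}"
        by (auto simp: * R_def split: if_splits)
      moreover have "R A \<in> sets borel" for A using * by (auto simp: R_def)
      ultimately show ?thesis unfolding \<I>_def using *(2-4) *(7-9)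
        by (intro UnI1 CollectI exI[of _ "\<A> \<union> \<A>'"] exI[of _ R]) auto
    qed
  qed
  moreover have "Int_stable \<J>"
  proof (unfold \<J>_def, rule Int_stableI, safe)
    fix S T :: "real set" assume "S \<in> sets borel" "T \<in> sets borel"
    then show "\<exists>U. W C -` S \<inter> space P \<inter> (W C -` T \<inter> space P) = W C -` U \<inter> space P \<and> U \<in> sets borel"
      by (intro exI[of _ "S \<inter> T"]) auto
  qed
  ultimately have ind: "indep_set (sigma_sets (space P) \<I>) (sigma_sets (space P) \<J>)"
    by (rule indep_set_sigma_sets)
  have "sets (outside C) \<subseteq> sigma_sets (space P) \<I>"
    unfolding sets_outside
  proof (rule sigma_sets_mono')
    show "{W A -` B \<inter> space P |A B. A \<in> cells \<and> A \<inter> C = {} \<and> B \<in> sets borel} \<union> null_sets P \<subseteq> \<I>"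
    proof safe
      fix A and B :: "real set" assume "A \<in> cells" "A \<inter> C = {}" "B \<in> sets borel"
      then show "W A -` B \<inter> space P \<in> \<I>" unfolding \<I>_def
        by (intro UnI1 CollectI exI[of _ "{A}"] exI[of _ "\<lambda>_. B"]) auto
    qed (auto simp: \<I>_def)
  qed
  moreover have "\<J> \<subseteq> sigma_sets (space P) \<J>" by auto
  ultimately show ?thesis using ind unfolding indep_sets2_eq \<J>_def by blast
qed

lemma indep_var_outside:
  assumes C: "C \<in> cells" "C \<noteq> {}" and Y: "Y \<in> borel_measurable (outside C)"
  shows "indep_var borel (Y :: 'a \<Rightarrow> real) borel (W C)"
proof -
  have "indep_set {Y -` A \<inter> space P | A. A \<in> sets borel} {W C -` B \<inter> space P | B. B \<in> sets borel}"
  proof -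
    have "{Y -` A \<inter> space P | A. A \<in> sets borel} \<subseteq> sets (outside C)"
      using measurable_sets[OF Y] by auto
    then show ?thesis using indep_outside[OF C] unfolding indep_sets2_eq by blast
  qed
  moreover have "Int_stable {X -` A \<inter> space P | A. A \<in> sets borel}" for X :: "'a \<Rightarrow> real"
  proof (rule Int_stableI, safe)
    fix S T :: "real set" assume "S \<in> sets borel" "T \<in> sets borel"
    then show "\<exists>U. X -` S \<inter> space P \<inter> (X -` T \<inter> space P) = X -` U \<inter> space P \<and> U \<in> sets borel"
      by (intro exI[of _ "S \<inter> T"]) auto
  qed
  ultimately have "indep_set (sigma_sets (space P) {Y -` A \<inter> space P | A. A \<in> sets borel})
      (sigma_sets (space P) {W C -` B \<inter> space P | B. B \<in> sets borel})"
    by (intro indep_set_sigma_sets)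
  then show ?thesis
    unfolding indep_var_eq by (intro conjI noise_measurable C outside_measurable[OF Y])
qed

text \<open>Sets of measure zero, whose noise has no density, obey the same formulas as the normal law, so that
  later arguments need no case distinction.\<close>

lemma noise_moment:
  assumes C: "C \<in> cells"
  shows "integrable P (\<lambda>\<omega>. W C \<omega> ^ k)"
    and "expectation (W C) = 0"
    and "expectation (\<lambda>\<omega>. W C \<omega> ^ 2) = measure lborel C"
    and "expectation (\<lambda>\<omega>. W C \<omega> ^ 3) = 0"
    and "expectation (\<lambda>\<omega>. W C \<omega> ^ 4) = 3 * (measure lborel C)\<^sup>2"
proof -
  have "integrable P (\<lambda>\<omega>. W C \<omega> ^ k) \<and> expectation (W C) = 0
    \<and> expectation (\<lambda>\<omega>. W C \<omega> ^ 2) = measure lborel C \<and> expectation (\<lambda>\<omega>. W C \<omega> ^ 3) = 0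
    \<and> expectation (\<lambda>\<omega>. W C \<omega> ^ 4) = 3 * (measure lborel C)\<^sup>2"
  proof (cases "measure lborel C = 0")
    case True
    have ae: "AE \<omega> in P. W C \<omega> = 0" using noise_null[OF C True] .
    have m: "W C \<in> borel_measurable P" using C by simp
    have e: "expectation (\<lambda>\<omega>. W C \<omega> ^ j) = 0" if "j > 0" for j
    proof (rule integral_eq_zero_AE)
      show "AE \<omega> in P. W C \<omega> ^ j = 0" using ae by eventually_elim (use that in simp)
    qed
    have "integrable P (\<lambda>\<omega>. W C \<omega> ^ k) = integrable P (\<lambda>\<omega>. 0 ^ k :: real)"
      using ae m by (intro integrable_cong_AE) auto
    then show ?thesis using e[of 1] e[of 2] e[of 3] e[of 4] True by simp
  next
    case False
    define s where "s = sqrt (measure lborel C)"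
    have s: "s > 0" using False by (simp add: s_def less_le)
    have s2: "s\<^sup>2 = measure lborel C" by (simp add: s_def)
    have D: "distributed P lborel (W C) (normal_density 0 s)"
      using noise_normal[OF C False] by (simp add: s_def)
    have I: "integrable P (\<lambda>\<omega>. W C \<omega> ^ j)" for j
      using integrable_normal_moment[OF s, of 0 j] s
      by (subst distributed_integrable[OF D, of "\<lambda>x. x ^ j", symmetric]) auto
    have E: "expectation (\<lambda>\<omega>. W C \<omega> ^ j) = (\<integral>x. normal_density 0 s x * x ^ j \<partial>lborel)" for j
      using s by (subst distributed_integral[OF D, of "\<lambda>x. x ^ j", symmetric]) auto
    have o: "expectation (\<lambda>\<omega>. W C \<omega> ^ (2 * j + 1)) = 0" for j
      unfolding E using integral_normal_moment_odd[OF s, of 0 j] by simp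
    have e2: "expectation (\<lambda>\<omega>. W C \<omega> ^ 2) = s\<^sup>2"
      using integral_normal_moment_even[OF s, of 0 1] s by (simp add: E)
    have e4: "expectation (\<lambda>\<omega>. W C \<omega> ^ 4) = 3 * (s\<^sup>2)\<^sup>2"
      using integral_normal_moment_even[OF s, of 0 2] s
      by (simp add: E fact_numeral power_mult_distrib field_simps)
    show ?thesis using I o[of 0] o[of 1] e2 e4 s2 by simp
  qed
  then show "integrable P (\<lambda>\<omega>. W C \<omega> ^ k)"
    and "expectation (W C) = 0"
    and "expectation (\<lambda>\<omega>. W C \<omega> ^ 2) = measure lborel C"
    and "expectation (\<lambda>\<omega>. W C \<omega> ^ 3) = 0"
    and "expectation (\<lambda>\<omega>. W C \<omega> ^ 4) = 3 * (measure lborel C)\<^sup>2" by blast+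
qed

lemma outside_product:
  assumes C: "C \<in> cells" and Y: "Y \<in> borel_measurable (outside C)" and I: "integrable P Y"
  shows "integrable P (\<lambda>\<omega>. Y \<omega> * W C \<omega> ^ k)"
    and "expectation (\<lambda>\<omega>. Y \<omega> * W C \<omega> ^ k) = expectation Y * expectation (\<lambda>\<omega>. W C \<omega> ^ k)"
proof -
  have "integrable P (\<lambda>\<omega>. Y \<omega> * W C \<omega> ^ k) \<and>
     expectation (\<lambda>\<omega>. Y \<omega> * W C \<omega> ^ k) = expectation Y * expectation (\<lambda>\<omega>. W C \<omega> ^ k)"
  proof (cases "C = {}")
    case False
    have "indep_var borel ((\<lambda>x. x) \<circ> Y) borel ((\<lambda>x. x ^ k) \<circ> W C)"
      by (rule indep_var_compose[OF indep_var_outside[OF C False Y]]) auto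
    then have iv: "indep_var borel Y borel (\<lambda>\<omega>. W C \<omega> ^ k)" by (simp add: comp_def)
    show ?thesis
      using indep_var_integrable[OF iv I noise_moment(1)[OF C]]
        indep_var_lebesgue_integral[OF iv I noise_moment(1)[OF C]] by simp
  next
    case True
    have ae: "AE \<omega> in P. W C \<omega> = 0" using noise_null[OF C] True by simp
    have [measurable]: "W C \<in> borel_measurable P" "Y \<in> borel_measurable P"
      using C outside_measurable[OF Y] by auto
    have "integrable P (\<lambda>\<omega>. Y \<omega> * W C \<omega> ^ k) = integrable P (\<lambda>\<omega>. Y \<omega> * 0 ^ k)"
      using ae by (intro integrable_cong_AE) auto
    moreover have "expectation (\<lambda>\<omega>. Y \<omega> * W C \<omega> ^ k) = expectation (\<lambda>\<omega>. Y \<omega> * 0 ^ k)"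
      using ae by (intro integral_cong_AE) auto
    moreover have "expectation (\<lambda>\<omega>. W C \<omega> ^ k) = expectation (\<lambda>\<omega>. 0 ^ k)"
      using ae by (intro integral_cong_AE) auto
    ultimately show ?thesis using I by (simp add: prob_space)
  qed
  then show "integrable P (\<lambda>\<omega>. Y \<omega> * W C \<omega> ^ k)"
    and "expectation (\<lambda>\<omega>. Y \<omega> * W C \<omega> ^ k) = expectation Y * expectation (\<lambda>\<omega>. W C \<omega> ^ k)" by auto
qed

end

section \<open>Integrals over the strip and rapid convergence in mean square\<close>

lemma space_leb01 [simp]: "space leb01 = {0..1}"
  by (simp add: space_restrict_space)

lemma prob_space_leb01: "prob_space leb01"
  by standard (simp add: emeasure_restrict_space)

interpretation leb01: prob_space leb01 by (rule prob_space_leb01)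

text \<open>The time interval with Lebesgue measure; \<open>Box\<close> is time \<open>\<times>\<close> space, time coming first.\<close>

definition slab :: "real \<Rightarrow> real measure" where
  "slab t = restrict_space lborel {0..t}"

lemma space_slab [simp]: "space (slab t) = {0..t}"
  by (simp add: slab_def space_restrict_space)

lemma sets_slab [measurable_cong]: "sets (slab t) = sets (restrict_space borel {0..t})"
  by (simp add: slab_def sets_restrict_space)

lemma finite_measure_slab: "finite_measure (slab t)"
  by standard (simp add: slab_def emeasure_restrict_space emeasure_lborel_Icc_eq)

interpretation slab: finite_measure "slab t" for t by (rule finite_measure_slab)

lemma emeasure_slab: "t \<ge> 0 \<Longrightarrow> emeasure (slab t) {0..t} = ennreal t"
  by (simp add: slab_def emeasure_restrict_space)

lemma nn_integral_slab: "(\<integral>\<^sup>+s. f s \<partial>slab t) = (\<integral>\<^sup>+s. f s * indicator {0..t} s \<partial>lborel)"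
  unfolding slab_def by (rule nn_integral_restrict_space) simp

lemma nn_integral_slab_sub:
  assumes "t \<le> T"
  shows "(\<integral>\<^sup>+s. f s \<partial>slab t) = (\<integral>\<^sup>+s. f s * indicator {..t} s \<partial>slab T)"
  unfolding nn_integral_slab using assms by (intro nn_integral_cong) (auto simp: indicator_def)

lemma nn_integral_slab_mono: "t \<le> T \<Longrightarrow> (\<integral>\<^sup>+s. f s \<partial>slab t) \<le> (\<integral>\<^sup>+s. f s \<partial>slab T)"
  unfolding nn_integral_slab_sub by (intro nn_integral_mono) (auto simp: indicator_def)

definition Box :: "real \<Rightarrow> (real \<times> real) measure" where
  "Box t = slab t \<Otimes>\<^sub>M leb01"

lemma space_Box [simp]: "space (Box t) = {0..t} \<times> {0..1}"
  by (simp add: Box_def space_pair_measure)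

lemma sets_Box [measurable_cong]: "sets (Box t) = sets (slab t \<Otimes>\<^sub>M leb01)"
  by (simp add: Box_def)

lemma finite_measure_Box: "finite_measure (Box t)"
  unfolding Box_def by (intro finite_measure_pair_measure finite_measure_slab leb01.finite_measure_axioms)

interpretation Box: finite_measure "Box t" for t by (rule finite_measure_Box)

lemma nn_integral_Box:
  "f \<in> borel_measurable (Box t) \<Longrightarrow> (\<integral>\<^sup>+p. f p \<partial>Box t) = (\<integral>\<^sup>+s. \<integral>\<^sup>+u. f (s, u) \<partial>leb01 \<partial>slab t)"
  unfolding Box_def by (rule leb01.nn_integral_fst[symmetric])

lemma measure_Box_Times:
  assumes "A \<in> sets (slab t)" "B \<in> sets leb01"
  shows "measure (Box t) (A \<times> B) = measure lborel A * measure lborel B"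
proof -
  have A: "A \<subseteq> {0..t}" "B \<subseteq> {0..1}" using sets.sets_into_space[OF assms(1)] sets.sets_into_space[OF assms(2)] by auto
  have "emeasure (Box t) (A \<times> B) = emeasure (slab t) A * emeasure leb01 B"
    unfolding Box_def using assms by (rule leb01.emeasure_pair_measure_Times)
  also have "\<dots> = emeasure lborel A * emeasure lborel B"
    using A by (simp add: slab_def emeasure_restrict_space)
  finally show ?thesis by (simp add: measure_def enn2real_mult)
qed

text \<open>The \<open>\<sigma>\<close>-algebras of the filtration carry no measure, whence measurability has to be moved from them
  to the probability space inside products.\<close>

lemma measurable_pair_sub:
  assumes "space M = space M'" "sets M \<subseteq> sets M'" "space N = space N'" "sets N \<subseteq> sets N'"
    and "f \<in> measurable (M \<Otimes>\<^sub>M N) L"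
  shows "f \<in> measurable (M' \<Otimes>\<^sub>M N') L"
proof -
  have "(\<lambda>p. (fst p, snd p)) \<in> measurable (M' \<Otimes>\<^sub>M N') (M \<Otimes>\<^sub>M N)"
  proof (rule measurable_Pair)
    have "(\<lambda>x. x) \<in> measurable M' M" "(\<lambda>x. x) \<in> measurable N' N"
      using assms by (auto simp: measurable_def dest: sets.sets_into_space)
    then show "fst \<in> measurable (M' \<Otimes>\<^sub>M N') M" "snd \<in> measurable (M' \<Otimes>\<^sub>M N') N"
      using measurable_compose[OF measurable_fst] measurable_compose[OF measurable_snd] by auto
  qed
  from measurable_compose[OF this assms(5)] show ?thesis by simp
qed

text \<open>The square of the \<open>L\<^sub>2\<close> norm, possibly infinite. Squares with the factor \<open>2\<close> in the triangle
  inequality replace norms throughout, because constants do not matter.\<close>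

definition sqn :: "'b measure \<Rightarrow> ('b \<Rightarrow> real) \<Rightarrow> ennreal" where
  "sqn M f = (\<integral>\<^sup>+x. ennreal ((f x)\<^sup>2) \<partial>M)"

lemma sqn_add:
  assumes [measurable]: "f \<in> borel_measurable M" "g \<in> borel_measurable M"
  shows "sqn M (\<lambda>x. f x + g x) \<le> 2 * sqn M f + 2 * sqn M g"
proof -
  have p: "(a + b)\<^sup>2 \<le> 2 * a\<^sup>2 + 2 * b\<^sup>2" for a b :: real
    using sum_squares_bound[of a b] by (simp add: power2_sum)
  have "sqn M (\<lambda>x. f x + g x) \<le> (\<integral>\<^sup>+x. 2 * ennreal ((f x)\<^sup>2) + 2 * ennreal ((g x)\<^sup>2) \<partial>M)"
    unfolding sqn_def
  proof (rule nn_integral_mono)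
    fix x
    have "ennreal ((f x + g x)\<^sup>2) \<le> ennreal (2 * (f x)\<^sup>2 + 2 * (g x)\<^sup>2)" using p by (rule ennreal_leI)
    then show "ennreal ((f x + g x)\<^sup>2) \<le> 2 * ennreal ((f x)\<^sup>2) + 2 * ennreal ((g x)\<^sup>2)"
      by (simp add: ennreal_mult)
  qed
  also have "\<dots> = 2 * sqn M f + 2 * sqn M g"
    unfolding sqn_def by (simp add: nn_integral_add nn_integral_cmult)
  finally show ?thesis .
qed

lemma sqn_triangle:
  assumes [measurable]: "f \<in> borel_measurable M" "g \<in> borel_measurable M" "h \<in> borel_measurable M"
  shows "sqn M (\<lambda>x. f x - h x) \<le> 2 * sqn M (\<lambda>x. f x - g x) + 2 * sqn M (\<lambda>x. g x - h x)"
  using sqn_add[of "\<lambda>x. f x - g x" M "\<lambda>x. g x - h x"] by simp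

lemma sqn_minus_commute: "sqn M (\<lambda>x. f x - g x) = sqn M (\<lambda>x. g x - f x)"
  unfolding sqn_def by (simp add: power2_commute)

lemma sqn_zero_iff:
  "f \<in> borel_measurable M \<Longrightarrow> sqn M f = 0 \<longleftrightarrow> (AE x in M. f x = 0)"
  unfolding sqn_def by (subst nn_integral_0_iff_AE) auto

lemma sqn_cong_AE: "AE x in M. f x = g x \<Longrightarrow> sqn M f = sqn M g"
  unfolding sqn_def by (rule nn_integral_cong_AE) auto

text \<open>The limit superior makes the limit measurable without a case distinction on convergence. Where the
  sequence converges it is the limit.\<close>

definition flim :: "(nat \<Rightarrow> 'b \<Rightarrow> real) \<Rightarrow> 'b \<Rightarrow> real" where
  "flim f x = real_of_ereal (limsup (\<lambda>n. ereal (f n x)))"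

lemma flim_eq: "(\<lambda>n. f n x) \<longlonglongrightarrow> l \<Longrightarrow> flim f x = l"
proof -
  assume "(\<lambda>n. f n x) \<longlonglongrightarrow> l"
  then have "(\<lambda>n. ereal (f n x)) \<longlonglongrightarrow> ereal l" by simp
  then have "limsup (\<lambda>n. ereal (f n x)) = ereal l" by (intro lim_imp_Limsup) auto
  then show ?thesis by (simp add: flim_def)
qed

lemma flim_measurable [measurable (raw)]:
  assumes "\<And>n. f n \<in> borel_measurable M"
  shows "flim f \<in> borel_measurable M"
  unfolding flim_def using assms by measurable

lemma ennreal_geometric:
  assumes "0 \<le> c" "c < 1"
  shows "(\<Sum>n. B * ennreal (c ^ n)) = B * ennreal (1 / (1 - c))"
proof -
  have "(\<Sum>n. ennreal (c ^ n)) = ennreal (1 / (1 - c))"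
    using assms by (intro suminf_ennreal_eq geometric_sums) auto
  then show ?thesis by simp
qed

lemma AE_tendsto_zero_fast:
  fixes h :: "nat \<Rightarrow> 'b \<Rightarrow> ennreal"
  assumes [measurable]: "\<And>n. h n \<in> borel_measurable M"
    and B: "B < \<infinity>" and c: "0 \<le> c" "c < 1" and le: "\<And>n. (\<integral>\<^sup>+x. h n x \<partial>M) \<le> B * ennreal (c ^ n)"
  shows "AE x in M. (\<lambda>n. h n x) \<longlonglongrightarrow> 0"
proof -
  have "(\<integral>\<^sup>+x. (\<Sum>n. h n x) \<partial>M) = (\<Sum>n. \<integral>\<^sup>+x. h n x \<partial>M)" by (simp add: nn_integral_suminf)
  also have "\<dots> \<le> (\<Sum>n. B * ennreal (c ^ n))" by (intro suminf_le le) auto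
  also have "\<dots> = B * ennreal (1 / (1 - c))" using c by (rule ennreal_geometric)
  also have "\<dots> < \<infinity>" using B by (simp add: ennreal_mult_less_top)
  finally have "AE x in M. (\<Sum>n. h n x) \<noteq> \<infinity>" by (intro nn_integral_PInf_AE) auto
  then show ?thesis
  proof eventually_elim
    case (elim x)
    then have fin: "h n x < top" for n
      using ennreal_suminf_lessD[of "\<lambda>n. h n x" top n] by (auto simp: less_top)
    have "summable (\<lambda>n. enn2real (h n x))"
    proof (rule summable_suminf_not_top)
      show "(\<Sum>n. ennreal (enn2real (h n x))) \<noteq> \<top>" using elim fin by simp
    qed auto
    then have "(\<lambda>n. enn2real (h n x)) \<longlonglongrightarrow> 0" by (rule summable_LIMSEQ_zero)
    then have "(\<lambda>n. ennreal (enn2real (h n x))) \<longlonglongrightarrow> ennreal 0" by (rule tendsto_ennrealI)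
    then show ?case using fin by simp
  qed
qed

text \<open>The bound \<open>\<bar>d\<bar> \<le> 2\<^sup>n d\<^sup>2 + 2\<^sup>-\<^sup>n\<close> makes the increments \<open>d\<close> absolutely summable almost everywhere
  when their squares integrate to \<open>O(4\<^sup>-\<^sup>n)\<close>. The second claim follows by Fatou's lemma from the bound
  for the differences \<open>f (n + k) - f n\<close>, where the factor \<open>2\<close> lost at each step of the triangle inequality is
  compensated by the rate \<open>1/4\<close>.\<close>

lemma fast_cauchy:
  fixes f :: "nat \<Rightarrow> 'b \<Rightarrow> real"
  assumes fin: "finite_measure M" and [measurable]: "\<And>n. f n \<in> borel_measurable M" and B: "B < \<infinity>"
    and le: "\<And>n. sqn M (\<lambda>x. f (Suc n) x - f n x) \<le> B * ennreal ((1/4) ^ n)"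
  shows "AE x in M. (\<lambda>n. f n x) \<longlonglongrightarrow> flim f x"
    and "sqn M (\<lambda>x. f n x - flim f x) \<le> 4 * B * ennreal ((1/4) ^ n)"
proof -
  interpret finite_measure M by fact
  have pt: "\<bar>d\<bar> \<le> 2 ^ n * d\<^sup>2 + (1/2) ^ n" for d :: real and n :: nat
  proof (cases "\<bar>d\<bar> \<le> (1/2) ^ n")
    case True then show ?thesis by (simp add: add_increasing)
  next
    case False
    then have "1 \<le> 2 ^ n * \<bar>d\<bar>" by (simp add: field_simps)
    then have "\<bar>d\<bar> * 1 \<le> \<bar>d\<bar> * (2 ^ n * \<bar>d\<bar>)" by (intro mult_left_mono) auto
    also have "\<dots> = 2 ^ n * d\<^sup>2" by (simp add: power2_eq_square)
    finally show ?thesis by (simp add: add_increasing2)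
  qed
  let ?d = "\<lambda>n x. f (Suc n) x - f n x"
  have dn: "(\<integral>\<^sup>+x. ennreal \<bar>?d n x\<bar> \<partial>M) \<le> (B + emeasure M (space M)) * ennreal ((1/2) ^ n)" for n
  proof -
    have "(\<integral>\<^sup>+x. ennreal \<bar>?d n x\<bar> \<partial>M) \<le> (\<integral>\<^sup>+x. ennreal (2 ^ n) * ennreal ((?d n x)\<^sup>2) + ennreal ((1/2)^n) \<partial>M)"
    proof (rule nn_integral_mono)
      fix x
      have "ennreal \<bar>?d n x\<bar> \<le> ennreal (2 ^ n * (?d n x)\<^sup>2 + (1/2) ^ n)" by (rule ennreal_leI[OF pt])
      then show "ennreal \<bar>?d n x\<bar> \<le> ennreal (2 ^ n) * ennreal ((?d n x)\<^sup>2) + ennreal ((1/2)^n)"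
        by (simp add: ennreal_mult del: ennreal_power)
    qed
    also have "\<dots> = ennreal (2 ^ n) * sqn M (?d n) + ennreal ((1/2)^n) * emeasure M (space M)"
      unfolding sqn_def by (simp add: nn_integral_add nn_integral_cmult)
    also have "\<dots> \<le> ennreal (2 ^ n) * (B * ennreal ((1/4) ^ n)) + ennreal ((1/2)^n) * emeasure M (space M)"
      using le by (intro add_right_mono mult_left_mono) auto
    also have "ennreal (2 ^ n) * (B * ennreal ((1/4) ^ n)) = B * (ennreal (2 ^ n) * ennreal ((1/4) ^ n))"
      by (simp add: mult_ac)
    also have "ennreal (2 ^ n) * ennreal ((1/4) ^ n) = ennreal ((1/2) ^ n)"
      by (subst ennreal_mult[symmetric]) (auto simp: power_mult_distrib[symmetric])
    finally show ?thesis by (simp add: distrib_right mult.commute)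
  qed
  have "(\<integral>\<^sup>+x. (\<Sum>n. ennreal \<bar>?d n x\<bar>) \<partial>M) = (\<Sum>n. \<integral>\<^sup>+x. ennreal \<bar>?d n x\<bar> \<partial>M)" by (simp add: nn_integral_suminf)
  also have "\<dots> \<le> (\<Sum>n. (B + emeasure M (space M)) * ennreal ((1/2) ^ n))" by (intro suminf_le dn) auto
  also have "\<dots> = (B + emeasure M (space M)) * ennreal (1 / (1 - 1/2))" by (rule ennreal_geometric) auto
  also have "\<dots> < \<infinity>" using B by (auto simp: ennreal_mult_less_top ennreal_mult_eq_top_iff emeasure_finite less_top[symmetric])
  finally have "AE x in M. (\<Sum>n. ennreal \<bar>?d n x\<bar>) \<noteq> \<infinity>" by (intro nn_integral_PInf_AE) auto
  then show AE: "AE x in M. (\<lambda>n. f n x) \<longlonglongrightarrow> flim f x"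
  proof eventually_elim
    case (elim x)
    then have "summable (\<lambda>n. \<bar>?d n x\<bar>)" by (intro summable_suminf_not_top) auto
    then have "summable (\<lambda>n. ?d n x)" by (rule summable_rabs_cancel)
    then have "(\<lambda>n. \<Sum>i<n. ?d i x) \<longlonglongrightarrow> suminf (\<lambda>n. ?d n x)" by (rule summable_LIMSEQ)
    then have "(\<lambda>n. (\<Sum>i<n. ?d i x) + f 0 x) \<longlonglongrightarrow> suminf (\<lambda>n. ?d n x) + f 0 x" by (intro tendsto_add) auto
    then have "(\<lambda>n. f n x) \<longlonglongrightarrow> suminf (\<lambda>n. ?d n x) + f 0 x"
      using sum_lessThan_telescope[of "\<lambda>n. f n x"] by simp
    then show ?case using flim_eq by metis
  qed
  \<comment> \<open>\<open>4\<close> is the fixed point of \<open>c \<mapsto> 2 + 2 c / 4\<close>, the effect of one step on the constant\<close>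
  have tail: "sqn M (\<lambda>x. f (n + k) x - f n x) \<le> 4 * B * ennreal ((1/4) ^ n)" for n k
  proof (induction k arbitrary: n)
    case 0 show ?case by (simp add: sqn_def)
  next
    case (Suc k)
    have "sqn M (\<lambda>x. f (n + Suc k) x - f n x) \<le>
        2 * sqn M (\<lambda>x. f (Suc n + k) x - f (Suc n) x) + 2 * sqn M (?d n)"
      using sqn_triangle[of "f (n + Suc k)" M "f (Suc n)" "f n"] by simp
    also have "\<dots> \<le> 2 * (4 * B * ennreal ((1/4) ^ Suc n)) + 2 * (B * ennreal ((1/4) ^ n))"
      by (intro add_mono mult_left_mono Suc.IH le) auto
    also have "\<dots> = (8 * B) * ennreal (1/4 * (1/4) ^ n) + (2 * B) * ennreal ((1/4) ^ n)"
      by (simp add: mult_ac)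
    also have "\<dots> = 2 * B * ennreal ((1/4) ^ n) + 2 * B * ennreal ((1/4) ^ n)"
    proof -
      have "(8 * B) * ennreal (1/4 * (1/4) ^ n) = (2 * B) * (ennreal 4 * ennreal (1/4 * (1/4) ^ n))"
        by (simp add: mult_ac)
      also have "ennreal 4 * ennreal (1/4 * (1/4) ^ n) = ennreal ((1/4) ^ n)"
        by (subst ennreal_mult[symmetric]) auto
      finally show ?thesis by simp
    qed
    also have "\<dots> = 4 * B * ennreal ((1/4) ^ n)"
      by (simp add: distrib_right[symmetric])
    finally show ?case .
  qed
  have "sqn M (\<lambda>x. f n x - flim f x) \<le> liminf (\<lambda>k. sqn M (\<lambda>x. f (n + k) x - f n x))"
  proof -
    have "sqn M (\<lambda>x. f n x - flim f x) = (\<integral>\<^sup>+x. liminf (\<lambda>k. ennreal ((f (n + k) x - f n x)\<^sup>2)) \<partial>M)"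
      unfolding sqn_def
    proof (rule nn_integral_cong_AE, use AE in eventually_elim)
      fix x assume "(\<lambda>n. f n x) \<longlonglongrightarrow> flim f x"
      then have "(\<lambda>k. f (n + k) x) \<longlonglongrightarrow> flim f x"
        using LIMSEQ_ignore_initial_segment[of "\<lambda>k. f k x" _ n] by (simp add: add.commute)
      then have "(\<lambda>k. ennreal ((f (n + k) x - f n x)\<^sup>2)) \<longlonglongrightarrow> ennreal ((flim f x - f n x)\<^sup>2)"
        by (intro tendsto_ennrealI tendsto_intros)
      then show "ennreal ((f n x - flim f x)\<^sup>2) = liminf (\<lambda>k. ennreal ((f (n + k) x - f n x)\<^sup>2))"
        using lim_imp_Liminf[OF trivial_limit_sequentially] power2_commute[of "f n x"] by metis
    qed
    also have "\<dots> \<le> liminf (\<lambda>k. sqn M (\<lambda>x. f (n + k) x - f n x))"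
      unfolding sqn_def by (rule nn_integral_liminf) auto
    finally show ?thesis .
  qed
  also have "\<dots> \<le> 4 * B * ennreal ((1/4) ^ n)"
    using tail by (intro Liminf_le) auto
  finally show "sqn M (\<lambda>x. f n x - flim f x) \<le> 4 * B * ennreal ((1/4) ^ n)" .
qed

lemma geometric_zero:
  assumes "C < \<infinity>" "\<And>n. x \<le> C * ennreal ((1/4) ^ n)"
  shows "x = 0"
proof -
  have "(\<lambda>n. C * ennreal ((1/4) ^ n)) \<longlonglongrightarrow> C * ennreal 0"
    using assms(1) by (intro ennreal_tendsto_cmult tendsto_ennrealI LIMSEQ_power_zero) auto
  then have "x \<le> C * ennreal 0" using assms(2) by (intro LIMSEQ_le_const) auto
  then show ?thesis by simp
qed

text \<open>The weight is chosen such that integration over \<open>[0,t]\<close> gains the factor \<open>1/(4C)\<close>.\<close>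

lemma exp_weight_step:
  assumes C: "C > 0" and h: "\<And>s. 0 \<le> s \<Longrightarrow> s \<le> t \<Longrightarrow> h s \<le> B * ennreal (exp (4 * C * s))"
    and t: "0 \<le> t"
  shows "ennreal C * (\<integral>\<^sup>+s. h s \<partial>slab t) \<le> ennreal (1/4) * B * ennreal (exp (4 * C * t))"
proof -
  have "(\<integral>\<^sup>+s. h s \<partial>slab t) \<le> (\<integral>\<^sup>+s. B * (ennreal (exp (4 * C * s)) * indicator {0..t} s) \<partial>lborel)"
    unfolding nn_integral_slab using h by (intro nn_integral_mono) (auto simp: indicator_def)
  also have "\<dots> = B * (\<integral>\<^sup>+s. ennreal (exp (4 * C * s)) * indicator {0..t} s \<partial>lborel)"
    by (rule nn_integral_cmult) measurable
  also have "(\<integral>\<^sup>+s. ennreal (exp (4 * C * s)) * indicator {0..t} s \<partial>lborel)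
      = ennreal (exp (4 * C * t) / (4 * C) - exp (4 * C * 0) / (4 * C))"
    by (rule nn_integral_FTC_Icc) (use C t in \<open>auto intro!: derivative_eq_intros\<close>)
  also have "\<dots> \<le> ennreal (exp (4 * C * t) / (4 * C))" using C by (intro ennreal_leI) auto
  finally have "(\<integral>\<^sup>+s. h s \<partial>slab t) \<le> B * ennreal (exp (4 * C * t) / (4 * C))"
    by (simp add: mult_left_mono)
  then have "ennreal C * (\<integral>\<^sup>+s. h s \<partial>slab t) \<le> ennreal C * (B * ennreal (exp (4 * C * t) / (4 * C)))"
    by (rule mult_left_mono) simp
  also have "\<dots> = B * (ennreal C * ennreal (exp (4 * C * t) / (4 * C)))" by (simp add: mult_ac)
  also have "ennreal C * ennreal (exp (4 * C * t) / (4 * C)) = ennreal (1/4) * ennreal (exp (4 * C * t))"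
    using C by (subst (1 2) ennreal_mult[symmetric]) (auto simp: field_simps)
  finally show ?thesis by (simp add: mult_ac)
qed

text \<open>The source of both existence (\<open>h n\<close> the distance of consecutive Picard iterates) and uniqueness
  (\<open>h\<close> constant in \<open>n\<close>).\<close>

lemma volterra_iterate:
  fixes h :: "nat \<Rightarrow> real \<Rightarrow> ennreal"
  assumes C: "C > 0" and B: "\<And>t. 0 \<le> t \<Longrightarrow> t \<le> T \<Longrightarrow> h 0 t \<le> B"
    and step: "\<And>n t. 0 \<le> t \<Longrightarrow> t \<le> T \<Longrightarrow> h (Suc n) t \<le> ennreal C * (\<integral>\<^sup>+s. h n s \<partial>slab t)"
    and t: "0 \<le> t" "t \<le> T"
  shows "h n t \<le> B * ennreal (exp (4 * C * T)) * ennreal ((1/4) ^ n)"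
proof -
  have "h n t \<le> (B * ennreal ((1/4) ^ n)) * ennreal (exp (4 * C * t))" if t: "0 \<le> t" "t \<le> T" for t
    using t
  proof (induction n arbitrary: t)
    case 0
    have "h 0 t * 1 \<le> B * ennreal (exp (4 * C * t))"
      using 0 C by (intro mult_mono B) (auto simp: ennreal_1[symmetric] simp del: ennreal_1 intro!: ennreal_leI)
    then show ?case by simp
  next
    case (Suc n)
    have "h (Suc n) t \<le> ennreal C * (\<integral>\<^sup>+s. h n s \<partial>slab t)" by (rule step[OF Suc.prems])
    also have "\<dots> \<le> ennreal (1/4) * (B * ennreal ((1/4) ^ n)) * ennreal (exp (4 * C * t))"
      using Suc by (intro exp_weight_step C) auto
    also have "ennreal (1/4) * (B * ennreal ((1/4) ^ n)) = B * ennreal ((1/4) ^ Suc n)"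
    proof -
      have "ennreal ((1/4) ^ Suc n) = ennreal (1/4) * ennreal ((1/4) ^ n)"
        by (subst ennreal_mult[symmetric]) auto
      then show ?thesis by (simp only: mult.left_commute)
    qed
    finally show ?case .
  qed
  then have "h n t \<le> (B * ennreal ((1/4) ^ n)) * ennreal (exp (4 * C * t))" using t by blast
  also have "\<dots> \<le> (B * ennreal ((1/4) ^ n)) * ennreal (exp (4 * C * T))"
    using t C by (intro mult_left_mono ennreal_leI) auto
  finally show ?thesis by (simp add: mult_ac)
qed

section \<open>The isometry for simple integrands\<close>

context sheet_noise
begin

lemma rect_cells:
  "0 \<le> c \<Longrightarrow> d \<le> 1 \<Longrightarrow> 0 \<le> a \<Longrightarrow> b \<le> T \<Longrightarrow> {c<..d} \<times> {a<..b} \<in> cells"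
  unfolding white_noise_sets_def by (auto simp: borel_prod[symmetric])

lemma measure_lborel_Times:
  fixes A B :: "real set"
  assumes "A \<in> sets borel" "B \<in> sets borel"
  shows "measure lborel (A \<times> B) = measure lborel A * measure lborel B"
proof -
  have "emeasure (lborel \<Otimes>\<^sub>M lborel) (A \<times> B) = emeasure lborel A * emeasure lborel B"
    using assms by (intro lborel.emeasure_pair_measure_Times) auto
  then show ?thesis by (simp add: lborel_prod measure_def enn2real_mult)
qed

lemma sheet_gen_sub:
  "t \<le> T \<Longrightarrow> {w u s -` B \<inter> space P | u s B. u \<in> {0..1} \<and> s \<in> {0..t} \<and> B \<in> sets borel} \<union> null_sets P
     \<subseteq> sets P"
  unfolding brownian_sheet_def by (auto intro!: measurable_sets[OF noise_measurable] rect_cells)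

lemma sheet_gen_Pow:
  "{w u s -` B \<inter> space P | u s B. u \<in> {0..1} \<and> s \<in> {0..t} \<and> B \<in> sets borel} \<union> null_sets P
     \<subseteq> Pow (space P)"
  using sets.sets_into_space[of _ P] by (auto dest: null_setsD2)

lemma space_G [simp]: "space (G t) = space P"
  unfolding sheet_filtration_def using sheet_gen_Pow by (rule space_measure_of)

lemma sets_G: "sets (G t) = sigma_sets (space P)
     ({w u s -` B \<inter> space P | u s B. u \<in> {0..1} \<and> s \<in> {0..t} \<and> B \<in> sets borel} \<union> null_sets P)"
  unfolding sheet_filtration_def using sheet_gen_Pow by (rule sets_measure_of)

lemma sets_G_sub: "t \<le> T \<Longrightarrow> sets (G t) \<subseteq> sets P"
  unfolding sets_G by (rule sets.sigma_sets_subset[OF sheet_gen_sub])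

lemma sets_G_mono: "s \<le> t \<Longrightarrow> sets (G s) \<subseteq> sets (G t)"
  unfolding sets_G atLeastAtMost_iff
  by (intro sigma_sets_mono' Un_mono order_refl) (blast intro: order_trans)

lemma null_G: "N \<in> null_sets P \<Longrightarrow> N \<in> sets (G t)"
  by (auto simp: sets_G)

lemma G_measurable: "f \<in> measurable (G t) L \<Longrightarrow> t \<le> T \<Longrightarrow> f \<in> measurable P L"
  by (rule measurable_from_sub[OF _ sets_G_sub]) auto

lemma G_measurable_mono: "f \<in> measurable (G s) L \<Longrightarrow> s \<le> t \<Longrightarrow> f \<in> measurable (G t) L"
  by (rule measurable_from_sub[OF _ sets_G_mono]) auto

lemma w_measurable_G: "u \<in> {0..1} \<Longrightarrow> 0 \<le> s \<Longrightarrow> s \<le> t \<Longrightarrow> w u s \<in> borel_measurable (G t)"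
  by (rule measurableI) (auto simp: sets_G intro!: sigma_sets.Basic)

lemma w_measurable: "u \<in> {0..1} \<Longrightarrow> s \<in> {0..T} \<Longrightarrow> w u s \<in> borel_measurable P"
  by (rule G_measurable[OF w_measurable_G, of _ _ s]) auto

text \<open>Everything observed up to time \<open>a\<close> comes from rectangles that do not meet a set lying after \<open>a\<close>.\<close>

lemma sets_G_outside:
  assumes "C \<subseteq> UNIV \<times> {a<..}" "a \<le> T"
  shows "sets (G a) \<subseteq> sets (outside C)"
  unfolding sets_G sets_outside
proof (rule sigma_sets_mono', safe)
  fix u s and B :: "real set" assume *: "u \<in> {0..1}" "s \<in> {0..a}" "B \<in> sets borel"
    and n: "w u s -` B \<inter> space P \<notin> null_sets P"
  show "\<exists>A B'. w u s -` B \<inter> space P = W A -` B' \<inter> space P \<and> A \<in> cells \<and> A \<inter> C = {} \<and> B' \<in> sets borel"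
    unfolding brownian_sheet_def using * assms
    by (intro exI[of _ "{0<..u} \<times> {0<..s}"] exI[of _ B]) (auto intro!: rect_cells)
qed

lemma G_outside:
  "f \<in> measurable (G a) L \<Longrightarrow> C \<subseteq> UNIV \<times> {a<..} \<Longrightarrow> a \<le> T \<Longrightarrow> f \<in> measurable (outside C) L"
  by (rule measurable_from_sub[OF _ sets_G_outside]) auto

text \<open>Inclusion and exclusion: the rectangular increment of the sheet is the noise of the rectangle.\<close>

lemma increment_AE:
  assumes "0 \<le> c" "c \<le> d" "d \<le> 1" "0 \<le> a" "a \<le> b" "b \<le> T"
  shows "AE \<omega> in P. w d b \<omega> - w c b \<omega> - w d a \<omega> + w c a \<omega> = W ({c<..d} \<times> {a<..b}) \<omega>"
proof -
  have E: "{0<..d} \<times> {0<..t} = {0<..c} \<times> {0<..t} \<union> {c<..d} \<times> {0<..t}" for t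
    using assms by auto
  have 1: "AE \<omega> in P. w d t \<omega> = w c t \<omega> + W ({c<..d} \<times> {0<..t}) \<omega>" if "t \<le> T" for t
    unfolding brownian_sheet_def E[of t] using assms that
    by (intro noise_add rect_cells) auto
  have F: "{c<..d} \<times> {0<..b} = {c<..d} \<times> {0<..a} \<union> {c<..d} \<times> {a<..b}"
    using assms by auto
  have 2: "AE \<omega> in P. W ({c<..d} \<times> {0<..b}) \<omega> = W ({c<..d} \<times> {0<..a}) \<omega> + W ({c<..d} \<times> {a<..b}) \<omega>"
    unfolding F using assms by (intro noise_add rect_cells) auto
  have "a \<le> T" using assms by simp
  from 1[OF this] 1[OF assms(6)] 2 show ?thesis by eventually_elim simp
qed

type_synonym 'b entry = "('b \<Rightarrow> real) \<times> real \<times> real \<times> real \<times> real"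

definition valid_entry :: "'a entry \<Rightarrow> bool" where
  "valid_entry e \<longleftrightarrow> simple_integrand P T G [e]"

definition coef :: "'a entry \<Rightarrow> 'a \<Rightarrow> real" where "coef e = fst e"

definition start :: "'a entry \<Rightarrow> real" where "start e = fst (snd e)"

text \<open>The part of the rectangle of an entry between the times \<open>s\<close> and \<open>t\<close>, in the coordinates (space,
  time) of the noise.\<close>

definition ebox :: "real \<Rightarrow> real \<Rightarrow> 'a entry \<Rightarrow> (real \<times> real) set" where
  "ebox s t e = (case e of (X, a, b, c, d) \<Rightarrow> {c<..d} \<times> {max a s<..min b t})"

definition eint :: "'a entry \<Rightarrow> real \<Rightarrow> 'a \<Rightarrow> real" where
  "eint e t \<omega> = simple_integral w [e] t \<omega>"

lemma simple_integrand_iff: "simple_integrand P T G F \<longleftrightarrow> (\<forall>e\<in>set F. valid_entry e)"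
  by (auto simp: simple_integrand_def valid_entry_def)

lemma simple_integral_sum_list: "simple_integral w F t \<omega> = (\<Sum>e\<leftarrow>F. eint e t \<omega>)"
  by (induction F) (auto simp: simple_integral_def eint_def)

lemma valid_entryE:
  assumes "valid_entry e"
  obtains X a b c d K where "e = (X, a, b, c, d)" "0 \<le> a" "a \<le> b" "b \<le> T" "0 \<le> c" "c \<le> d" "d \<le> 1"
    "X \<in> borel_measurable (G a)" "\<And>\<omega>. \<omega> \<in> space P \<Longrightarrow> \<bar>X \<omega>\<bar> \<le> K"
  using assms by (cases e) (auto simp: valid_entry_def simple_integrand_def)

lemma ebox_cells: "valid_entry e \<Longrightarrow> 0 \<le> s \<Longrightarrow> t \<le> T \<Longrightarrow> ebox s t e \<in> cells"
  by (erule valid_entryE) (auto simp: ebox_def intro!: rect_cells)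

lemma ebox_after: "ebox s t e \<subseteq> UNIV \<times> {start e<..}"
  by (auto simp: ebox_def start_def split: prod.splits)

lemma eint_increment:
  assumes "valid_entry e" "0 \<le> s" "s \<le> t" "t \<le> T"
  shows "AE \<omega> in P. eint e t \<omega> - eint e s \<omega> = coef e \<omega> * W (ebox s t e) \<omega>"
  using assms(1)
proof (rule valid_entryE)
  fix X a b c d K
  assume e: "e = (X, a, b, c, d)" "0 \<le> a" "a \<le> b" "b \<le> T" "0 \<le> c" "c \<le> d" "d \<le> 1"
  have dif: "eint e t \<omega> - eint e s \<omega> = X \<omega> *
     ((w d (min b t) \<omega> - w c (min b t) \<omega> - w d (min a t) \<omega> + w c (min a t) \<omega>)
      - (w d (min b s) \<omega> - w c (min b s) \<omega> - w d (min a s) \<omega> + w c (min a s) \<omega>))" for \<omega>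
    by (simp add: eint_def simple_integral_def e algebra_simps)
  show ?thesis
  proof (cases "max a s < min b t")
    case True
    have "AE \<omega> in P. w d (min b t) \<omega> - w c (min b t) \<omega> - w d (max a s) \<omega> + w c (max a s) \<omega>
       = W ({c<..d} \<times> {max a s<..min b t}) \<omega>"
      using e assms True by (intro increment_AE) auto
    then show ?thesis
    proof eventually_elim
      case (elim \<omega>)
      have "(w d (min b t) \<omega> - w c (min b t) \<omega> - w d (min a t) \<omega> + w c (min a t) \<omega>)
        - (w d (min b s) \<omega> - w c (min b s) \<omega> - w d (min a s) \<omega> + w c (min a s) \<omega>)
        = w d (min b t) \<omega> - w c (min b t) \<omega> - w d (max a s) \<omega> + w c (max a s) \<omega>"
        using True e assms by (cases "a \<le> s") (auto simp: min_def max_def)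
      then show ?case unfolding dif using elim by (simp add: ebox_def e coef_def)
    qed
  next
    case False
    then have emp: "ebox s t e = {}" by (simp add: ebox_def e)
    have z: "eint e t \<omega> - eint e s \<omega> = 0" for \<omega>
    proof (cases "a \<ge> t")
      case True
      then have "min b t = t" "min a t = t" "min b s = s" "min a s = s" using e assms by auto
      then show ?thesis unfolding dif by simp
    next
      case nat: False
      then have "b \<le> s \<or> a = b \<or> s = t" using False e assms by (auto simp: max_def min_def split: if_splits)
      then show ?thesis unfolding dif using e assms by (elim disjE) (auto simp: min_absorb1)
    qed
    have "AE \<omega> in P. W (ebox s t e) \<omega> = 0" using noise_null[of "{}"] emp by simp
    then show ?thesis by eventually_elim (simp only: z mult_zero_right)
  qed
qed

lemma eint_0: "valid_entry e \<Longrightarrow> eint e 0 \<omega> = 0"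
  by (erule valid_entryE) (simp add: eint_def simple_integral_def min_absorb2)

lemma eint_AE:
  assumes "valid_entry e" "0 \<le> t" "t \<le> T"
  shows "AE \<omega> in P. eint e t \<omega> = coef e \<omega> * W (ebox 0 t e) \<omega>"
  using eint_increment[OF assms(1) order_refl assms(2,3)] eint_0[OF assms(1)] by simp

lemma coef_measurable:
  "valid_entry e \<Longrightarrow> coef e \<in> borel_measurable (G (start e))"
  by (erule valid_entryE) (simp add: coef_def start_def)

lemma start_bounds: "valid_entry e \<Longrightarrow> 0 \<le> start e \<and> start e \<le> T"
  by (erule valid_entryE) (simp add: start_def)

lemma coef_measurable_P: "valid_entry e \<Longrightarrow> coef e \<in> borel_measurable P"
  using coef_measurable[of e] start_bounds[of e] G_measurable by blast

lemma coef_bounded: "valid_entry e \<Longrightarrow> \<exists>K. \<forall>\<omega>\<in>space P. \<bar>coef e \<omega>\<bar> \<le> K"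
  by (erule valid_entryE) (auto simp: coef_def)

lemma eint_measurable:
  assumes "valid_entry e" "0 \<le> t" "t \<le> T"
  shows "eint e t \<in> borel_measurable P"
  using assms(1)
proof (rule valid_entryE)
  fix X a b c d K
  assume e: "e = (X, a, b, c, d)" "0 \<le> a" "a \<le> b" "b \<le> T" "0 \<le> c" "c \<le> d" "d \<le> 1"
  have [measurable]: "X \<in> borel_measurable P" using coef_measurable_P[OF assms(1)] by (simp add: coef_def e)
  have [measurable]: "w u (min r t) \<in> borel_measurable P" if "u \<in> {c, d}" "r \<in> {a, b}" for u r
    using that e assms by (intro w_measurable) auto
  show ?thesis unfolding eint_def simple_integral_def e by simp
qed

lemma simple_integral_measurable:
  assumes "simple_integrand P T G F" "0 \<le> t" "t \<le> T"
  shows "simple_integral w F t \<in> borel_measurable P"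
  using assms(1)
proof (induction F)
  case (Cons e F)
  have "valid_entry e" "simple_integrand P T G F" using Cons.prems by (auto simp: simple_integrand_iff)
  then have [measurable]: "eint e t \<in> borel_measurable P" "simple_integral w F t \<in> borel_measurable P"
    using Cons.IH eint_measurable assms by auto
  have "simple_integral w (e # F) t = (\<lambda>\<omega>. eint e t \<omega> + simple_integral w F t \<omega>)"
    by (auto simp: simple_integral_sum_list)
  then show ?case by simp
qed (simp add: simple_integral_def[abs_def])

text \<open>Integrands of the elementary form have bounded coefficients, which makes all the expectations below
  finite.\<close>

lemma coef_product_bounded:
  assumes "valid_entry e" "valid_entry e'"
  obtains K where "\<And>\<omega>. \<omega> \<in> space P \<Longrightarrow> \<bar>coef e \<omega> * coef e' \<omega>\<bar> \<le> K"
proof -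
  obtain K K' where "\<forall>\<omega>\<in>space P. \<bar>coef e \<omega>\<bar> \<le> K" "\<forall>\<omega>\<in>space P. \<bar>coef e' \<omega>\<bar> \<le> K'"
    using coef_bounded assms by meson
  then have "\<bar>coef e \<omega> * coef e' \<omega>\<bar> \<le> K * K'" if "\<omega> \<in> space P" for \<omega>
    using that by (auto simp: abs_mult intro!: mult_mono order_trans[OF abs_ge_zero])
  then show thesis by (rule that)
qed

lemma coef_product_integrable:
  assumes e: "valid_entry e" "valid_entry e'"
  shows "integrable P (\<lambda>\<omega>. coef e \<omega> * coef e' \<omega>)"
proof -
  obtain K where "\<And>\<omega>. \<omega> \<in> space P \<Longrightarrow> \<bar>coef e \<omega> * coef e' \<omega>\<bar> \<le> K"
    using coef_product_bounded[OF e] by blast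
  then show ?thesis
    using coef_measurable_P[OF e(1)] coef_measurable_P[OF e(2)] by (intro integrable_const_bound[of _ K]) auto
qed

text \<open>Both sets are split along their intersection. The square of the common part has expectation
  \<open>measure lborel (A \<inter> B)\<close>, and each of the other products contains the noise of a set that is
  independent of the remaining factors.\<close>

lemma noise_covariance:
  assumes A: "A \<in> cells" and B: "B \<in> cells"
    and Y: "Y \<in> borel_measurable (outside (A \<union> B))" and bd: "integrable P Y"
  shows "integrable P (\<lambda>\<omega>. Y \<omega> * W A \<omega> * W B \<omega>)"
    and "expectation (\<lambda>\<omega>. Y \<omega> * W A \<omega> * W B \<omega>) = expectation Y * measure lborel (A \<inter> B)"
proof -
  define I where "I = A \<inter> B"
  have I: "I \<in> cells" and AB: "A - B \<in> cells" and BA: "B - A \<in> cells"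
    using A B by (auto simp: I_def intro: cells_Int cells_Diff)
  have mono: "Y \<in> borel_measurable (outside C)" if "C \<subseteq> A \<union> B" for C
  proof (rule measurable_from_sub[OF _ _ Y])
    show "sets (outside (A \<union> B)) \<subseteq> sets (outside C)"
      unfolding sets_outside by (rule sigma_sets_mono') (use that in blast)
  qed simp
  have YI: "Y \<in> borel_measurable (outside I)" "Y \<in> borel_measurable (outside (A - B))" "Y \<in> borel_measurable (outside (B - A))"
    by (auto intro!: mono simp: I_def)
  note [measurable] = outside_measurable[OF Y] noise_measurable[OF A] noise_measurable[OF B]
    noise_measurable[OF I] noise_measurable[OF AB] noise_measurable[OF BA]
  have cross: "integrable P (\<lambda>\<omega>. Y \<omega> * W D \<omega> * W E \<omega>) \<and> expectation (\<lambda>\<omega>. Y \<omega> * W D \<omega> * W E \<omega>) = 0"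
    if D: "D \<in> cells" and E: "E \<in> cells" and dj: "D \<inter> E = {}" and sub: "D \<subseteq> A \<union> B" "E \<subseteq> A \<union> B" for D E
  proof -
    have m: "(\<lambda>\<omega>. Y \<omega> * W D \<omega>) \<in> borel_measurable (outside E)"
      by (intro borel_measurable_times mono noise_outside D sub) (use dj in auto)
    have i: "integrable P (\<lambda>\<omega>. Y \<omega> * W D \<omega>)"
      using outside_product(1)[OF D mono[OF sub(1)] bd, of 1] by simp
    show ?thesis
      using outside_product[OF E m i, of 1] noise_moment(2)[OF E] by simp
  qed
  have sq: "integrable P (\<lambda>\<omega>. Y \<omega> * (W I \<omega>)\<^sup>2)" "expectation (\<lambda>\<omega>. Y \<omega> * (W I \<omega>)\<^sup>2) = expectation Y * measure lborel I"
    using outside_product[OF I YI(1) bd, of 2] noise_moment(3)[OF I] by auto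
  have c: "integrable P (\<lambda>\<omega>. Y \<omega> * W I \<omega> * W (B - A) \<omega>)" "expectation (\<lambda>\<omega>. Y \<omega> * W I \<omega> * W (B - A) \<omega>) = 0"
    "integrable P (\<lambda>\<omega>. Y \<omega> * W (A - B) \<omega> * W I \<omega>)" "expectation (\<lambda>\<omega>. Y \<omega> * W (A - B) \<omega> * W I \<omega>) = 0"
    "integrable P (\<lambda>\<omega>. Y \<omega> * W (A - B) \<omega> * W (B - A) \<omega>)" "expectation (\<lambda>\<omega>. Y \<omega> * W (A - B) \<omega> * W (B - A) \<omega>) = 0"
    using cross[OF I BA] cross[OF AB I] cross[OF AB BA] by (auto simp: I_def)
  have ae: "AE \<omega> in P. Y \<omega> * W A \<omega> * W B \<omega> = Y \<omega> * (W I \<omega>)\<^sup>2 + Y \<omega> * W I \<omega> * W (B - A) \<omega>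
     + Y \<omega> * W (A - B) \<omega> * W I \<omega> + Y \<omega> * W (A - B) \<omega> * W (B - A) \<omega>"
  proof -
    have "AE \<omega> in P. W (I \<union> (A - B)) \<omega> = W I \<omega> + W (A - B) \<omega>"
      "AE \<omega> in P. W (I \<union> (B - A)) \<omega> = W I \<omega> + W (B - A) \<omega>"
      by (intro noise_add I AB BA; auto simp: I_def)+
    moreover have "I \<union> (A - B) = A" "I \<union> (B - A) = B" by (auto simp: I_def)
    ultimately have "AE \<omega> in P. W A \<omega> = W I \<omega> + W (A - B) \<omega>" "AE \<omega> in P. W B \<omega> = W I \<omega> + W (B - A) \<omega>"
      by auto
    then show ?thesis by eventually_elim (simp add: algebra_simps power2_eq_square)
  qed
  have int: "integrable P (\<lambda>\<omega>. Y \<omega> * (W I \<omega>)\<^sup>2 + Y \<omega> * W I \<omega> * W (B - A) \<omega>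
     + Y \<omega> * W (A - B) \<omega> * W I \<omega> + Y \<omega> * W (A - B) \<omega> * W (B - A) \<omega>)"
    by (intro Bochner_Integration.integrable_add sq c)
  show "integrable P (\<lambda>\<omega>. Y \<omega> * W A \<omega> * W B \<omega>)"
    using int by (subst integrable_cong_AE[OF _ _ ae]) measurable
  have "expectation (\<lambda>\<omega>. Y \<omega> * W A \<omega> * W B \<omega>) = expectation (\<lambda>\<omega>. Y \<omega> * (W I \<omega>)\<^sup>2 + Y \<omega> * W I \<omega> * W (B - A) \<omega>
     + Y \<omega> * W (A - B) \<omega> * W I \<omega> + Y \<omega> * W (A - B) \<omega> * W (B - A) \<omega>)"
    by (rule integral_cong_AE[OF _ _ ae]) measurable
  also have "\<dots> = expectation Y * measure lborel I"
    using sq c by (simp add: Bochner_Integration.integral_add Bochner_Integration.integrable_add)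
  finally show "expectation (\<lambda>\<omega>. Y \<omega> * W A \<omega> * W B \<omega>) = expectation Y * measure lborel (A \<inter> B)"
    by (simp add: I_def)
qed

text \<open>The rectangles of a list of entries may overlap in any way, so the isometry is proved pair by pair.
  If \<open>e'\<close> starts last, at time \<open>a\<close>, the rectangle of \<open>e\<close> is cut at \<open>a\<close>: its early part is independent
  of the noise of \<open>e'\<close>, which has mean zero, and to its late part the covariance formula applies.\<close>

lemma eint_product:
  assumes e: "valid_entry e" and e': "valid_entry e'" and t: "0 \<le> t" "t \<le> T"
  shows "integrable P (\<lambda>\<omega>. eint e t \<omega> * eint e' t \<omega>) \<and>
    expectation (\<lambda>\<omega>. eint e t \<omega> * eint e' t \<omega>) =
      expectation (\<lambda>\<omega>. coef e \<omega> * coef e' \<omega>) * measure lborel (ebox 0 t e \<inter> ebox 0 t e')"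
proof -
  have main: "integrable P (\<lambda>\<omega>. eint e t \<omega> * eint e' t \<omega>) \<and>
    expectation (\<lambda>\<omega>. eint e t \<omega> * eint e' t \<omega>) =
      expectation (\<lambda>\<omega>. coef e \<omega> * coef e' \<omega>) * measure lborel (ebox 0 t e \<inter> ebox 0 t e')"
    if e: "valid_entry e" and e': "valid_entry e'" and le: "start e \<le> start e'" for e e'
  proof -
    define a where "a = start e'"
    define R R' where "R = ebox 0 t e" and "R' = ebox 0 t e'"
    \<comment> \<open>\<open>R \<inter> H\<close> and \<open>R - H\<close> are the parts of \<open>R\<close> before and after the start of \<open>e'\<close>\<close>
    define H where "H = {0<..1::real} \<times> {0<..a}"
    have a: "0 \<le> a" "a \<le> T" using start_bounds[OF e'] by (auto simp: a_def)
    have R: "R \<in> cells" "R' \<in> cells" and H: "H \<in> cells"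
      using ebox_cells[OF e] ebox_cells[OF e'] t a by (auto simp: R_def R'_def H_def intro!: rect_cells)
    have R'a: "R' \<subseteq> UNIV \<times> {a<..}" using ebox_after[of 0 t e'] by (simp add: R'_def a_def)
    have RHa: "R - H \<subseteq> UNIV \<times> {a<..}"
      using e by (rule valid_entryE) (auto simp: R_def ebox_def H_def)
    have RH: "R \<inter> H \<in> cells" "R - H \<in> cells" using R H by (auto intro: cells_Int cells_Diff)
    let ?Y = "\<lambda>\<omega>. coef e \<omega> * coef e' \<omega>"
    have Ym: "?Y \<in> borel_measurable (G a)"
      using coef_measurable[OF e'] G_measurable_mono[OF coef_measurable[OF e] le] by (auto simp: a_def)
    have Yi: "integrable P ?Y" using e e' by (rule coef_product_integrable)
    note [measurable] = G_measurable[OF Ym a(2)] noise_measurable[OF RH(1)] noise_measurable[OF RH(2)]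
      noise_measurable[OF R(2)] noise_measurable[OF R(1)] eint_measurable[OF e t] eint_measurable[OF e' t]
    have ae: "AE \<omega> in P. eint e t \<omega> * eint e' t \<omega> =
        ?Y \<omega> * W (R \<inter> H) \<omega> * W R' \<omega> + ?Y \<omega> * W (R - H) \<omega> * W R' \<omega>"
    proof -
      have "AE \<omega> in P. W ((R \<inter> H) \<union> (R - H)) \<omega> = W (R \<inter> H) \<omega> + W (R - H) \<omega>"
        by (intro noise_add RH) auto
      moreover have "(R \<inter> H) \<union> (R - H) = R" by auto
      ultimately have "AE \<omega> in P. W R \<omega> = W (R \<inter> H) \<omega> + W (R - H) \<omega>" by simp
      with eint_AE[OF e t] eint_AE[OF e' t] show ?thesis
        by eventually_elim (simp add: R_def R'_def algebra_simps)
    qed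
    have 1: "integrable P (\<lambda>\<omega>. ?Y \<omega> * W (R \<inter> H) \<omega> * W R' \<omega>)"
      "expectation (\<lambda>\<omega>. ?Y \<omega> * W (R \<inter> H) \<omega> * W R' \<omega>) = 0"
    proof -
      have m: "(\<lambda>\<omega>. ?Y \<omega> * W (R \<inter> H) \<omega>) \<in> borel_measurable (outside R')"
        using R'a by (intro borel_measurable_times[OF G_outside[OF Ym R'a a(2)]] noise_outside RH) (auto simp: H_def)
      have i: "integrable P (\<lambda>\<omega>. ?Y \<omega> * W (R \<inter> H) \<omega>)"
      proof -
        obtain K where K: "\<And>\<omega>. \<omega> \<in> space P \<Longrightarrow> \<bar>?Y \<omega>\<bar> \<le> K"
          using coef_product_bounded[OF e e'] by blast
        have WI: "integrable P (W (R \<inter> H))" using noise_moment(1)[OF RH(1), of 1] by simp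
        show ?thesis
        proof (rule Bochner_Integration.integrable_bound[OF integrable_mult_right[OF WI, of K]])
          show "AE \<omega> in P. norm (?Y \<omega> * W (R \<inter> H) \<omega>) \<le> norm (K * W (R \<inter> H) \<omega>)"
            using order_trans[OF K abs_ge_self] by (intro AE_I2) (simp add: abs_mult mult_right_mono)
        qed measurable
      qed
      show "integrable P (\<lambda>\<omega>. ?Y \<omega> * W (R \<inter> H) \<omega> * W R' \<omega>)"
        "expectation (\<lambda>\<omega>. ?Y \<omega> * W (R \<inter> H) \<omega> * W R' \<omega>) = 0"
        using outside_product[OF R(2) m i, of 1] noise_moment(2)[OF R(2)] by auto
    qed
    have m2: "?Y \<in> borel_measurable (outside ((R - H) \<union> R'))"
      using RHa R'a by (intro G_outside[OF Ym _ a(2)]) auto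
    note 2 = noise_covariance[OF RH(2) R(2) m2 Yi]
    have eqI: "(R - H) \<inter> R' = R \<inter> R'" using R'a by (auto simp: H_def)
    have "integrable P (\<lambda>\<omega>. ?Y \<omega> * W (R \<inter> H) \<omega> * W R' \<omega> + ?Y \<omega> * W (R - H) \<omega> * W R' \<omega>)"
      by (intro Bochner_Integration.integrable_add 1 2)
    then have i: "integrable P (\<lambda>\<omega>. eint e t \<omega> * eint e' t \<omega>)"
      by (subst integrable_cong_AE[OF _ _ ae]) measurable
    have "expectation (\<lambda>\<omega>. eint e t \<omega> * eint e' t \<omega>) =
      expectation (\<lambda>\<omega>. ?Y \<omega> * W (R \<inter> H) \<omega> * W R' \<omega> + ?Y \<omega> * W (R - H) \<omega> * W R' \<omega>)"
      by (rule integral_cong_AE[OF _ _ ae]) measurable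
    also have "\<dots> = expectation ?Y * measure lborel (R \<inter> R')"
      using 1 2 eqI by (simp add: Bochner_Integration.integral_add)
    finally show ?thesis using i by (simp add: R_def R'_def)
  qed
  show ?thesis
  proof (cases "start e \<le> start e'")
    case True then show ?thesis using main[OF e e'] by blast
  next
    case False then show ?thesis using main[OF e' e] by (simp add: mult.commute Int_commute)
  qed
qed

lemma simple_eval_box:
  "s \<le> t \<Longrightarrow> simple_eval F \<omega> u s = (\<Sum>e\<leftarrow>F. coef e \<omega> * indicator (ebox 0 t e) (u, s))" if "0 \<le> s" "\<forall>e\<in>set F. valid_entry e"
  using that(2)
proof (induction F)
  case (Cons e F)
  have "valid_entry e" using Cons.prems by simp
  then have "simple_eval [e] \<omega> u s = coef e \<omega> * indicator (ebox 0 t e) (u, s)"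
    by (rule valid_entryE) (use \<open>s \<le> t\<close> that in \<open>auto simp: simple_eval_def coef_def ebox_def indicator_def\<close>)
  then show ?case using Cons by (auto simp: simple_eval_def)
qed (simp add: simple_eval_def)


lemma sum_list_index: "(\<Sum>x\<leftarrow>xs. f x) = (\<Sum>i<length xs. f (xs ! i))"
  by (simp add: sum_list_sum_nth atLeast0LessThan)

lemma ebox_indicator_integral:
  assumes e: "valid_entry e" and e': "valid_entry e'" and t: "0 \<le> t"
  shows "(\<integral>p. indicator (ebox 0 t e) (snd p, fst p) * indicator (ebox 0 t e') (snd p, fst p) \<partial>Box t)
     = measure lborel (ebox 0 t e \<inter> ebox 0 t e')"
    and "(\<lambda>p. indicator (ebox 0 t e) (snd p, fst p) :: real) \<in> borel_measurable (Box t)"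
proof -
  obtain X a b c d where e1: "e = (X, a, b, c, d)" "0 \<le> a" "0 \<le> c" "d \<le> 1"
    using e by (auto elim: valid_entryE)
  obtain X' a' b' c' d' where e2: "e' = (X', a', b', c', d')" "0 \<le> a'" "0 \<le> c'" "d' \<le> 1"
    using e' by (auto elim: valid_entryE)
  let ?A = "{c<..d} \<inter> {c'<..d'}" and ?B = "{max a 0<..min b t} \<inter> {max a' 0<..min b' t}"
  have s: "?B \<in> sets (slab t)" "?A \<in> sets leb01"
    using e1 e2 by (auto simp: slab_def sets_restrict_space_iff)
  have "(\<integral>p. indicator (ebox 0 t e) (snd p, fst p) * indicator (ebox 0 t e') (snd p, fst p) \<partial>Box t)
     = (\<integral>p. indicator (?B \<times> ?A) p \<partial>Box t :: real)"
    by (intro Bochner_Integration.integral_cong) (auto simp: e1 e2 ebox_def indicator_def)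
  also have "\<dots> = measure (Box t) (?B \<times> ?A)"
    using s by (subst Bochner_Integration.integral_indicator) (auto simp: Int_absorb2 sets.sets_into_space Box_def)
  also have "\<dots> = measure lborel ?B * measure lborel ?A" using s by (rule measure_Box_Times)
  also have "\<dots> = measure lborel (?A \<times> ?B)" by (subst measure_lborel_Times) auto
  also have "?A \<times> ?B = ebox 0 t e \<inter> ebox 0 t e'" by (auto simp: e1 e2 ebox_def)
  finally show "(\<integral>p. indicator (ebox 0 t e) (snd p, fst p) * indicator (ebox 0 t e') (snd p, fst p) \<partial>Box t)
     = measure lborel (ebox 0 t e \<inter> ebox 0 t e')" .
  have s: "{max a 0<..min b t} \<in> sets (slab t)" "{c<..d} \<in> sets leb01"
    using e1 by (auto simp: slab_def sets_restrict_space_iff)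
  have "(\<lambda>p. indicator (ebox 0 t e) (snd p, fst p) :: real) = indicator ({max a 0<..min b t} \<times> {c<..d})"
    by (auto simp: e1 ebox_def indicator_def fun_eq_iff)
  also have "\<dots> \<in> borel_measurable (Box t)"
    using s by (intro borel_measurable_indicator) (simp add: Box_def)
  finally show "(\<lambda>p. indicator (ebox 0 t e) (snd p, fst p) :: real) \<in> borel_measurable (Box t)" .
qed

text \<open>The space on which integrands live.\<close>

definition Q :: "real \<Rightarrow> ('a \<times> real \<times> real) measure" where
  "Q t = P \<Otimes>\<^sub>M Box t"

lemma sets_Q [measurable_cong]: "sets (Q t) = sets (P \<Otimes>\<^sub>M (slab t \<Otimes>\<^sub>M leb01))"
  by (simp add: Q_def Box_def)

lemma space_Q: "space (Q t) = space P \<times> {0..t} \<times> {0..1}"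
  by (simp add: Q_def space_pair_measure)

lemma simple_eval_measurable:
  assumes F: "simple_integrand P T G F" and t: "0 \<le> t"
  shows "(\<lambda>(\<omega>, s, u). simple_eval F \<omega> u s) \<in> borel_measurable (Q t)"
proof -
  have v: "\<forall>e\<in>set F. valid_entry e" using F by (simp add: simple_integrand_iff)
  have "(\<lambda>(\<omega>, s, u). simple_eval F \<omega> u s) \<in> borel_measurable (Q t) \<longleftrightarrow>
    (\<lambda>q. \<Sum>i<length F. coef (F ! i) (fst q) * indicator (ebox 0 t (F ! i)) (snd (snd q), fst (snd q))) \<in> borel_measurable (Q t)"
    by (intro measurable_cong) (auto simp: space_Q simple_eval_box[OF _ v, of _ t] sum_list_index)
  also have "\<dots>"
  proof (intro borel_measurable_sum borel_measurable_times)
    fix i assume "i \<in> {..<length F}"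
    then have e: "valid_entry (F ! i)" using v by auto
    show "(\<lambda>q. coef (F ! i) (fst q)) \<in> borel_measurable (Q t)"
      unfolding Q_def by (rule measurable_compose[OF measurable_fst coef_measurable_P[OF e]])
    show "(\<lambda>q. indicator (ebox 0 t (F ! i)) (snd (snd q), fst (snd q)) :: real) \<in> borel_measurable (Q t)"
      unfolding Q_def by (rule measurable_compose[OF measurable_snd ebox_indicator_integral(2)[OF e e t]])
  qed
  finally show ?thesis .
qed

lemma sqn_Q:
  assumes "f \<in> borel_measurable (Q t)"
  shows "sqn (Q t) f = (\<integral>\<^sup>+\<omega>. (\<integral>\<^sup>+s. (\<integral>\<^sup>+u. ennreal ((f (\<omega>, s, u))\<^sup>2) \<partial>leb01) \<partial>slab t) \<partial>P)"
proof -
  have m: "(\<lambda>q. ennreal ((f q)\<^sup>2)) \<in> borel_measurable (P \<Otimes>\<^sub>M Box t)"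
    using assms by (simp add: Q_def)
  have "sqn (Q t) f = (\<integral>\<^sup>+\<omega>. \<integral>\<^sup>+p. ennreal ((f (\<omega>, p))\<^sup>2) \<partial>Box t \<partial>P)"
    unfolding sqn_def Q_def by (rule Box.nn_integral_fst[OF m, symmetric])
  also have "\<dots> = (\<integral>\<^sup>+\<omega>. (\<integral>\<^sup>+s. (\<integral>\<^sup>+u. ennreal ((f (\<omega>, s, u))\<^sup>2) \<partial>leb01) \<partial>slab t) \<partial>P)"
  proof (intro nn_integral_cong nn_integral_Box)
    fix \<omega> assume "\<omega> \<in> space P"
    then show "(\<lambda>p. ennreal ((f (\<omega>, p))\<^sup>2)) \<in> borel_measurable (Box t)"
      using measurable_compose[OF measurable_Pair1' m] by simp
  qed
  finally show ?thesis .
qed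

text \<open>Both sides are the same quadratic form in the coefficients, with the areas of the intersections of
  the rectangles as matrix.\<close>

lemma simple_isometry:
  assumes F: "simple_integrand P T G F" and t: "0 \<le> t" "t \<le> T"
  shows "sqn P (simple_integral w F t) = sqn (Q t) (\<lambda>(\<omega>, s, u). simple_eval F \<omega> u s)"
proof -
  have v: "\<forall>e\<in>set F. valid_entry e" using F by (simp add: simple_integrand_iff)
  define n where "n = length F"
  have vi: "valid_entry (F ! i)" if "i < n" for i using v that by (auto simp: n_def)
  define m where "m i j = measure lborel (ebox 0 t (F ! i) \<inter> ebox 0 t (F ! j))" for i j
  define S where "S \<omega> = (\<Sum>i<n. \<Sum>j<n. coef (F ! i) \<omega> * coef (F ! j) \<omega> * m i j)" for \<omega>
  have ci: "integrable P (\<lambda>\<omega>. coef (F ! i) \<omega> * coef (F ! j) \<omega>)" if ij: "i < n" "j < n" for i j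
    using vi ij by (intro coef_product_integrable)
  have I2: "(simple_integral w F t \<omega>)\<^sup>2 = (\<Sum>i<n. \<Sum>j<n. eint (F ! i) t \<omega> * eint (F ! j) t \<omega>)" for \<omega>
    by (simp add: simple_integral_sum_list sum_list_index n_def power2_eq_square sum_product)
  have ep: "integrable P (\<lambda>\<omega>. eint (F ! i) t \<omega> * eint (F ! j) t \<omega>)"
    "expectation (\<lambda>\<omega>. eint (F ! i) t \<omega> * eint (F ! j) t \<omega>) = expectation (\<lambda>\<omega>. coef (F ! i) \<omega> * coef (F ! j) \<omega>) * m i j"
    if "i < n" "j < n" for i j
    using eint_product[OF vi[OF that(1)] vi[OF that(2)] t] by (auto simp: m_def)
  have Ii: "integrable P (\<lambda>\<omega>. (simple_integral w F t \<omega>)\<^sup>2)"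
    unfolding I2 by (intro Bochner_Integration.integrable_sum ep) auto
  have Si: "integrable P S"
    unfolding S_def by (intro Bochner_Integration.integrable_sum integrable_mult_left ci) auto
  have E: "expectation (\<lambda>\<omega>. (simple_integral w F t \<omega>)\<^sup>2) = expectation S"
  proof -
    have "expectation (\<lambda>\<omega>. (simple_integral w F t \<omega>)\<^sup>2)
        = (\<Sum>i<n. \<Sum>j<n. expectation (\<lambda>\<omega>. coef (F ! i) \<omega> * coef (F ! j) \<omega>) * m i j)"
      unfolding I2 using ep
      by (subst Bochner_Integration.integral_sum, force intro: Bochner_Integration.integrable_sum)
         (auto intro!: sum.cong Bochner_Integration.integral_sum[THEN trans])
    also have "\<dots> = expectation S"
      unfolding S_def using ci
      by (subst Bochner_Integration.integral_sum, force intro: Bochner_Integration.integrable_sum)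
         (auto intro!: sum.cong Bochner_Integration.integral_sum[THEN trans, symmetric])
    finally show ?thesis .
  qed
  define A where "A i p = (indicator (ebox 0 t (F ! i)) (snd p, fst p) :: real)" for i p
  have Am [measurable]: "A i \<in> borel_measurable (Box t)" if "i < n" for i
    unfolding A_def[abs_def] using ebox_indicator_integral(2)[OF vi vi t(1)] that by blast
  have ev: "simple_eval F \<omega> u s = (\<Sum>i<n. coef (F ! i) \<omega> * A i (s, u))" if "0 \<le> s" "s \<le> t" for \<omega> u s
    using simple_eval_box[OF that(1) v that(2)] by (simp add: sum_list_index n_def A_def)
  have Ai: "integrable (Box t) (\<lambda>p. A i p * A j p)" if "i < n" "j < n" for i j
  proof (rule Box.integrable_const_bound[of _ 1])
    show "(\<lambda>p. A i p * A j p) \<in> borel_measurable (Box t)"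
      by (intro borel_measurable_times Am that)
  qed (auto simp: A_def indicator_def)
  have sq: "(\<Sum>i<n. coef (F ! i) \<omega> * A i p)\<^sup>2 = (\<Sum>i<n. \<Sum>j<n. (coef (F ! i) \<omega> * coef (F ! j) \<omega>) * (A i p * A j p))" for \<omega> p
    by (simp add: power2_eq_square sum_product mult_ac)
  have sqi: "integrable (Box t) (\<lambda>p. (\<Sum>i<n. coef (F ! i) \<omega> * A i p)\<^sup>2)" for \<omega>
    unfolding sq by (intro Bochner_Integration.integrable_sum integrable_mult_right Ai) auto
  have S_int: "(\<integral>p. (\<Sum>i<n. coef (F ! i) \<omega> * A i p)\<^sup>2 \<partial>Box t) = S \<omega>" for \<omega>
  proof -
    have "(\<integral>p. (\<Sum>i<n. coef (F ! i) \<omega> * A i p)\<^sup>2 \<partial>Box t)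
      = (\<Sum>i<n. \<Sum>j<n. (coef (F ! i) \<omega> * coef (F ! j) \<omega>) * (\<integral>p. A i p * A j p \<partial>Box t))"
      unfolding sq using Ai by (subst Bochner_Integration.integral_sum, force intro: Bochner_Integration.integrable_sum)
         (auto intro!: sum.cong Bochner_Integration.integral_sum[THEN trans])
    also have "\<dots> = S \<omega>"
      unfolding S_def A_def m_def using ebox_indicator_integral(1)[OF vi vi t(1)] by (auto intro!: sum.cong)
    finally show ?thesis .
  qed
  have inner: "(\<integral>\<^sup>+p. ennreal ((simple_eval F \<omega> (snd p) (fst p))\<^sup>2) \<partial>Box t) = ennreal (S \<omega>)" for \<omega>
  proof -
    have "(\<integral>\<^sup>+p. ennreal ((simple_eval F \<omega> (snd p) (fst p))\<^sup>2) \<partial>Box t)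
      = (\<integral>\<^sup>+p. ennreal ((\<Sum>i<n. coef (F ! i) \<omega> * A i p)\<^sup>2) \<partial>Box t)"
      using ev by (intro nn_integral_cong) auto
    also have "\<dots> = ennreal (S \<omega>)" by (subst nn_integral_eq_integral[OF sqi]) (simp_all add: S_int)
    finally show ?thesis .
  qed
  have "sqn P (simple_integral w F t) = ennreal (expectation S)"
    unfolding sqn_def E[symmetric] by (rule nn_integral_eq_integral[OF Ii]) auto
  also have "\<dots> = (\<integral>\<^sup>+\<omega>. ennreal (S \<omega>) \<partial>P)"
    by (rule nn_integral_eq_integral[OF Si, symmetric]) (simp add: S_int[symmetric])
  also have "\<dots> = (\<integral>\<^sup>+\<omega>. (\<integral>\<^sup>+p. ennreal ((simple_eval F \<omega> (snd p) (fst p))\<^sup>2) \<partial>Box t) \<partial>P)"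
    by (simp add: inner)
  also have "\<dots> = sqn (Q t) (\<lambda>(\<omega>, s, u). simple_eval F \<omega> u s)"
  proof -
    have "(\<lambda>q. ennreal ((case q of (\<omega>, s, u) \<Rightarrow> simple_eval F \<omega> u s)\<^sup>2)) \<in> borel_measurable (P \<Otimes>\<^sub>M Box t)"
      using simple_eval_measurable[OF F t(1)] by (simp add: Q_def)
    from Box.nn_integral_fst[OF this] show ?thesis
      unfolding sqn_def Q_def by (simp add: case_prod_beta)
  qed
  finally show ?thesis .
qed

lemma simple_diff:
  assumes "simple_integrand P T G F" "simple_integrand P T G F'"
  obtains H where "simple_integrand P T G H"
    "\<And>t \<omega>. simple_integral w H t \<omega> = simple_integral w F t \<omega> - simple_integral w F' t \<omega>"
    "\<And>\<omega> u s. simple_eval H \<omega> u s = simple_eval F \<omega> u s - simple_eval F' \<omega> u s"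
proof
  define N where "N = map (\<lambda>(X :: 'a \<Rightarrow> real, r). (\<lambda>\<omega>. - X \<omega>, r)) F'"
  show "simple_integrand P T G (F @ N)"
  proof -
    have "valid_entry (case e of (X, r) \<Rightarrow> (\<lambda>\<omega>. - X \<omega>, r))" if "valid_entry e" for e
      using that by (rule valid_entryE) (auto simp: valid_entry_def simple_integrand_def)
    then show ?thesis using assms unfolding simple_integrand_iff N_def by auto
  qed
  have 1: "simple_integral w N t \<omega> = - simple_integral w F' t \<omega>" for t \<omega>
    unfolding N_def by (induction F') (auto simp: simple_integral_def split: prod.splits)
  have 2: "simple_eval N \<omega> u s = - simple_eval F' \<omega> u s" for \<omega> u s
    unfolding N_def by (induction F') (auto simp: simple_eval_def split: prod.splits)
  show "simple_integral w (F @ N) t \<omega> = simple_integral w F t \<omega> - simple_integral w F' t \<omega>" for t \<omega>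
    using 1[of t \<omega>] by (simp add: simple_integral_def)
  show "simple_eval (F @ N) \<omega> u s = simple_eval F \<omega> u s - simple_eval F' \<omega> u s" for \<omega> u s
    using 2[of \<omega> u s] by (simp add: simple_eval_def)
qed

lemma simple_isometry_diff:
  assumes "simple_integrand P T G F" "simple_integrand P T G F'" "0 \<le> t" "t \<le> T"
  shows "sqn P (\<lambda>\<omega>. simple_integral w F t \<omega> - simple_integral w F' t \<omega>)
    = sqn (Q t) (\<lambda>(\<omega>, s, u). simple_eval F \<omega> u s - simple_eval F' \<omega> u s)"
proof -
  obtain H where H: "simple_integrand P T G H"
    "\<And>t \<omega>. simple_integral w H t \<omega> = simple_integral w F t \<omega> - simple_integral w F' t \<omega>"
    "\<And>\<omega> u s. simple_eval H \<omega> u s = simple_eval F \<omega> u s - simple_eval F' \<omega> u s"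
    using simple_diff[OF assms(1,2)] by blast
  have "simple_integral w H t = (\<lambda>\<omega>. simple_integral w F t \<omega> - simple_integral w F' t \<omega>)"
    using H(2) by auto
  then show ?thesis using simple_isometry[OF H(1) assms(3,4)] H(3) by simp
qed

end

section \<open>Stability of the sheet integral and fourth moments\<close>

context sheet_noise
begin

lemma id_P_G: "t \<le> T \<Longrightarrow> (\<lambda>\<omega>. \<omega>) \<in> measurable P (G t)"
  using sets_G_sub[of t] by (auto simp: measurable_def dest: sets.sets_into_space)

lemma progressive_Q:
  assumes f: "jointly_progressive T G f" and t: "0 \<le> t" "t \<le> T"
  shows "(\<lambda>(\<omega>, s, u). f \<omega> u s) \<in> borel_measurable (Q t)"
proof -
  have "(\<lambda>(s, \<omega>, u). f \<omega> u s) \<in> borel_measurable (restrict_space borel {0..t} \<Otimes>\<^sub>M (G t \<Otimes>\<^sub>M leb01))"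
    using f t by (auto simp: jointly_progressive_def)
  then have 1: "(\<lambda>(s, \<omega>, u). f \<omega> u s) \<in> borel_measurable (slab t \<Otimes>\<^sub>M (G t \<Otimes>\<^sub>M leb01))"
    by (subst measurable_cong_sets[OF sets_pair_measure_cong[OF sets_slab refl] refl])
  have [measurable]: "(\<lambda>\<omega>. \<omega>) \<in> measurable P (G t)" using t by (intro id_P_G)
  have "(\<lambda>q. (fst (snd q), (fst q, snd (snd q)))) \<in> measurable (P \<Otimes>\<^sub>M (slab t \<Otimes>\<^sub>M leb01)) (slab t \<Otimes>\<^sub>M (G t \<Otimes>\<^sub>M leb01))"
    by measurable
  from measurable_compose[OF this 1] show ?thesis
    by (simp add: Q_def Box_def case_prod_beta)
qed

text \<open>The triangle inequality through approximating simple integrands, with squares. The factor \<open>16\<close>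
  (instead of \<open>1\<close>) is harmless.\<close>

lemma has_sheet_integral_stability:
  assumes 1: "has_sheet_integral P T G w f t Y" and 2: "has_sheet_integral P T G w f' t Y'"
    and t: "0 \<le> t" "t \<le> T"
  shows "sqn P (\<lambda>\<omega>. Y \<omega> - Y' \<omega>) \<le> 16 * sqn (Q t) (\<lambda>(\<omega>, s, u). f \<omega> u s - f' \<omega> u s)"
proof -
  have Qdiff: "sqn (Q t) (\<lambda>(\<omega>, s, u). a \<omega> u s - b \<omega> u s) =
      (\<integral>\<^sup>+ \<omega>. (\<integral>\<^sup>+ s. (\<integral>\<^sup>+ u. ennreal ((a \<omega> u s - b \<omega> u s)\<^sup>2) \<partial>leb01) \<partial>restrict_space lborel {0..t}) \<partial>P)"
    if "(\<lambda>(\<omega>, s, u). a \<omega> u s) \<in> borel_measurable (Q t)" "(\<lambda>(\<omega>, s, u). b \<omega> u s) \<in> borel_measurable (Q t)" for a b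
  proof -
    have "(\<lambda>(\<omega>, s, u). a \<omega> u s - b \<omega> u s) \<in> borel_measurable (Q t)"
      using borel_measurable_diff[OF that] by (simp add: case_prod_beta)
    from sqn_Q[OF this] show ?thesis by (simp add: slab_def)
  qed
  from 1 have fp: "jointly_progressive T G f" and [measurable]: "Y \<in> borel_measurable P"
    by (auto simp: has_sheet_integral_def)
  from 2 have fp': "jointly_progressive T G f'" and [measurable]: "Y' \<in> borel_measurable P"
    by (auto simp: has_sheet_integral_def)
  note fm = progressive_Q[OF fp t] and fm' = progressive_Q[OF fp' t]
  from 1 obtain F where F: "\<And>n. simple_integrand P T G (F n)"
    and F1: "(\<lambda>n. sqn (Q t) (\<lambda>(\<omega>, s, u). simple_eval (F n) \<omega> u s - f \<omega> u s)) \<longlonglongrightarrow> 0"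
    and F2: "(\<lambda>n. sqn P (\<lambda>\<omega>. simple_integral w (F n) t \<omega> - Y \<omega>)) \<longlonglongrightarrow> 0"
    unfolding has_sheet_integral_def sqn_def[of P]
    using Qdiff[OF simple_eval_measurable[OF _ t(1)] fm] by auto
  from 2 obtain F' where F': "\<And>n. simple_integrand P T G (F' n)"
    and F1': "(\<lambda>n. sqn (Q t) (\<lambda>(\<omega>, s, u). simple_eval (F' n) \<omega> u s - f' \<omega> u s)) \<longlonglongrightarrow> 0"
    and F2': "(\<lambda>n. sqn P (\<lambda>\<omega>. simple_integral w (F' n) t \<omega> - Y' \<omega>)) \<longlonglongrightarrow> 0"
    unfolding has_sheet_integral_def sqn_def[of P]
    using Qdiff[OF simple_eval_measurable[OF _ t(1)] fm'] by auto
  let ?a = "\<lambda>n. sqn (Q t) (\<lambda>(\<omega>, s, u). simple_eval (F n) \<omega> u s - f \<omega> u s)"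
  let ?a' = "\<lambda>n. sqn (Q t) (\<lambda>(\<omega>, s, u). simple_eval (F' n) \<omega> u s - f' \<omega> u s)"
  let ?b = "\<lambda>n. sqn P (\<lambda>\<omega>. simple_integral w (F n) t \<omega> - Y \<omega>)"
  let ?b' = "\<lambda>n. sqn P (\<lambda>\<omega>. simple_integral w (F' n) t \<omega> - Y' \<omega>)"
  let ?R = "sqn (Q t) (\<lambda>(\<omega>, s, u). f \<omega> u s - f' \<omega> u s)"
  have bound: "sqn P (\<lambda>\<omega>. Y \<omega> - Y' \<omega>) \<le> 2 * ?b n + 4 * ?b' n + 8 * ?a n + 16 * ?a' n + 16 * ?R" for n
  proof -
    note [measurable] = simple_integral_measurable[OF F[of n] t] simple_integral_measurable[OF F'[of n] t]
    note ev = simple_eval_measurable[OF F[of n] t(1)] and ev' = simple_eval_measurable[OF F'[of n] t(1)]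
    have "sqn P (\<lambda>\<omega>. Y \<omega> - Y' \<omega>) \<le> 2 * sqn P (\<lambda>\<omega>. Y \<omega> - simple_integral w (F n) t \<omega>)
       + 2 * sqn P (\<lambda>\<omega>. simple_integral w (F n) t \<omega> - Y' \<omega>)"
      by (rule sqn_triangle) measurable
    also have "\<dots> \<le> 2 * ?b n + 2 * (2 * sqn P (\<lambda>\<omega>. simple_integral w (F n) t \<omega> - simple_integral w (F' n) t \<omega>)
       + 2 * ?b' n)"
      by (intro add_mono mult_left_mono sqn_triangle eq_refl[OF sqn_minus_commute]) measurable
    also have "sqn P (\<lambda>\<omega>. simple_integral w (F n) t \<omega> - simple_integral w (F' n) t \<omega>) =
        sqn (Q t) (\<lambda>q. (\<lambda>(\<omega>, s, u). simple_eval (F n) \<omega> u s) q - (\<lambda>(\<omega>, s, u). simple_eval (F' n) \<omega> u s) q)"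
      using simple_isometry_diff[OF F F' t] by (simp add: case_prod_beta')
    also have "\<dots> \<le> 2 * ?a n + 2 * sqn (Q t) (\<lambda>q. (\<lambda>(\<omega>, s, u). f \<omega> u s) q - (\<lambda>(\<omega>, s, u). simple_eval (F' n) \<omega> u s) q)"
      using sqn_triangle[OF ev fm ev'] by (simp add: case_prod_beta')
    also have "sqn (Q t) (\<lambda>q. (\<lambda>(\<omega>, s, u). f \<omega> u s) q - (\<lambda>(\<omega>, s, u). simple_eval (F' n) \<omega> u s) q)
       \<le> 2 * ?R + 2 * ?a' n"
      using sqn_triangle[OF fm fm' ev'] sqn_minus_commute[of "Q t" "\<lambda>(\<omega>, s, u). f' \<omega> u s" "\<lambda>(\<omega>, s, u). simple_eval (F' n) \<omega> u s"]
      by (simp add: case_prod_beta')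
    finally have "sqn P (\<lambda>\<omega>. Y \<omega> - Y' \<omega>) \<le> 2 * ?b n + 2 * (2 * (2 * ?a n + 2 * (2 * ?R + 2 * ?a' n)) + 2 * ?b' n)"
      by (simp add: add_mono mult_left_mono)
    then show ?thesis by (simp add: distrib_left mult.assoc[symmetric] add_ac)
  qed
  have "(\<lambda>n. 2 * ?b n + 4 * ?b' n + 8 * ?a n + 16 * ?a' n + 16 * ?R) \<longlonglongrightarrow> 2 * 0 + 4 * 0 + 8 * 0 + 16 * 0 + 16 * ?R"
    by (intro tendsto_add ennreal_tendsto_cmult F1 F1' F2 F2' tendsto_const) auto
  then show ?thesis using LIMSEQ_le_const[of _ _ "sqn P (\<lambda>\<omega>. Y \<omega> - Y' \<omega>)"] bound by fastforce
qed

text \<open>The entries can be revealed in the order of the list: no coefficient depends on the noise of a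
  later entry.\<close>

definition orderly :: "real \<Rightarrow> real \<Rightarrow> 'a simple_data \<Rightarrow> bool" where
  "orderly s t F \<longleftrightarrow> sorted_wrt (\<lambda>e e'. start e \<le> start e' \<and> ebox s t e \<inter> ebox s t e' = {}) F"

text \<open>Induction on the number of entries. In the expansion of \<open>(M + X W(C))\<^sup>4\<close> the odd powers of \<open>W(C)\<close>
  vanish in expectation, since \<open>M\<close> and \<open>X\<close> are determined by the noise off \<open>C\<close>. With \<open>v = |C|\<close> and
  \<open>L\<close> the area covered before, what remains is at most \<open>3K\<^sup>4L\<^sup>2 + 6K\<^sup>4Lv + 3K\<^sup>4v\<^sup>2 = 3K\<^sup>4(L + v)\<^sup>2\<close>. The second
  moment has to be carried along for the middle term.\<close>

lemma fourth_moment_aux: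
  assumes "orderly s t F" "\<forall>e\<in>set F. valid_entry e" "0 \<le> s" "s \<le> t" "t \<le> T"
    and K: "\<forall>e\<in>set F. \<forall>\<omega>\<in>space P. \<bar>coef e \<omega>\<bar> \<le> K" "K \<ge> 0"
  shows "integrable P (\<lambda>\<omega>. (\<Sum>e\<leftarrow>F. coef e \<omega> * W (ebox s t e) \<omega>) ^ 4) \<and>
    expectation (\<lambda>\<omega>. (\<Sum>e\<leftarrow>F. coef e \<omega> * W (ebox s t e) \<omega>)\<^sup>2) \<le> K\<^sup>2 * measure lborel (\<Union>e\<in>set F. ebox s t e) \<and>
    expectation (\<lambda>\<omega>. (\<Sum>e\<leftarrow>F. coef e \<omega> * W (ebox s t e) \<omega>) ^ 4) \<le> 3 * K ^ 4 * (measure lborel (\<Union>e\<in>set F. ebox s t e))\<^sup>2"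
  using assms(1,2) K(1)
proof (induction F rule: rev_induct)
  case (snoc e F)
  define M where "M \<omega> = (\<Sum>e\<leftarrow>F. coef e \<omega> * W (ebox s t e) \<omega>)" for \<omega>
  define C where "C = ebox s t e"
  define L where "L = measure lborel (\<Union>e\<in>set F. ebox s t e)"
  define v where "v = measure lborel C"
  define X where "X = coef e"
  have e: "valid_entry e" and F: "\<forall>e\<in>set F. valid_entry e" using snoc.prems by auto
  have ord: "orderly s t F" and before: "\<forall>e'\<in>set F. start e' \<le> start e \<and> ebox s t e' \<inter> C = {}"
    using snoc.prems by (auto simp: orderly_def sorted_wrt_append C_def)
  have IH: "integrable P (\<lambda>\<omega>. M \<omega> ^ 4)" "expectation (\<lambda>\<omega>. (M \<omega>)\<^sup>2) \<le> K\<^sup>2 * L"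
    "expectation (\<lambda>\<omega>. (M \<omega>) ^ 4) \<le> 3 * K ^ 4 * L\<^sup>2"
    using snoc.IH[OF ord F] snoc.prems by (auto simp: M_def L_def)
  have C: "C \<in> cells" using ebox_cells[OF e] assms by (simp add: C_def)
  have sub: "C \<subseteq> UNIV \<times> {start e<..}" by (simp add: C_def ebox_after)
  have sT: "start e \<le> T" using start_bounds[OF e] by simp
  have Xo: "X \<in> borel_measurable (outside C)"
    unfolding X_def by (rule G_outside[OF coef_measurable[OF e] sub sT])
  have Mo: "M \<in> borel_measurable (outside C)"
  proof -
    have "(\<lambda>\<omega>. \<Sum>i<length F. coef (F ! i) \<omega> * W (ebox s t (F ! i)) \<omega>) \<in> borel_measurable (outside C)"
    proof (intro borel_measurable_sum borel_measurable_times)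
      fix i assume "i \<in> {..<length F}"
      then have i: "F ! i \<in> set F" by simp
      then show "coef (F ! i) \<in> borel_measurable (outside C)"
        using F before by (intro G_outside[OF G_measurable_mono[OF coef_measurable] sub sT]) auto
      show "W (ebox s t (F ! i)) \<in> borel_measurable (outside C)"
        using i F before assms by (intro noise_outside ebox_cells) auto
    qed
    then show ?thesis unfolding M_def[abs_def] sum_list_index .
  qed
  note [measurable] = outside_measurable[OF Mo] outside_measurable[OF Xo] noise_measurable[OF C]
  have XK: "\<bar>X \<omega>\<bar> \<le> K" if "\<omega> \<in> space P" for \<omega> using snoc.prems that by (auto simp: X_def)
  have pw: "\<bar>x\<bar> ^ k \<le> 1 + x ^ 4" if "k \<le> 4" for x :: real and k
  proof (cases "\<bar>x\<bar> \<le> 1")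
    case True
    then have "\<bar>x\<bar> ^ k \<le> 1" by (simp add: power_le_one)
    then show ?thesis by (simp add: add_increasing2)
  next
    case False
    then have "\<bar>x\<bar> ^ k \<le> \<bar>x\<bar> ^ 4" using that by (intro power_increasing) auto
    then show ?thesis by (simp add: power_even_abs)
  qed
  have iMX: "integrable P (\<lambda>\<omega>. M \<omega> ^ k * X \<omega> ^ j)" if "k \<le> 4" for k j
  proof (rule Bochner_Integration.integrable_bound)
    show "integrable P (\<lambda>\<omega>. (1 + M \<omega> ^ 4) * K ^ j)" using IH(1) by auto
    show "AE \<omega> in P. norm (M \<omega> ^ k * X \<omega> ^ j) \<le> norm ((1 + M \<omega> ^ 4) * K ^ j)"
    proof (rule AE_I2)
      fix \<omega> assume "\<omega> \<in> space P"
      then have "\<bar>M \<omega>\<bar> ^ k * \<bar>X \<omega>\<bar> ^ j \<le> (1 + M \<omega> ^ 4) * K ^ j"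
        using XK by (intro mult_mono pw that power_mono) auto
      also have "\<dots> \<le> \<bar>(1 + M \<omega> ^ 4) * K ^ j\<bar>" by simp
      finally show "norm (M \<omega> ^ k * X \<omega> ^ j) \<le> norm ((1 + M \<omega> ^ 4) * K ^ j)"
        by (simp add: abs_mult power_abs)
    qed
  qed measurable
  have oMX: "(\<lambda>\<omega>. M \<omega> ^ k * X \<omega> ^ j) \<in> borel_measurable (outside C)" for k j
    using Mo Xo by measurable
  have pr: "integrable P (\<lambda>\<omega>. M \<omega> ^ k * X \<omega> ^ j * W C \<omega> ^ i)"
    "expectation (\<lambda>\<omega>. M \<omega> ^ k * X \<omega> ^ j * W C \<omega> ^ i) = expectation (\<lambda>\<omega>. M \<omega> ^ k * X \<omega> ^ j) * expectation (\<lambda>\<omega>. W C \<omega> ^ i)"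
    if "k \<le> 4" for k j i
    using outside_product[OF C oMX iMX[OF that]] by auto
  note mom = noise_moment(2-5)[OF C, folded v_def]
  have sum: "(\<Sum>e\<leftarrow>F @ [e]. coef e \<omega> * W (ebox s t e) \<omega>) = M \<omega> + X \<omega> * W C \<omega>" for \<omega>
    by (simp add: M_def X_def C_def)
  have ex4: "(M \<omega> + X \<omega> * W C \<omega>) ^ 4 = M \<omega> ^ 4 + 4 * (M \<omega> ^ 3 * X \<omega> ^ 1 * W C \<omega> ^ 1)
     + 6 * (M \<omega> ^ 2 * X \<omega> ^ 2 * W C \<omega> ^ 2) + 4 * (M \<omega> ^ 1 * X \<omega> ^ 3 * W C \<omega> ^ 3)
     + M \<omega> ^ 0 * X \<omega> ^ 4 * W C \<omega> ^ 4" for \<omega> by algebra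
  have ex2: "(M \<omega> + X \<omega> * W C \<omega>)\<^sup>2 = M \<omega> ^ 2 * X \<omega> ^ 0 + 2 * (M \<omega> ^ 1 * X \<omega> ^ 1 * W C \<omega> ^ 1)
     + M \<omega> ^ 0 * X \<omega> ^ 2 * W C \<omega> ^ 2" for \<omega> by algebra
  have i4: "integrable P (\<lambda>\<omega>. (M \<omega> + X \<omega> * W C \<omega>) ^ 4)"
    unfolding ex4 by (intro Bochner_Integration.integrable_add integrable_mult_right pr IH(1)) auto
  have Xb: "expectation (\<lambda>\<omega>. M \<omega> ^ k * X \<omega> ^ (2*j)) \<le> expectation (\<lambda>\<omega>. M \<omega> ^ k) * K ^ (2*j)" if "k \<le> 4" "even k" for k j
  proof -
    have "expectation (\<lambda>\<omega>. M \<omega> ^ k * X \<omega> ^ (2*j)) \<le> expectation (\<lambda>\<omega>. M \<omega> ^ k * K ^ (2*j))"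
    proof (rule integral_mono)
      show "integrable P (\<lambda>\<omega>. M \<omega> ^ k * K ^ (2*j))" using iMX[OF that(1), of 0] by auto
      fix \<omega> assume "\<omega> \<in> space P"
      then have "\<bar>X \<omega>\<bar> ^ (2*j) \<le> K ^ (2*j)" using XK by (intro power_mono) auto
      then have "X \<omega> ^ (2*j) \<le> K ^ (2*j)" by (simp add: power_even_abs)
      then show "M \<omega> ^ k * X \<omega> ^ (2*j) \<le> M \<omega> ^ k * K ^ (2*j)"
        using that by (intro mult_left_mono) (auto simp: zero_le_even_power)
    qed (use iMX that in auto)
    then show ?thesis by simp
  qed
  have X2: "expectation (\<lambda>\<omega>. M \<omega> ^ 2 * X \<omega> ^ 2) \<le> K\<^sup>2 * L * K\<^sup>2"
    using Xb[of 2 1] IH(2) mult_right_mono[OF IH(2), of "K^2"] by simp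
  have X0: "expectation (\<lambda>\<omega>. M \<omega> ^ 0 * X \<omega> ^ 2) \<le> K\<^sup>2" "expectation (\<lambda>\<omega>. M \<omega> ^ 0 * X \<omega> ^ 4) \<le> K ^ 4"
    using Xb[of 0 1] Xb[of 0 2] by (auto simp: prob_space)
  have v0: "v \<ge> 0" by (simp add: v_def)
  have Un: "measure lborel (\<Union>e\<in>set (F @ [e]). ebox s t e) = L + v"
  proof -
    have a: "(\<Union>e\<in>set F. ebox s t e) \<in> cells"
      using F assms by (intro cells_Union) (auto intro: ebox_cells)
    have "(\<Union>e\<in>set (F @ [e]). ebox s t e) = (\<Union>e\<in>set F. ebox s t e) \<union> C" by (auto simp: C_def)
    also have "measure lborel \<dots> = L + v"
      unfolding L_def v_def using before cells_fmeasurable[OF a] cells_fmeasurable[OF C]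
      by (intro measure_Union) (auto simp: fmeasurable_def)
    finally show ?thesis .
  qed
  have E2: "expectation (\<lambda>\<omega>. (M \<omega> + X \<omega> * W C \<omega>)\<^sup>2) \<le> K\<^sup>2 * (L + v)"
  proof -
    have "expectation (\<lambda>\<omega>. (M \<omega> + X \<omega> * W C \<omega>)\<^sup>2) = expectation (\<lambda>\<omega>. M \<omega> ^ 2 * X \<omega> ^ 0)
      + 2 * expectation (\<lambda>\<omega>. M \<omega> ^ 1 * X \<omega> ^ 1 * W C \<omega> ^ 1) + expectation (\<lambda>\<omega>. M \<omega> ^ 0 * X \<omega> ^ 2 * W C \<omega> ^ 2)"
      unfolding ex2 using pr[of 1 1 1] pr[of 0 2 2] iMX[of 2 0]
      by (simp del: power_0 power_one_right mult_1_left mult_1_right power_Suc0_right)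
    also have "\<dots> = expectation (\<lambda>\<omega>. (M \<omega>)\<^sup>2) + expectation (\<lambda>\<omega>. M \<omega> ^ 0 * X \<omega> ^ 2) * v"
      using pr(2)[of 1 1 1] pr(2)[of 0 2 2] mom by simp
    also have "\<dots> \<le> K\<^sup>2 * L + K\<^sup>2 * v" by (intro add_mono IH mult_right_mono X0 v0)
    finally show ?thesis by (simp add: distrib_left)
  qed
  have E4: "expectation (\<lambda>\<omega>. (M \<omega> + X \<omega> * W C \<omega>) ^ 4) \<le> 3 * K ^ 4 * (L + v)\<^sup>2"
  proof -
    have "expectation (\<lambda>\<omega>. (M \<omega> + X \<omega> * W C \<omega>) ^ 4) = expectation (\<lambda>\<omega>. M \<omega> ^ 4)
      + 4 * expectation (\<lambda>\<omega>. M \<omega> ^ 3 * X \<omega> ^ 1 * W C \<omega> ^ 1) + 6 * expectation (\<lambda>\<omega>. M \<omega> ^ 2 * X \<omega> ^ 2 * W C \<omega> ^ 2)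
      + 4 * expectation (\<lambda>\<omega>. M \<omega> ^ 1 * X \<omega> ^ 3 * W C \<omega> ^ 3) + expectation (\<lambda>\<omega>. M \<omega> ^ 0 * X \<omega> ^ 4 * W C \<omega> ^ 4)"
      unfolding ex4 using pr[of 3 1 1] pr[of 2 2 2] pr[of 1 3 3] pr[of 0 4 4] IH(1)
      by (simp del: power_0 power_one_right mult_1_left mult_1_right power_Suc0_right)
    also have "\<dots> = expectation (\<lambda>\<omega>. M \<omega> ^ 4) + 6 * (expectation (\<lambda>\<omega>. M \<omega> ^ 2 * X \<omega> ^ 2) * v)
       + expectation (\<lambda>\<omega>. M \<omega> ^ 0 * X \<omega> ^ 4) * (3 * v\<^sup>2)"
      using pr(2)[of 3 1 1] pr(2)[of 2 2 2] pr(2)[of 1 3 3] pr(2)[of 0 4 4] mom by simp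
    also have "\<dots> \<le> 3 * K ^ 4 * L\<^sup>2 + 6 * (K\<^sup>2 * L * K\<^sup>2 * v) + K ^ 4 * (3 * v\<^sup>2)"
      by (intro add_mono mult_left_mono IH mult_right_mono X2 X0 v0) auto
    also have "\<dots> = 3 * K ^ 4 * (L + v)\<^sup>2" by algebra
    finally show ?thesis .
  qed
  show ?case unfolding sum Un using i4 E2 E4 by simp
qed (simp add: K)

lemma simple_fourth_moment:
  assumes F: "simple_integrand P T G F" and ord: "orderly s t F" and st: "0 \<le> s" "s \<le> t" "t \<le> T"
    and K: "\<forall>e\<in>set F. \<forall>\<omega>\<in>space P. \<bar>coef e \<omega>\<bar> \<le> K" "K \<ge> 0"
  shows "(\<integral>\<^sup>+\<omega>. ennreal ((simple_integral w F t \<omega> - simple_integral w F s \<omega>) ^ 4) \<partial>P)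
     \<le> ennreal (3 * K ^ 4 * (t - s)\<^sup>2)"
proof -
  have v: "\<forall>e\<in>set F. valid_entry e" using F by (simp add: simple_integrand_iff)
  let ?M = "\<lambda>\<omega>. \<Sum>e\<leftarrow>F. coef e \<omega> * W (ebox s t e) \<omega>"
  note fm = fourth_moment_aux[OF ord v st K]
  have ae: "AE \<omega> in P. simple_integral w F t \<omega> - simple_integral w F s \<omega> = ?M \<omega>"
    using v
  proof (induction F)
    case (Cons e F)
    then have "AE \<omega> in P. simple_integral w F t \<omega> - simple_integral w F s \<omega> = (\<Sum>e\<leftarrow>F. coef e \<omega> * W (ebox s t e) \<omega>)"
      by simp
    moreover have "AE \<omega> in P. eint e t \<omega> - eint e s \<omega> = coef e \<omega> * W (ebox s t e) \<omega>"
      using Cons st by (intro eint_increment) auto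
    ultimately show ?case by eventually_elim (simp add: simple_integral_sum_list)
  qed (simp add: simple_integral_def)
  have "measure lborel (\<Union>e\<in>set F. ebox s t e) \<le> measure lborel ({0<..1::real} \<times> {s<..t})"
  proof (rule measure_mono_fmeasurable)
    show "(\<Union>e\<in>set F. ebox s t e) \<subseteq> {0<..1} \<times> {s<..t}"
      using v by (auto elim!: valid_entryE simp: ebox_def)
    have "(\<Union>e\<in>set F. ebox s t e) \<in> cells"
      using v st by (intro cells_Union) (auto intro: ebox_cells)
    then show "(\<Union>e\<in>set F. ebox s t e) \<in> sets lborel" by (simp add: white_noise_sets_def)
    show "{0<..1::real} \<times> {s<..t} \<in> fmeasurable lborel"
      using st by (intro cells_fmeasurable rect_cells) auto
  qed
  also have "\<dots> = t - s" using st by (subst measure_lborel_Times) auto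
  finally have L: "(measure lborel (\<Union>e\<in>set F. ebox s t e))\<^sup>2 \<le> (t - s)\<^sup>2" by (intro power_mono) auto
  have "(\<integral>\<^sup>+\<omega>. ennreal ((simple_integral w F t \<omega> - simple_integral w F s \<omega>) ^ 4) \<partial>P) = (\<integral>\<^sup>+\<omega>. ennreal (?M \<omega> ^ 4) \<partial>P)"
    by (rule nn_integral_cong_AE) (use ae in eventually_elim, simp)
  also have "\<dots> = ennreal (expectation (\<lambda>\<omega>. ?M \<omega> ^ 4))"
    using fm by (intro nn_integral_eq_integral) auto
  also have "\<dots> \<le> ennreal (3 * K ^ 4 * (measure lborel (\<Union>e\<in>set F. ebox s t e))\<^sup>2)"
    using fm by (intro ennreal_leI) blast
  also have "\<dots> \<le> ennreal (3 * K ^ 4 * (t - s)\<^sup>2)"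
    by (intro ennreal_leI mult_left_mono L) auto
  finally show ?thesis .
qed

end

section \<open>Lagged grid averages\<close>

lemma inter_slab: "X \<in> sets borel \<Longrightarrow> X \<inter> {0..t} \<in> sets (slab t)"
  unfolding sets_slab sets_restrict_space by (rule image_eqI[of _ _ X]) auto

lemma inter_leb01: "X \<in> sets borel \<Longrightarrow> X \<inter> {0..1} \<in> sets leb01"
  unfolding sets_restrict_space by (rule image_eqI[of _ _ X]) auto

text \<open>Lower left quadrants are a convenient generator for the averages: away from their two boundary lines
  their indicator is locally constant.\<close>

lemma sets_Box_generated:
  "sets (Box t) = sigma_sets ({0..t} \<times> {0..1}) {({..a} \<times> {..b}) \<inter> ({0..t} \<times> {0..1}) | a b. True}"
  (is "_ = sigma_sets ?\<Omega> ?g")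
proof
  define M where "M = sigma ?\<Omega> ?g"
  have sp: "space M = ?\<Omega>" and st: "sets M = sigma_sets ?\<Omega> ?g"
    unfolding M_def by (rule space_measure_of sets_measure_of; blast)+
  have g: "({..a} \<times> {..b}) \<inter> ?\<Omega> \<in> sets M" for a b unfolding st by (intro sigma_sets.Basic) blast
  have f: "fst \<in> measurable M (restrict_space borel {0..t})"
  proof (rule measurable_restrict_space2)
    show "fst \<in> borel_measurable M"
    proof (rule borel_measurableI_le)
      fix y
      have "{x \<in> space M. fst x \<le> y} = ({..y} \<times> {..1}) \<inter> ?\<Omega>" by (auto simp: sp)
      then show "{x \<in> space M. fst x \<le> y} \<in> sets M" using g by simp
    qed
  qed (auto simp: sp)
  have s: "snd \<in> measurable M (restrict_space borel {0..1})"
  proof (rule measurable_restrict_space2)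
    show "snd \<in> borel_measurable M"
    proof (rule borel_measurableI_le)
      fix y
      have "{x \<in> space M. snd x \<le> y} = ({..t} \<times> {..y}) \<inter> ?\<Omega>" by (auto simp: sp)
      then show "{x \<in> space M. snd x \<le> y} \<in> sets M" using g by simp
    qed
  qed (auto simp: sp)
  have "sets (Box t) \<subseteq> sets M"
  proof -
    have "space (slab t) \<times> space leb01 = space M" by (simp add: sp)
    then show ?thesis
      unfolding Box_def sets_pair_measure
    proof (simp only:, intro sets.sigma_sets_subset, safe)
      fix a b assume a: "a \<in> sets (slab t)" and b: "b \<in> sets leb01"
      have "a \<subseteq> {0..t}" "b \<subseteq> {0..1}"
        using sets.sets_into_space[OF a] sets.sets_into_space[OF b] by auto
      then have "a \<times> b = (fst -` a \<inter> space M) \<inter> (snd -` b \<inter> space M)" by (auto simp: sp)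
      also have "\<dots> \<in> sets M"
        using a b by (intro sets.Int measurable_sets[OF f] measurable_sets[OF s])
          (auto simp: sets_slab sets_restrict_space)
      finally show "a \<times> b \<in> sets M" .
    qed
  qed
  then show "sets (Box t) \<subseteq> sigma_sets ?\<Omega> ?g" by (simp add: st)
  show "sigma_sets ?\<Omega> ?g \<subseteq> sets (Box t)"
  proof -
    have "?\<Omega> = space (Box t)" by simp
    then show ?thesis
    proof (simp only:, intro sets.sigma_sets_subset, safe)
      fix a b
      have "({..a} \<times> {..b}) \<inter> space (Box t) = ({..a} \<inter> {0..t}) \<times> ({..b} \<inter> {0..1})" by auto
      also have "\<dots> \<in> sets (Box t)"
        unfolding Box_def by (intro pair_measureI inter_slab inter_leb01) auto
      finally show "({..a} \<times> {..b}) \<inter> space (Box t) \<in> sets (Box t)" .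
    qed
  qed
qed

text \<open>The cell with number \<open>k\<close> of the \<open>N \<times> N\<close> grid on \<open>(0,T] \<times> (0,1]\<close>, shifted in time by \<open>r\<close> columns.
  Numbering the cells by a single index, column after column, makes the order of the grid the order in
  which the noise is revealed.\<close>

definition cell :: "real \<Rightarrow> nat \<Rightarrow> real \<Rightarrow> nat \<Rightarrow> (real \<times> real) set" where
  "cell T N r k = {(real (k div N) + r) * T / N<..(real (k div N) + r + 1) * T / N}
      \<times> {real (k mod N) / N<..(real (k mod N) + 1) / N}"

text \<open>The average over the cell one column earlier; in the first column that cell lies outside the box, up
  to a null set, and the coefficient is \<open>0\<close>.\<close>

definition avg_coef :: "real \<Rightarrow> nat \<Rightarrow> (real \<times> real \<Rightarrow> real) \<Rightarrow> nat \<Rightarrow> real" where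
  "avg_coef T N f k = (real N)\<^sup>2 / T * (\<integral>p. indicator (cell T N (-1) k) p * f p \<partial>Box T)"

definition lag_avg :: "real \<Rightarrow> nat \<Rightarrow> (real \<times> real \<Rightarrow> real) \<Rightarrow> real \<times> real \<Rightarrow> real" where
  "lag_avg T N f p = (\<Sum>k<N*N. avg_coef T N f k * indicator (cell T N 0 k) p)"

context
  fixes T :: real assumes T: "0 < T"
begin

lemma cell_unique:
  assumes N: "0 < N" and "p \<in> cell T N r k" "p \<in> cell T N r k'"
  shows "k = k'"
proof -
  obtain s u where p: "p = (s, u)" by (cases p)
  have eqn: "i = i'" if "real i < x" "x \<le> real i + 1" "real i' < x" "x \<le> real i' + 1" for i i' x
    using that by linarith
  have "k div N = k' div N"
    using assms T by (intro eqn[of _ "s * N / T - r"]) (auto simp: cell_def p field_simps)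
  moreover have "k mod N = k' mod N"
    using assms T by (intro eqn[of _ "u * N"]) (auto simp: cell_def p field_simps)
  ultimately show ?thesis by (metis div_mult_mod_eq)
qed

lemma cell_cover:
  assumes N: "0 < N" and s: "0 < s" "s \<le> T" and u: "0 < u" "u \<le> 1"
  obtains k where "k < N * N" "(s, u) \<in> cell T N 0 k"
proof -
  have ex: "\<exists>i<N. real i < x \<and> x \<le> real i + 1" if "0 < x" "x \<le> real N" for x
  proof (intro exI conjI)
    let ?i = "nat (\<lceil>x\<rceil> - 1)"
    have "real ?i = of_int \<lceil>x\<rceil> - 1" using that by simp
    then show "real ?i < x" "x \<le> real ?i + 1" by linarith+
    then have "real ?i < real N" using that by linarith
    then show "?i < N" by simp
  qed
  have "0 < s * N / T" "s * N / T \<le> N" using s T N by (auto simp: field_simps)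
  then obtain i where i: "i < N" "real i < s * N / T" "s * N / T \<le> real i + 1" using ex by blast
  have "0 < u * N" "u * N \<le> N" using u N by auto
  then obtain j where j: "j < N" "real j < u * N" "u * N \<le> real j + 1" using ex by blast
  have "(i * N + j) div N = i" "(i * N + j) mod N = j" using j by auto
  moreover have "real i * T / N < s" "s \<le> (real i + 1) * T / N" "real j / N < u" "u \<le> (real j + 1) / N"
    using i(2,3) j(2,3) T N by (simp_all add: pos_less_divide_eq pos_divide_less_eq pos_le_divide_eq pos_divide_le_eq)
  ultimately have "(s, u) \<in> cell T N 0 (i * N + j)"
    by (simp add: cell_def)
  moreover have "i * N + j < N * N"
  proof -
    have "i * N + j < (i + 1) * N" using j by simp
    also have "\<dots> \<le> N * N" using i by (intro mult_right_mono) auto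
    finally show ?thesis .
  qed
  ultimately show thesis using that by blast
qed

lemma index_bounds: "k < N * N \<Longrightarrow> k div N < N \<and> k mod N < N" for k N :: nat
  by (metis less_mult_imp_div_less mod_less_divisor mult_eq_0_iff not_gr_zero not_less0)

lemma cell_bounds:
  assumes k: "k < N * N" and r: "r \<in> {-1, 0}"
  shows "(real (k div N) + r + 1) * T / N \<le> T" "(real (k mod N) + 1) / N \<le> 1"
    "(r = 0 \<or> 1 \<le> k div N) \<Longrightarrow> 0 \<le> (real (k div N) + r) * T / N"
proof -
  have N: "0 < N" using k by (cases N) auto
  have "real (k div N) + 1 \<le> real N" "real (k mod N) + 1 \<le> real N"
    using index_bounds[OF k] by linarith+
  moreover then have "real (k div N) + r + 1 \<le> real N" using r by auto
  ultimately have "(real (k div N) + r + 1) * T \<le> real N * T" "real (k mod N) + 1 \<le> real N * 1"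
    using T by (auto intro: mult_right_mono)
  then show "(real (k div N) + r + 1) * T / N \<le> T" "(real (k mod N) + 1) / N \<le> 1"
    using N by (auto simp: pos_divide_le_eq mult.commute)
  show "0 \<le> (real (k div N) + r) * T / N" if "r = 0 \<or> 1 \<le> k div N"
    using that r T by (auto intro!: divide_nonneg_nonneg mult_nonneg_nonneg)
qed

lemma cell_in_Box: "cell T N r k \<inter> space (Box T) \<in> sets (Box T)"
proof -
  have "cell T N r k \<inter> space (Box T) =
    ({(real (k div N) + r) * T / N<..(real (k div N) + r + 1) * T / N} \<inter> {0..T})
    \<times> ({real (k mod N) / N<..(real (k mod N) + 1) / N} \<inter> {0..1})"
    by (auto simp: cell_def)
  also have "\<dots> \<in> sets (Box T)"
    unfolding Box_def by (intro pair_measureI inter_slab inter_leb01) auto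
  finally show ?thesis .
qed

lemma cell_indicator_measurable [measurable]:
  "(\<lambda>p. indicator (cell T N r k) p :: real) \<in> borel_measurable (Box T)"
proof -
  have "(\<lambda>p. indicator (cell T N r k) p :: real) \<in> borel_measurable (Box T) \<longleftrightarrow>
    (\<lambda>p. indicator (cell T N r k \<inter> space (Box T)) p :: real) \<in> borel_measurable (Box T)"
    by (intro measurable_cong) (auto simp: indicator_def)
  then show ?thesis using cell_in_Box by simp
qed

lemma cell_integral:
  assumes k: "k < N * N" and r: "r = 0 \<or> (r = -1 \<and> 1 \<le> k div N)"
  shows "(\<integral>p. indicator (cell T N r k) p \<partial>Box T) = T / (real N)\<^sup>2"
proof -
  have N: "0 < N" using k by (cases N) auto
  have r': "r \<in> {-1, 0}" using r by auto
  let ?A = "{(real (k div N) + r) * T / N<..(real (k div N) + r + 1) * T / N}"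
  let ?B = "{real (k mod N) / N<..(real (k mod N) + 1) / N}"
  have b: "(real (k div N) + r + 1) * T / N \<le> T" "(real (k mod N) + 1) / N \<le> 1" "0 \<le> (real (k div N) + r) * T / N"
    using cell_bounds[OF k r'] r by auto
  have "0 \<le> real (k mod N) / N" by simp
  have AB: "?A \<in> sets (slab T)" "?B \<in> sets leb01"
    using b order_trans[OF b(3)] order_trans[OF \<open>0 \<le> real (k mod N) / N\<close>]
    by (auto simp: slab_def sets_restrict_space_iff less_imp_le)
  have "(\<integral>p. indicator (cell T N r k) p \<partial>Box T) = measure (Box T) (?A \<times> ?B)"
    using AB by (subst Bochner_Integration.integral_indicator)
      (auto simp: cell_def Box_def Int_absorb2 sets.sets_into_space)
  also have "\<dots> = measure lborel ?A * measure lborel ?B" by (rule measure_Box_Times[OF AB])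
  also have "\<dots> = (T / N) * (1 / N)"
  proof -
    have "(real (k div N) + r + 1) * T / N = (real (k div N) + r) * T / N + T / N"
      "(real (k mod N) + 1) / N = real (k mod N) / N + 1 / N"
      by (simp_all add: add_divide_distrib distrib_right)
    then show ?thesis using T by simp
  qed
  finally show ?thesis by (simp add: power2_eq_square)
qed

lemma lag_avg_cell:
  assumes N: "0 < N" and k: "k < N * N" and p: "p \<in> cell T N 0 k"
  shows "lag_avg T N f p = avg_coef T N f k"
proof -
  have "lag_avg T N f p = (\<Sum>k'<N*N. if k' = k then avg_coef T N f k else 0)"
    unfolding lag_avg_def
  proof (intro sum.cong refl)
    fix k'
    show "avg_coef T N f k' * indicator (cell T N 0 k') p = (if k' = k then avg_coef T N f k else 0)"
      using cell_unique[OF N p, of k'] p by (cases "k' = k") (auto simp: indicator_def)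
  qed
  then show ?thesis using k by simp
qed

lemma lag_avg_0:
  assumes "\<And>k. k < N * N \<Longrightarrow> p \<notin> cell T N 0 k"
  shows "lag_avg T N f p = 0"
  unfolding lag_avg_def using assms by (intro sum.neutral) auto

lemma lag_avg_measurable [measurable]: "lag_avg T N f \<in> borel_measurable (Box T)"
  unfolding lag_avg_def[abs_def] by measurable

lemma integrable_cell_mult:
  fixes f :: "real \<times> real \<Rightarrow> real"
  shows "integrable (Box T) f \<Longrightarrow> integrable (Box T) (\<lambda>p. indicator (cell T N r k) p * f p)"
proof (rule Bochner_Integration.integrable_bound)
  assume [measurable]: "integrable (Box T) f"
  then show "integrable (Box T) f" .
  show "(\<lambda>p. indicator (cell T N r k) p * f p) \<in> borel_measurable (Box T)" by measurable
qed (auto simp: indicator_def)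

lemma integrable_cell: "integrable (Box T) (indicator (cell T N r k) :: real \<times> real \<Rightarrow> real)"
  using integrable_cell_mult[of "\<lambda>_. 1"] by simp

lemma avg_coef_bound:
  assumes f: "integrable (Box T) f" and K: "\<And>p. p \<in> space (Box T) \<Longrightarrow> \<bar>f p\<bar> \<le> K" and k: "k < N * N"
  shows "\<bar>avg_coef T N f k\<bar> \<le> K"
proof -
  have N: "0 < N" using k by (cases N) auto
  have K0: "0 \<le> K" using K[of "(0, 0)"] T by auto
  show ?thesis
  proof (cases "1 \<le> k div N")
    case True
    have "\<bar>\<integral>p. indicator (cell T N (-1) k) p * f p \<partial>Box T\<bar> \<le> (\<integral>p. \<bar>indicator (cell T N (-1) k) p * f p\<bar> \<partial>Box T)"
      by (rule integral_abs_bound)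
    also have "\<dots> \<le> (\<integral>p. indicator (cell T N (-1) k) p * K \<partial>Box T)"
    proof (rule integral_mono)
      show "integrable (Box T) (\<lambda>p. \<bar>indicator (cell T N (-1) k) p * f p\<bar>)"
        by (intro integrable_abs integrable_cell_mult f)
      show "integrable (Box T) (\<lambda>p. indicator (cell T N (-1) k) p * K)"
        by (intro integrable_mult_left integrable_cell)
    qed (use K K0 in \<open>auto simp: indicator_def\<close>)
    also have "\<dots> = T / (real N)\<^sup>2 * K" using cell_integral[OF k, of "-1"] True by simp
    finally have "\<bar>\<integral>p. indicator (cell T N (-1) k) p * f p \<partial>Box T\<bar> \<le> T / (real N)\<^sup>2 * K" .
    then show ?thesis using T N by (simp add: avg_coef_def abs_mult field_simps)
  next
    case False
    have z: "AE p in Box T. indicator (cell T N (-1) k) p * f p = 0"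
    proof (rule AE_I')
      have m: "{0} \<in> sets (slab T)" "{0..1} \<in> sets leb01"
        using inter_slab[of "{0}" T] inter_leb01[of "{0..1}"] T by auto
      have "measure (Box T) ({0} \<times> {0..1}) = 0" using measure_Box_Times[OF m] by simp
      moreover have "{0} \<times> {0..1} \<in> sets (Box T)"
        unfolding Box_def by (intro pair_measureI m)
      ultimately show "{0} \<times> {0..1} \<in> null_sets (Box T)" by (simp add: null_sets_def Box.emeasure_eq_measure)
      have "real (k div N) = 0" using False by simp
      then show "{p \<in> space (Box T). indicator (cell T N (-1) k) p * f p \<noteq> 0} \<subseteq> {0} \<times> {0..1}"
        by (auto simp: indicator_def cell_def)
    qed
    then have "(\<integral>p. indicator (cell T N (-1) k) p * f p \<partial>Box T) = 0" by (rule integral_eq_zero_AE)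
    then show ?thesis using K0 by (simp add: avg_coef_def)
  qed
qed

lemma lag_avg_bound:
  assumes f: "integrable (Box T) f" and K: "\<And>p. p \<in> space (Box T) \<Longrightarrow> \<bar>f p\<bar> \<le> K"
  shows "\<bar>lag_avg T N f p\<bar> \<le> K"
proof (cases "\<exists>k<N*N. p \<in> cell T N 0 k")
  case True
  then obtain k where k: "k < N * N" "p \<in> cell T N 0 k" by blast
  then have "0 < N" by (cases N) auto
  then show ?thesis using lag_avg_cell[OF _ k] avg_coef_bound[OF f K k(1)] by simp
next
  case False
  then have "lag_avg T N f p = 0" by (intro lag_avg_0) auto
  moreover have "0 \<le> K" using K[of "(0, 0)"] T by auto
  ultimately show ?thesis by simp
qed

lemma lag_avg_integrable: "integrable (Box T) (lag_avg T N f)"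
  unfolding lag_avg_def[abs_def]
  by (intro Bochner_Integration.integrable_sum integrable_mult_right integrable_cell)

text \<open>The shifted cells are still disjoint.\<close>

lemma lag_avg_contraction:
  assumes f: "integrable (Box T) f"
  shows "(\<integral>p. \<bar>lag_avg T N f p\<bar> \<partial>Box T) \<le> (\<integral>p. \<bar>f p\<bar> \<partial>Box T)"
proof (cases "N = 0")
  case True then show ?thesis by (simp add: lag_avg_def[abs_def])
next
  case False
  then have N: "0 < N" by simp
  note ind = integrable_cell
  have fa: "integrable (Box T) (\<lambda>p. \<bar>f p\<bar>)" using f by simp
  have "(\<integral>p. \<bar>lag_avg T N f p\<bar> \<partial>Box T) \<le> (\<integral>p. (\<Sum>k<N*N. \<bar>avg_coef T N f k\<bar> * indicator (cell T N 0 k) p) \<partial>Box T)"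
  proof (rule integral_mono)
    show "integrable (Box T) (\<lambda>p. \<bar>lag_avg T N f p\<bar>)" using lag_avg_integrable by simp
    show "integrable (Box T) (\<lambda>p. \<Sum>k<N*N. \<bar>avg_coef T N f k\<bar> * indicator (cell T N 0 k) p)"
      by (intro Bochner_Integration.integrable_sum integrable_mult_right ind)
    show "\<bar>lag_avg T N f p\<bar> \<le> (\<Sum>k<N*N. \<bar>avg_coef T N f k\<bar> * indicator (cell T N 0 k) p)" for p
      unfolding lag_avg_def by (rule order_trans[OF sum_abs]) (auto simp: abs_mult intro!: sum_mono)
  qed
  also have "\<dots> = (\<Sum>k<N*N. \<bar>avg_coef T N f k\<bar> * (T / (real N)\<^sup>2))"
    using ind cell_integral[where r=0] by (subst Bochner_Integration.integral_sum) (auto intro!: sum.cong)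
  also have "\<dots> = (\<Sum>k<N*N. \<bar>\<integral>p. indicator (cell T N (-1) k) p * f p \<partial>Box T\<bar>)"
    using T N by (intro sum.cong) (auto simp: avg_coef_def abs_mult)
  also have "\<dots> \<le> (\<Sum>k<N*N. \<integral>p. indicator (cell T N (-1) k) p * \<bar>f p\<bar> \<partial>Box T)"
    by (intro sum_mono order_trans[OF integral_abs_bound]) (simp add: abs_mult)
  also have "\<dots> = (\<integral>p. (\<Sum>k<N*N. indicator (cell T N (-1) k) p * \<bar>f p\<bar>) \<partial>Box T)"
    by (rule Bochner_Integration.integral_sum[symmetric]) (rule integrable_cell_mult[OF fa])
  also have "\<dots> \<le> (\<integral>p. \<bar>f p\<bar> \<partial>Box T)"
  proof (rule integral_mono)
    show "integrable (Box T) (\<lambda>p. \<Sum>k<N*N. indicator (cell T N (-1) k) p * \<bar>f p\<bar>)"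
      by (intro Bochner_Integration.integrable_sum integrable_cell_mult[OF fa])
    show "(\<Sum>k<N*N. indicator (cell T N (-1) k) p * \<bar>f p\<bar>) \<le> \<bar>f p\<bar>" for p
    proof (cases "\<exists>k<N*N. p \<in> cell T N (-1) k")
      case True
      then obtain k where k: "k < N*N" "p \<in> cell T N (-1) k" by blast
      have "(\<Sum>k'<N*N. indicator (cell T N (-1) k') p * \<bar>f p\<bar>) = (\<Sum>k'<N*N. if k' = k then \<bar>f p\<bar> else 0)"
      proof (intro sum.cong refl)
        fix k'
        show "indicator (cell T N (-1) k') p * \<bar>f p\<bar> = (if k' = k then \<bar>f p\<bar> else 0)"
          using cell_unique[OF N k(2), of k'] k by (cases "k' = k") (auto simp: indicator_def)
      qed
      also have "\<dots> = \<bar>f p\<bar>" using k(1) by simp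
      finally show ?thesis by (rule eq_refl)
    next
      case False
      then have "(\<Sum>k'<N*N. indicator (cell T N (-1) k') p * \<bar>f p\<bar>) = 0" by (intro sum.neutral) auto
      also have "\<dots> \<le> \<bar>f p\<bar>" by simp
      finally show ?thesis .
    qed
  qed (use fa in auto)
  finally show ?thesis .
qed

lemma lag_avg_add:
  assumes "integrable (Box T) f" "integrable (Box T) g"
  shows "lag_avg T N (\<lambda>p. f p + c * g p) p = lag_avg T N f p + c * lag_avg T N g p"
proof -
  have "avg_coef T N (\<lambda>p. f p + c * g p) k = avg_coef T N f k + c * avg_coef T N g k" for k
    using integrable_cell_mult[OF assms(1)] integrable_cell_mult[OF assms(2)]
    by (simp add: avg_coef_def distrib_left mult.left_commute[of _ c])
  then show ?thesis
    by (simp only: lag_avg_def distrib_right sum.distrib sum_distrib_left mult.assoc)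
qed

definition avg_dev :: "(real \<times> real \<Rightarrow> real) \<Rightarrow> nat \<Rightarrow> real" where
  "avg_dev f N = (\<integral>p. \<bar>lag_avg T N f p - f p\<bar> \<partial>Box T)"

lemma avg_dev_add:
  assumes f: "integrable (Box T) f" and g: "integrable (Box T) g"
  shows "avg_dev (\<lambda>p. f p + c * g p) N \<le> avg_dev f N + \<bar>c\<bar> * avg_dev g N"
proof -
  have "avg_dev (\<lambda>p. f p + c * g p) N \<le> (\<integral>p. \<bar>lag_avg T N f p - f p\<bar> + \<bar>c\<bar> * \<bar>lag_avg T N g p - g p\<bar> \<partial>Box T)"
    unfolding avg_dev_def
  proof (rule integral_mono)
    show "integrable (Box T) (\<lambda>p. \<bar>lag_avg T N (\<lambda>p. f p + c * g p) p - (f p + c * g p)\<bar>)"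
      using f g lag_avg_integrable by auto
    show "integrable (Box T) (\<lambda>p. \<bar>lag_avg T N f p - f p\<bar> + \<bar>c\<bar> * \<bar>lag_avg T N g p - g p\<bar>)"
      using f g lag_avg_integrable by auto
    fix p
    have "lag_avg T N (\<lambda>p. f p + c * g p) p - (f p + c * g p) =
        (lag_avg T N f p - f p) + c * (lag_avg T N g p - g p)"
      by (simp add: lag_avg_add[OF f g] algebra_simps)
    then show "\<bar>lag_avg T N (\<lambda>p. f p + c * g p) p - (f p + c * g p)\<bar> \<le> \<bar>lag_avg T N f p - f p\<bar> + \<bar>c\<bar> * \<bar>lag_avg T N g p - g p\<bar>"
      by (metis abs_mult abs_triangle_ineq)
  qed
  also have "\<dots> = avg_dev f N + \<bar>c\<bar> * avg_dev g N"
    unfolding avg_dev_def using f g lag_avg_integrable by simp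
  finally show ?thesis .
qed

lemma avg_dev_le:
  assumes f: "integrable (Box T) f"
  shows "avg_dev f N \<le> 2 * (\<integral>p. \<bar>f p\<bar> \<partial>Box T)"
proof -
  have "avg_dev f N \<le> (\<integral>p. \<bar>lag_avg T N f p\<bar> + \<bar>f p\<bar> \<partial>Box T)"
    unfolding avg_dev_def using f lag_avg_integrable by (intro integral_mono) auto
  also have "\<dots> \<le> 2 * (\<integral>p. \<bar>f p\<bar> \<partial>Box T)"
    using f lag_avg_integrable lag_avg_contraction[OF f, of N] by simp
  finally show ?thesis .
qed

lemma avg_dev_nonneg: "0 \<le> avg_dev f N"
  by (simp add: avg_dev_def)

lemma avg_dev_tendsto_add:
  assumes f: "integrable (Box T) f" "avg_dev f \<longlonglongrightarrow> 0" and g: "integrable (Box T) g" "avg_dev g \<longlonglongrightarrow> 0"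
  shows "avg_dev (\<lambda>p. f p + c * g p) \<longlonglongrightarrow> 0"
proof -
  have "(\<lambda>N. avg_dev f N + \<bar>c\<bar> * avg_dev g N) \<longlonglongrightarrow> 0 + \<bar>c\<bar> * 0" by (intro tendsto_intros f g)
  then have lim: "(\<lambda>N. avg_dev f N + \<bar>c\<bar> * avg_dev g N) \<longlonglongrightarrow> 0" by simp
  show ?thesis
    by (rule tendsto_sandwich[OF _ _ tendsto_const lim])
      (intro always_eventually allI avg_dev_nonneg avg_dev_add f g)+
qed

text \<open>Averaging is a contraction of \<open>L\<^sub>1\<close>, so the functions whose averages converge form a closed set.\<close>

lemma avg_dev_closed:
  assumes f: "integrable (Box T) f" and h: "\<And>i. integrable (Box T) (h i)"
    and dev: "\<And>i. avg_dev (h i) \<longlonglongrightarrow> 0"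
    and lim: "(\<lambda>i. \<integral>p. \<bar>f p - h i p\<bar> \<partial>Box T) \<longlonglongrightarrow> 0"
  shows "avg_dev f \<longlonglongrightarrow> 0"
proof (rule LIMSEQ_I)
  fix e :: real assume e: "0 < e"
  from LIMSEQ_D[OF lim, of "e/4"] e obtain i where i: "\<bar>\<integral>p. \<bar>f p - h i p\<bar> \<partial>Box T\<bar> < e/4" by auto
  from LIMSEQ_D[OF dev, of "e/2" i] e obtain N0 where N0: "\<And>N. N \<ge> N0 \<Longrightarrow> \<bar>avg_dev (h i) N\<bar> < e/2" by auto
  show "\<exists>N0. \<forall>N\<ge>N0. norm (avg_dev f N - 0) < e"
  proof (intro exI allI impI)
    fix N assume "N \<ge> N0"
    have fh: "integrable (Box T) (\<lambda>p. f p - h i p)" using f h by auto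
    have "avg_dev f N = avg_dev (\<lambda>p. h i p + 1 * (f p - h i p)) N" by simp
    also have "\<dots> \<le> avg_dev (h i) N + \<bar>1\<bar> * avg_dev (\<lambda>p. f p - h i p) N" by (rule avg_dev_add[OF h fh])
    also have "\<dots> < e" using N0[OF \<open>N \<ge> N0\<close>] i avg_dev_le[OF fh, of N] by simp
    finally show "norm (avg_dev f N - 0) < e" using avg_dev_nonneg[of f N] by simp
  qed
qed

lemma null_lines: "AE p in Box T. fst p \<noteq> a \<and> snd p \<noteq> b"
proof (rule AE_I')
  let ?A = "({a} \<inter> {0..T}) \<times> (UNIV \<inter> {0..1})" and ?B = "(UNIV \<inter> {0..T}) \<times> ({b} \<inter> {0..1})"
  have z: "measure lborel ({c} \<inter> X) = 0" for c :: real and X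
    by (cases "c \<in> X") auto
  have m: "{a} \<inter> {0..T} \<in> sets (slab T)" "UNIV \<inter> {0..T} \<in> sets (slab T)"
    "{b} \<inter> {0..1} \<in> sets leb01" "UNIV \<inter> {0..1} \<in> sets leb01"
    by (intro inter_slab inter_leb01; simp)+
  have "measure (Box T) ?A = 0" "measure (Box T) ?B = 0"
    using m by (simp_all only: measure_Box_Times z mult_zero_left mult_zero_right)
  moreover have "?A \<in> sets (Box T)" "?B \<in> sets (Box T)"
    unfolding Box_def by (intro pair_measureI m)+
  ultimately show "?A \<union> ?B \<in> null_sets (Box T)"
    by (intro null_sets.Un) (auto simp: null_sets_def Box.emeasure_eq_measure)
qed auto

text \<open>Almost every point has a neighbourhood on which the indicator is constant; once the mesh is small
  enough, the cell of the point and the preceding one lie in it, and the average is exact.\<close>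

lemma avg_dev_quadrant:
  "avg_dev (indicator (({..a} \<times> {..b}) \<inter> ({0..T} \<times> {0..1}))) \<longlonglongrightarrow> 0"
proof -
  let ?f = "indicator (({..a} \<times> {..b}) \<inter> ({0..T} \<times> {0..1})) :: real \<times> real \<Rightarrow> real"
  have fs: "({..a} \<times> {..b}) \<inter> ({0..T} \<times> {0..1}) \<in> sets (Box T)"
    unfolding sets_Box_generated by (intro sigma_sets.Basic) blast
  have f: "integrable (Box T) ?f" using fs by (simp add: Box.emeasure_eq_measure)
  have [measurable]: "?f \<in> borel_measurable (Box T)" using fs by simp
  have "avg_dev ?f \<longlonglongrightarrow> (\<integral>p. 0 \<partial>Box T)"
    unfolding avg_dev_def[abs_def]
  proof (rule integral_dominated_convergence[where w="\<lambda>_. 2"])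
    show "AE p in Box T. norm \<bar>lag_avg T N ?f p - ?f p\<bar> \<le> 2" for N
    proof (rule AE_I2)
      fix p
      have "\<bar>lag_avg T N ?f p\<bar> \<le> 1" by (rule lag_avg_bound[OF f]) (auto simp: indicator_def)
      moreover have "\<bar>?f p\<bar> \<le> 1" by (auto simp: indicator_def)
      moreover have "norm \<bar>x - y\<bar> \<le> 2" if "\<bar>x\<bar> \<le> 1" "\<bar>y\<bar> \<le> 1" for x y :: real using that by simp
      ultimately show "norm \<bar>lag_avg T N ?f p - ?f p\<bar> \<le> 2" by blast
    qed
    show "AE p in Box T. (\<lambda>N. \<bar>lag_avg T N ?f p - ?f p\<bar>) \<longlonglongrightarrow> 0"
      using null_lines[of a b] null_lines[of 0 0] AE_space
    proof eventually_elim
      case (elim p)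
      obtain s u where p: "p = (s, u)" by (cases p)
      have su: "s \<noteq> a" "u \<noteq> b" "0 < s" "s \<le> T" "0 < u" "u \<le> 1" using elim p by auto
      \<comment> \<open>the preceding cell reaches back by less than two time steps and one space step\<close>
      define m where "m = Min {s / (2 * T), \<bar>s - a\<bar> / (2 * T), \<bar>u - b\<bar>}"
      have m: "0 < m" using su T by (auto simp: m_def)
      have "eventually (\<lambda>N. lag_avg T N ?f p = ?f p) sequentially"
        using eventually_gt_at_top[of "nat \<lceil>1 / m\<rceil>"]
      proof eventually_elim
        case (elim N)
        then have Nm: "1 / m < real N" by linarith
        then have N: "0 < N" using m by (metis divide_pos_pos less_trans of_nat_0_less_iff zero_less_one)
        have inv: "1 / real N < m" using Nm m N by (simp add: field_simps)
        have d: "2 * T / N < s" "2 * T / N < \<bar>s - a\<bar>" "1 / N < \<bar>u - b\<bar>"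
        proof -
          have "m \<le> s / (2 * T)" "m \<le> \<bar>s - a\<bar> / (2 * T)" "m \<le> \<bar>u - b\<bar>" by (simp_all add: m_def)
          with inv have i: "1 / real N < s / (2 * T)" "1 / real N < \<bar>s - a\<bar> / (2 * T)" "1 / N < \<bar>u - b\<bar>" by linarith+
          show "1 / N < \<bar>u - b\<bar>" by fact
          show "2 * T / N < s" using i(1) T N by (simp add: field_simps)
          show "2 * T / N < \<bar>s - a\<bar>" using i(2) T N by (simp add: field_simps)
        qed
        obtain k where k: "k < N * N" "(s, u) \<in> cell T N 0 k" using cell_cover[OF N su(3-6)] .
        have sk: "real (k div N) * T / N < s" "s \<le> (real (k div N) + 1) * T / N"
          "real (k mod N) / N < u" "u \<le> (real (k mod N) + 1) / N" using k(2) by (auto simp: cell_def)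
        have i1: "1 \<le> k div N"
        proof (rule ccontr)
          assume "\<not> 1 \<le> k div N"
          then have "real (k div N) = 0" by simp
          then have "s \<le> 1 * T / N" using sk(2) by simp
          moreover have "T / N \<le> 2 * T / N" using T N by (simp add: divide_right_mono)
          ultimately show False using d(1) by simp
        qed
        have same: "?f q = ?f p" if q: "q \<in> cell T N (-1) k" "q \<in> space (Box T)" for q
        proof -
          obtain s' u' where q': "q = (s', u')" by (cases q)
          have s': "(real (k div N) - 1) * T / N < s'" "s' \<le> real (k div N) * T / N"
            "real (k mod N) / N < u'" "u' \<le> (real (k mod N) + 1) / N"
            using q(1) by (auto simp: cell_def q')
          have "(real (k div N) + 1) * T / N = (real (k div N) - 1) * T / N + 2 * T / N"
            "(real (k mod N) + 1) / N = real (k mod N) / N + 1 / N"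
            by (auto simp: add_divide_distrib[symmetric] algebra_simps)
          then have "s - s' < 2 * T / N" "0 < s - s'" "\<bar>u - u'\<bar> < 1 / N" using s' sk by linarith+
          then have "s' \<le> a \<longleftrightarrow> s \<le> a" "u' \<le> b \<longleftrightarrow> u \<le> b" using d by linarith+
          then show ?thesis using q(2) su by (auto simp: q' p indicator_def)
        qed
        have "avg_coef T N ?f k = (real N)\<^sup>2 / T * (\<integral>q. indicator (cell T N (-1) k) q * ?f p \<partial>Box T)"
          unfolding avg_coef_def
        proof (rule arg_cong2[where f="(*)", OF refl], rule Bochner_Integration.integral_cong[OF refl])
          fix q assume "q \<in> space (Box T)"
          then show "indicator (cell T N (-1) k) q * ?f q = indicator (cell T N (-1) k) q * ?f p"
            using same[of q] by (cases "q \<in> cell T N (-1) k") (simp_all only: indicator_simps(2) mult_zero_left not_False_eq_True)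
        qed
        also have "\<dots> = ?f p" using cell_integral[OF k(1), of "-1"] i1 T N by simp
        finally show ?case using lag_avg_cell[OF N k(1), of p] k(2) p by simp
      qed
      then show ?case by (intro tendsto_eventually) (auto elim: eventually_mono)
    qed
  qed (auto intro!: Box.integrable_const)
  then show ?thesis by simp
qed

lemma avg_dev_indicator:
  assumes A: "A \<in> sets (Box T)"
  shows "avg_dev (indicator A) \<longlonglongrightarrow> 0"
proof -
  let ?\<Omega> = "{0..T} \<times> {0..1::real}"
  have ind: "integrable (Box T) (indicator A :: _ \<Rightarrow> real)" if "A \<in> sets (Box T)" for A
    using that by (simp add: Box.emeasure_eq_measure)
  have stable: "Int_stable {({..a} \<times> {..b}) \<inter> ?\<Omega> | a b. True}"
  proof (rule Int_stableI, safe)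
    fix a b a' b'
    show "\<exists>c d. ({..a} \<times> {..b}) \<inter> ?\<Omega> \<inter> (({..a'} \<times> {..b'}) \<inter> ?\<Omega>) = ({..c} \<times> {..d}) \<inter> ?\<Omega> \<and> True"
      by (intro exI[of _ "min a a'"] exI[of _ "min b b'"]) auto
  qed
  have sub: "{({..a} \<times> {..b}) \<inter> ?\<Omega> | a b. True} \<subseteq> Pow ?\<Omega>" by auto
  show ?thesis using stable sub A[unfolded sets_Box_generated]
  proof (induction rule: sigma_sets_induct_disjoint)
    case (basic A) then show ?case using avg_dev_quadrant by auto
  next
    case empty
    show ?case by (simp add: avg_dev_def[abs_def] lag_avg_def avg_coef_def)
  next
    case (compl A)
    have A: "A \<in> sets (Box T)" "A \<subseteq> ?\<Omega>"
      using compl(1) sets.sets_into_space[of A "Box T"] by (auto simp: sets_Box_generated)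
    have 1: "avg_dev (indicator ?\<Omega>) \<longlonglongrightarrow> 0"
    proof -
      have "({..T} \<times> {..1}) \<inter> ?\<Omega> = ?\<Omega>" by auto
      then show ?thesis using avg_dev_quadrant[of T 1] by simp
    qed
    have O: "?\<Omega> \<in> sets (Box T)" using sets.top[of "Box T"] by simp
    have eq: "indicator (?\<Omega> - A) = (\<lambda>p. indicator ?\<Omega> p + (-1) * indicator A p :: real)"
      using A by (auto simp: indicator_def fun_eq_iff)
    show ?case unfolding eq by (intro avg_dev_tendsto_add ind O A 1 compl(2))
  next
    case (union A)
    have A: "A i \<in> sets (Box T)" for i using union(2) by (auto simp: sets_Box_generated)
    define h where "h n = (indicator (\<Union>i<n. A i) :: _ \<Rightarrow> real)" for n
    have UA: "(\<Union>i<n. A i) \<in> sets (Box T)" "(\<Union>i. A i) \<in> sets (Box T)" for n using A by auto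
    show ?case
    proof (rule avg_dev_closed[where h=h])
      show "integrable (Box T) (indicator (\<Union>i. A i) :: _ \<Rightarrow> real)" using UA by (intro ind)
      show hi: "integrable (Box T) (h n)" for n unfolding h_def using UA by (intro ind)
      show "avg_dev (h n) \<longlonglongrightarrow> 0" for n
      proof (induction n)
        case 0 show ?case by (simp add: h_def avg_dev_def[abs_def] lag_avg_def avg_coef_def)
      next
        case (Suc n)
        have eq: "h (Suc n) = (\<lambda>p. h n p + 1 * indicator (A n) p)"
        proof -
          have "A n \<inter> A i = {}" if "i < n" for i
            using union(1) that by (auto simp: disjoint_family_on_def)
          then have "A n \<inter> (\<Union>i<n. A i) = {}" by blast
          then show ?thesis by (auto simp: h_def indicator_def fun_eq_iff lessThan_Suc)
        qed
        show ?case unfolding eq by (intro avg_dev_tendsto_add hi ind A Suc union(3))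
      qed
      have "(\<lambda>n. \<integral>p. \<bar>indicator (\<Union>i. A i) p - h n p\<bar> \<partial>Box T) \<longlonglongrightarrow> (\<integral>p. 0 \<partial>Box T)"
      proof (rule integral_dominated_convergence[where w="\<lambda>_. 1"])
        show "AE p in Box T. (\<lambda>n. \<bar>indicator (\<Union>i. A i) p - h n p\<bar>) \<longlonglongrightarrow> 0"
        proof (rule AE_I2)
          fix p
          have "eventually (\<lambda>n. \<bar>indicator (\<Union>i. A i) p - h n p\<bar> = 0) sequentially"
          proof (cases "\<exists>i. p \<in> A i")
            case True
            then obtain i where i: "p \<in> A i" by blast
            show ?thesis using eventually_gt_at_top[of i] by eventually_elim (use i in \<open>auto simp: h_def indicator_def\<close>)
          next
            case False then show ?thesis by (auto simp: h_def indicator_def)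
          qed
          then show "(\<lambda>n. \<bar>indicator (\<Union>i. A i) p - h n p\<bar>) \<longlonglongrightarrow> 0" by (rule tendsto_eventually)
        qed
        show "(\<lambda>p. \<bar>indicator (\<Union>i. A i) p - h n p\<bar>) \<in> borel_measurable (Box T)" for n
          unfolding h_def using UA by (intro borel_measurable_abs borel_measurable_diff borel_measurable_indicator)
      qed (auto simp: h_def indicator_def intro!: Box.integrable_const)
      then show "(\<lambda>n. \<integral>p. \<bar>indicator (\<Union>i. A i) p - h n p\<bar> \<partial>Box T) \<longlonglongrightarrow> 0" by simp
    qed
  qed
qed

text \<open>Convergence in \<open>L\<^sub>1\<close> is enough, because the integrands are bounded.\<close>

lemma lag_avg_converges:
  assumes f: "integrable (Box T) f"
  shows "avg_dev f \<longlonglongrightarrow> 0"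
  using f
proof (induction rule: integrable_induct)
  case (base A c)
  have i: "integrable (Box T) (indicator A :: _ \<Rightarrow> real)" using base by simp
  have eq: "(\<lambda>x. indicator A x *\<^sub>R c) = (\<lambda>x. 0 + c * indicator A x)" by (auto simp: mult.commute)
  have z: "avg_dev (\<lambda>_. 0) \<longlonglongrightarrow> 0"
    by (simp add: avg_dev_def[abs_def] lag_avg_def avg_coef_def)
  show ?case unfolding eq by (rule avg_dev_tendsto_add[OF _ z i avg_dev_indicator[OF base(1)]]) simp
next
  case (add f g)
  show ?case using avg_dev_tendsto_add[OF add(1,3,2,4), of 1] by simp
next
  case (lim f s)
  show ?case
  proof (rule avg_dev_closed[OF lim(4) lim(1) lim(5)])
    have "(\<lambda>i. \<integral>p. \<bar>f p - s i p\<bar> \<partial>Box T) \<longlonglongrightarrow> (\<integral>p. 0 \<partial>Box T)"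
    proof (rule integral_dominated_convergence[where w="\<lambda>p. 3 * \<bar>f p\<bar>"])
      show "AE p in Box T. (\<lambda>i. \<bar>f p - s i p\<bar>) \<longlonglongrightarrow> 0"
      proof (rule AE_I2)
        fix p assume "p \<in> space (Box T)"
        from tendsto_rabs[OF tendsto_diff[OF tendsto_const[of "f p"] lim(2)[OF this]]]
        show "(\<lambda>i. \<bar>f p - s i p\<bar>) \<longlonglongrightarrow> 0" by simp
      qed
      show "AE p in Box T. norm \<bar>f p - s i p\<bar> \<le> 3 * \<bar>f p\<bar>" for i
        using lim(3) by (intro AE_I2) (smt (verit) real_norm_def)
    qed (use lim(1,4) in auto)
    then show "(\<lambda>i. \<integral>p. \<bar>f p - s i p\<bar> \<partial>Box T) \<longlonglongrightarrow> 0" by simp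
  qed
qed

end

section \<open>Stochastic integrals depending on a parameter\<close>

lemma nn_integral_Box_mono:
  assumes "f \<in> borel_measurable (Box T)" "t \<le> T"
  shows "(\<integral>\<^sup>+p. f p \<partial>Box t) \<le> (\<integral>\<^sup>+p. f p \<partial>Box T)"
proof -
  have "(\<lambda>p. (fst p, snd p)) \<in> measurable (slab t \<Otimes>\<^sub>M leb01) (slab T \<Otimes>\<^sub>M leb01)"
  proof (rule measurable_Pair)
    have "(\<lambda>x. x) \<in> measurable (slab t) (slab T)"
      using assms(2) unfolding measurable_cong_sets[OF sets_slab sets_slab]
      by (intro measurable_restrict_space2 measurable_restrict_space1) (auto simp: space_restrict_space)
    then show "fst \<in> measurable (slab t \<Otimes>\<^sub>M leb01) (slab T)" by (rule measurable_compose[OF measurable_fst])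
  qed measurable
  then have "f \<in> borel_measurable (Box t)"
    using measurable_compose[of "\<lambda>p. (fst p, snd p)" "Box t" "Box T" f borel] assms(1) by (simp add: Box_def)
  then show ?thesis
    using nn_integral_slab_mono[OF assms(2)] by (simp add: nn_integral_Box assms(1))
qed

context sheet_noise
begin

abbreviation "PU \<equiv> P \<Otimes>\<^sub>M leb01"

lemma GU_measurable: "h \<in> measurable (G t \<Otimes>\<^sub>M leb01) L \<Longrightarrow> t \<le> T \<Longrightarrow> h \<in> measurable PU L"
  by (rule measurable_pair_sub[rotated 4, of _ "G t" leb01]) (simp_all add: sets_G_sub)

end

locale bounded_integrand = sheet_noise P W T for P :: "'a measure" and W T +
  fixes f :: "'a \<Rightarrow> real \<Rightarrow> real \<Rightarrow> real \<Rightarrow> real" and K :: real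
  assumes prog: "\<And>t. 0 \<le> t \<Longrightarrow> t \<le> T \<Longrightarrow> (\<lambda>(s, \<omega>, u, u'). f \<omega> u u' s)
      \<in> borel_measurable (restrict_space borel {0..t} \<Otimes>\<^sub>M (G t \<Otimes>\<^sub>M (leb01 \<Otimes>\<^sub>M leb01)))"
    and bound: "\<And>\<omega> u u' s. \<bar>f \<omega> u u' s\<bar> \<le> K"
begin

lemma finite_PU: "finite_measure PU"
  by (intro finite_measure_pair_measure) (unfold_locales)

lemma K_nonneg: "0 \<le> K"
  using bound[of undefined 0 0 0] by linarith

text \<open>The integrand \<open>f \<omega> u u' s\<close> has the parameter \<open>u\<close> and is integrated against the noise in \<open>(u',s)\<close>.\<close>

definition slice :: "'a \<Rightarrow> real \<Rightarrow> real \<times> real \<Rightarrow> real" where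
  "slice \<omega> u p = f \<omega> u (snd p) (fst p)"

definition grid_coef :: "nat \<Rightarrow> nat \<Rightarrow> 'a \<Rightarrow> real \<Rightarrow> real" where
  "grid_coef N k \<omega> u = avg_coef T N (slice \<omega> u) k"

definition grid_entry :: "nat \<Rightarrow> real \<Rightarrow> nat \<Rightarrow> 'a entry" where
  "grid_entry N u k = (\<lambda>\<omega>. grid_coef N k \<omega> u, real (k div N) * T / N, (real (k div N) + 1) * T / N,
     real (k mod N) / N, (real (k mod N) + 1) / N)"

definition grid :: "nat \<Rightarrow> real \<Rightarrow> 'a simple_data" where
  "grid N u = map (grid_entry N u) [0..<N*N]"

definition grid_integral :: "nat \<Rightarrow> real \<Rightarrow> 'a \<times> real \<Rightarrow> real" where
  "grid_integral N t q = simple_integral w (grid N (snd q)) t (fst q)"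

text \<open>Progressive measurability is used only through this: freezing the time at \<open>a\<close> gives a function of
  the whole strip that is known at time \<open>a\<close>.\<close>

lemma stopped_measurable:
  assumes a: "0 \<le> a" "a \<le> T"
  shows "(\<lambda>((\<omega>, u), p). f \<omega> u (snd p) (min (fst p) a)) \<in> borel_measurable ((G a \<Otimes>\<^sub>M leb01) \<Otimes>\<^sub>M Box T)"
proof -
  have [measurable]: "(\<lambda>s. min s a) \<in> measurable (slab T) (restrict_space borel {0..a})"
    unfolding measurable_cong_sets[OF sets_slab refl]
    using a by (intro measurable_restrict_space2 measurable_restrict_space1) (auto simp: space_restrict_space)
  have "(\<lambda>z. (min (fst (snd z)) a, fst (fst z), snd (fst z), snd (snd z))) \<in> measurable ((G a \<Otimes>\<^sub>M leb01) \<Otimes>\<^sub>M (slab T \<Otimes>\<^sub>M leb01))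
      (restrict_space borel {0..a} \<Otimes>\<^sub>M (G a \<Otimes>\<^sub>M (leb01 \<Otimes>\<^sub>M leb01)))"
    by measurable
  from measurable_compose[OF this prog[OF a]] show ?thesis
    by (simp add: Box_def case_prod_beta')
qed

lemma slice_measurable: "(\<lambda>(q, p). slice (fst q) (snd q) p) \<in> borel_measurable (PU \<Otimes>\<^sub>M Box T)"
proof -
  have "(\<lambda>((\<omega>, u), p). f \<omega> u (snd p) (min (fst p) T)) \<in> borel_measurable ((G T \<Otimes>\<^sub>M leb01) \<Otimes>\<^sub>M Box T)"
    using T_pos by (intro stopped_measurable) auto
  then have "(\<lambda>((\<omega>, u), p). f \<omega> u (snd p) (min (fst p) T)) \<in> borel_measurable (PU \<Otimes>\<^sub>M Box T)"
  proof (rule measurable_pair_sub[rotated 4])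
    show "sets (G T \<Otimes>\<^sub>M leb01) \<subseteq> sets PU"
      by (intro sets_pair_in_sets pair_measureI subsetD[OF sets_G_sub[OF order_refl]])
  qed (auto simp: space_pair_measure)
  also have "?this \<longleftrightarrow> ?thesis"
    by (intro measurable_cong) (auto simp: space_pair_measure slice_def min_absorb1)
  finally show ?thesis .
qed

lemma slice_measurable1:
  "\<omega> \<in> space P \<Longrightarrow> u \<in> {0..1} \<Longrightarrow> slice \<omega> u \<in> borel_measurable (Box T)"
  using measurable_compose[OF measurable_Pair1'[of "(\<omega>, u)" PU "Box T"] slice_measurable]
  by (simp add: space_pair_measure)

lemma slice_integrable:
  "\<omega> \<in> space P \<Longrightarrow> u \<in> {0..1} \<Longrightarrow> integrable (Box T) (slice \<omega> u)"
  using slice_measurable1 bound by (intro Box.integrable_const_bound[of _ K]) (auto simp: slice_def)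

lemma time_bounds:
  assumes "k < N * N"
  shows "0 \<le> real (k div N) * T / N" "(real (k div N) + 1) * T / N \<le> T" "real (k div N) * T / N \<le> (real (k div N) + 1) * T / N"
    "real (k mod N) / N \<le> (real (k mod N) + 1) / N" "(real (k mod N) + 1) / N \<le> 1"
    "real (k div N) * T / N \<le> T"
proof -
  show "0 \<le> real (k div N) * T / N" "(real (k div N) + 1) * T / N \<le> T" "(real (k mod N) + 1) / N \<le> 1"
    using cell_bounds[OF T_pos assms, of 0] by auto
  show "real (k div N) * T / N \<le> (real (k div N) + 1) * T / N" "real (k mod N) / N \<le> (real (k mod N) + 1) / N"
    using T_pos by (auto intro!: divide_right_mono mult_right_mono)
  then show "real (k div N) * T / N \<le> T" using \<open>(real (k div N) + 1) * T / N \<le> T\<close> by linarith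
qed

text \<open>The lag pays off here: the coefficient averages \<open>f\<close> before the time at which its cell starts.\<close>

lemma grid_coef_measurable:
  assumes k: "k < N * N"
  shows "(\<lambda>(\<omega>, u). grid_coef N k \<omega> u) \<in> borel_measurable (G (real (k div N) * T / N) \<Otimes>\<^sub>M leb01)"
proof -
  define a where "a = real (k div N) * T / N"
  have a: "0 \<le> a" "a \<le> T" using time_bounds[OF k] by (auto simp: a_def)
  note [measurable] = stopped_measurable[OF a]
  have ind: "(\<lambda>p. indicator (cell T N (-1) k) p :: real) \<in> borel_measurable (Box T)"
    using T_pos by (rule cell_indicator_measurable)
  have "(\<lambda>(q, p). indicator (cell T N (-1) k) p * f (fst q) (snd q) (snd p) (min (fst p) a))
     \<in> borel_measurable ((G a \<Otimes>\<^sub>M leb01) \<Otimes>\<^sub>M Box T)"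
  proof -
    have "(\<lambda>z. indicator (cell T N (-1) k) (snd z) * (\<lambda>((\<omega>, u), p). f \<omega> u (snd p) (min (fst p) a)) z)
      \<in> borel_measurable ((G a \<Otimes>\<^sub>M leb01) \<Otimes>\<^sub>M Box T)"
      by (intro borel_measurable_times measurable_compose[OF measurable_snd ind] stopped_measurable a)
    then show ?thesis by (simp add: case_prod_beta')
  qed
  then have m: "(\<lambda>q. \<integral>p. indicator (cell T N (-1) k) p * f (fst q) (snd q) (snd p) (min (fst p) a) \<partial>Box T)
     \<in> borel_measurable (G a \<Otimes>\<^sub>M leb01)"
    by (rule Box.borel_measurable_lebesgue_integral)
  have eq: "(\<lambda>(\<omega>, u). grid_coef N k \<omega> u) = (\<lambda>q. (real N)\<^sup>2 / T *
      (\<integral>p. indicator (cell T N (-1) k) p * f (fst q) (snd q) (snd p) (min (fst p) a) \<partial>Box T))"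
  proof (rule ext, clarify)
    fix \<omega> u
    show "grid_coef N k \<omega> u = (real N)\<^sup>2 / T *
      (\<integral>p. indicator (cell T N (-1) k) p * f (fst (\<omega>, u)) (snd (\<omega>, u)) (snd p) (min (fst p) a) \<partial>Box T)"
      unfolding grid_coef_def avg_coef_def
      by (rule arg_cong2[where f="(*)", OF refl], rule Bochner_Integration.integral_cong[OF refl])
        (auto simp: indicator_def cell_def slice_def a_def min_absorb1)
  qed
  show ?thesis unfolding eq a_def[symmetric] using m by (rule borel_measurable_times[OF borel_measurable_const])
qed

lemma grid_coef_bound: "\<omega> \<in> space P \<Longrightarrow> u \<in> {0..1} \<Longrightarrow> k < N * N \<Longrightarrow> \<bar>grid_coef N k \<omega> u\<bar> \<le> K"
  unfolding grid_coef_def by (rule avg_coef_bound[OF T_pos slice_integrable]) (auto simp: slice_def bound)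

lemma grid_simple: "u \<in> {0..1} \<Longrightarrow> simple_integrand P T G (grid N u)"
proof -
  assume u: "u \<in> {0..1}"
  have "valid_entry (grid_entry N u k)" if k: "k < N * N" for k
  proof -
    have "(\<lambda>\<omega>. grid_coef N k \<omega> u) \<in> borel_measurable (G (real (k div N) * T / N))"
      using measurable_compose[OF measurable_Pair2'[of u leb01] grid_coef_measurable[OF k]] u by simp
    moreover have "\<exists>K. \<forall>\<omega>\<in>space P. \<bar>grid_coef N k \<omega> u\<bar> \<le> K" using grid_coef_bound[OF _ u k] by blast
    ultimately show ?thesis
      using time_bounds[OF k] by (auto simp: valid_entry_def simple_integrand_def grid_entry_def)
  qed
  then show ?thesis by (auto simp: simple_integrand_iff grid_def)
qed

lemma grid_eval: "simple_eval (grid N u) \<omega> u' s = lag_avg T N (slice \<omega> u) (s, u')"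
proof -
  have "simple_eval (grid N u) \<omega> u' s = (\<Sum>k\<leftarrow>[0..<N*N]. grid_coef N k \<omega> u * indicator (cell T N 0 k) (s, u'))"
    unfolding simple_eval_def grid_def
    by (auto simp: grid_entry_def cell_def indicator_def comp_def intro!: arg_cong[where f=sum_list])
  also have "\<dots> = (\<Sum>k<N*N. grid_coef N k \<omega> u * indicator (cell T N 0 k) (s, u'))"
    by (simp only: interv_sum_list_conv_sum_set_nat set_upt atLeast0LessThan)
  finally show ?thesis by (simp add: lag_avg_def grid_coef_def)
qed

lemma grid_orderly: "orderly s t (grid N u)"
proof -
  have "sorted_wrt (\<lambda>k k'. start (grid_entry N u k) \<le> start (grid_entry N u k') \<and>
      ebox s t (grid_entry N u k) \<inter> ebox s t (grid_entry N u k') = {}) [0..<N*N]"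
  proof (rule sorted_wrt_mono_rel[OF _ sorted_wrt_upt])
    fix k k' assume "k \<in> set [0..<N*N]" "k' \<in> set [0..<N*N]" and kk: "k < k'"
    then have k: "k < N*N" "k' < N*N" by auto
    then have N: "0 < N" by (cases N) auto
    have "real (k div N) \<le> real (k' div N)" using kk by (simp add: div_le_mono)
    then have "start (grid_entry N u k) \<le> start (grid_entry N u k')"
      using T_pos by (simp add: start_def grid_entry_def divide_right_mono mult_right_mono)
    moreover have "p \<notin> ebox s t (grid_entry N u k')" if p: "p \<in> ebox s t (grid_entry N u k)" for p
    proof
      assume p': "p \<in> ebox s t (grid_entry N u k')"
      have "prod.swap p \<in> cell T N 0 k" "prod.swap p \<in> cell T N 0 k'"
        using p p' by (auto simp: ebox_def grid_entry_def cell_def)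
      then have "k = k'" by (rule cell_unique[OF T_pos N])
      then show False using kk by simp
    qed
    ultimately show "start (grid_entry N u k) \<le> start (grid_entry N u k') \<and>
      ebox s t (grid_entry N u k) \<inter> ebox s t (grid_entry N u k') = {}" by auto
  qed
  then show ?thesis by (simp add: orderly_def grid_def sorted_wrt_map)
qed

lemma grid_integral_measurable:
  assumes t: "0 \<le> t" "t \<le> T"
  shows "grid_integral N t \<in> borel_measurable (G t \<Otimes>\<^sub>M leb01)"
proof -
  define \<Delta> where "\<Delta> k \<omega> = (let a = real (k div N) * T / N; b = (real (k div N) + 1) * T / N;
     c = real (k mod N) / N; d = (real (k mod N) + 1) / N in
     w d (min b t) \<omega> - w c (min b t) \<omega> - w d (min a t) \<omega> + w c (min a t) \<omega>)" for k \<omega>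
  have "grid_integral N t q = (\<Sum>k<N*N. grid_coef N k (fst q) (snd q) * \<Delta> k (fst q))" for q
  proof -
    have "grid_integral N t q = (\<Sum>k\<leftarrow>[0..<N*N]. grid_coef N k (fst q) (snd q) * \<Delta> k (fst q))"
      unfolding grid_integral_def simple_integral_def grid_def
      by (auto simp: grid_entry_def \<Delta>_def Let_def comp_def intro!: arg_cong[where f=sum_list])
    also have "\<dots> = (\<Sum>k<N*N. grid_coef N k (fst q) (snd q) * \<Delta> k (fst q))"
      by (simp only: interv_sum_list_conv_sum_set_nat set_upt atLeast0LessThan)
    finally show ?thesis .
  qed
  moreover have "(\<lambda>q. grid_coef N k (fst q) (snd q) * \<Delta> k (fst q)) \<in> borel_measurable (G t \<Otimes>\<^sub>M leb01)" if k: "k < N*N" for k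
  proof (cases "real (k div N) * T / N < t")
    case False
    then have "\<Delta> k \<omega> = 0" for \<omega>
    proof -
      have "min (real (k div N) * T / N) t = t" "min ((real (k div N) + 1) * T / N) t = t"
        using False time_bounds(3)[OF k] by linarith+
      then show ?thesis by (simp add: \<Delta>_def)
    qed
    then show ?thesis by simp
  next
    case True
    have 1: "(\<lambda>(\<omega>, u). grid_coef N k \<omega> u) \<in> borel_measurable (G t \<Otimes>\<^sub>M leb01)"
      by (rule measurable_pair_sub[OF _ _ _ _ grid_coef_measurable[OF k]]) (simp_all add: sets_G_mono less_imp_le[OF True])
    have c: "0 \<le> real (k mod N) / N" "0 \<le> (real (k mod N) + 1) / N" by auto
    have "w v (min r t) \<in> borel_measurable (G t)"
      if "v \<in> {real (k mod N) / N, (real (k mod N) + 1) / N}" "r \<in> {real (k div N) * T / N, (real (k div N) + 1) * T / N}" for v r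
    proof (rule w_measurable_G)
      note tb = time_bounds[OF k]
      have "0 \<le> v" "v \<le> 1" using that(1) c tb(4,5) by (elim insertE emptyE; linarith)+
      then show "v \<in> {0..1}" by simp
      have "0 \<le> r" using that(2) tb(1,3) by (elim insertE emptyE; linarith)
      then show "0 \<le> min r t" using t by simp
    qed simp
    then have "\<Delta> k \<in> borel_measurable (G t)"
      unfolding \<Delta>_def[abs_def] Let_def by (intro borel_measurable_add borel_measurable_diff) auto
    then have "(\<lambda>q. \<Delta> k (fst q)) \<in> borel_measurable (G t \<Otimes>\<^sub>M leb01)"
      by (rule measurable_compose[OF measurable_fst])
    then show ?thesis using 1 by (auto simp: case_prod_beta' intro!: borel_measurable_times)
  qed
  ultimately show ?thesis by (subst measurable_cong) (auto intro!: borel_measurable_sum)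
qed

lemma grid_integral_measurable_PU [measurable]: "0 \<le> t \<Longrightarrow> t \<le> T \<Longrightarrow> grid_integral N t \<in> borel_measurable PU"
  using GU_measurable[OF grid_integral_measurable] .

definition grid_error :: "nat \<Rightarrow> 'a \<times> real \<Rightarrow> ennreal" where
  "grid_error N q = (\<integral>\<^sup>+p. ennreal \<bar>lag_avg T N (slice (fst q) (snd q)) p - slice (fst q) (snd q) p\<bar> \<partial>Box T)"

lemma lag_avg_slice_measurable:
  "(\<lambda>(q, p). lag_avg T N (slice (fst q) (snd q)) p) \<in> borel_measurable (PU \<Otimes>\<^sub>M Box T)"
proof -
  have "(\<lambda>z. grid_coef N k (fst (fst z)) (snd (fst z)) * indicator (cell T N 0 k) (snd z)) \<in> borel_measurable (PU \<Otimes>\<^sub>M Box T)"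
    if k: "k < N * N" for k
  proof (rule borel_measurable_times)
    have "(\<lambda>(\<omega>, u). grid_coef N k \<omega> u) \<in> borel_measurable PU"
      by (rule GU_measurable[OF grid_coef_measurable[OF k] time_bounds(6)[OF k]])
    from measurable_compose[OF measurable_fst this]
    show "(\<lambda>z. grid_coef N k (fst (fst z)) (snd (fst z))) \<in> borel_measurable (PU \<Otimes>\<^sub>M Box T)" by (simp add: case_prod_beta')
    show "(\<lambda>z. indicator (cell T N 0 k) (snd z) :: real) \<in> borel_measurable (PU \<Otimes>\<^sub>M Box T)"
      by (rule measurable_compose[OF measurable_snd cell_indicator_measurable[OF T_pos]])
  qed
  then have "(\<lambda>z. \<Sum>k<N*N. grid_coef N k (fst (fst z)) (snd (fst z)) * indicator (cell T N 0 k) (snd z)) \<in> borel_measurable (PU \<Otimes>\<^sub>M Box T)"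
    by (intro borel_measurable_sum) simp
  then show ?thesis
    by (simp only: lag_avg_def grid_coef_def case_prod_beta')
qed

lemma dev_measurable:
  "(\<lambda>(q, p). ennreal \<bar>lag_avg T N (slice (fst q) (snd q)) p - slice (fst q) (snd q) p\<bar>) \<in> borel_measurable (PU \<Otimes>\<^sub>M Box T)"
  using borel_measurable_diff[OF lag_avg_slice_measurable slice_measurable, of N] by (simp add: case_prod_beta')

lemma grid_error_measurable [measurable]: "grid_error N \<in> borel_measurable PU"
  unfolding grid_error_def[abs_def] by (rule Box.borel_measurable_nn_integral[OF dev_measurable])

lemma grid_error_eq: "\<omega> \<in> space P \<Longrightarrow> u \<in> {0..1} \<Longrightarrow> grid_error N (\<omega>, u) = ennreal (avg_dev T (slice \<omega> u) N)"
  unfolding grid_error_def avg_dev_def[OF T_pos] fst_conv snd_conv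
  by (intro nn_integral_eq_integral integrable_abs Bochner_Integration.integrable_diff lag_avg_integrable[OF T_pos] slice_integrable) auto

lemma emeasure_Box_space: "emeasure (Box T) (space (Box T)) = ennreal T"
proof -
  have "emeasure (Box T) ({0..T} \<times> {0..1}) = emeasure (slab T) {0..T} * emeasure leb01 {0..1}"
    unfolding Box_def using sets.top[of "slab T"] sets.top[of leb01]
    by (intro leb01.emeasure_pair_measure_Times) auto
  then show ?thesis using T_pos leb01.emeasure_space_1 by (simp add: emeasure_slab)
qed

lemma lag_slice_bound: "\<omega> \<in> space P \<Longrightarrow> u \<in> {0..1} \<Longrightarrow> \<bar>lag_avg T N (slice \<omega> u) p\<bar> \<le> K"
  by (rule lag_avg_bound[OF T_pos slice_integrable]) (auto simp: slice_def bound)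

lemma grid_error_tendsto: "(\<lambda>N. \<integral>\<^sup>+q. grid_error N q \<partial>PU) \<longlonglongrightarrow> 0"
proof -
  interpret PU: finite_measure PU by (rule finite_PU)
  have "(\<lambda>N. \<integral>\<^sup>+q. grid_error N q \<partial>PU) \<longlonglongrightarrow> (\<integral>\<^sup>+q. 0 \<partial>PU)"
  proof (rule nn_integral_dominated_convergence[where w="\<lambda>_. ennreal (2 * K * T)"])
    show "AE q in PU. grid_error N q \<le> ennreal (2 * K * T)" for N
    proof (rule AE_I2)
      fix q assume q: "q \<in> space PU"
      have "grid_error N q \<le> (\<integral>\<^sup>+p. ennreal (2 * K) \<partial>Box T)"
        unfolding grid_error_def
      proof (intro nn_integral_mono ennreal_leI)
        fix p
        have "\<bar>lag_avg T N (slice (fst q) (snd q)) p\<bar> \<le> K" "\<bar>slice (fst q) (snd q) p\<bar> \<le> K"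
          using q by (auto intro!: lag_slice_bound simp: space_pair_measure slice_def bound)
        then show "\<bar>lag_avg T N (slice (fst q) (snd q)) p - slice (fst q) (snd q) p\<bar> \<le> 2 * K" by linarith
      qed
      also have "\<dots> = ennreal (2 * K * T)"
        using K_nonneg T_pos by (simp add: emeasure_Box_space ennreal_mult[symmetric] del: space_Box)
      finally show "grid_error N q \<le> ennreal (2 * K * T)" .
    qed
    show "(\<integral>\<^sup>+q. ennreal (2 * K * T) \<partial>PU) < \<infinity>"
      using PU.emeasure_finite[of "space PU"] by (simp add: less_top[symmetric] ennreal_mult_eq_top_iff del: PU.emeasure_finite)
    show "AE q in PU. (\<lambda>N. grid_error N q) \<longlonglongrightarrow> 0"
    proof (rule AE_I2)
      fix q assume "q \<in> space PU"
      then obtain \<omega> u where q: "q = (\<omega>, u)" "\<omega> \<in> space P" "u \<in> {0..1}" by (auto simp: space_pair_measure)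
      have "(\<lambda>N. ennreal (avg_dev T (slice \<omega> u) N)) \<longlonglongrightarrow> ennreal 0"
        by (intro tendsto_ennrealI lag_avg_converges[OF T_pos] slice_integrable q)
      then show "(\<lambda>N. grid_error N q) \<longlonglongrightarrow> 0" using grid_error_eq q by simp
    qed
  qed auto
  then show ?thesis by simp
qed


text \<open>The isometry for each \<open>u\<close>, and \<open>\<bar>x\<bar>\<^sup>2 \<le> 2K\<bar>x\<bar>\<close> for a difference \<open>x\<close> of functions bounded by \<open>K\<close>.\<close>

lemma grid_integral_distance:
  assumes t: "0 \<le> t" "t \<le> T"
  shows "sqn PU (\<lambda>q. grid_integral N t q - grid_integral M t q) \<le> ennreal (2 * K) * ((\<integral>\<^sup>+q. grid_error N q \<partial>PU) + (\<integral>\<^sup>+q. grid_error M q \<partial>PU))"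
proof -
  interpret PL: pair_sigma_finite P leb01 by unfold_locales
  have dm: "(\<lambda>p. ennreal \<bar>lag_avg T N (slice \<omega> u) p - slice \<omega> u p\<bar>) \<in> borel_measurable (Box T)"
    if "\<omega> \<in> space P" "u \<in> {0..1}" for N \<omega> u
    using slice_measurable1[OF that] lag_avg_measurable[OF T_pos, of N "slice \<omega> u"] by measurable
  have m: "(\<lambda>q. ennreal ((grid_integral N t q - grid_integral M t q)\<^sup>2)) \<in> borel_measurable PU" using t by measurable
  have "sqn PU (\<lambda>q. grid_integral N t q - grid_integral M t q) = (\<integral>\<^sup>+u. \<integral>\<^sup>+\<omega>. ennreal ((grid_integral N t (\<omega>, u) - grid_integral M t (\<omega>, u))\<^sup>2) \<partial>P \<partial>leb01)"
    unfolding sqn_def by (rule PL.nn_integral_snd[OF m, symmetric])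
  also have "\<dots> \<le> (\<integral>\<^sup>+u. \<integral>\<^sup>+\<omega>. ennreal (2 * K) * (grid_error N (\<omega>, u) + grid_error M (\<omega>, u)) \<partial>P \<partial>leb01)"
  proof (rule nn_integral_mono)
    fix u assume u: "u \<in> space leb01"
    then have u: "u \<in> {0..1}" by simp
    note s = grid_simple[OF u, of N] grid_simple[OF u, of M]
    have "(\<integral>\<^sup>+\<omega>. ennreal ((grid_integral N t (\<omega>, u) - grid_integral M t (\<omega>, u))\<^sup>2) \<partial>P) =
        sqn (Q t) (\<lambda>(\<omega>, s, u'). simple_eval (grid N u) \<omega> u' s - simple_eval (grid M u) \<omega> u' s)"
      using simple_isometry_diff[OF s t] by (simp add: sqn_def grid_integral_def)
    also have "\<dots> = (\<integral>\<^sup>+\<omega>. \<integral>\<^sup>+p. ennreal ((lag_avg T N (slice \<omega> u) p - lag_avg T M (slice \<omega> u) p)\<^sup>2) \<partial>Box t \<partial>P)"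
    proof -
      have "(\<lambda>(\<omega>, s, u'). simple_eval (grid N u) \<omega> u' s - simple_eval (grid M u) \<omega> u' s) \<in> borel_measurable (P \<Otimes>\<^sub>M Box t)"
        using borel_measurable_diff[OF simple_eval_measurable[OF s(1) t(1)] simple_eval_measurable[OF s(2) t(1)]]
        by (simp add: case_prod_beta' Q_def)
      then have "(\<lambda>q. ennreal ((case q of (\<omega>, s, u') \<Rightarrow> simple_eval (grid N u) \<omega> u' s - simple_eval (grid M u) \<omega> u' s)\<^sup>2)) \<in> borel_measurable (P \<Otimes>\<^sub>M Box t)"
        by measurable
      from Box.nn_integral_fst[OF this] show ?thesis
        by (simp add: sqn_def Q_def grid_eval case_prod_beta')
    qed
    also have "\<dots> \<le> (\<integral>\<^sup>+\<omega>. ennreal (2 * K) * (grid_error N (\<omega>, u) + grid_error M (\<omega>, u)) \<partial>P)"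
    proof (rule nn_integral_mono)
      fix \<omega> assume \<omega>: "\<omega> \<in> space P"
      let ?A = "\<lambda>N p. lag_avg T N (slice \<omega> u) p" and ?f = "slice \<omega> u"
      have pt: "ennreal ((?A N p - ?A M p)\<^sup>2) \<le> ennreal (2 * K) * (ennreal \<bar>?A N p - ?f p\<bar> + ennreal \<bar>?A M p - ?f p\<bar>)" for p
      proof -
        have b: "\<bar>?A N p\<bar> \<le> K" "\<bar>?A M p\<bar> \<le> K" using lag_slice_bound[OF \<omega> u] by auto
        have "(?A N p - ?A M p)\<^sup>2 = \<bar>?A N p - ?A M p\<bar> * \<bar>?A N p - ?A M p\<bar>" by (simp add: power2_eq_square)
        also have "\<dots> \<le> (2 * K) * (\<bar>?A N p - ?f p\<bar> + \<bar>?A M p - ?f p\<bar>)"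
          using b K_nonneg by (intro mult_mono) linarith+
        finally have "ennreal ((?A N p - ?A M p)\<^sup>2) \<le> ennreal ((2 * K) * (\<bar>?A N p - ?f p\<bar> + \<bar>?A M p - ?f p\<bar>))"
          by (rule ennreal_leI)
        also have "\<dots> = ennreal (2 * K) * (ennreal \<bar>?A N p - ?f p\<bar> + ennreal \<bar>?A M p - ?f p\<bar>)"
          using K_nonneg by (subst ennreal_mult) (auto simp: ennreal_plus)
        finally show ?thesis .
      qed
      have mN: "(\<lambda>p. ennreal \<bar>?A N p - ?f p\<bar> + ennreal \<bar>?A M p - ?f p\<bar>) \<in> borel_measurable (Box T)"
        using dm[OF \<omega> u] by (intro borel_measurable_add)
      have "(\<integral>\<^sup>+p. ennreal ((?A N p - ?A M p)\<^sup>2) \<partial>Box t) \<le> (\<integral>\<^sup>+p. ennreal ((?A N p - ?A M p)\<^sup>2) \<partial>Box T)"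
      proof (rule nn_integral_Box_mono[OF _ t(2)])
        have "(\<lambda>p. ?A N p - ?A M p) \<in> borel_measurable (Box T)"
          by (intro borel_measurable_diff lag_avg_measurable[OF T_pos])
        then show "(\<lambda>p. ennreal ((?A N p - ?A M p)\<^sup>2)) \<in> borel_measurable (Box T)" by simp
      qed
      also have "\<dots> \<le> (\<integral>\<^sup>+p. ennreal (2 * K) * (ennreal \<bar>?A N p - ?f p\<bar> + ennreal \<bar>?A M p - ?f p\<bar>) \<partial>Box T)"
        using pt by (rule nn_integral_mono)
      also have "\<dots> = ennreal (2 * K) * (grid_error N (\<omega>, u) + grid_error M (\<omega>, u))"
        using mN dm[OF \<omega> u] by (simp add: nn_integral_cmult nn_integral_add grid_error_def)
      finally show "(\<integral>\<^sup>+p. ennreal ((?A N p - ?A M p)\<^sup>2) \<partial>Box t) \<le> ennreal (2 * K) * (grid_error N (\<omega>, u) + grid_error M (\<omega>, u))" .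
    qed
    finally show "(\<integral>\<^sup>+\<omega>. ennreal ((grid_integral N t (\<omega>, u) - grid_integral M t (\<omega>, u))\<^sup>2) \<partial>P) \<le> (\<integral>\<^sup>+\<omega>. ennreal (2 * K) * (grid_error N (\<omega>, u) + grid_error M (\<omega>, u)) \<partial>P)" .
  qed
  also have "\<dots> = (\<integral>\<^sup>+q. ennreal (2 * K) * (grid_error N q + grid_error M q) \<partial>PU)"
    by (rule PL.nn_integral_snd) measurable
  also have "\<dots> = ennreal (2 * K) * ((\<integral>\<^sup>+q. grid_error N q \<partial>PU) + (\<integral>\<^sup>+q. grid_error M q \<partial>PU))"
    by (simp add: nn_integral_cmult nn_integral_add)
  finally show ?thesis .
qed

text \<open>Mesh sizes along which the convergence is fast; they depend neither on \<open>t\<close> nor on \<open>u\<close>.\<close>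

definition rate :: "nat \<Rightarrow> nat" where
  "rate l = (SOME N. (\<integral>\<^sup>+q. grid_error N q \<partial>PU) \<le> ennreal ((1/4) ^ l))"

lemma rate: "(\<integral>\<^sup>+q. grid_error (rate l) q \<partial>PU) \<le> ennreal ((1/4) ^ l)"
proof -
  have "eventually (\<lambda>N. (\<integral>\<^sup>+q. grid_error N q \<partial>PU) < ennreal ((1/4) ^ l)) sequentially"
    using grid_error_tendsto by (rule order_tendstoD) simp
  then obtain N where "(\<integral>\<^sup>+q. grid_error N q \<partial>PU) \<le> ennreal ((1/4) ^ l)"
    by (auto simp: eventually_sequentially intro: less_imp_le)
  then show ?thesis unfolding rate_def by (rule someI)
qed

definition field_integral :: "real \<Rightarrow> 'a \<times> real \<Rightarrow> real" where
  "field_integral t = flim (\<lambda>l. grid_integral (rate l) t)"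

lemma field_integral_measurable: "0 \<le> t \<Longrightarrow> t \<le> T \<Longrightarrow> field_integral t \<in> borel_measurable (G t \<Otimes>\<^sub>M leb01)"
  unfolding field_integral_def by (intro flim_measurable grid_integral_measurable)

lemma field_integral_measurable_PU [measurable]: "0 \<le> t \<Longrightarrow> t \<le> T \<Longrightarrow> field_integral t \<in> borel_measurable PU"
  using GU_measurable[OF field_integral_measurable] .

lemma field_integral_0: "u \<in> {0..1} \<Longrightarrow> field_integral 0 (\<omega>, u) = 0"
proof -
  assume u: "u \<in> {0..1}"
  have "grid_integral N 0 (\<omega>, u) = 0" for N
    using grid_simple[OF u, of N] unfolding grid_integral_def simple_integral_sum_list simple_integrand_iff
    by (auto simp: eint_0 intro!: sum_list_0[THEN trans[rotated]] arg_cong[where f=sum_list] map_cong)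
  then show ?thesis unfolding field_integral_def by (intro flim_eq) simp
qed

lemma field_integral_limit:
  assumes t: "0 \<le> t" "t \<le> T"
  shows "AE q in PU. (\<lambda>l. grid_integral (rate l) t q) \<longlonglongrightarrow> field_integral t q"
    and "sqn PU (\<lambda>q. grid_integral (rate l) t q - field_integral t q) \<le> ennreal (16 * K) * ennreal ((1/4) ^ l)"
proof -
  have le: "sqn PU (\<lambda>q. grid_integral (rate (Suc l)) t q - grid_integral (rate l) t q) \<le> ennreal (4 * K) * ennreal ((1/4) ^ l)" for l
  proof -
    have "sqn PU (\<lambda>q. grid_integral (rate (Suc l)) t q - grid_integral (rate l) t q) \<le> ennreal (2 * K) * (ennreal ((1/4) ^ Suc l) + ennreal ((1/4) ^ l))"
      by (rule order_trans[OF grid_integral_distance[OF t]]) (intro mult_left_mono add_mono rate, simp)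
    also have "\<dots> \<le> ennreal (2 * K) * (ennreal ((1/4) ^ l) + ennreal ((1/4) ^ l))"
      by (intro mult_left_mono add_mono ennreal_leI power_decreasing) auto
    also have "\<dots> = ennreal (4 * K) * ennreal ((1/4) ^ l)"
      using K_nonneg by (simp add: ennreal_plus[symmetric] ennreal_mult[symmetric] del: ennreal_plus)
    finally show ?thesis .
  qed
  note fc = fast_cauchy[of PU "\<lambda>l. grid_integral (rate l) t" "ennreal (4 * K)", OF finite_PU grid_integral_measurable_PU[OF t] _ le]
  show "AE q in PU. (\<lambda>l. grid_integral (rate l) t q) \<longlonglongrightarrow> field_integral t q" unfolding field_integral_def by (rule fc(1)) simp
  have "sqn PU (\<lambda>q. grid_integral (rate l) t q - field_integral t q) \<le> 4 * ennreal (4 * K) * ennreal ((1/4) ^ l)"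
    unfolding field_integral_def by (rule fc(2)) simp
  also have "4 * ennreal (4 * K) = ennreal (16 * K)"
    using K_nonneg ennreal_mult[of 4 "4 * K"] by simp
  finally show "sqn PU (\<lambda>q. grid_integral (rate l) t q - field_integral t q) \<le> ennreal (16 * K) * ennreal ((1/4) ^ l)" .
qed

text \<open>Fatou's lemma along the grid integrals.\<close>

lemma field_integral_fourth_moment:
  assumes st: "0 \<le> s" "s \<le> t" "t \<le> T"
  shows "(\<integral>\<^sup>+q. ennreal ((field_integral t q - field_integral s q) ^ 4) \<partial>PU) \<le> ennreal (3 * K ^ 4 * (t - s)\<^sup>2)"
proof -
  interpret PL: pair_sigma_finite P leb01 by unfold_locales
  have s': "0 \<le> s" "s \<le> T" and t': "0 \<le> t" "t \<le> T" using st by auto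
  note [measurable] = grid_integral_measurable_PU[OF s'] grid_integral_measurable_PU[OF t']
  have b: "(\<integral>\<^sup>+q. ennreal ((grid_integral N t q - grid_integral N s q) ^ 4) \<partial>PU) \<le> ennreal (3 * K ^ 4 * (t - s)\<^sup>2)" for N
  proof -
    have m: "(\<lambda>q. ennreal ((grid_integral N t q - grid_integral N s q) ^ 4)) \<in> borel_measurable PU" by measurable
    have "(\<integral>\<^sup>+q. ennreal ((grid_integral N t q - grid_integral N s q) ^ 4) \<partial>PU) = (\<integral>\<^sup>+u. \<integral>\<^sup>+\<omega>. ennreal ((grid_integral N t (\<omega>, u) - grid_integral N s (\<omega>, u)) ^ 4) \<partial>P \<partial>leb01)"
      by (rule PL.nn_integral_snd[OF m, symmetric])
    also have "\<dots> \<le> (\<integral>\<^sup>+u. ennreal (3 * K ^ 4 * (t - s)\<^sup>2) \<partial>leb01)"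
    proof (rule nn_integral_mono)
      fix u assume "u \<in> space leb01"
      then have u: "u \<in> {0..1}" by simp
      have "\<forall>e\<in>set (grid N u). \<forall>\<omega>\<in>space P. \<bar>coef e \<omega>\<bar> \<le> K"
        using grid_coef_bound[OF _ u] by (auto simp: grid_def grid_entry_def coef_def)
      from simple_fourth_moment[OF grid_simple[OF u] grid_orderly st this K_nonneg]
      show "(\<integral>\<^sup>+\<omega>. ennreal ((grid_integral N t (\<omega>, u) - grid_integral N s (\<omega>, u)) ^ 4) \<partial>P) \<le> ennreal (3 * K ^ 4 * (t - s)\<^sup>2)"
        by (simp add: grid_integral_def)
    qed
    also have "\<dots> = ennreal (3 * K ^ 4 * (t - s)\<^sup>2)" using leb01.emeasure_space_1 by simp
    finally show ?thesis .
  qed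
  have "(\<integral>\<^sup>+q. ennreal ((field_integral t q - field_integral s q) ^ 4) \<partial>PU) = (\<integral>\<^sup>+q. liminf (\<lambda>l. ennreal ((grid_integral (rate l) t q - grid_integral (rate l) s q) ^ 4)) \<partial>PU)"
    using field_integral_limit(1)[OF s'] field_integral_limit(1)[OF t']
  proof (intro nn_integral_cong_AE, eventually_elim)
    case (elim q)
    then have "(\<lambda>l. ennreal ((grid_integral (rate l) t q - grid_integral (rate l) s q) ^ 4)) \<longlonglongrightarrow> ennreal ((field_integral t q - field_integral s q) ^ 4)"
      by (intro tendsto_ennrealI tendsto_intros)
    from lim_imp_Liminf[OF trivial_limit_sequentially this] show ?case by (rule sym)
  qed
  also have "\<dots> \<le> liminf (\<lambda>l. \<integral>\<^sup>+q. ennreal ((grid_integral (rate l) t q - grid_integral (rate l) s q) ^ 4) \<partial>PU)"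
    by (rule nn_integral_liminf) measurable
  also have "\<dots> \<le> ennreal (3 * K ^ 4 * (t - s)\<^sup>2)" using b by (intro Liminf_le) auto
  finally show ?thesis .
qed

lemma jointly_progressive_slice:
  assumes u: "u \<in> {0..1}"
  shows "jointly_progressive T G (\<lambda>\<omega> u' s. f \<omega> u u' s)"
  unfolding jointly_progressive_def
proof
  fix t assume t: "t \<in> {0..T}"
  have [measurable]: "u \<in> space leb01" using u by simp
  have "(\<lambda>z. (fst z, fst (snd z), u, snd (snd z))) \<in> measurable (restrict_space borel {0..t} \<Otimes>\<^sub>M (G t \<Otimes>\<^sub>M leb01))
     (restrict_space borel {0..t} \<Otimes>\<^sub>M (G t \<Otimes>\<^sub>M (leb01 \<Otimes>\<^sub>M leb01)))"
    by measurable
  from measurable_compose[OF this prog] t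
  show "(\<lambda>(s, \<omega>, u'). f \<omega> u u' s) \<in> borel_measurable (restrict_space borel {0..t} \<Otimes>\<^sub>M (G t \<Otimes>\<^sub>M leb01))"
    by (simp add: case_prod_beta')
qed

text \<open>The integrated errors over \<open>u\<close> are summable along the chosen meshes, so for almost every \<open>u\<close> the
  errors themselves tend to \<open>0\<close>.\<close>

lemma field_integral_is_integral:
  assumes t: "0 \<le> t" "t \<le> T"
  shows "AE u in leb01. has_sheet_integral P T G w (\<lambda>\<omega> u' s. f \<omega> u u' s) t (\<lambda>\<omega>. field_integral t (\<omega>, u))"
proof -
  interpret PL: pair_sigma_finite P leb01 by unfold_locales
  note [measurable] = grid_integral_measurable_PU[OF t] field_integral_measurable_PU[OF t]
  have "AE u in leb01. (\<lambda>l. \<integral>\<^sup>+\<omega>. grid_error (rate l) (\<omega>, u) \<partial>P) \<longlonglongrightarrow> 0"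
  proof (rule AE_tendsto_zero_fast[where B=1 and c="1/4"])
    show "(\<integral>\<^sup>+u. \<integral>\<^sup>+\<omega>. grid_error (rate l) (\<omega>, u) \<partial>P \<partial>leb01) \<le> 1 * ennreal ((1/4) ^ l)" for l
      using rate[of l] by (subst PL.nn_integral_snd) auto
  qed (auto intro!: borel_measurable_nn_integral)
  moreover have "AE u in leb01. (\<lambda>l. \<integral>\<^sup>+\<omega>. ennreal ((grid_integral (rate l) t (\<omega>, u) - field_integral t (\<omega>, u))\<^sup>2) \<partial>P) \<longlonglongrightarrow> 0"
  proof (rule AE_tendsto_zero_fast[where B="ennreal (16 * K)" and c="1/4"])
    show "(\<integral>\<^sup>+u. \<integral>\<^sup>+\<omega>. ennreal ((grid_integral (rate l) t (\<omega>, u) - field_integral t (\<omega>, u))\<^sup>2) \<partial>P \<partial>leb01) \<le> ennreal (16 * K) * ennreal ((1/4) ^ l)" for l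
      using field_integral_limit(2)[OF t, of l] unfolding sqn_def by (subst PL.nn_integral_snd) auto
  qed (auto intro!: borel_measurable_nn_integral)
  ultimately show ?thesis using AE_space
  proof eventually_elim
    case (elim u)
    then have u: "u \<in> {0..1}" by simp
    have Ym: "(\<lambda>\<omega>. field_integral t (\<omega>, u)) \<in> borel_measurable P"
      using measurable_compose[OF measurable_Pair2'[of u leb01 P] field_integral_measurable_PU[OF t]] u by simp
    have le: "(\<integral>\<^sup>+ \<omega>. (\<integral>\<^sup>+ s. (\<integral>\<^sup>+ u'. ennreal ((simple_eval (grid N u) \<omega> u' s - f \<omega> u u' s)\<^sup>2) \<partial>leb01)
               \<partial>restrict_space lborel {0..t}) \<partial>P) \<le> ennreal (2 * K) * (\<integral>\<^sup>+\<omega>. grid_error N (\<omega>, u) \<partial>P)" for N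
    proof -
      have "(\<integral>\<^sup>+ s. (\<integral>\<^sup>+ u'. ennreal ((simple_eval (grid N u) \<omega> u' s - f \<omega> u u' s)\<^sup>2) \<partial>leb01)
               \<partial>restrict_space lborel {0..t}) \<le> ennreal (2 * K) * grid_error N (\<omega>, u)" if \<omega>: "\<omega> \<in> space P" for \<omega>
      proof -
        let ?h = "\<lambda>p. lag_avg T N (slice \<omega> u) p - slice \<omega> u p"
        have hm: "?h \<in> borel_measurable (Box T)"
          by (intro borel_measurable_diff lag_avg_measurable[OF T_pos] slice_measurable1 \<omega> u)
        have "(\<integral>\<^sup>+ s. (\<integral>\<^sup>+ u'. ennreal ((simple_eval (grid N u) \<omega> u' s - f \<omega> u u' s)\<^sup>2) \<partial>leb01) \<partial>restrict_space lborel {0..t})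
           = (\<integral>\<^sup>+ s. (\<integral>\<^sup>+ u'. ennreal ((?h (s, u'))\<^sup>2) \<partial>leb01) \<partial>slab t)"
          by (simp add: grid_eval slice_def slab_def)
        also have "\<dots> \<le> (\<integral>\<^sup>+ s. (\<integral>\<^sup>+ u'. ennreal ((?h (s, u'))\<^sup>2) \<partial>leb01) \<partial>slab T)"
          by (rule nn_integral_slab_mono[OF t(2)])
        also have "\<dots> = (\<integral>\<^sup>+p. ennreal ((?h p)\<^sup>2) \<partial>Box T)"
          using hm by (subst nn_integral_Box) auto
        also have "\<dots> \<le> (\<integral>\<^sup>+p. ennreal (2 * K) * ennreal \<bar>?h p\<bar> \<partial>Box T)"
        proof (rule nn_integral_mono)
          fix p
          have b: "\<bar>lag_avg T N (slice \<omega> u) p\<bar> \<le> K" "\<bar>slice \<omega> u p\<bar> \<le> K"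
            using lag_slice_bound[OF \<omega> u] bound by (auto simp: slice_def)
          have "(?h p)\<^sup>2 = \<bar>?h p\<bar> * \<bar>?h p\<bar>" by (simp add: power2_eq_square)
          also have "\<dots> \<le> (2 * K) * \<bar>?h p\<bar>" using b by (intro mult_right_mono) auto
          finally have "ennreal ((?h p)\<^sup>2) \<le> ennreal ((2 * K) * \<bar>?h p\<bar>)" by (rule ennreal_leI)
          then show "ennreal ((?h p)\<^sup>2) \<le> ennreal (2 * K) * ennreal \<bar>?h p\<bar>"
            using K_nonneg by (simp add: ennreal_mult)
        qed
        also have "\<dots> = ennreal (2 * K) * grid_error N (\<omega>, u)"
          using hm by (simp add: nn_integral_cmult grid_error_def)
        finally show ?thesis .
      qed
      then have "(\<integral>\<^sup>+ \<omega>. (\<integral>\<^sup>+ s. (\<integral>\<^sup>+ u'. ennreal ((simple_eval (grid N u) \<omega> u' s - f \<omega> u u' s)\<^sup>2) \<partial>leb01)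
               \<partial>restrict_space lborel {0..t}) \<partial>P) \<le> (\<integral>\<^sup>+\<omega>. ennreal (2 * K) * grid_error N (\<omega>, u) \<partial>P)"
        by (rule nn_integral_mono)
      also have "\<dots> = ennreal (2 * K) * (\<integral>\<^sup>+\<omega>. grid_error N (\<omega>, u) \<partial>P)"
        using measurable_compose[OF measurable_Pair2'[of u leb01 P] grid_error_measurable[of N]] u
        by (intro nn_integral_cmult) simp
      finally show ?thesis .
    qed
    have "(\<lambda>l. ennreal (2 * K) * (\<integral>\<^sup>+\<omega>. grid_error (rate l) (\<omega>, u) \<partial>P)) \<longlonglongrightarrow> ennreal (2 * K) * 0"
      by (intro ennreal_tendsto_cmult elim) simp
    then have lim: "(\<lambda>l. ennreal (2 * K) * (\<integral>\<^sup>+\<omega>. grid_error (rate l) (\<omega>, u) \<partial>P)) \<longlonglongrightarrow> 0" by simp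
    have "(\<lambda>l. \<integral>\<^sup>+ \<omega>. (\<integral>\<^sup>+ s. (\<integral>\<^sup>+ u'. ennreal ((simple_eval (grid (rate l) u) \<omega> u' s - f \<omega> u u' s)\<^sup>2) \<partial>leb01)
               \<partial>restrict_space lborel {0..t}) \<partial>P) \<longlonglongrightarrow> 0"
      by (rule tendsto_sandwich[OF _ _ tendsto_const lim]) (auto intro!: always_eventually le)
    then show ?case
      unfolding has_sheet_integral_def using jointly_progressive_slice[OF u] Ym grid_simple[OF u] elim(2)
      by (intro conjI exI[of _ "\<lambda>l. grid (rate l) u"]) (auto simp: grid_integral_def)
  qed
qed

end

section \<open>Continuous paths from values on refining grids\<close>

lemma L2_funs_iff: "f \<in> L2_funs \<longleftrightarrow> f \<in> borel_measurable leb01 \<and> sqn leb01 f < \<infinity>"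
  unfolding L2_funs_def sqn_def by (auto simp: integrable_iff_bounded)

lemma L2_norm_sq: "f \<in> L2_funs \<Longrightarrow> ennreal ((L2_norm f)\<^sup>2) = sqn leb01 f"
  unfolding L2_norm_def sqn_def L2_funs_def by (simp add: nn_integral_eq_integral)

lemma L2_norm_nonneg: "0 \<le> L2_norm f"
  by (simp add: L2_norm_def)

lemma L2_norm_less:
  assumes f: "f \<in> L2_funs" and r: "0 < r"
  shows "L2_norm f < r \<longleftrightarrow> sqn leb01 f < ennreal (r\<^sup>2)"
proof -
  have "L2_norm f < r \<longleftrightarrow> (L2_norm f)\<^sup>2 < r\<^sup>2"
  proof
    show "L2_norm f < r \<Longrightarrow> (L2_norm f)\<^sup>2 < r\<^sup>2"
      by (rule power_strict_mono[OF _ L2_norm_nonneg]) simp_all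
    show "(L2_norm f)\<^sup>2 < r\<^sup>2 \<Longrightarrow> L2_norm f < r"
      by (rule power2_less_imp_less[OF _ less_imp_le[OF r]])
  qed
  also have "\<dots> \<longleftrightarrow> ennreal ((L2_norm f)\<^sup>2) < ennreal (r\<^sup>2)" by (simp add: ennreal_less_iff)
  finally show ?thesis by (simp only: L2_norm_sq[OF f])
qed

lemma L2_funs_diff: "f \<in> L2_funs \<Longrightarrow> g \<in> L2_funs \<Longrightarrow> (\<lambda>u. f u - g u) \<in> L2_funs"
proof -
  assume f: "f \<in> L2_funs" and g: "g \<in> L2_funs"
  then have [measurable]: "f \<in> borel_measurable leb01" "g \<in> borel_measurable leb01" by (auto simp: L2_funs_iff)
  have "sqn leb01 (\<lambda>u. f u - g u) \<le> 2 * sqn leb01 f + 2 * sqn leb01 (\<lambda>u. - g u)"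
    using sqn_add[of f leb01 "\<lambda>u. - g u"] by simp
  also have "\<dots> < \<infinity>" using f g by (auto simp: L2_funs_iff sqn_def ennreal_mult_less_top)
  finally show ?thesis by (simp add: L2_funs_iff)
qed

text \<open>The ratio \<open>32\<close> of consecutive meshes is large enough for the bounds \<open>4\<^sup>-\<^sup>n\<close> used below: in
  Kolmogorov's argument a grid with \<open>32\<^sup>n\<close> points and fourth moments \<open>O(32\<^sup>-\<^sup>2\<^sup>n)\<close> leaves
  \<open>16\<^sup>n \<cdot> 32\<^sup>n \<cdot> 32\<^sup>-\<^sup>2\<^sup>n = 2\<^sup>-\<^sup>n\<close>.\<close>

definition node :: "real \<Rightarrow> nat \<Rightarrow> nat \<Rightarrow> real" where
  "node T n k = real k * T / 32 ^ n"

definition node_index :: "real \<Rightarrow> nat \<Rightarrow> real \<Rightarrow> nat" where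
  "node_index T n t = nat \<lfloor>t * 32 ^ n / T\<rfloor>"

context
  fixes T :: real assumes T: "0 < T"
begin

lemma node_index_iff:
  assumes "0 \<le> t"
  shows "node_index T n t = k \<longleftrightarrow> node T n k \<le> t \<and> t < node T n (Suc k)"
proof -
  have "0 \<le> t * 32 ^ n / T" using assms T by simp
  then have "node_index T n t = k \<longleftrightarrow> \<lfloor>t * 32 ^ n / T\<rfloor> = int k"
    unfolding node_index_def by (metis int_nat_eq nat_int zero_le_floor)
  also have "\<dots> \<longleftrightarrow> real k \<le> t * 32 ^ n / T \<and> t * 32 ^ n / T < real k + 1"
    by (simp add: floor_eq_iff)
  also have "\<dots> \<longleftrightarrow> node T n k \<le> t \<and> t < node T n (Suc k)"
    using T by (simp add: node_def field_simps)
  finally show ?thesis .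
qed

lemma node_mono: "k \<le> l \<Longrightarrow> node T n k \<le> node T n l"
  using T by (auto simp: node_def intro!: divide_right_mono mult_right_mono)

lemma node_le: "k \<le> 32 ^ n \<Longrightarrow> node T n k \<le> T"
  using T node_mono[of k "32 ^ n" n] by (simp add: node_def)

lemma node_nonneg: "0 \<le> node T n k"
  using T by (simp add: node_def)

lemma node_Suc: "node T n (Suc k) = node T n k + T / 32 ^ n"
  using T by (simp add: node_def add_divide_distrib distrib_right)

lemma node_floor:
  assumes "0 \<le> t" "t \<le> T"
  shows "node T n (node_index T n t) \<le> t" "t < node T n (node_index T n t) + T / 32 ^ n" "node_index T n t \<le> 32 ^ n"
proof -
  show 1: "node T n (node_index T n t) \<le> t" "t < node T n (node_index T n t) + T / 32 ^ n"
    using node_index_iff[OF assms(1), of n "node_index T n t"] by (auto simp: node_Suc)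
  show "node_index T n t \<le> 32 ^ n"
  proof (rule ccontr)
    assume "\<not> node_index T n t \<le> 32 ^ n"
    then have "node T n (Suc (32 ^ n)) \<le> node T n (node_index T n t)" by (intro node_mono) simp
    then have "T + T / 32 ^ n \<le> t" using 1(1) by (simp add: node_Suc) (simp add: node_def)
    moreover have "0 < T / 32 ^ n" using T by simp
    ultimately show False using assms by linarith
  qed
qed

lemma node_refine:
  shows "node T n (k div 32) \<le> node T (Suc n) k" "node T (Suc n) k < node T n (k div 32) + T / 32 ^ n"
proof -
  have e: "node T (Suc n) (32 * j) = node T n j" for j by (simp add: node_def)
  have "node T (Suc n) (32 * (k div 32)) \<le> node T (Suc n) k" by (intro node_mono) simp
  then show "node T n (k div 32) \<le> node T (Suc n) k" by (simp add: e)
  have "real k < real (32 * Suc (k div 32))" by (subst of_nat_less_iff) (simp add: dividend_less_times_div)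
  then have "node T (Suc n) k < node T (Suc n) (32 * Suc (k div 32))"
    unfolding node_def using T by (intro divide_strict_right_mono mult_strict_right_mono) auto
  then show "node T (Suc n) k < node T n (k div 32) + T / 32 ^ n" by (simp only: e node_Suc)
qed

lemma node_index_refine:
  assumes "0 \<le> t" "t \<le> T"
  shows "node_index T n t = node_index T (Suc n) t div 32"
proof -
  let ?k = "node_index T (Suc n) t"
  have 1: "node T (Suc n) ?k \<le> t" "t < node T (Suc n) (Suc ?k)"
    using node_index_iff[OF assms(1), of "Suc n" ?k] by auto
  have "node T (Suc n) (Suc ?k) \<le> node T (Suc n) (32 * Suc (?k div 32))"
    by (intro node_mono) (simp add: dividend_less_times_div Suc_leI)
  also have "node T (Suc n) (32 * j) = node T n j" for j by (simp add: node_def)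
  finally show ?thesis using 1 node_refine(1)[of n ?k] by (subst node_index_iff[OF assms(1)]) auto
qed

text \<open>The value at the largest node not after \<open>t\<close> involves only the past, unlike linear interpolation;
  this keeps the limit progressive.\<close>

definition path :: "(real \<Rightarrow> real \<Rightarrow> real) \<Rightarrow> real \<Rightarrow> real \<Rightarrow> real" where
  "path Z t = flim (\<lambda>n. Z (node T n (node_index T n t)))"

text \<open>The two families of increments are those between a node and its predecessor on the next coarser grid,
  which give convergence, and those between neighbours, which give continuity of the limit although the
  approximating paths jump.\<close>

definition controlled :: "(real \<Rightarrow> real \<Rightarrow> real) \<Rightarrow> real \<Rightarrow> bool" where
  "controlled Z b \<longleftrightarrow>
     (\<forall>t. 0 \<le> t \<longrightarrow> t \<le> T \<longrightarrow> Z t \<in> borel_measurable leb01) \<and>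
     (\<forall>u\<in>{0..1}. Z 0 u = 0) \<and>
     (\<forall>n. \<forall>k\<le>32 ^ Suc n. sqn leb01 (\<lambda>u. Z (node T (Suc n) k) u - Z (node T n (k div 32)) u) \<le> ennreal (b * (1/4) ^ n)) \<and>
     (\<forall>n. \<forall>k<32 ^ n. sqn leb01 (\<lambda>u. Z (node T n (Suc k)) u - Z (node T n k) u) \<le> ennreal (b * (1/4) ^ n))"

text \<open>Passing from a grid to the next finer one moves the sampling point to a node whose predecessor on
  the coarser grid is the old one.\<close>

lemma controlled_path:
  assumes Z: "controlled Z b" and b: "0 \<le> b" and t: "0 \<le> t" "t \<le> T"
  shows "path Z t \<in> borel_measurable leb01"
    and "sqn leb01 (\<lambda>u. Z (node T n (node_index T n t)) u - path Z t u) \<le> ennreal (4 * b * (1/4) ^ n)"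
    and "sqn leb01 (path Z t) \<le> ennreal (10 * b)"
proof -
  have Zm: "Z (node T n (node_index T n t)) \<in> borel_measurable leb01" for n
    using Z node_nonneg node_le[OF node_floor(3)[OF t]] by (auto simp: controlled_def)
  have step: "sqn leb01 (\<lambda>u. Z (node T (Suc n) (node_index T (Suc n) t)) u - Z (node T n (node_index T n t)) u)
      \<le> ennreal b * ennreal ((1/4) ^ n)" for n
    using Z node_floor(3)[OF t, of "Suc n"] b unfolding node_index_refine[OF t, of n] controlled_def
    by (auto simp: ennreal_mult)
  show m: "path Z t \<in> borel_measurable leb01"
    unfolding path_def by (intro flim_measurable Zm)
  have fc: "sqn leb01 (\<lambda>u. Z (node T n (node_index T n t)) u - path Z t u) \<le> 4 * ennreal b * ennreal ((1/4) ^ n)" for n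
    unfolding path_def
    by (rule fast_cauchy(2)[where f="\<lambda>n. Z (node T n (node_index T n t))", OF leb01.finite_measure_axioms Zm _ step]) simp
  have four: "4 * ennreal b * ennreal ((1/4) ^ n) = ennreal (4 * b * (1/4) ^ n)" for n
    using b by (simp add: ennreal_mult)
  show *: "sqn leb01 (\<lambda>u. Z (node T n (node_index T n t)) u - path Z t u) \<le> ennreal (4 * b * (1/4) ^ n)" for n
    using fc[of n] four[of n] by simp
  \<comment> \<open>on the coarsest grid the sampling node is \<open>0\<close>, where \<open>Z\<close> vanishes, or \<open>T\<close>\<close>
  let ?k = "node_index T 0 t"
  have Zk: "sqn leb01 (Z (node T 0 ?k)) \<le> ennreal b"
  proof (cases "?k = 0")
    case True
    have "sqn leb01 (Z 0) = sqn leb01 (\<lambda>_. 0)" unfolding sqn_def using Z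
      by (intro nn_integral_cong) (auto simp: controlled_def)
    then show ?thesis by (simp add: True node_def sqn_def)
  next
    case False
    then have k: "?k = 1" using node_floor(3)[OF t, of 0] by simp
    have "sqn leb01 (Z (node T 0 1)) = sqn leb01 (\<lambda>u. Z (node T 0 (Suc 0)) u - Z (node T 0 0) u)"
      unfolding sqn_def using Z by (intro nn_integral_cong) (auto simp: controlled_def node_def)
    also have "\<dots> \<le> ennreal (b * (1/4) ^ 0)" using Z unfolding controlled_def by (metis power_0 zero_less_one)
    finally show ?thesis using k by simp
  qed
  have "sqn leb01 (path Z t) = sqn leb01 (\<lambda>u. (path Z t u - Z (node T 0 ?k) u) + Z (node T 0 ?k) u)" by simp
  also have "\<dots> \<le> 2 * sqn leb01 (\<lambda>u. path Z t u - Z (node T 0 ?k) u) + 2 * sqn leb01 (Z (node T 0 ?k))"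
    using m Zm by (intro sqn_add borel_measurable_diff)
  also have "\<dots> \<le> 2 * ennreal (4 * b * (1/4) ^ 0) + 2 * ennreal b"
    using *[of 0] Zk by (intro add_mono mult_left_mono) (auto simp: sqn_minus_commute)
  also have "\<dots> = ennreal (10 * b)"
  proof -
    have "2 * ennreal (4 * b * (1/4) ^ 0) + 2 * ennreal b = ennreal (2 * (4 * b)) + ennreal (2 * b)"
      using b by (simp add: ennreal_mult)
    also have "\<dots> = ennreal (10 * b)" using b by (subst ennreal_plus[symmetric]) auto
    finally show ?thesis .
  qed
  finally show "sqn leb01 (path Z t) \<le> ennreal (10 * b)" .
qed

text \<open>Two times closer than the mesh have equal or neighbouring sampling nodes.\<close>

lemma controlled_path_close:
  assumes Z: "controlled Z b" and b: "0 \<le> b" and s: "0 \<le> s" "s \<le> T" and t: "0 \<le> t" "t \<le> T"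
    and near: "\<bar>s - t\<bar> < T / 32 ^ n"
  shows "sqn leb01 (\<lambda>u. path Z s u - path Z t u) \<le> ennreal (28 * b * (1/4) ^ n)"
proof -
  have main: "sqn leb01 (\<lambda>u. path Z s u - path Z t u) \<le> ennreal (28 * b * (1/4) ^ n)"
    if s: "0 \<le> s" "s \<le> T" and t: "0 \<le> t" "t \<le> T" and st: "s \<le> t" and near: "t - s < T / 32 ^ n" for s t
  proof -
    let ?k = "node_index T n s" and ?l = "node_index T n t"
    have ks: "node T n ?k \<le> s" "s < node T n (Suc ?k)" "node T n ?l \<le> t" "t < node T n (Suc ?l)"
      using node_index_iff[OF s(1), of n ?k] node_index_iff[OF t(1), of n ?l] by auto
    have "?k \<le> ?l"
    proof (rule ccontr)
      assume "\<not> ?k \<le> ?l"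
      then have "node T n (Suc ?l) \<le> node T n ?k" by (intro node_mono) simp
      then show False using ks st by linarith
    qed
    moreover have "?l \<le> Suc ?k"
    proof (rule ccontr)
      assume "\<not> ?l \<le> Suc ?k"
      then have "node T n (Suc (Suc ?k)) \<le> node T n ?l" by (intro node_mono) simp
      moreover have "node T n (Suc (Suc ?k)) = node T n (Suc ?k) + T / 32 ^ n" by (rule node_Suc)
      ultimately show False using ks near by linarith
    qed
    ultimately have l: "?l = ?k \<or> ?l = Suc ?k" by linarith
    have inc: "sqn leb01 (\<lambda>u. Z (node T n ?l) u - Z (node T n ?k) u) \<le> ennreal (b * (1/4) ^ n)"
    proof (cases "?l = ?k")
      case True then show ?thesis by (simp add: sqn_def)
    next
      case False
      then have "?l = Suc ?k" "?k < 32 ^ n" using l node_floor(3)[OF t, of n] by auto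
      then show ?thesis using Z by (auto simp: controlled_def)
    qed
    have m: "Z (node T n ?l) \<in> borel_measurable leb01" "Z (node T n ?k) \<in> borel_measurable leb01"
      using Z node_nonneg node_le[OF node_floor(3)[OF t]] node_le[OF node_floor(3)[OF s]] by (auto simp: controlled_def)
    note ps = controlled_path[OF Z b s] and pt = controlled_path[OF Z b t]
    have "sqn leb01 (\<lambda>u. path Z t u - path Z s u) \<le> 2 * sqn leb01 (\<lambda>u. path Z t u - Z (node T n ?l) u)
        + 2 * sqn leb01 (\<lambda>u. Z (node T n ?l) u - path Z s u)"
      by (intro sqn_triangle ps pt m)
    also have "\<dots> \<le> 2 * sqn leb01 (\<lambda>u. path Z t u - Z (node T n ?l) u)
        + 2 * (2 * sqn leb01 (\<lambda>u. Z (node T n ?l) u - Z (node T n ?k) u) + 2 * sqn leb01 (\<lambda>u. Z (node T n ?k) u - path Z s u))"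
      by (intro add_mono mult_left_mono sqn_triangle ps pt m) auto
    also have "\<dots> \<le> 2 * ennreal (4 * b * (1/4) ^ n) + 2 * (2 * ennreal (b * (1/4) ^ n) + 2 * ennreal (4 * b * (1/4) ^ n))"
      using ps(2)[of n] pt(2)[of n] inc
      by (intro add_mono mult_left_mono) (auto simp: sqn_minus_commute[of leb01 "path Z t"])
    also have "\<dots> = ennreal (28 * b * (1/4) ^ n)"
    proof -
      define x where "x = b * (1/4) ^ n"
      have x: "0 \<le> x" using b by (simp add: x_def)
      have "8 * X + (4 * X + 16 * X) = (8 + (4 + 16)) * X" for X :: ennreal by (simp only: distrib_right)
      then have "2 * ennreal (4 * x) + 2 * (2 * ennreal x + 2 * ennreal (4 * x)) = ennreal (28 * x)"
        using x by (simp add: ennreal_mult distrib_left mult.assoc[symmetric])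
      then show ?thesis by (simp add: x_def mult.assoc)
    qed
    finally show ?thesis by (subst sqn_minus_commute)
  qed
  show ?thesis
  proof (cases "s \<le> t")
    case True then show ?thesis using main[OF s t True] near by simp
  next
    case False
    then show ?thesis using main[OF t s] near by (subst sqn_minus_commute) simp
  qed
qed

lemma controlled_continuous:
  assumes Z: "controlled Z b" and b: "0 \<le> b"
  shows "L2_continuous T (\<lambda>u t. path Z t u)"
  unfolding L2_continuous_def
proof (intro ballI conjI)
  fix t assume "t \<in> {0..T}"
  then have t: "0 \<le> t" "t \<le> T" by auto
  have L2: "path Z s \<in> L2_funs" if "0 \<le> s" "s \<le> T" for s
    using controlled_path(1,3)[OF Z b that] by (auto simp: L2_funs_iff intro: le_less_trans)
  show "(\<lambda>u. path Z t u) \<in> L2_funs" using L2[OF t] by simp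
  show "((\<lambda>s. L2_norm (\<lambda>u. path Z s u - path Z t u)) \<longlongrightarrow> 0) (at t within {0..T})"
  proof (rule tendstoI)
    fix e :: real assume e: "0 < e"
    have "(\<lambda>n. 28 * b * (1/4) ^ n) \<longlonglongrightarrow> 28 * b * 0"
      by (intro tendsto_intros LIMSEQ_power_zero) auto
    then have "eventually (\<lambda>n. 28 * b * (1/4) ^ n < e\<^sup>2) sequentially"
      using e by (intro order_tendstoD) auto
    then obtain n where n: "28 * b * (1/4) ^ n < e\<^sup>2" by (auto simp: eventually_sequentially)
    show "eventually (\<lambda>s. dist (L2_norm (\<lambda>u. path Z s u - path Z t u)) 0 < e) (at t within {0..T})"
      unfolding eventually_at
    proof (intro exI conjI ballI impI)
      show "0 < T / 32 ^ n" using T by simp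
      fix s assume "s \<in> {0..T}" "s \<noteq> t \<and> dist s t < T / 32 ^ n"
      then have s: "0 \<le> s" "s \<le> T" and near: "\<bar>s - t\<bar> < T / 32 ^ n" by (auto simp: dist_real_def)
      have "sqn leb01 (\<lambda>u. path Z s u - path Z t u) \<le> ennreal (28 * b * (1/4) ^ n)"
        by (rule controlled_path_close[OF Z b s t near])
      also have "\<dots> < ennreal (e\<^sup>2)" using n e by (intro ennreal_lessI) auto
      finally have "L2_norm (\<lambda>u. path Z s u - path Z t u) < e"
        by (subst L2_norm_less[OF L2_funs_diff[OF L2[OF s] L2[OF t]] e])
      then show "dist (L2_norm (\<lambda>u. path Z s u - path Z t u)) 0 < e" by (simp add: L2_norm_nonneg)
    qed
  qed
qed

end

section \<open>Continuous versions\<close>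

context sheet_noise
begin

lemma GU_mono: "h \<in> measurable (G s \<Otimes>\<^sub>M leb01) L \<Longrightarrow> s \<le> t \<Longrightarrow> h \<in> measurable (G t \<Otimes>\<^sub>M leb01) L"
  by (rule measurable_pair_sub[rotated 4, of _ "G s" leb01]) (simp_all add: sets_G_mono)

lemma sqn_PU:
  assumes "h \<in> borel_measurable PU"
  shows "sqn PU h = (\<integral>\<^sup>+\<omega>. sqn leb01 (\<lambda>u. h (\<omega>, u)) \<partial>P)"
  unfolding sqn_def using assms by (intro leb01.nn_integral_fst[symmetric]) simp

lemma emeasure_PU: "emeasure PU (space PU) = 1"
proof -
  have "emeasure PU (space P \<times> space leb01) = emeasure P (space P) * emeasure leb01 (space leb01)"
    by (intro leb01.emeasure_pair_measure_Times sets.top)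
  then show ?thesis by (simp add: space_pair_measure emeasure_space_1 leb01.emeasure_space_1[unfolded space_leb01])
qed

text \<open>Turns fourth moments into second moments, at a scale \<open>\<delta>\<close> of our choice.\<close>

lemma square_le_fourth: "0 < \<delta> \<Longrightarrow> x\<^sup>2 \<le> x ^ 4 / \<delta> + \<delta>" for x \<delta> :: real
proof -
  assume d: "0 < \<delta>"
  have "0 \<le> (x\<^sup>2 - \<delta>)\<^sup>2" by simp
  then have "2 * (x\<^sup>2 * \<delta>) \<le> x ^ 4 + \<delta>\<^sup>2" by (simp add: power2_diff algebra_simps)
  moreover have "0 \<le> x\<^sup>2 * \<delta>" using d by simp
  ultimately have "x\<^sup>2 * \<delta> \<le> x ^ 4 + \<delta>\<^sup>2" by linarith
  then show ?thesis using d by (simp add: field_simps power2_eq_square)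
qed

lemma sqn_le_fourth:
  assumes "0 < \<delta>" and [measurable]: "h \<in> borel_measurable M" and M: "emeasure M (space M) = 1"
  shows "sqn M h \<le> ennreal (1 / \<delta>) * (\<integral>\<^sup>+x. ennreal (h x ^ 4) \<partial>M) + ennreal \<delta>"
proof -
  have "sqn M h \<le> (\<integral>\<^sup>+x. ennreal (1 / \<delta>) * ennreal (h x ^ 4) + ennreal \<delta> \<partial>M)"
    unfolding sqn_def
  proof (rule nn_integral_mono)
    fix x
    have "ennreal ((h x)\<^sup>2) \<le> ennreal (1 / \<delta> * h x ^ 4 + \<delta>)"
      using square_le_fourth[OF assms(1), of "h x"] by (intro ennreal_leI) simp
    also have "\<dots> = ennreal (1 / \<delta> * h x ^ 4) + ennreal \<delta>"
      using assms(1) by (intro ennreal_plus) (auto simp: zero_le_even_power)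
    also have "ennreal (1 / \<delta> * h x ^ 4) = ennreal (1 / \<delta>) * ennreal (h x ^ 4)"
      using assms(1) by (intro ennreal_mult) (auto simp: zero_le_even_power)
    finally show "ennreal ((h x)\<^sup>2) \<le> ennreal (1 / \<delta>) * ennreal (h x ^ 4) + ennreal \<delta>" .
  qed
  also have "\<dots> = ennreal (1 / \<delta>) * (\<integral>\<^sup>+x. ennreal (h x ^ 4) \<partial>M) + ennreal \<delta>"
    by (simp add: nn_integral_add nn_integral_cmult M)
  finally show ?thesis .
qed

text \<open>Kolmogorov's continuity argument for an \<open>L\<^sub>2(0,1)\<close>-valued process. \<open>S n\<close> collects the fourth moments
  in \<open>u\<close> of all increments of level \<open>n\<close>, and \<open>B = \<Sum> 16\<^sup>n S n\<close> has finite expectation. Where \<open>B\<close> is finite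
  the path is controlled; elsewhere it is replaced by \<open>0\<close>, which keeps the process adapted because
  null sets belong to the filtration at every time.\<close>

theorem continuous_version:
  fixes Y :: "real \<Rightarrow> 'a \<times> real \<Rightarrow> real"
  assumes Ym: "\<And>t. 0 \<le> t \<Longrightarrow> t \<le> T \<Longrightarrow> Y t \<in> borel_measurable (G t \<Otimes>\<^sub>M leb01)"
    and Y0: "\<And>\<omega> u. u \<in> {0..1} \<Longrightarrow> Y 0 (\<omega>, u) = 0"
    and C: "0 \<le> C"
    and Y4: "\<And>s t. 0 \<le> s \<Longrightarrow> s \<le> t \<Longrightarrow> t \<le> T \<Longrightarrow>
       (\<integral>\<^sup>+q. ennreal ((Y t q - Y s q) ^ 4) \<partial>PU) \<le> ennreal (C * (t - s)\<^sup>2)"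
  obtains y S where "jointly_progressive T G y" "\<And>\<omega>. \<omega> \<in> space P \<Longrightarrow> L2_continuous T (y \<omega>)"
    "S \<in> borel_measurable P" "(\<integral>\<^sup>+\<omega>. S \<omega> \<partial>P) < \<infinity>"
    "\<And>\<omega> t. \<omega> \<in> space P \<Longrightarrow> t \<in> {0..T} \<Longrightarrow> sqn leb01 (\<lambda>u. y \<omega> u t) \<le> S \<omega>"
    "\<And>t. 0 \<le> t \<Longrightarrow> t \<le> T \<Longrightarrow> AE q in PU. y (fst q) (snd q) t = Y t q"
proof -
  define d where "d r s \<omega> = (\<integral>\<^sup>+u. ennreal ((Y r (\<omega>, u) - Y s (\<omega>, u)) ^ 4) \<partial>leb01)" for r s \<omega>
  define S where "S n \<omega> = (\<Sum>k\<le>32 ^ Suc n. d (node T (Suc n) k) (node T n (k div 32)) \<omega>)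
      + (\<Sum>k<32 ^ n. d (node T n (Suc k)) (node T n k) \<omega>)" for n \<omega>
  define B where "B \<omega> = (\<Sum>n. ennreal (16 ^ n) * S n \<omega>)" for \<omega>
  have YPU [measurable]: "Y t \<in> borel_measurable PU" if "0 \<le> t" "t \<le> T" for t
    using GU_measurable[OF Ym[OF that] that(2)] .
  have nd: "0 \<le> node T n k" for n k using T_pos by (rule node_nonneg)
  have nT: "node T n k \<le> T" if "k \<le> 32 ^ n" for n k using T_pos that by (rule node_le)
  have div32: "k div 32 \<le> 32 ^ n" if "k \<le> 32 ^ Suc n" for k n :: nat
    using div_le_mono[OF that, of 32] by simp
  have dm: "d r s \<in> borel_measurable P" if "0 \<le> r" "r \<le> T" "0 \<le> s" "s \<le> T" for r s
    unfolding d_def[abs_def] using YPU[OF that(1,2)] YPU[OF that(3,4)]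
    by (intro leb01.borel_measurable_nn_integral) (simp add: case_prod_beta')
  have dI: "(\<integral>\<^sup>+\<omega>. d r s \<omega> \<partial>P) \<le> ennreal (C * (r - s)\<^sup>2)" if "0 \<le> s" "s \<le> r" "r \<le> T" for r s
  proof -
    have m: "(\<lambda>q. ennreal ((Y r q - Y s q) ^ 4)) \<in> borel_measurable PU"
      using YPU[of r] YPU[of s] that by simp
    show ?thesis unfolding d_def using Y4[OF that] leb01.nn_integral_fst[OF m] by simp
  qed
  have Sm [measurable]: "S n \<in> borel_measurable P" for n
    unfolding S_def[abs_def] using nd nT div32 by (intro borel_measurable_add borel_measurable_sum dm) auto
  have Bm [measurable]: "B \<in> borel_measurable P" unfolding B_def[abs_def] by measurable
  have SI: "(\<integral>\<^sup>+\<omega>. S n \<omega> \<partial>P) \<le> ennreal (34 * C * T\<^sup>2 * (1/32) ^ n)" for n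
  proof -
    let ?c = "C * (T / 32 ^ n)\<^sup>2"
    have c: "0 \<le> ?c" using C by simp
    have bd: "(\<integral>\<^sup>+\<omega>. d r s \<omega> \<partial>P) \<le> ennreal ?c" if "0 \<le> s" "s \<le> r" "r \<le> T" "r - s \<le> T / 32 ^ n" for r s
      by (rule order_trans[OF dI[OF that(1-3)]]) (use that C in \<open>auto intro!: ennreal_leI mult_left_mono power_mono\<close>)
    have "(\<integral>\<^sup>+\<omega>. S n \<omega> \<partial>P) = (\<integral>\<^sup>+\<omega>. (\<Sum>k\<le>32 ^ Suc n. d (node T (Suc n) k) (node T n (k div 32)) \<omega>) \<partial>P)
        + (\<integral>\<^sup>+\<omega>. (\<Sum>k<32 ^ n. d (node T n (Suc k)) (node T n k) \<omega>) \<partial>P)"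
      unfolding S_def using nd nT div32 by (intro nn_integral_add borel_measurable_sum dm) auto
    also have "(\<integral>\<^sup>+\<omega>. (\<Sum>k\<le>32 ^ Suc n. d (node T (Suc n) k) (node T n (k div 32)) \<omega>) \<partial>P)
        = (\<Sum>k\<le>32 ^ Suc n. \<integral>\<^sup>+\<omega>. d (node T (Suc n) k) (node T n (k div 32)) \<omega> \<partial>P)"
      using nd nT div32 by (intro nn_integral_sum dm) auto
    also have "(\<integral>\<^sup>+\<omega>. (\<Sum>k<32 ^ n. d (node T n (Suc k)) (node T n k) \<omega>) \<partial>P)
        = (\<Sum>k<32 ^ n. \<integral>\<^sup>+\<omega>. d (node T n (Suc k)) (node T n k) \<omega> \<partial>P)"
      using nd nT by (intro nn_integral_sum dm) auto
    also have "(\<Sum>k\<le>32 ^ Suc n. \<integral>\<^sup>+\<omega>. d (node T (Suc n) k) (node T n (k div 32)) \<omega> \<partial>P)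
        + (\<Sum>k<32 ^ n. \<integral>\<^sup>+\<omega>. d (node T n (Suc k)) (node T n k) \<omega> \<partial>P)
       \<le> (\<Sum>k\<le>(32 :: nat) ^ Suc n. ennreal ?c) + (\<Sum>k<(32 :: nat) ^ n. ennreal ?c)"
    proof (intro add_mono sum_mono bd)
      fix k assume k: "k \<in> {..(32 :: nat) ^ Suc n}"
      show "node T n (k div 32) \<le> node T (Suc n) k" "node T (Suc n) k - node T n (k div 32) \<le> T / 32 ^ n"
        using node_refine[OF T_pos, of n k] by auto
      show "node T (Suc n) k \<le> T" using nT k by auto
    next
      fix k assume "k \<in> {..<(32 :: nat) ^ n}"
      then show "node T n (Suc k) \<le> T" by (intro nT) auto
    qed (auto simp: nd node_Suc[OF T_pos] T_pos less_imp_le)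
    also have "\<dots> = ennreal (real (32 ^ Suc n + 1 + 32 ^ n) * ?c)"
      using c by (simp add: ennreal_of_nat_eq_real_of_nat ennreal_mult[symmetric] ennreal_plus[symmetric] distrib_right
          del: ennreal_plus of_nat_add of_nat_power power_Suc of_nat_Suc)
        (simp add: ennreal_mult[symmetric] ennreal_plus[symmetric] distrib_right del: ennreal_plus)
    also have "\<dots> \<le> ennreal (34 * C * T\<^sup>2 * (1/32) ^ n)"
    proof (rule ennreal_leI)
      have "real (32 ^ Suc n + 1 + 32 ^ n) * ?c \<le> (34 * 32 ^ n) * ?c"
        using c by (intro mult_right_mono) auto
      also have "\<dots> = 34 * C * T\<^sup>2 * (1/32) ^ n"
        by (simp add: power2_eq_square power_one_over field_simps)
      finally show "real (32 ^ Suc n + 1 + 32 ^ n) * ?c \<le> 34 * C * T\<^sup>2 * (1/32) ^ n" .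
    qed
    finally show ?thesis .
  qed
  have EB: "(\<integral>\<^sup>+\<omega>. B \<omega> \<partial>P) < \<infinity>"
  proof -
    have "(\<integral>\<^sup>+\<omega>. B \<omega> \<partial>P) = (\<Sum>n. \<integral>\<^sup>+\<omega>. ennreal (16 ^ n) * S n \<omega> \<partial>P)"
      unfolding B_def by (rule nn_integral_suminf) measurable
    also have "\<dots> \<le> (\<Sum>n. ennreal (34 * C * T\<^sup>2) * ennreal ((1/2) ^ n))"
    proof (rule suminf_le)
      fix n
      have "(\<integral>\<^sup>+\<omega>. ennreal (16 ^ n) * S n \<omega> \<partial>P) = ennreal (16 ^ n) * (\<integral>\<^sup>+\<omega>. S n \<omega> \<partial>P)"
        by (rule nn_integral_cmult) measurable
      also have "\<dots> \<le> ennreal (16 ^ n) * ennreal (34 * C * T\<^sup>2 * (1/32) ^ n)"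
        by (intro mult_left_mono SI) simp
      also have "\<dots> = ennreal (34 * C * T\<^sup>2 * (16 ^ n * (1/32) ^ n))"
        using C by (subst ennreal_mult[symmetric]) (auto simp: mult_ac)
      also have "(16 :: real) ^ n * (1/32) ^ n = (1/2) ^ n" by (simp add: power_mult_distrib[symmetric])
      finally show "(\<integral>\<^sup>+\<omega>. ennreal (16 ^ n) * S n \<omega> \<partial>P) \<le> ennreal (34 * C * T\<^sup>2) * ennreal ((1/2) ^ n)"
        using C by (simp add: ennreal_mult)
    qed auto
    also have "\<dots> = ennreal (34 * C * T\<^sup>2) * ennreal (1 / (1 - 1/2))" by (rule ennreal_geometric) auto
    also have "\<dots> < \<infinity>" by (auto simp: ennreal_mult_less_top)
    finally show ?thesis .
  qed
  \<comment> \<open>its complement is a null set, so it belongs to the filtration at every time\<close>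
  define good where "good = {\<omega>\<in>space P. B \<omega> < \<infinity>}"
  have AEB: "AE \<omega> in P. B \<omega> < \<infinity>"
    using nn_integral_PInf_AE[OF Bm] EB by (auto simp: less_top)
  have good_G: "good \<in> sets (G t)" for t
  proof -
    have "{\<omega>\<in>space P. \<not> B \<omega> < \<infinity>} \<in> null_sets P"
      using AEB by (subst AE_iff_null[symmetric]) auto
    then have "space (G t) - {\<omega>\<in>space P. \<not> B \<omega> < \<infinity>} \<in> sets (G t)"
      by (intro sets.compl_sets null_G)
    also have "space (G t) - {\<omega>\<in>space P. \<not> B \<omega> < \<infinity>} = good" by (auto simp: good_def)
    finally show ?thesis .
  qed
  define Z where "Z \<omega> t u = (if \<omega> \<in> good then Y t (\<omega>, u) else 0)" for \<omega> t u
  define b where "b \<omega> = 1 + enn2real (B \<omega>)" for \<omega>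
  have b0: "0 \<le> b \<omega>" for \<omega> by (simp add: b_def)
  have Zu: "Z \<omega> t \<in> borel_measurable leb01" if "\<omega> \<in> space P" "0 \<le> t" "t \<le> T" for \<omega> t
    using measurable_compose[OF measurable_Pair1'[OF that(1), of leb01] YPU[OF that(2,3)]]
    by (cases "\<omega> \<in> good") (auto simp: Z_def[abs_def])
  have ctrl: "controlled T (Z \<omega>) (b \<omega>)" if \<omega>: "\<omega> \<in> space P" for \<omega>
  proof -
    have key: "sqn leb01 (\<lambda>u. Z \<omega> r u - Z \<omega> s u) \<le> ennreal (b \<omega> * (1/4) ^ n)"
      if rs: "0 \<le> r" "r \<le> T" "0 \<le> s" "s \<le> T" and dS: "d r s \<omega> \<le> S n \<omega>" for r s n
    proof (cases "\<omega> \<in> good")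
      case False then show ?thesis by (simp add: Z_def sqn_def)
    next
      case True
      then have fin: "B \<omega> < \<infinity>" by (simp add: good_def)
      have "ennreal (16 ^ n) * S n \<omega> \<le> B \<omega>"
        unfolding B_def using sum_le_suminf[of "\<lambda>n. ennreal (16 ^ n) * S n \<omega>" "{n}"] by simp
      then have "ennreal (16 ^ n) * d r s \<omega> \<le> B \<omega>"
        using dS by (meson mult_left_mono order_trans zero_le)
      have "sqn leb01 (\<lambda>u. Z \<omega> r u - Z \<omega> s u)
         \<le> ennreal (1 / (1/4) ^ n) * (\<integral>\<^sup>+u. ennreal ((Z \<omega> r u - Z \<omega> s u) ^ 4) \<partial>leb01) + ennreal ((1/4) ^ n)"
        using Zu[OF \<omega> rs(1,2)] Zu[OF \<omega> rs(3,4)] leb01.emeasure_space_1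
        by (intro sqn_le_fourth borel_measurable_diff) auto
      also have "(\<integral>\<^sup>+u. ennreal ((Z \<omega> r u - Z \<omega> s u) ^ 4) \<partial>leb01) = d r s \<omega>"
        using True by (simp add: Z_def d_def)
      also have "ennreal (1 / (1/4) ^ n) * d r s \<omega> = ennreal ((1/4) ^ n) * (ennreal (16 ^ n) * d r s \<omega>)"
      proof -
        have "(1 / (1/4) ^ n) = (1/4) ^ n * (16 :: real) ^ n"
        proof -
          have "(16 :: real) ^ n = 4 ^ n * 4 ^ n" by (simp add: power_mult_distrib[symmetric])
          then show ?thesis by (simp add: power_one_over)
        qed
        then show ?thesis by (simp add: ennreal_mult mult.assoc)
      qed
      also have "\<dots> \<le> ennreal ((1/4) ^ n) * B \<omega>"
        by (intro mult_left_mono) (fact, simp)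
      finally have "sqn leb01 (\<lambda>u. Z \<omega> r u - Z \<omega> s u) \<le> ennreal ((1/4) ^ n) * B \<omega> + ennreal ((1/4) ^ n)"
        by (simp add: add_right_mono)
      also have "\<dots> = ennreal (b \<omega> * (1/4) ^ n)"
      proof -
        have "B \<omega> = ennreal (enn2real (B \<omega>))" using fin by simp
        then have "ennreal ((1/4) ^ n) * B \<omega> = ennreal ((1/4) ^ n * enn2real (B \<omega>))"
          by (metis enn2real_nonneg ennreal_mult zero_le_divide_1_iff zero_le_numeral zero_le_power)
        then show ?thesis by (simp add: b_def distrib_right ennreal_plus[symmetric] mult.commute add.commute del: ennreal_plus)
      qed
      finally show ?thesis .
    qed
    have S1: "d (node T (Suc n) k) (node T n (k div 32)) \<omega> \<le> S n \<omega>" if "k \<le> 32 ^ Suc n" for n k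
    proof -
      have "d (node T (Suc n) k) (node T n (k div 32)) \<omega> \<le> (\<Sum>k\<le>32 ^ Suc n. d (node T (Suc n) k) (node T n (k div 32)) \<omega>)"
        using that by (intro member_le_sum) auto
      then show ?thesis unfolding S_def by (rule order_trans[OF _ add_increasing2[OF zero_le order_refl]])
    qed
    have S2: "d (node T n (Suc k)) (node T n k) \<omega> \<le> S n \<omega>" if "k < 32 ^ n" for n k
    proof -
      have "d (node T n (Suc k)) (node T n k) \<omega> \<le> (\<Sum>k<32 ^ n. d (node T n (Suc k)) (node T n k) \<omega>)"
        using that by (intro member_le_sum) auto
      then show ?thesis unfolding S_def by (rule order_trans[OF _ add_increasing[OF zero_le order_refl]])
    qed
    show ?thesis
      unfolding controlled_def[OF T_pos]
    proof (intro conjI allI impI ballI)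
      fix t assume "0 \<le> t" "t \<le> T" then show "Z \<omega> t \<in> borel_measurable leb01" by (rule Zu[OF \<omega>])
    next
      fix u :: real assume "u \<in> {0..1}" then show "Z \<omega> 0 u = 0" by (simp add: Z_def Y0)
    next
      fix n k :: nat assume k: "k \<le> 32 ^ Suc n"
      show "sqn leb01 (\<lambda>u. Z \<omega> (node T (Suc n) k) u - Z \<omega> (node T n (k div 32)) u) \<le> ennreal (b \<omega> * (1/4) ^ n)"
        by (rule key[OF nd nT[OF k] nd nT[OF div32[OF k]] S1[OF k]])
    next
      fix n k :: nat assume k: "k < 32 ^ n"
      show "sqn leb01 (\<lambda>u. Z \<omega> (node T n (Suc k)) u - Z \<omega> (node T n k) u) \<le> ennreal (b \<omega> * (1/4) ^ n)"
        by (rule key[OF nd nT nd nT S2[OF k]]) (use k in auto)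
    qed
  qed
  have ZG: "(\<lambda>q. Z (fst q) r (snd q)) \<in> borel_measurable (G t \<Otimes>\<^sub>M leb01)" if "0 \<le> r" "r \<le> t" "t \<le> T" for r t
  proof -
    have "r \<le> T" using that by simp
    have 1: "Y r \<in> borel_measurable (G t \<Otimes>\<^sub>M leb01)" by (rule GU_mono[OF Ym[OF that(1) \<open>r \<le> T\<close>] that(2)])
    have 2: "(\<lambda>q. indicator good (fst q) :: real) \<in> borel_measurable (G t \<Otimes>\<^sub>M leb01)"
      by (rule measurable_compose[OF measurable_fst borel_measurable_indicator[OF good_G]])
    have "(\<lambda>q. Z (fst q) r (snd q)) = (\<lambda>q. indicator good (fst q) * Y r q)"
      by (auto simp: Z_def indicator_def)
    then show ?thesis using borel_measurable_times[OF 2 1] by simp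
  qed
  define y where "y \<omega> u t = path T (Z \<omega>) t u" for \<omega> u t
  have y_eq: "y \<omega> u t = flim (\<lambda>n q. Z (fst q) (node T n (node_index T n t)) (snd q)) (\<omega>, u)" for \<omega> u t
    by (simp add: y_def path_def[OF T_pos] flim_def)
  have y_sec: "(\<lambda>q. y (fst q) (snd q) t) \<in> borel_measurable (G t \<Otimes>\<^sub>M leb01)" if t: "0 \<le> t" "t \<le> T" for t
    unfolding y_eq using nd node_floor(1)[OF T_pos t] t
    by (simp, intro flim_measurable ZG) auto
  have jp: "jointly_progressive T G y"
    unfolding jointly_progressive_def
  proof
    fix t assume "t \<in> {0..T}"
    then have t: "0 \<le> t" "t \<le> T" by auto
    let ?M = "restrict_space borel {0..t} \<Otimes>\<^sub>M (G t \<Otimes>\<^sub>M leb01)"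
    define \<Phi> where "\<Phi> n x = Z (fst (snd x)) (node T n (node_index T n (fst x))) (snd (snd x))" for n and x :: "real \<times> 'a \<times> real"
    have "\<Phi> n \<in> borel_measurable ?M" for n
    proof -
      \<comment> \<open>nodes after \<open>t\<close> may be dropped: they are not the sampling node of any time up to \<open>t\<close>\<close>
      define \<Psi> where "\<Psi> x = (\<Sum>k\<le>32 ^ n. indicator {node T n k..<node T n (Suc k)} (fst x) *
          (if node T n k \<le> t then Z (fst (snd x)) (node T n k) (snd (snd x)) else 0))" for x :: "real \<times> 'a \<times> real"
      have "\<Psi> \<in> borel_measurable ?M"
        unfolding \<Psi>_def[abs_def]
      proof (intro borel_measurable_sum borel_measurable_times)
        fix k
        have "(\<lambda>s. indicator {node T n k..<node T n (Suc k)} s :: real) \<in> borel_measurable (restrict_space borel {0..t})"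
          by (intro measurable_restrict_space1) simp
        then show "(\<lambda>x. indicator {node T n k..<node T n (Suc k)} (fst x) :: real) \<in> borel_measurable ?M"
          by (rule measurable_compose[OF measurable_fst])
        show "(\<lambda>x. if node T n k \<le> t then Z (fst (snd x)) (node T n k) (snd (snd x)) else 0) \<in> borel_measurable ?M"
        proof (cases "node T n k \<le> t")
          case True
          then show ?thesis using measurable_compose[OF measurable_snd ZG[OF nd True t(2)]] by simp
        qed simp
      qed
      moreover have "\<Phi> n x = \<Psi> x" if x: "x \<in> space ?M" for x
      proof -
        obtain s \<omega> u where xe: "x = (s, \<omega>, u)" by (cases x)
        have s: "0 \<le> s" "s \<le> t" "s \<le> T" using x t by (auto simp: xe space_pair_measure space_restrict_space)
        let ?k = "node_index T n s"
        have k: "?k \<le> 32 ^ n" "node T n ?k \<le> t" using node_floor(1,3)[OF T_pos s(1,3), of n] s by auto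
        have "\<Psi> x = (\<Sum>k\<le>32 ^ n. if k = ?k then Z \<omega> (node T n ?k) u else 0)"
          unfolding \<Psi>_def
        proof (intro sum.cong refl)
          fix k
          have "s \<in> {node T n k..<node T n (Suc k)} \<longleftrightarrow> ?k = k"
            using node_index_iff[OF T_pos s(1), of n k] by auto
          then show "indicator {node T n k..<node T n (Suc k)} (fst x) *
             (if node T n k \<le> t then Z (fst (snd x)) (node T n k) (snd (snd x)) else 0)
             = (if k = ?k then Z \<omega> (node T n ?k) u else 0)"
            using k(2) by (cases "k = ?k") (auto simp: xe indicator_def)
        qed
        also have "\<dots> = Z \<omega> (node T n ?k) u" using k(1) by simp
        finally show ?thesis by (simp add: \<Phi>_def xe)
      qed
      ultimately show ?thesis by (subst measurable_cong) auto
    qed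
    then have "flim \<Phi> \<in> borel_measurable ?M" by (rule flim_measurable)
    also have "flim \<Phi> = (\<lambda>(s, \<omega>, u). y \<omega> u s)"
      by (auto simp: y_eq flim_def \<Phi>_def fun_eq_iff)
    finally show "(\<lambda>(s, \<omega>, u). y \<omega> u s) \<in> borel_measurable ?M" .
  qed
  have cont: "L2_continuous T (y \<omega>)" if "\<omega> \<in> space P" for \<omega>
    using controlled_continuous[OF T_pos ctrl[OF that] b0] by (simp add: y_def[abs_def])
  have major: "sqn leb01 (\<lambda>u. y \<omega> u t) \<le> 10 + 10 * B \<omega>" if \<omega>: "\<omega> \<in> space P" and t: "t \<in> {0..T}" for \<omega> t
  proof -
    have "sqn leb01 (\<lambda>u. y \<omega> u t) \<le> ennreal (10 * b \<omega>)"
      using controlled_path(3)[OF T_pos ctrl[OF \<omega>] b0, of t] t by (simp add: y_def)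
    also have "\<dots> = 10 + 10 * ennreal (enn2real (B \<omega>))"
      by (simp add: b_def distrib_left ennreal_plus ennreal_mult)
    also have "\<dots> \<le> 10 + 10 * B \<omega>"
      by (intro add_left_mono mult_left_mono) (cases "B \<omega>", auto)
    finally show ?thesis .
  qed
  have major_fin: "(\<integral>\<^sup>+\<omega>. 10 + 10 * B \<omega> \<partial>P) < \<infinity>"
  proof -
    have "(\<integral>\<^sup>+\<omega>. 10 + 10 * B \<omega> \<partial>P) = 10 + 10 * (\<integral>\<^sup>+\<omega>. B \<omega> \<partial>P)"
      by (simp add: nn_integral_add nn_integral_cmult emeasure_space_1)
    also have "\<dots> < \<infinity>" using EB by (auto simp: ennreal_mult_less_top)
    finally show ?thesis .
  qed
  have eq: "AE q in PU. y (fst q) (snd q) t = Y t q" if t: "0 \<le> t" "t \<le> T" for t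
  proof -
    note [measurable] = GU_measurable[OF y_sec[OF t] t(2)] YPU[OF t]
    \<comment> \<open>compare both with the value at the sampling node and let the mesh tend to \<open>0\<close>\<close>
    define c where "c = 2 * ennreal ((C + 1) * T) + 2 * (4 * (1 + (\<integral>\<^sup>+\<omega>. B \<omega> \<partial>P)))"
    have c: "c < \<infinity>" using EB by (auto simp: c_def ennreal_mult_less_top)
    have le: "sqn PU (\<lambda>q. Y t q - y (fst q) (snd q) t) \<le> c * ennreal ((1/4) ^ n)" for n
    proof -
      define s where "s = node T n (node_index T n t)"
      have s: "0 \<le> s" "s \<le> t" "s \<le> T" "t - s \<le> T / 32 ^ n"
        using nd node_floor(1,2)[OF T_pos t, of n] t by (auto simp: s_def)
      note [measurable] = YPU[OF s(1,3)]
      have p: "0 < T / 32 ^ n" using T_pos by simp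
      have "sqn PU (\<lambda>q. Y t q - Y s q) \<le> ennreal (1 / (T / 32 ^ n)) * (\<integral>\<^sup>+q. ennreal ((Y t q - Y s q) ^ 4) \<partial>PU) + ennreal (T / 32 ^ n)"
        by (rule sqn_le_fourth[OF p _ emeasure_PU]) measurable
      also have "\<dots> \<le> ennreal (1 / (T / 32 ^ n)) * ennreal (C * (T / 32 ^ n)\<^sup>2) + ennreal (T / 32 ^ n)"
      proof (intro add_right_mono mult_left_mono)
        have "(\<integral>\<^sup>+q. ennreal ((Y t q - Y s q) ^ 4) \<partial>PU) \<le> ennreal (C * (t - s)\<^sup>2)" using Y4 s t by blast
        also have "\<dots> \<le> ennreal (C * (T / 32 ^ n)\<^sup>2)"
          using s C by (intro ennreal_leI mult_left_mono power_mono) auto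
        finally show "(\<integral>\<^sup>+q. ennreal ((Y t q - Y s q) ^ 4) \<partial>PU) \<le> ennreal (C * (T / 32 ^ n)\<^sup>2)" .
      qed simp
      also have "\<dots> = ennreal ((C + 1) * T * (1 / 32 ^ n))"
        using C T_pos by (simp add: ennreal_mult[symmetric] ennreal_plus[symmetric] power2_eq_square distrib_right add_divide_distrib del: ennreal_plus)
      also have "\<dots> \<le> ennreal ((C + 1) * T * (1/4) ^ n)"
        using C T_pos by (intro ennreal_leI mult_left_mono) (auto simp: power_one_over divide_le_cancel intro!: divide_left_mono power_mono)
      finally have 1: "sqn PU (\<lambda>q. Y t q - Y s q) \<le> ennreal ((C + 1) * T) * ennreal ((1/4) ^ n)"
        using C T_pos by (simp add: ennreal_mult)
      have "sqn PU (\<lambda>q. Y s q - y (fst q) (snd q) t) = (\<integral>\<^sup>+\<omega>. sqn leb01 (\<lambda>u. Y s (\<omega>, u) - y \<omega> u t) \<partial>P)"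
      proof -
        have "(\<lambda>q. Y s q - y (fst q) (snd q) t) \<in> borel_measurable PU" by measurable
        from sqn_PU[OF this] show ?thesis by simp
      qed
      also have "\<dots> \<le> (\<integral>\<^sup>+\<omega>. 4 * (1 + B \<omega>) * ennreal ((1/4) ^ n) \<partial>P)"
      proof (rule nn_integral_mono_AE, use AEB AE_space in eventually_elim)
        fix \<omega> assume fin: "B \<omega> < \<infinity>" and \<omega>: "\<omega> \<in> space P"
        have "sqn leb01 (\<lambda>u. Y s (\<omega>, u) - y \<omega> u t) = sqn leb01 (\<lambda>u. Z \<omega> s u - path T (Z \<omega>) t u)"
          using fin \<omega> by (simp add: Z_def good_def y_def)
        also have "\<dots> \<le> ennreal (4 * b \<omega> * (1/4) ^ n)"
          unfolding s_def by (rule controlled_path(2)[OF T_pos ctrl[OF \<omega>] b0 t])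
        also have "\<dots> = 4 * (1 + B \<omega>) * ennreal ((1/4) ^ n)"
        proof -
          have "ennreal (b \<omega>) = 1 + B \<omega>" using fin by (simp add: b_def ennreal_plus)
          moreover have "ennreal (4 * b \<omega> * (1/4) ^ n) = 4 * ennreal (b \<omega>) * ennreal ((1/4) ^ n)"
            using b0 by (simp add: ennreal_mult)
          ultimately show ?thesis by simp
        qed
        finally show "sqn leb01 (\<lambda>u. Y s (\<omega>, u) - y \<omega> u t) \<le> 4 * (1 + B \<omega>) * ennreal ((1/4) ^ n)" .
      qed
      also have "\<dots> = 4 * (1 + (\<integral>\<^sup>+\<omega>. B \<omega> \<partial>P)) * ennreal ((1/4) ^ n)"
        by (simp add: nn_integral_multc nn_integral_cmult nn_integral_add emeasure_space_1)
      finally have 2: "sqn PU (\<lambda>q. Y s q - y (fst q) (snd q) t) \<le> 4 * (1 + (\<integral>\<^sup>+\<omega>. B \<omega> \<partial>P)) * ennreal ((1/4) ^ n)" .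
      have "sqn PU (\<lambda>q. Y t q - y (fst q) (snd q) t) \<le> 2 * sqn PU (\<lambda>q. Y t q - Y s q) + 2 * sqn PU (\<lambda>q. Y s q - y (fst q) (snd q) t)"
        by (rule sqn_triangle) measurable
      also have "\<dots> \<le> 2 * (ennreal ((C + 1) * T) * ennreal ((1/4) ^ n)) + 2 * (4 * (1 + (\<integral>\<^sup>+\<omega>. B \<omega> \<partial>P)) * ennreal ((1/4) ^ n))"
        using 1 2 by (intro add_mono mult_left_mono) auto
      also have "\<dots> = c * ennreal ((1/4) ^ n)" by (simp only: c_def distrib_right mult.assoc)
      finally show ?thesis .
    qed
    have "sqn PU (\<lambda>q. Y t q - y (fst q) (snd q) t) = 0" using c le by (rule geometric_zero)
    then have "AE q in PU. Y t q - y (fst q) (snd q) t = 0" by (subst (asm) sqn_zero_iff) measurable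
    then show ?thesis by eventually_elim simp
  qed
  show thesis by (rule that[OF jp cont _ major_fin major eq]) measurable
qed

end

section \<open>Borel sets of the space of square integrable functions\<close>

definition step :: "(rat \<times> rat \<times> rat) list \<Rightarrow> real \<Rightarrow> real" where
  "step L u = (\<Sum>(q, a, b)\<leftarrow>L. of_rat q * indicator {of_rat a<..of_rat b} u)"

lemma step_measurable [measurable]: "step L \<in> borel_measurable leb01"
proof (induction L)
  case (Cons x L)
  obtain q a b where x: "x = (q, a, b)" by (cases x)
  have eq: "step (x # L) = (\<lambda>u. of_rat q * indicator {of_rat a<..of_rat b} u + step L u)"
    by (auto simp: step_def x)
  have "(\<lambda>u. of_rat q * indicator {of_rat a<..of_rat b} u :: real) \<in> borel_measurable leb01"
    by (intro measurable_restrict_space1) simp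
  then show ?case unfolding eq using Cons by simp
qed (simp add: step_def[abs_def])

lemma sqn_bound_const: "(\<And>u. u \<in> space M \<Longrightarrow> \<bar>f u\<bar> \<le> c) \<Longrightarrow> emeasure M (space M) = 1 \<Longrightarrow> sqn M f \<le> ennreal (c\<^sup>2)"
proof -
  assume b: "\<And>u. u \<in> space M \<Longrightarrow> \<bar>f u\<bar> \<le> c" and M: "emeasure M (space M) = 1"
  have "sqn M f \<le> (\<integral>\<^sup>+u. ennreal (c\<^sup>2) \<partial>M)"
    unfolding sqn_def using power_mono[OF b abs_ge_zero, of _ 2] by (intro nn_integral_mono ennreal_leI) simp
  then show ?thesis using M by simp
qed

lemma step_L2: "step L \<in> L2_funs"
proof -
  have "\<bar>step L u\<bar> \<le> (\<Sum>x\<leftarrow>L. \<bar>of_rat (fst x)\<bar>)" for u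
  proof (induction L)
    case (Cons x L)
    obtain q a b where x: "x = (q, a, b)" by (cases x)
    have "step (x # L) u = of_rat q * indicator {of_rat a<..of_rat b} u + step L u"
      by (simp add: step_def x)
    then have "\<bar>step (x # L) u\<bar> \<le> \<bar>of_rat q * indicator {of_rat a<..of_rat b} u\<bar> + \<bar>step L u\<bar>" by linarith
    also have "\<dots> \<le> \<bar>of_rat q\<bar> + (\<Sum>x\<leftarrow>L. \<bar>of_rat (fst x)\<bar>)"
      using Cons by (intro add_mono) (auto simp: indicator_def)
    finally show ?case by (simp add: x)
  qed (simp add: step_def)
  then have "sqn leb01 (step L) \<le> ennreal ((\<Sum>x\<leftarrow>L. \<bar>of_rat (fst x)\<bar>)\<^sup>2)"
    using leb01.emeasure_space_1 by (intro sqn_bound_const)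
  then show ?thesis by (auto simp: L2_funs_iff intro: le_less_trans)
qed

lemma step_dense_steps:
  fixes c :: "nat \<Rightarrow> real" and n :: nat
  assumes e: "0 < e"
  shows "\<exists>L. \<forall>u. \<bar>(\<Sum>k<n. c k * indicator {of_rat (a k)<..of_rat (b k)} u) - step L u\<bar> \<le> (e :: real)"
proof -
  have "\<exists>L. \<forall>u. \<bar>(\<Sum>k<n. c k * indicator {of_rat (a k)<..of_rat (b k)} u) - step L u\<bar> \<le> real n * d" if d: "0 < d" for d
  proof (induction n)
    case 0 show ?case by (rule exI[of _ "[]"]) (simp add: step_def)
  next
    case (Suc n)
    then obtain L where L: "\<And>u. \<bar>(\<Sum>k<n. c k * indicator {of_rat (a k)<..of_rat (b k)} u) - step L u\<bar> \<le> real n * d" by blast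
    obtain q where q: "c n - d < of_rat q" "of_rat q < c n + d"
      using of_rat_dense[of "c n - d" "c n + d"] d by auto
    show ?case
    proof (intro exI[of _ "(q, a n, b n) # L"] allI)
      fix u :: real
      have "\<bar>(c n - of_rat q) * indicator {of_rat (a n)<..of_rat (b n)} u\<bar> \<le> d"
        using q d by (auto simp: indicator_def)
      moreover have "(\<Sum>k<Suc n. c k * indicator {of_rat (a k)<..of_rat (b k)} u) - step ((q, a n, b n) # L) u
        = ((\<Sum>k<n. c k * indicator {of_rat (a k)<..of_rat (b k)} u) - step L u)
          + (c n - of_rat q) * indicator {of_rat (a n)<..of_rat (b n)} u"
        by (simp add: step_def algebra_simps)
      ultimately show "\<bar>(\<Sum>k<Suc n. c k * indicator {of_rat (a k)<..of_rat (b k)} u) - step ((q, a n, b n) # L) u\<bar> \<le> real (Suc n) * d"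
        using L[of u] by (simp add: distrib_right del: sum.lessThan_Suc)
    qed
  qed
  from this[of "e / (real n + 1)"] e obtain L where
    L: "\<And>u. \<bar>(\<Sum>k<n. c k * indicator {of_rat (a k)<..of_rat (b k)} u) - step L u\<bar> \<le> real n * (e / (real n + 1))" by auto
  have "real n * (e / (real n + 1)) \<le> e" using e by (simp add: field_simps)
  then show ?thesis using L order_trans by blast
qed

text \<open>Density follows from the convergence of the grid averages, applied to a function of \<open>(s,u)\<close> that is
  constant in \<open>s\<close>: for some \<open>s\<close> the average at time \<open>s\<close> is close to \<open>h\<close>, and it is a step function of \<open>u\<close>.\<close>

lemma step_dense_bounded:
  assumes h: "h \<in> borel_measurable leb01" and m: "\<And>u. \<bar>h u\<bar> \<le> m" and e: "0 < e"
  shows "\<exists>L. sqn leb01 (\<lambda>u. h u - step L u) \<le> ennreal e"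
proof -
  have m0: "0 \<le> m" using m[of 0] by linarith
  define f where "f = (\<lambda>p :: real \<times> real. h (snd p))"
  have fm: "f \<in> borel_measurable (Box 1)" unfolding f_def Box_def using measurable_compose[OF measurable_snd h] .
  have f: "integrable (Box 1) f"
    using m fm by (intro Box.integrable_const_bound[of _ m]) (auto simp: f_def)
  \<comment> \<open>an \<open>L\<^sub>1\<close> error \<open>\<delta>\<close> of functions bounded by \<open>m\<close> is a squared \<open>L\<^sub>2\<close> error of at most \<open>2 m \<delta>\<close>\<close>
  define \<delta> where "\<delta> = e / (4 * (2 * m + 1))"
  have d: "0 < \<delta>" using e m0 by (simp add: \<delta>_def)
  have "eventually (\<lambda>N. avg_dev 1 f N < \<delta>) sequentially"
    using lag_avg_converges[OF zero_less_one f] d by (rule order_tendstoD)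
  then obtain N where N: "avg_dev 1 f N < \<delta>" by (auto simp: eventually_sequentially)
  let ?A = "lag_avg 1 N f"
  have Am: "?A \<in> borel_measurable (Box 1)" by (rule lag_avg_measurable[OF zero_less_one])
  have "(\<integral>\<^sup>+s. \<integral>\<^sup>+u. ennreal \<bar>?A (s, u) - h u\<bar> \<partial>leb01 \<partial>slab 1) = (\<integral>\<^sup>+p. ennreal \<bar>?A p - f p\<bar> \<partial>Box 1)"
    using Am fm by (subst nn_integral_Box) (auto simp: f_def)
  also have "\<dots> = ennreal (avg_dev 1 f N)"
    unfolding avg_dev_def[OF zero_less_one]
    by (intro nn_integral_eq_integral integrable_abs Bochner_Integration.integrable_diff f lag_avg_integrable) auto
  also have "\<dots> < ennreal \<delta>" using N d by (intro ennreal_lessI)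
  finally have lt: "(\<integral>\<^sup>+s. \<integral>\<^sup>+u. ennreal \<bar>?A (s, u) - h u\<bar> \<partial>leb01 \<partial>slab 1) < ennreal \<delta>" .
  have "\<exists>s\<in>{0..1}. (\<integral>\<^sup>+u. ennreal \<bar>?A (s, u) - h u\<bar> \<partial>leb01) < ennreal \<delta>"
  proof (rule ccontr)
    assume "\<not> ?thesis"
    then have "(\<integral>\<^sup>+s. ennreal \<delta> \<partial>slab 1) \<le> (\<integral>\<^sup>+s. \<integral>\<^sup>+u. ennreal \<bar>?A (s, u) - h u\<bar> \<partial>leb01 \<partial>slab 1)"
      by (intro nn_integral_mono) (auto simp: not_less)
    moreover have "(\<integral>\<^sup>+s. ennreal \<delta> \<partial>slab 1) = ennreal \<delta>" by (simp add: emeasure_slab)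
    ultimately show False using lt by simp
  qed
  then obtain s where s: "s \<in> {0..1}" and slt: "(\<integral>\<^sup>+u. ennreal \<bar>?A (s, u) - h u\<bar> \<partial>leb01) < ennreal \<delta>" by blast
  have Asm: "(\<lambda>u. ?A (s, u)) \<in> borel_measurable leb01"
    using measurable_compose[OF measurable_Pair1'[of s "slab 1" leb01] Am[unfolded Box_def]] s by simp
  have As: "sqn leb01 (\<lambda>u. h u - ?A (s, u)) \<le> ennreal (2 * m * \<delta>)"
  proof -
    have "sqn leb01 (\<lambda>u. h u - ?A (s, u)) \<le> (\<integral>\<^sup>+u. ennreal (2 * m) * ennreal \<bar>?A (s, u) - h u\<bar> \<partial>leb01)"
      unfolding sqn_def
    proof (rule nn_integral_mono)
      fix u
      have "\<bar>?A (s, u)\<bar> \<le> m" by (rule lag_avg_bound[OF zero_less_one f]) (simp add: f_def m)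
      then have "\<bar>h u - ?A (s, u)\<bar> \<le> 2 * m" using m[of u] by linarith
      then have "\<bar>h u - ?A (s, u)\<bar> * \<bar>h u - ?A (s, u)\<bar> \<le> 2 * m * \<bar>h u - ?A (s, u)\<bar>" by (intro mult_right_mono) auto
      then have "(h u - ?A (s, u))\<^sup>2 \<le> 2 * m * \<bar>?A (s, u) - h u\<bar>" by (simp add: power2_eq_square abs_minus_commute)
      then have "ennreal ((h u - ?A (s, u))\<^sup>2) \<le> ennreal (2 * m * \<bar>?A (s, u) - h u\<bar>)" by (rule ennreal_leI)
      then show "ennreal ((h u - ?A (s, u))\<^sup>2) \<le> ennreal (2 * m) * ennreal \<bar>?A (s, u) - h u\<bar>"
        using m0 by (simp add: ennreal_mult)
    qed
    also have "\<dots> = ennreal (2 * m) * (\<integral>\<^sup>+u. ennreal \<bar>?A (s, u) - h u\<bar> \<partial>leb01)"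
      using Asm h by (intro nn_integral_cmult) simp
    also have "\<dots> \<le> ennreal (2 * m) * ennreal \<delta>" using slt by (intro mult_left_mono) auto
    also have "\<dots> = ennreal (2 * m * \<delta>)" using m0 d by (simp add: ennreal_mult)
    finally show ?thesis .
  qed
  define c where "c k = avg_coef 1 N f k * indicator {real (k div N) * 1 / N<..(real (k div N) + 1) * 1 / N} s" for k
  define \<eta> where "\<eta> = sqrt (e / 4)"
  have eta: "0 < \<eta>" "\<eta>\<^sup>2 = e / 4" using e by (auto simp: \<eta>_def)
  obtain L where L: "\<And>u. \<bar>(\<Sum>k<N*N. c k * indicator {of_rat (of_nat (k mod N) / of_nat N)<..of_rat ((of_nat (k mod N) + 1) / of_nat N)} u) - step L u\<bar> \<le> \<eta>"
    using step_dense_steps[OF eta(1), where n = "N*N" and c = c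
      and a = "\<lambda>k. of_nat (k mod N) / of_nat N" and b = "\<lambda>k. (of_nat (k mod N) + 1) / of_nat N"] by blast
  have A_eq: "?A (s, u) = (\<Sum>k<N*N. c k * indicator {of_rat (of_nat (k mod N) / of_nat N)<..of_rat ((of_nat (k mod N) + 1) / of_nat N)} u)" for u
    unfolding lag_avg_def c_def
    by (intro sum.cong refl) (auto simp: cell_def indicator_def of_rat_divide of_rat_add)
  have "sqn leb01 (\<lambda>u. ?A (s, u) - step L u) \<le> ennreal (\<eta>\<^sup>2)"
    using L leb01.emeasure_space_1 by (intro sqn_bound_const) (simp_all only: A_eq)
  then have "2 * sqn leb01 (\<lambda>u. h u - ?A (s, u)) + 2 * sqn leb01 (\<lambda>u. ?A (s, u) - step L u)
      \<le> 2 * ennreal (2 * m * \<delta>) + 2 * ennreal (e / 4)"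
    unfolding eta(2) by (intro add_mono mult_left_mono As) auto
  with sqn_triangle[OF h Asm step_measurable[of L]]
  have "sqn leb01 (\<lambda>u. h u - step L u) \<le> 2 * ennreal (2 * m * \<delta>) + 2 * ennreal (e / 4)"
    by (rule order_trans)
  also have "\<dots> = ennreal (2 * (2 * m * \<delta>) + 2 * (e / 4))"
  proof -
    have "2 * ennreal x + 2 * ennreal y = ennreal (2 * x + 2 * y)" if "0 \<le> x" "0 \<le> y" for x y
      using that by (simp add: ennreal_mult ennreal_plus)
    then show ?thesis using m0 d e by simp
  qed
  also have "\<dots> \<le> ennreal e"
  proof (rule ennreal_leI)
    have "2 * m * \<delta> \<le> (2 * m + 1) * \<delta>" using d by (intro mult_right_mono) auto
    also have "\<dots> = e / 4"
    proof -
      have "x * (e / (4 * x)) = e / 4" if "x \<noteq> 0" for x :: real using that by simp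
      then show ?thesis unfolding \<delta>_def using m0 by (metis add_nonneg_eq_0_iff mult_nonneg_nonneg zero_le_numeral zero_le_one zero_neq_one)
    qed
    finally show "2 * (2 * m * \<delta>) + 2 * (e / 4) \<le> e" by simp
  qed
  finally show ?thesis by blast
qed

text \<open>Truncation reduces to bounded functions.\<close>

lemma step_dense:
  assumes h: "h \<in> L2_funs" and e: "0 < e"
  shows "\<exists>L. sqn leb01 (\<lambda>u. h u - step L u) < ennreal e"
proof -
  have hm [measurable]: "h \<in> borel_measurable leb01" and fin: "sqn leb01 h < \<infinity>" using h by (auto simp: L2_funs_iff)
  define trunc where "trunc m u = max (- real m) (min (h u) (real m))" for m u
  have tm [measurable]: "trunc m \<in> borel_measurable leb01" for m unfolding trunc_def[abs_def] by measurable
  have "(\<lambda>m. sqn leb01 (\<lambda>u. h u - trunc m u)) \<longlonglongrightarrow> (\<integral>\<^sup>+u. 0 \<partial>leb01)"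
    unfolding sqn_def
  proof (rule nn_integral_dominated_convergence[where w="\<lambda>u. ennreal ((h u)\<^sup>2)"])
    show "AE u in leb01. ennreal ((h u - trunc m u)\<^sup>2) \<le> ennreal ((h u)\<^sup>2)" for m
      by (intro AE_I2 ennreal_leI) (auto simp: trunc_def abs_le_square_iff[symmetric] max_def min_def)
    show "AE u in leb01. (\<lambda>m. ennreal ((h u - trunc m u)\<^sup>2)) \<longlonglongrightarrow> 0"
    proof (rule AE_I2)
      fix u
      have "eventually (\<lambda>m. ennreal ((h u - trunc m u)\<^sup>2) = 0) sequentially"
        using eventually_ge_at_top[of "nat \<lceil>\<bar>h u\<bar>\<rceil>"]
      proof eventually_elim
        case (elim m)
        then have "\<bar>h u\<bar> \<le> real m" by linarith
        then show ?case by (simp add: trunc_def)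
      qed
      then show "(\<lambda>m. ennreal ((h u - trunc m u)\<^sup>2)) \<longlonglongrightarrow> 0" by (rule tendsto_eventually)
    qed
  qed (use fin in \<open>auto simp: sqn_def\<close>)
  then have "eventually (\<lambda>m. sqn leb01 (\<lambda>u. h u - trunc m u) < ennreal (e / 8)) sequentially"
    using e by (intro order_tendstoD) auto
  then obtain m where m: "sqn leb01 (\<lambda>u. h u - trunc m u) < ennreal (e / 8)" by (auto simp: eventually_sequentially)
  have "\<bar>trunc m u\<bar> \<le> real m" for u by (auto simp: trunc_def)
  then obtain L where L: "sqn leb01 (\<lambda>u. trunc m u - step L u) \<le> ennreal (e / 8)"
    using step_dense_bounded[OF tm, of m "real m" "e / 8"] e by auto
  have "sqn leb01 (\<lambda>u. h u - step L u) \<le> 2 * ennreal (e / 8) + 2 * ennreal (e / 8)"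
    by (rule order_trans[OF sqn_triangle[OF hm tm[of m] step_measurable[of L]]])
      (intro add_mono mult_left_mono L less_imp_le[OF m], auto)
  also have "\<dots> = ennreal (e / 2)" using e by (simp add: ennreal_mult[symmetric] ennreal_plus[symmetric] flip: ennreal_numeral del: ennreal_plus)
  also have "\<dots> < ennreal e" using e by (intro ennreal_lessI) auto
  finally show ?thesis by blast
qed

lemma space_L2_borel [simp]: "space L2_borel = L2_funs"
  unfolding L2_borel_def by (rule space_measure_of) (auto simp: L2_open_def)

lemma sets_L2_borel: "sets L2_borel = sigma_sets L2_funs {U. L2_open U}"
  unfolding L2_borel_def by (rule sets_measure_of) (auto simp: L2_open_def)

text \<open>Sharper than the triangle inequality with the factor \<open>2\<close>, which would not show that balls are
  open.\<close>

lemma sqn_add_weighted: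
  assumes "0 < \<eta>" and [measurable]: "f \<in> borel_measurable M" "g \<in> borel_measurable M"
  shows "sqn M (\<lambda>x. f x + g x) \<le> ennreal (1 + \<eta>) * sqn M f + ennreal (1 + 1 / \<eta>) * sqn M g"
proof -
  have p: "(a + b)\<^sup>2 \<le> (1 + \<eta>) * a\<^sup>2 + (1 + 1 / \<eta>) * b\<^sup>2" for a b :: real
  proof -
    have "0 \<le> (\<eta> * a - b)\<^sup>2 / \<eta>" using assms(1) by simp
    also have "(\<eta> * a - b)\<^sup>2 / \<eta> = \<eta> * a\<^sup>2 - 2 * (a * b) + 1 / \<eta> * b\<^sup>2"
      using assms(1) by (simp add: power2_eq_square field_simps)
    finally show ?thesis by (simp add: power2_sum algebra_simps)
  qed
  have "sqn M (\<lambda>x. f x + g x) \<le> (\<integral>\<^sup>+x. ennreal (1 + \<eta>) * ennreal ((f x)\<^sup>2) + ennreal (1 + 1 / \<eta>) * ennreal ((g x)\<^sup>2) \<partial>M)"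
    unfolding sqn_def
  proof (rule nn_integral_mono)
    fix x
    have "ennreal ((f x + g x)\<^sup>2) \<le> ennreal ((1 + \<eta>) * (f x)\<^sup>2 + (1 + 1 / \<eta>) * (g x)\<^sup>2)" using p by (rule ennreal_leI)
    also have "\<dots> = ennreal ((1 + \<eta>) * (f x)\<^sup>2) + ennreal ((1 + 1 / \<eta>) * (g x)\<^sup>2)"
      using assms(1) by (intro ennreal_plus) auto
    finally show "ennreal ((f x + g x)\<^sup>2) \<le> ennreal (1 + \<eta>) * ennreal ((f x)\<^sup>2) + ennreal (1 + 1 / \<eta>) * ennreal ((g x)\<^sup>2)"
      using assms(1) by (simp only: ennreal_mult zero_le_power2 add_nonneg_nonneg zero_le_one less_imp_le zero_le_divide_1_iff)
  qed
  also have "\<dots> = ennreal (1 + \<eta>) * sqn M f + ennreal (1 + 1 / \<eta>) * sqn M g"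
    unfolding sqn_def by (simp add: nn_integral_add nn_integral_cmult)
  finally show ?thesis .
qed

lemma L2_ball_open:
  assumes d: "d \<in> L2_funs" and r: "0 < r"
  shows "L2_open {h\<in>L2_funs. sqn leb01 (\<lambda>u. h u - d u) < ennreal r}"
  unfolding L2_open_def
proof (intro conjI ballI)
  fix f assume f: "f \<in> {h\<in>L2_funs. sqn leb01 (\<lambda>u. h u - d u) < ennreal r}"
  then have fL: "f \<in> L2_funs" by simp
  define a where "a = (L2_norm (\<lambda>u. f u - d u))\<^sup>2"
  have a0: "0 \<le> a" by (simp add: a_def)
  have a: "sqn leb01 (\<lambda>u. f u - d u) = ennreal a"
    unfolding a_def by (rule L2_norm_sq[OF L2_funs_diff[OF fL d], symmetric])
  have ar: "a < r" using f a0 by (simp add: a ennreal_less_iff)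
  \<comment> \<open>one half of the gap \<open>r - a\<close> is spent on \<open>\<eta> a\<close>, the other half on the distance to \<open>f\<close>\<close>
  define \<eta> where "\<eta> = (r - a) / (2 * (a + 1))"
  have eta: "0 < \<eta>" using ar a0 by (simp add: \<eta>_def)
  define \<rho> where "\<rho> = sqrt ((r - a) / 2 / (1 + 1 / \<eta>))"
  have rho: "0 < \<rho>" "\<rho>\<^sup>2 = (r - a) / 2 / (1 + 1 / \<eta>)" using eta ar by (auto simp: \<rho>_def add_pos_pos)
  show "\<exists>r'>0. \<forall>h\<in>L2_funs. L2_norm (\<lambda>u. h u - f u) < r' \<longrightarrow> h \<in> {h\<in>L2_funs. sqn leb01 (\<lambda>u. h u - d u) < ennreal r}"
  proof (intro exI conjI ballI impI)
    show "0 < \<rho>" by fact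
    fix h assume h: "h \<in> L2_funs" and "L2_norm (\<lambda>u. h u - f u) < \<rho>"
    then have hf: "sqn leb01 (\<lambda>u. h u - f u) < ennreal (\<rho>\<^sup>2)" using L2_norm_less[OF L2_funs_diff[OF h fL] rho(1)] by simp
    have [measurable]: "h \<in> borel_measurable leb01" "f \<in> borel_measurable leb01" "d \<in> borel_measurable leb01"
      using h fL d by (auto simp: L2_funs_iff)
    have "sqn leb01 (\<lambda>u. h u - d u) = sqn leb01 (\<lambda>u. (f u - d u) + (h u - f u))" by simp
    also have "\<dots> \<le> ennreal (1 + \<eta>) * ennreal a + ennreal (1 + 1 / \<eta>) * sqn leb01 (\<lambda>u. h u - f u)"
      unfolding a[symmetric] by (rule sqn_add_weighted[OF eta]) measurable
    also have "\<dots> < ennreal (1 + \<eta>) * ennreal a + ennreal (1 + 1 / \<eta>) * ennreal (\<rho>\<^sup>2)"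
    proof -
      have "ennreal (1 + 1 / \<eta>) * sqn leb01 (\<lambda>u. h u - f u) < ennreal (1 + 1 / \<eta>) * ennreal (\<rho>\<^sup>2)"
        using hf eta by (intro ennreal_mult_strict_left_mono) (auto simp: add_pos_pos)
      then show ?thesis by (simp add: ennreal_add_left_cancel_less ennreal_mult_eq_top_iff)
    qed
    also have "\<dots> = ennreal ((1 + \<eta>) * a + (1 + 1 / \<eta>) * \<rho>\<^sup>2)"
      using eta a0 by (simp add: ennreal_mult[symmetric] ennreal_plus[symmetric] del: ennreal_plus)
    also have "\<dots> \<le> ennreal r"
    proof (rule ennreal_leI)
      have "(1 + 1 / \<eta>) \<noteq> 0" using eta by (simp add: add_pos_pos less_imp_neq[symmetric])
      moreover have "c * (x / c) = x" if "c \<noteq> 0" for c x :: real using that by simp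
      ultimately have 1: "(1 + 1 / \<eta>) * \<rho>\<^sup>2 = (r - a) / 2" unfolding rho(2) by blast
      have "\<eta> * a = (r - a) / 2 * (a / (a + 1))" by (simp add: \<eta>_def field_simps)
      also have "\<dots> \<le> (r - a) / 2 * 1" using a0 ar by (intro mult_left_mono) auto
      finally have "(1 + \<eta>) * a \<le> a + (r - a) / 2" by (simp add: distrib_right)
      then have "(1 + \<eta>) * a + (1 + 1 / \<eta>) * \<rho>\<^sup>2 \<le> (a + (r - a) / 2) + (r - a) / 2" using 1 by linarith
      also have "\<dots> = r" by (simp add: field_simps)
      finally show "(1 + \<eta>) * a + (1 + 1 / \<eta>) * \<rho>\<^sup>2 \<le> r" .
    qed
    finally show "h \<in> {h\<in>L2_funs. sqn leb01 (\<lambda>u. h u - d u) < ennreal r}" using h by simp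
  qed
qed auto

lemma L2_distance_measurable:
  assumes d: "d \<in> L2_funs" and r: "0 < r"
  shows "{h\<in>space L2_borel. sqn leb01 (\<lambda>u. h u - d u) < ennreal r} \<in> sets L2_borel"
  using L2_ball_open[OF assms] by (auto simp: sets_L2_borel)

text \<open>By separability every open set is a countable union of balls around step functions.\<close>

lemma measurable_L2_borel:
  assumes z: "\<And>x. x \<in> space M \<Longrightarrow> z x \<in> L2_funs"
    and m: "\<And>L. (\<lambda>x. sqn leb01 (\<lambda>u. z x u - step L u)) \<in> borel_measurable M"
  shows "z \<in> measurable M L2_borel"
  unfolding L2_borel_def
proof (rule measurable_measure_of)
  show "z \<in> space M \<rightarrow> L2_funs" using z by auto
  show "{U. L2_open U} \<subseteq> Pow L2_funs" by (auto simp: L2_open_def)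
  fix U assume "U \<in> {U. L2_open U}"
  then have U: "U \<subseteq> L2_funs" "\<And>f. f \<in> U \<Longrightarrow> \<exists>r>0. \<forall>h\<in>L2_funs. L2_norm (\<lambda>u. h u - f u) < r \<longrightarrow> h \<in> U"
    by (auto simp: L2_open_def)
  define ball where "ball L n = {h\<in>L2_funs. sqn leb01 (\<lambda>u. h u - step L u) < ennreal (1 / real (Suc n))}" for L n
  define J where "J = {x. ball (fst x) (snd x) \<subseteq> U}"
  have Ueq: "U = (\<Union>x\<in>J. ball (fst x) (snd x))"
  proof (intro equalityI subsetI)
    fix f assume f: "f \<in> U"
    then have fL: "f \<in> L2_funs" using U by auto
    from U(2)[OF f] obtain r where r: "0 < r" "\<And>h. h \<in> L2_funs \<Longrightarrow> L2_norm (\<lambda>u. h u - f u) < r \<Longrightarrow> h \<in> U" by blast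
    obtain n where n: "1 / real (Suc n) < r\<^sup>2 / 4" using reals_Archimedean[of "r\<^sup>2 / 4"] r(1) by (auto simp: inverse_eq_divide)
    obtain L where L: "sqn leb01 (\<lambda>u. f u - step L u) < ennreal (1 / real (Suc n))"
      using step_dense[OF fL, of "1 / real (Suc n)"] by auto
    have "ball L n \<subseteq> U"
    proof
      fix h assume "h \<in> ball L n"
      then have h: "h \<in> L2_funs" "sqn leb01 (\<lambda>u. h u - step L u) < ennreal (1 / real (Suc n))" by (auto simp: ball_def)
      have [measurable]: "h \<in> borel_measurable leb01" "f \<in> borel_measurable leb01" using h fL by (auto simp: L2_funs_iff)
      have "sqn leb01 (\<lambda>u. h u - f u) \<le> 2 * sqn leb01 (\<lambda>u. h u - step L u) + 2 * sqn leb01 (\<lambda>u. step L u - f u)"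
        by (rule sqn_triangle) measurable
      also have "\<dots> \<le> 2 * ennreal (1 / real (Suc n)) + 2 * ennreal (1 / real (Suc n))"
        using h(2) L by (intro add_mono mult_left_mono) (auto simp: sqn_minus_commute[of _ "step L"] less_imp_le)
      also have "\<dots> = ennreal (4 * (1 / real (Suc n)))"
        by (simp add: ennreal_mult[symmetric] ennreal_plus[symmetric] flip: ennreal_numeral del: ennreal_plus)
      also have "\<dots> < ennreal (r\<^sup>2)" using n r(1) by (intro ennreal_lessI) auto
      finally show "h \<in> U" using r(2)[OF h(1)] L2_norm_less[OF L2_funs_diff[OF h(1) fL] r(1)] by simp
    qed
    moreover have "f \<in> ball L n" using fL L by (simp add: ball_def)
    ultimately show "f \<in> (\<Union>x\<in>J. ball (fst x) (snd x))"
      unfolding J_def by (intro UN_I[of "(L, n)"]) auto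
  qed (auto simp: J_def)
  then have "z -` U \<inter> space M = (\<Union>x\<in>J. z -` ball (fst x) (snd x) \<inter> space M)" by blast
  also have "\<dots> \<in> sets M"
  proof (rule sets.countable_UN'')
    show "countable J" by (rule countableI_type)
    fix x :: "(rat \<times> rat \<times> rat) list \<times> nat"
    define L n where "L = fst x" and "n = snd x"
    note [measurable] = m[of L]
    have "z -` ball L n \<inter> space M = {x\<in>space M. sqn leb01 (\<lambda>u. z x u - step L u) < ennreal (1 / real (Suc n))}"
      using z by (auto simp: ball_def)
    also have "\<dots> \<in> sets M" by measurable
    finally show "z -` ball (fst x) (snd x) \<inter> space M \<in> sets M" by (simp add: L_def n_def)
  qed
  finally show "z -` U \<inter> space M \<in> sets M" .
qed

definition dense_step :: "nat \<Rightarrow> real \<Rightarrow> real" where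
  "dense_step j = step (from_nat j)"

definition near_step :: "nat \<Rightarrow> (real \<Rightarrow> real) \<Rightarrow> nat" where
  "near_step k h = (LEAST j. sqn leb01 (\<lambda>u. h u - dense_step j u) < ennreal ((1/4) ^ k))"

text \<open>A representative that depends measurably on the class: the limit of the first step function, in a
  fixed enumeration, at distance less than \<open>2\<^sup>-\<^sup>k\<close>.\<close>

definition repr :: "(real \<Rightarrow> real) \<Rightarrow> real \<Rightarrow> real" where
  "repr h = flim (\<lambda>k. dense_step (near_step k h))"

lemma dense_step_L2 [simp]: "dense_step j \<in> L2_funs" "dense_step j \<in> borel_measurable leb01"
  using step_L2[of "from_nat j"] by (auto simp: dense_step_def L2_funs_iff)

lemma near_step:
  assumes "h \<in> L2_funs"
  shows "sqn leb01 (\<lambda>u. h u - dense_step (near_step k h) u) < ennreal ((1/4) ^ k)"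
proof -
  obtain L where "sqn leb01 (\<lambda>u. h u - step L u) < ennreal ((1/4) ^ k)" using step_dense[OF assms, of "(1/4) ^ k"] by auto
  then have "sqn leb01 (\<lambda>u. h u - dense_step (to_nat L) u) < ennreal ((1/4) ^ k)" by (simp add: dense_step_def)
  then show ?thesis unfolding near_step_def by (rule LeastI)
qed

lemma repr_AE:
  assumes h: "h \<in> L2_funs"
  shows "repr h \<in> borel_measurable leb01" "AE u in leb01. repr h u = h u"
proof -
  have hm: "h \<in> borel_measurable leb01" using h by (simp add: L2_funs_iff)
  let ?f = "\<lambda>k. dense_step (near_step k h)"
  show rm: "repr h \<in> borel_measurable leb01" unfolding repr_def by (intro flim_measurable dense_step_L2)
  have stp: "sqn leb01 (\<lambda>u. ?f (Suc k) u - ?f k u) \<le> 4 * ennreal ((1/4) ^ k)" for k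
  proof -
    have "sqn leb01 (\<lambda>u. ?f (Suc k) u - ?f k u) \<le> 2 * sqn leb01 (\<lambda>u. ?f (Suc k) u - h u) + 2 * sqn leb01 (\<lambda>u. h u - ?f k u)"
      by (intro sqn_triangle dense_step_L2 hm)
    also have "\<dots> \<le> 2 * ennreal ((1/4) ^ Suc k) + 2 * ennreal ((1/4) ^ k)"
      using near_step[OF h, of "Suc k"] near_step[OF h, of k]
      by (intro add_mono mult_left_mono) (auto simp: sqn_minus_commute[of _ _ h] less_imp_le)
    also have "\<dots> \<le> 2 * ennreal ((1/4) ^ k) + 2 * ennreal ((1/4) ^ k)"
      by (intro add_mono mult_left_mono ennreal_leI power_decreasing) auto
    also have "\<dots> = 4 * ennreal ((1/4) ^ k)" by (simp add: distrib_right[symmetric])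
    finally show ?thesis .
  qed
  have fc: "sqn leb01 (\<lambda>u. ?f k u - repr h u) \<le> 4 * 4 * ennreal ((1/4) ^ k)" for k
    unfolding repr_def by (rule fast_cauchy(2)[where f="?f", OF leb01.finite_measure_axioms _ _ stp]) (auto simp: less_top[symmetric])
  have le: "sqn leb01 (\<lambda>u. h u - repr h u) \<le> 34 * ennreal ((1/4) ^ k)" for k
  proof -
    have "sqn leb01 (\<lambda>u. h u - repr h u) \<le> 2 * sqn leb01 (\<lambda>u. h u - ?f k u) + 2 * sqn leb01 (\<lambda>u. ?f k u - repr h u)"
      by (intro sqn_triangle dense_step_L2 hm rm)
    also have "\<dots> \<le> 2 * ennreal ((1/4) ^ k) + 2 * (4 * 4 * ennreal ((1/4) ^ k))"
      using near_step[OF h, of k] fc[of k] by (intro add_mono mult_left_mono) auto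
    also have "\<dots> = (2 + 2 * (4 * 4)) * ennreal ((1/4) ^ k)" by (simp only: distrib_right mult.assoc)
    also have "\<dots> = 34 * ennreal ((1/4) ^ k)" by simp
    finally show ?thesis .
  qed
  have "sqn leb01 (\<lambda>u. h u - repr h u) = 0" by (rule geometric_zero[OF _ le]) (simp add: less_top[symmetric])
  then have "AE u in leb01. h u - repr h u = 0"
    using hm rm by (subst sqn_zero_iff[symmetric]) auto
  then show "AE u in leb01. repr h u = h u" by eventually_elim simp
qed

lemma near_step_measurable: "near_step k \<in> measurable L2_borel (count_space UNIV)"
  unfolding near_step_def[abs_def]
  by (intro measurable_Least pred_sets1 L2_distance_measurable[unfolded Measurable.pred_def[symmetric]])
     (auto simp: pred_def intro!: L2_distance_measurable)

lemma repr_jointly_measurable: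
  assumes z: "z \<in> measurable M L2_borel"
  shows "(\<lambda>(x, u). repr (z x) u) \<in> borel_measurable (M \<Otimes>\<^sub>M leb01)"
proof -
  have "(\<lambda>q. dense_step (near_step k (z (fst q))) (snd q)) \<in> borel_measurable (M \<Otimes>\<^sub>M leb01)" for k
  proof (rule measurable_compose_countable)
    show "(\<lambda>q. dense_step j (snd q)) \<in> borel_measurable (M \<Otimes>\<^sub>M leb01)" for j
      by (rule measurable_compose[OF measurable_snd dense_step_L2(2)])
    show "(\<lambda>q. near_step k (z (fst q))) \<in> measurable (M \<Otimes>\<^sub>M leb01) (count_space UNIV)"
      by (rule measurable_compose[OF measurable_compose[OF measurable_fst z] near_step_measurable])
  qed
  then have "flim (\<lambda>k q. dense_step (near_step k (z (fst q))) (snd q)) \<in> borel_measurable (M \<Otimes>\<^sub>M leb01)"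
    by (rule flim_measurable)
  also have "flim (\<lambda>k q. dense_step (near_step k (z (fst q))) (snd q)) = (\<lambda>(x, u). repr (z x) u)"
    by (auto simp: fun_eq_iff flim_def repr_def)
  finally show ?thesis .
qed

section \<open>Processes with continuous paths and their representatives\<close>

context sheet_noise
begin

lemma progressive_section:
  assumes y: "jointly_progressive T G y" and t: "0 \<le> t" "t \<le> T"
  shows "(\<lambda>q. y (fst q) (snd q) t) \<in> borel_measurable (G t \<Otimes>\<^sub>M leb01)"
proof -
  have m: "(\<lambda>(s, \<omega>, u). y \<omega> u s) \<in> borel_measurable (restrict_space borel {0..t} \<Otimes>\<^sub>M (G t \<Otimes>\<^sub>M leb01))"
    using y t by (auto simp: jointly_progressive_def)
  have "t \<in> space (restrict_space borel {0..t})" using t by (simp add: space_restrict_space)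
  from measurable_compose[OF measurable_Pair1'[OF this] m] show ?thesis
    by (simp add: case_prod_beta')
qed

lemma progressive_section_PU:
  "jointly_progressive T G y \<Longrightarrow> 0 \<le> t \<Longrightarrow> t \<le> T \<Longrightarrow> (\<lambda>q. y (fst q) (snd q) t) \<in> borel_measurable PU"
  using GU_measurable[OF progressive_section] .

text \<open>The distance to a fixed step function is measurable by Fubini's theorem.\<close>

lemma progressive_L2_progressive:
  assumes y: "jointly_progressive T G y"
    and L2: "\<And>\<omega> t. \<omega> \<in> space P \<Longrightarrow> t \<in> {0..T} \<Longrightarrow> (\<lambda>u. y \<omega> u t) \<in> L2_funs"
  shows "L2_progressive T G y"
  unfolding L2_progressive_def
proof
  fix t assume t: "t \<in> {0..T}"
  let ?M = "restrict_space borel {0..t} \<Otimes>\<^sub>M G t"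
  have m: "(\<lambda>(s, \<omega>, u). y \<omega> u s) \<in> borel_measurable (restrict_space borel {0..t} \<Otimes>\<^sub>M (G t \<Otimes>\<^sub>M leb01))"
    using y t by (auto simp: jointly_progressive_def)
  have "(\<lambda>x. (fst (fst x), snd (fst x), snd x)) \<in> measurable (?M \<Otimes>\<^sub>M leb01) (restrict_space borel {0..t} \<Otimes>\<^sub>M (G t \<Otimes>\<^sub>M leb01))"
    by measurable
  from measurable_compose[OF this m]
  have ym: "(\<lambda>x. y (snd (fst x)) (snd x) (fst (fst x))) \<in> borel_measurable (?M \<Otimes>\<^sub>M leb01)"
    by (simp add: case_prod_beta')
  show "(\<lambda>(s, \<omega>) u. y \<omega> u s) \<in> measurable ?M L2_borel"
  proof (rule measurable_L2_borel)
    fix x assume "x \<in> space ?M"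
    then show "(case x of (s, \<omega>) \<Rightarrow> \<lambda>u. y \<omega> u s) \<in> L2_funs"
      using t L2 by (auto simp: space_pair_measure space_restrict_space)
  next
    fix L
    have "(\<lambda>(x, u). ennreal ((y (snd x) u (fst x) - step L u)\<^sup>2)) \<in> borel_measurable (?M \<Otimes>\<^sub>M leb01)"
      using ym measurable_compose[OF measurable_snd step_measurable] by (simp add: case_prod_beta')
    from leb01.borel_measurable_nn_integral[OF this]
    show "(\<lambda>x. sqn leb01 (\<lambda>u. (case x of (s, \<omega>) \<Rightarrow> \<lambda>u. y \<omega> u s) u - step L u)) \<in> borel_measurable ?M"
      by (simp add: sqn_def case_prod_beta')
  qed
qed

lemma M_processesI:
  assumes "jointly_progressive T G y" "\<And>\<omega>. \<omega> \<in> space P \<Longrightarrow> L2_continuous T (y \<omega>)" "M_norm_sq P T y < \<infinity>"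
  shows "y \<in> M_processes P T G"
proof -
  have "L2_progressive T G y"
    using assms(2) by (intro progressive_L2_progressive assms(1)) (auto simp: L2_continuous_def)
  then show ?thesis using assms by (auto simp: M_processes_def)
qed

lemma M_processes_L2:
  "y \<in> M_processes P T G \<Longrightarrow> \<omega> \<in> space P \<Longrightarrow> 0 \<le> t \<Longrightarrow> t \<le> T \<Longrightarrow> (\<lambda>u. y \<omega> u t) \<in> L2_funs"
  by (auto simp: M_processes_def L2_continuous_def)

lemma L2_norm_cong_AE:
  assumes "f \<in> L2_funs" "g \<in> L2_funs" "AE u in leb01. f u = g u"
  shows "L2_norm f = L2_norm g"
proof -
  have "sqn leb01 f = sqn leb01 g" by (rule sqn_cong_AE[OF assms(3)])
  then have "(L2_norm f)\<^sup>2 = (L2_norm g)\<^sup>2"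
    using L2_norm_sq[OF assms(1)] L2_norm_sq[OF assms(2)] by (metis ennreal_inj zero_le_power2)
  then show ?thesis using L2_norm_nonneg power2_eq_imp_eq by blast
qed

text \<open>Every class contains a process to which the formula for \<open>\<psi>\<close> applies.\<close>

lemma exists_progressive_representative:
  assumes z: "z \<in> M_processes P T G"
  obtains z' where "jointly_progressive T G z'" "(z', z) \<in> M_eq P T G"
proof -
  define z' where "z' \<omega> u s = repr (\<lambda>u. z \<omega> u s) u" for \<omega> u s
  have L2: "(\<lambda>u. z \<omega> u t) \<in> L2_funs" if "\<omega> \<in> space P" "t \<in> {0..T}" for \<omega> t
    using M_processes_L2[OF z] that by auto
  have ae: "AE u in leb01. z' \<omega> u t = z \<omega> u t" if "\<omega> \<in> space P" "t \<in> {0..T}" for \<omega> t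
    unfolding z'_def by (rule repr_AE(2)[OF L2[OF that]])
  have L2': "(\<lambda>u. z' \<omega> u t) \<in> L2_funs" if "\<omega> \<in> space P" "t \<in> {0..T}" for \<omega> t
  proof -
    have "(\<lambda>u. z' \<omega> u t) \<in> borel_measurable leb01" unfolding z'_def using repr_AE(1)[OF L2[OF that]] by simp
    moreover have "sqn leb01 (\<lambda>u. z' \<omega> u t) = sqn leb01 (\<lambda>u. z \<omega> u t)" by (rule sqn_cong_AE[OF ae[OF that]])
    ultimately show ?thesis using L2[OF that] by (auto simp: L2_funs_iff)
  qed
  have jp: "jointly_progressive T G z'"
    unfolding jointly_progressive_def
  proof
    fix t assume t: "t \<in> {0..T}"
    have "(\<lambda>(s, \<omega>) u. z \<omega> u s) \<in> measurable (restrict_space borel {0..t} \<Otimes>\<^sub>M G t) L2_borel"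
      using z t by (auto simp: M_processes_def L2_progressive_def)
    note m = repr_jointly_measurable[OF this]
    have "(\<lambda>x. ((fst x, fst (snd x)), snd (snd x))) \<in> measurable (restrict_space borel {0..t} \<Otimes>\<^sub>M (G t \<Otimes>\<^sub>M leb01))
       ((restrict_space borel {0..t} \<Otimes>\<^sub>M G t) \<Otimes>\<^sub>M leb01)" by measurable
    from measurable_compose[OF this m]
    show "(\<lambda>(s, \<omega>, u). z' \<omega> u s) \<in> borel_measurable (restrict_space borel {0..t} \<Otimes>\<^sub>M (G t \<Otimes>\<^sub>M leb01))"
      by (simp add: case_prod_beta' z'_def)
  qed
  have "z' \<in> M_processes P T G"
  proof (rule M_processesI[OF jp])
    fix \<omega> assume \<omega>: "\<omega> \<in> space P"
    have nrm: "L2_norm (\<lambda>u. z' \<omega> u s - z' \<omega> u t) = L2_norm (\<lambda>u. z \<omega> u s - z \<omega> u t)" if st: "s \<in> {0..T}" "t \<in> {0..T}" for s t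
    proof (rule L2_norm_cong_AE[OF L2_funs_diff L2_funs_diff])
      show "AE u in leb01. z' \<omega> u s - z' \<omega> u t = z \<omega> u s - z \<omega> u t"
        using ae[OF \<omega> st(1)] ae[OF \<omega> st(2)] by eventually_elim simp
    qed (use L2 L2' \<omega> st in auto)
    show "L2_continuous T (z' \<omega>)"
      unfolding L2_continuous_def
    proof (intro ballI conjI L2'[OF \<omega>])
      fix t assume t: "t \<in> {0..T}"
      have "((\<lambda>s. L2_norm (\<lambda>u. z \<omega> u s - z \<omega> u t)) \<longlongrightarrow> 0) (at t within {0..T})"
        using z \<omega> t by (auto simp: M_processes_def L2_continuous_def)
      then show "((\<lambda>s. L2_norm (\<lambda>u. z' \<omega> u s - z' \<omega> u t)) \<longlongrightarrow> 0) (at t within {0..T})"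
        by (rule Lim_transform_eventually) (use nrm[OF _ t] in \<open>auto simp: eventually_at_filter\<close>)
    qed
  next
    have "M_norm_sq P T z' = M_norm_sq P T z"
      unfolding M_norm_sq_def
    proof (rule nn_integral_cong, rule SUP_cong[OF refl])
      fix \<omega> t assume "\<omega> \<in> space P" "t \<in> {0..T}"
      from ae[OF this] show "(\<integral>\<^sup>+ u. ennreal ((z' \<omega> u t)\<^sup>2) \<partial>leb01) = (\<integral>\<^sup>+ u. ennreal ((z \<omega> u t)\<^sup>2) \<partial>leb01)"
        by (intro nn_integral_cong_AE) (auto elim: eventually_mono)
    qed
    then show "M_norm_sq P T z' < \<infinity>" using z by (simp add: M_processes_def)
  qed
  then have "(z', z) \<in> M_eq P T G" using z ae by (auto simp: M_eq_def)
  with jp show thesis by (rule that)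
qed

lemma M_eq_equiv: "equiv (M_processes P T G) (M_eq P T G)"
proof (rule equivI)
  show "refl_on (M_processes P T G) (M_eq P T G)" by (auto simp: refl_on_def M_eq_def)
  show "sym (M_eq P T G)"
  proof (rule symI)
    fix z z' assume "(z, z') \<in> M_eq P T G"
    then have "z \<in> M_processes P T G" "z' \<in> M_processes P T G"
      "AE \<omega> in P. \<forall>t\<in>{0..T}. AE u in leb01. z \<omega> u t = z' \<omega> u t" by (auto simp: M_eq_def)
    moreover from this(3) have "AE \<omega> in P. \<forall>t\<in>{0..T}. AE u in leb01. z' \<omega> u t = z \<omega> u t"
    proof eventually_elim
      case (elim \<omega>)
      show ?case
      proof
        fix t assume "t \<in> {0..T}"
        with elim have "AE u in leb01. z \<omega> u t = z' \<omega> u t" by blast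
        then show "AE u in leb01. z' \<omega> u t = z \<omega> u t" by eventually_elim (rule sym)
      qed
    qed
    ultimately show "(z', z) \<in> M_eq P T G" by (auto simp: M_eq_def)
  qed
  show "trans (M_eq P T G)"
  proof (rule transI)
    fix x y z assume "(x, y) \<in> M_eq P T G" "(y, z) \<in> M_eq P T G"
    then have *: "x \<in> M_processes P T G" "z \<in> M_processes P T G"
      "AE \<omega> in P. \<forall>t\<in>{0..T}. AE u in leb01. x \<omega> u t = y \<omega> u t"
      "AE \<omega> in P. \<forall>t\<in>{0..T}. AE u in leb01. y \<omega> u t = z \<omega> u t" by (auto simp: M_eq_def)
    from *(3,4) have "AE \<omega> in P. \<forall>t\<in>{0..T}. AE u in leb01. x \<omega> u t = z \<omega> u t"
    proof eventually_elim
      case (elim \<omega>)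
      show ?case
      proof
        fix t assume "t \<in> {0..T}"
        with elim have "AE u in leb01. x \<omega> u t = y \<omega> u t" "AE u in leb01. y \<omega> u t = z \<omega> u t" by auto
        then show "AE u in leb01. x \<omega> u t = z \<omega> u t" by eventually_elim simp
      qed
    qed
    with * show "(x, z) \<in> M_eq P T G" by (auto simp: M_eq_def)
  qed
qed (auto simp: M_eq_def)

lemma L2_continuous_nodes:
  assumes c: "L2_continuous T x" and t: "0 \<le> t" "t \<le> T"
  shows "(\<lambda>n. sqn leb01 (\<lambda>u. x u (node T n (node_index T n t)) - x u t)) \<longlonglongrightarrow> 0"
proof -
  let ?s = "\<lambda>n. node T n (node_index T n t)"
  let ?F = "\<lambda>s. L2_norm (\<lambda>u. x u s - x u t)"
  have s: "0 \<le> ?s n" "?s n \<le> t" "?s n \<le> T" "t - T / 32 ^ n \<le> ?s n" for n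
    using node_nonneg[OF T_pos] node_floor(1,2)[OF T_pos t, of n] t by (auto intro: order_trans)
  have L2: "(\<lambda>u. x u r) \<in> L2_funs" if "0 \<le> r" "r \<le> T" for r using c that by (auto simp: L2_continuous_def)
  have "(\<lambda>n. T / 32 ^ n) \<longlonglongrightarrow> 0"
    using LIMSEQ_divide_realpow_zero[of 32 T] by simp
  then have "(\<lambda>n. t - T / 32 ^ n) \<longlonglongrightarrow> t - 0" by (intro tendsto_diff tendsto_const)
  then have st: "?s \<longlonglongrightarrow> t"
    by (intro tendsto_sandwich[of "\<lambda>n. t - T / 32 ^ n" ?s sequentially "\<lambda>_. t"]) (auto intro!: always_eventually s)
  have F0: "?F t = 0" by (simp add: L2_norm_def)
  have "(?F \<longlongrightarrow> ?F t) (at t within {0..T})" using c t unfolding F0 by (auto simp: L2_continuous_def)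
  then have "continuous (at t within {0..T}) ?F" by (simp add: continuous_within)
  then have "(\<lambda>n. ?F (?s n)) \<longlonglongrightarrow> ?F t"
    using st s by (intro continuous_within_tendsto_compose'[of t "{0..T}" ?F ?s]) auto
  then have "(\<lambda>n. ?F (?s n)) \<longlonglongrightarrow> 0" by (simp only: F0)
  then have "(\<lambda>n. ennreal ((?F (?s n))\<^sup>2)) \<longlonglongrightarrow> ennreal (0\<^sup>2)" by (intro tendsto_ennrealI tendsto_power)
  moreover have "ennreal ((?F (?s n))\<^sup>2) = sqn leb01 (\<lambda>u. x u (?s n) - x u t)" for n
    by (rule L2_norm_sq[OF L2_funs_diff[OF L2[OF s(1,3)] L2[OF t]]])
  ultimately show ?thesis by simp
qed

text \<open>The nodes are countably many and dense, so equality at each time improves to equality at all times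
  by continuity of the paths.\<close>

lemma M_eqI:
  assumes z: "z \<in> M_processes P T G" "z' \<in> M_processes P T G"
    and eq: "\<And>t. 0 \<le> t \<Longrightarrow> t \<le> T \<Longrightarrow> AE \<omega> in P. AE u in leb01. z \<omega> u t = z' \<omega> u t"
  shows "(z, z') \<in> M_eq P T G"
proof -
  have "AE \<omega> in P. \<forall>n k. k \<le> (32 :: nat) ^ n \<longrightarrow> (AE u in leb01. z \<omega> u (node T n k) = z' \<omega> u (node T n k))"
    unfolding AE_all_countable
  proof (intro allI)
    fix n k
    show "AE \<omega> in P. k \<le> (32 :: nat) ^ n \<longrightarrow> (AE u in leb01. z \<omega> u (node T n k) = z' \<omega> u (node T n k))"
    proof (cases "k \<le> 32 ^ n")
      case True
      then show ?thesis using eq[OF node_nonneg[OF T_pos] node_le[OF T_pos True]] by simp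
    qed simp
  qed
  then have "AE \<omega> in P. \<forall>t\<in>{0..T}. AE u in leb01. z \<omega> u t = z' \<omega> u t"
    using AE_space
  proof eventually_elim
    case (elim \<omega>)
    show ?case
    proof
      fix t assume "t \<in> {0..T}"
      then have t: "0 \<le> t" "t \<le> T" by auto
      let ?s = "\<lambda>n. node T n (node_index T n t)"
      have zm: "(\<lambda>u. z \<omega> u r) \<in> borel_measurable leb01" "(\<lambda>u. z' \<omega> u r) \<in> borel_measurable leb01"
        if "0 \<le> r" "r \<le> T" for r
        using M_processes_L2[OF z(1) elim(2) that] M_processes_L2[OF z(2) elim(2) that] by (auto simp: L2_funs_iff)
      have c: "L2_continuous T (z \<omega>)" "L2_continuous T (z' \<omega>)" using z elim(2) by (auto simp: M_processes_def)
      have s: "0 \<le> ?s n" "?s n \<le> T" for n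
        using node_nonneg[OF T_pos] node_floor(1)[OF T_pos t, of n] t by (auto intro: order_trans)
      have le: "sqn leb01 (\<lambda>u. z \<omega> u t - z' \<omega> u t)
         \<le> 2 * sqn leb01 (\<lambda>u. z \<omega> u (?s n) - z \<omega> u t) + 2 * sqn leb01 (\<lambda>u. z' \<omega> u (?s n) - z' \<omega> u t)" for n
      proof -
        have ae: "AE u in leb01. z \<omega> u (?s n) = z' \<omega> u (?s n)" using elim(1) node_floor(3)[OF T_pos t] by blast
        have "sqn leb01 (\<lambda>u. z \<omega> u t - z' \<omega> u t) \<le> 2 * sqn leb01 (\<lambda>u. z \<omega> u t - z \<omega> u (?s n)) + 2 * sqn leb01 (\<lambda>u. z \<omega> u (?s n) - z' \<omega> u t)"
          by (intro sqn_triangle zm t s)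
        also have "sqn leb01 (\<lambda>u. z \<omega> u (?s n) - z' \<omega> u t) = sqn leb01 (\<lambda>u. z' \<omega> u (?s n) - z' \<omega> u t)"
          by (rule sqn_cong_AE) (use ae in eventually_elim, simp)
        finally show ?thesis by (subst (asm) sqn_minus_commute)
      qed
      have "(\<lambda>n. 2 * sqn leb01 (\<lambda>u. z \<omega> u (?s n) - z \<omega> u t) + 2 * sqn leb01 (\<lambda>u. z' \<omega> u (?s n) - z' \<omega> u t)) \<longlonglongrightarrow> 2 * 0 + 2 * 0"
        by (intro tendsto_add ennreal_tendsto_cmult L2_continuous_nodes c t) (auto simp: less_top[symmetric])
      then have "sqn leb01 (\<lambda>u. z \<omega> u t - z' \<omega> u t) \<le> 2 * 0 + 2 * 0"
        using le by (intro LIMSEQ_le_const) auto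
      then have "sqn leb01 (\<lambda>u. z \<omega> u t - z' \<omega> u t) = 0" by simp
      then have "AE u in leb01. z \<omega> u t - z' \<omega> u t = 0"
        using zm[OF t] by (subst (asm) sqn_zero_iff) auto
      then show "AE u in leb01. z \<omega> u t = z' \<omega> u t" by eventually_elim simp
    qed
  qed
  then show ?thesis using z by (auto simp: M_eq_def)
qed

lemma M_norm_bound:
  assumes z: "z \<in> M_processes P T G" and jp: "jointly_progressive T G z" and t: "0 \<le> t" "t \<le> T"
  shows "sqn PU (\<lambda>q. z (fst q) (snd q) t) \<le> M_norm_sq P T z"
proof -
  have "sqn PU (\<lambda>q. z (fst q) (snd q) t) = (\<integral>\<^sup>+\<omega>. sqn leb01 (\<lambda>u. z \<omega> u t) \<partial>P)"
    using sqn_PU[OF progressive_section_PU[OF jp t]] by simp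
  also have "\<dots> \<le> M_norm_sq P T z"
    unfolding M_norm_sq_def using t by (intro nn_integral_mono) (auto intro!: SUP_upper simp: sqn_def)
  finally show ?thesis .
qed

text \<open>The norm of \<open>\<M>\<close> integrates a supremum over uncountably many times. The measurable majorant \<open>S\<close> of
  that supremum makes additivity of the integral applicable.\<close>

lemma path_plus_M_process:
  assumes jp: "jointly_progressive T G y"
    and cont: "\<And>\<omega>. \<omega> \<in> space P \<Longrightarrow> L2_continuous T (y \<omega>)"
    and S [measurable]: "S \<in> borel_measurable P" and fin: "(\<integral>\<^sup>+\<omega>. S \<omega> \<partial>P) < \<infinity>"
    and maj: "\<And>\<omega> t. \<omega> \<in> space P \<Longrightarrow> t \<in> {0..T} \<Longrightarrow> sqn leb01 (\<lambda>u. y \<omega> u t) \<le> S \<omega>"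
    and g: "g \<in> L2_funs"
  shows "jointly_progressive T G (\<lambda>\<omega> u t. g u + y \<omega> u t)"
    and "(\<lambda>\<omega> u t. g u + y \<omega> u t) \<in> M_processes P T G"
proof -
  have gm: "g \<in> borel_measurable leb01" and gfin: "sqn leb01 g < \<infinity>" using g by (auto simp: L2_funs_iff)
  show jp': "jointly_progressive T G (\<lambda>\<omega> u t. g u + y \<omega> u t)"
    unfolding jointly_progressive_def
  proof
    fix t assume "t \<in> {0..T}"
    then have 1: "(\<lambda>(s, \<omega>, u). y \<omega> u s) \<in> borel_measurable (restrict_space borel {0..t} \<Otimes>\<^sub>M (G t \<Otimes>\<^sub>M leb01))"
      using jp by (auto simp: jointly_progressive_def)
    have 2: "(\<lambda>x. g (snd (snd x))) \<in> borel_measurable (restrict_space borel {0..t} \<Otimes>\<^sub>M (G t \<Otimes>\<^sub>M leb01))"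
      by (rule measurable_compose[OF measurable_snd measurable_compose[OF measurable_snd gm]])
    show "(\<lambda>(s, \<omega>, u). g u + y \<omega> u s) \<in> borel_measurable (restrict_space borel {0..t} \<Otimes>\<^sub>M (G t \<Otimes>\<^sub>M leb01))"
      using borel_measurable_add[OF 2 1] by (simp add: case_prod_beta')
  qed
  have L2: "(\<lambda>u. g u + y \<omega> u t) \<in> L2_funs" and bd: "sqn leb01 (\<lambda>u. g u + y \<omega> u t) \<le> 2 * sqn leb01 g + 2 * sqn leb01 (\<lambda>u. y \<omega> u t)"
    if "\<omega> \<in> space P" "t \<in> {0..T}" for \<omega> t
  proof -
    have yL: "(\<lambda>u. y \<omega> u t) \<in> L2_funs" using cont[OF that(1)] that(2) by (auto simp: L2_continuous_def)
    then have ym: "(\<lambda>u. y \<omega> u t) \<in> borel_measurable leb01" by (simp add: L2_funs_iff)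
    show b: "sqn leb01 (\<lambda>u. g u + y \<omega> u t) \<le> 2 * sqn leb01 g + 2 * sqn leb01 (\<lambda>u. y \<omega> u t)"
      by (rule sqn_add[OF gm ym])
    have "2 * sqn leb01 g + 2 * sqn leb01 (\<lambda>u. y \<omega> u t) < \<infinity>"
      using g yL by (auto simp: L2_funs_iff ennreal_mult_less_top)
    then show "(\<lambda>u. g u + y \<omega> u t) \<in> L2_funs"
      using b gm ym by (auto simp: L2_funs_iff intro: le_less_trans)
  qed
  show "(\<lambda>\<omega> u t. g u + y \<omega> u t) \<in> M_processes P T G"
  proof (rule M_processesI[OF jp'])
    fix \<omega> assume \<omega>: "\<omega> \<in> space P"
    show "L2_continuous T (\<lambda>u t. g u + y \<omega> u t)"
      using cont[OF \<omega>] L2[OF \<omega>] by (auto simp: L2_continuous_def)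
  next
    have "M_norm_sq P T (\<lambda>\<omega> u t. g u + y \<omega> u t) \<le> (\<integral>\<^sup>+\<omega>. 2 * sqn leb01 g + 2 * S \<omega> \<partial>P)"
      unfolding M_norm_sq_def
    proof (intro nn_integral_mono SUP_least)
      fix \<omega> t assume *: "\<omega> \<in> space P" "t \<in> {0..T}"
      have "(\<integral>\<^sup>+ u. ennreal ((g u + y \<omega> u t)\<^sup>2) \<partial>leb01) \<le> 2 * sqn leb01 g + 2 * sqn leb01 (\<lambda>u. y \<omega> u t)"
        using bd[OF *] by (simp add: sqn_def)
      also have "\<dots> \<le> 2 * sqn leb01 g + 2 * S \<omega>"
        by (intro add_mono mult_left_mono maj *) auto
      finally show "(\<integral>\<^sup>+ u. ennreal ((g u + y \<omega> u t)\<^sup>2) \<partial>leb01) \<le> 2 * sqn leb01 g + 2 * S \<omega>" .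
    qed
    also have "\<dots> = 2 * sqn leb01 g + 2 * (\<integral>\<^sup>+\<omega>. S \<omega> \<partial>P)"
      by (simp add: nn_integral_add nn_integral_cmult emeasure_space_1)
    also have "\<dots> < \<infinity>" using gfin fin by (auto simp: ennreal_mult_less_top)
    finally show "M_norm_sq P T (\<lambda>\<omega> u t. g u + y \<omega> u t) < \<infinity>" .
  qed
qed

lemma has_sheet_integral_cong:
  assumes "has_sheet_integral P T G w f t Y" "AE \<omega> in P. Y \<omega> = Y' \<omega>" "Y' \<in> borel_measurable P"
  shows "has_sheet_integral P T G w f t Y'"
proof -
  have "(\<integral>\<^sup>+ \<omega>. ennreal ((simple_integral w F t \<omega> - Y \<omega>)\<^sup>2) \<partial>P) = (\<integral>\<^sup>+ \<omega>. ennreal ((simple_integral w F t \<omega> - Y' \<omega>)\<^sup>2) \<partial>P)" for F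
    by (rule nn_integral_cong_AE) (use assms(2) in eventually_elim, simp)
  then show ?thesis using assms(1,3) unfolding has_sheet_integral_def by simp
qed

end

context bounded_integrand
begin

text \<open>The integral process, started at \<open>g\<close>, as an element of \<open>\<M>\<close>.\<close>

theorem continuous_integral:
  assumes g: "g \<in> L2_funs"
  obtains y where "jointly_progressive T G y" "y \<in> M_processes P T G"
    "\<And>t. t \<in> {0..T} \<Longrightarrow> AE u in leb01. has_sheet_integral P T G w (\<lambda>\<omega> u' s. f \<omega> u u' s) t (\<lambda>\<omega>. y \<omega> u t - g u)"
proof -
  interpret PL: pair_sigma_finite P leb01 by unfold_locales
  obtain y S where y: "jointly_progressive T G y" "\<And>\<omega>. \<omega> \<in> space P \<Longrightarrow> L2_continuous T (y \<omega>)"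
    "S \<in> borel_measurable P" "(\<integral>\<^sup>+\<omega>. S \<omega> \<partial>P) < \<infinity>"
    "\<And>\<omega> t. \<omega> \<in> space P \<Longrightarrow> t \<in> {0..T} \<Longrightarrow> sqn leb01 (\<lambda>u. y \<omega> u t) \<le> S \<omega>"
    and eq: "\<And>t. 0 \<le> t \<Longrightarrow> t \<le> T \<Longrightarrow> AE q in PU. y (fst q) (snd q) t = field_integral t q"
  proof (rule continuous_version[of field_integral "3 * K ^ 4"])
    show "field_integral t \<in> borel_measurable (G t \<Otimes>\<^sub>M leb01)" if "0 \<le> t" "t \<le> T" for t using that by (rule field_integral_measurable)
    show "field_integral 0 (\<omega>, u) = 0" if "u \<in> {0..1}" for \<omega> u using that by (rule field_integral_0)
    show "(\<integral>\<^sup>+q. ennreal ((field_integral t q - field_integral s q) ^ 4) \<partial>PU) \<le> ennreal (3 * K ^ 4 * (t - s)\<^sup>2)" if "0 \<le> s" "s \<le> t" "t \<le> T" for s t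
      using that by (rule field_integral_fourth_moment)
    show "0 \<le> 3 * K ^ 4" by simp
  qed blast
  show thesis
  proof (rule that[OF path_plus_M_process[OF y g]])
    fix t assume "t \<in> {0..T}"
    then have t: "0 \<le> t" "t \<le> T" by auto
    have ym: "(\<lambda>q. y (fst q) (snd q) t) \<in> borel_measurable PU" by (rule progressive_section_PU[OF y(1) t])
    have "AE q in PU. case q of (\<omega>, u) \<Rightarrow> field_integral t (\<omega>, u) = y \<omega> u t"
      using eq[OF t] by eventually_elim (simp add: case_prod_beta)
    then have 1: "AE \<omega> in P. AE u in leb01. field_integral t (\<omega>, u) = y \<omega> u t"
      using PL.AE_pair[of "\<lambda>q. case q of (\<omega>, u) \<Rightarrow> field_integral t (\<omega>, u) = y \<omega> u t"] by simp
    have "AE u in leb01. AE \<omega> in P. field_integral t (\<omega>, u) = y \<omega> u t"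
    proof (rule PL.AE_commute[THEN iffD1, OF _ 1])
      have "{q\<in>space PU. field_integral t q = y (fst q) (snd q) t} \<in> sets PU"
        using field_integral_measurable_PU[OF t] ym by measurable
      then show "{x\<in>space PU. field_integral t (fst x, snd x) = y (fst x) (snd x) t} \<in> sets PU" by simp
    qed
    with field_integral_is_integral[OF t] show "AE u in leb01. has_sheet_integral P T G w (\<lambda>\<omega> u' s. f \<omega> u u' s) t (\<lambda>\<omega>. g u + y \<omega> u t - g u)"
      using AE_space
    proof eventually_elim
      case (elim u)
      have "(\<lambda>\<omega>. y \<omega> u t) \<in> borel_measurable P"
        using measurable_compose[OF measurable_Pair2'[of u leb01 P] ym] elim(3) by simp
      from has_sheet_integral_cong[OF elim(1) elim(2) this] show ?case by simp
    qed
  qed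
qed

end

section \<open>The kernel of the map\<close>

lemma smooth_cutoff_continuous: "smooth_cutoff \<sigma> \<phi> \<Longrightarrow> continuous_on UNIV \<phi>"
proof -
  assume "smooth_cutoff \<sigma> \<phi>"
  then have "\<forall>x. ((deriv ^^ 0) \<phi>) differentiable (at x)" unfolding smooth_cutoff_def by blast
  then have "\<phi> differentiable_on UNIV" by (simp add: differentiable_on_def)
  then show ?thesis by (rule differentiable_imp_continuous_on)
qed

text \<open>The derivative is continuous, hence bounded on \<open>[-\<sigma>,\<sigma>]\<close>; clipping the argument to this interval
  does not change the value, because the cutoff vanishes near its end points and beyond.\<close>

lemma smooth_cutoff_lipschitz:
  assumes sm: "smooth_cutoff \<sigma> \<phi>" and s: "0 < \<sigma>"
  obtains L where "0 \<le> L" "\<And>x y. \<bar>\<phi> x - \<phi> y\<bar> \<le> L * \<bar>x - y\<bar>"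
proof -
  have dif: "((deriv ^^ n) \<phi>) differentiable (at x)" for n x
    using sm by (auto simp: smooth_cutoff_def)
  have even: "\<phi> (- x) = \<phi> x" for x using sm by (auto simp: smooth_cutoff_def)
  have out: "\<phi> x = 0" if "\<sigma> \<le> \<bar>x\<bar>" for x
  proof -
    have "\<phi> \<bar>x\<bar> = 0" using sm that s by (auto simp: smooth_cutoff_def)
    then show ?thesis using even[of x] by (cases "0 \<le> x") auto
  qed
  have der: "(\<phi> has_field_derivative deriv \<phi> x) (at x within S)" for x S
  proof -
    have "\<phi> field_differentiable (at x)"
      using dif[of 0 x] by (simp add: field_differentiable_def real_differentiable_def)
    then show ?thesis by (rule DERIV_subset[OF field_differentiable_derivI]) simp
  qed
  have "deriv \<phi> differentiable (at x)" for x using dif[of 1 x] by simp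
  then have "deriv \<phi> differentiable_on {-\<sigma>..\<sigma>}" by (meson differentiable_at_imp_differentiable_on)
  then have "continuous_on {-\<sigma>..\<sigma>} (deriv \<phi>)" by (rule differentiable_imp_continuous_on)
  then have "bounded (deriv \<phi> ` {-\<sigma>..\<sigma>})" by (intro compact_imp_bounded compact_continuous_image) auto
  then obtain L where "\<forall>y\<in>deriv \<phi> ` {-\<sigma>..\<sigma>}. norm y \<le> L" unfolding bounded_iff by blast
  then have L: "norm (deriv \<phi> x) \<le> L" if "x \<in> {-\<sigma>..\<sigma>}" for x using that by blast
  have L0: "0 \<le> L" using L[of 0] s by (auto intro: order_trans[OF norm_ge_zero])
  define c where "c x = max (-\<sigma>) (min \<sigma> x)" for x
  have cin: "c x \<in> {-\<sigma>..\<sigma>}" for x using s by (auto simp: c_def)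
  have phic: "\<phi> (c x) = \<phi> x" for x
  proof (cases "\<bar>x\<bar> \<le> \<sigma>")
    case True then have "c x = x" by (auto simp: c_def) then show ?thesis by simp
  next
    case False
    then have "\<sigma> \<le> \<bar>c x\<bar>" "\<sigma> \<le> \<bar>x\<bar>" using s by (auto simp: c_def)
    then show ?thesis by (simp add: out)
  qed
  show thesis
  proof (rule that[OF L0])
    fix x y
    have "norm (\<phi> (c x) - \<phi> (c y)) \<le> L * norm (c x - c y)"
      by (rule field_differentiable_bound[OF _ der L cin cin]) auto
    also have "\<dots> \<le> L * \<bar>x - y\<bar>"
      using L0 by (intro mult_left_mono) (auto simp: c_def)
    finally show "\<bar>\<phi> x - \<phi> y\<bar> \<le> L * \<bar>x - y\<bar>" by (simp add: phic)
  qed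
qed

lemma square_integral_le:
  assumes h: "h \<in> borel_measurable leb01" and b: "\<And>v. \<bar>h v\<bar> \<le> c"
  shows "ennreal ((\<integral>v. h v \<partial>leb01)\<^sup>2) \<le> (\<integral>\<^sup>+v. ennreal ((h v)\<^sup>2) \<partial>leb01)"
proof -
  have i: "integrable leb01 h" using h b by (intro leb01.integrable_const_bound[of _ c]) auto
  have i2: "integrable leb01 (\<lambda>v. (h v)\<^sup>2)"
    using h power_mono[OF b abs_ge_zero, of _ 2] by (intro leb01.integrable_const_bound[of _ "c\<^sup>2"]) auto
  have "0 \<le> leb01.variance h" by simp
  then have "(\<integral>v. h v \<partial>leb01)\<^sup>2 \<le> (\<integral>v. (h v)\<^sup>2 \<partial>leb01)" using leb01.variance_eq[OF i i2] by simp
  then have "ennreal ((\<integral>v. h v \<partial>leb01)\<^sup>2) \<le> ennreal (\<integral>v. (h v)\<^sup>2 \<partial>leb01)" by (rule ennreal_leI)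
  also have "\<dots> = (\<integral>\<^sup>+v. ennreal ((h v)\<^sup>2) \<partial>leb01)"
    by (rule nn_integral_eq_integral[OF i2, symmetric]) simp
  finally show ?thesis .
qed

definition kernel :: "(real \<Rightarrow> real) \<Rightarrow> real \<Rightarrow> (real \<Rightarrow> real) \<Rightarrow> real \<Rightarrow> real \<Rightarrow> real" where
  "kernel \<phi> \<epsilon> a u u' = \<phi> (a u - a u') / (\<epsilon> + (\<integral>v. (\<phi> (a u - a v))\<^sup>2 \<partial>leb01))"

lemma psi_integrand_kernel: "psi_integrand \<phi> \<epsilon> z u \<omega> u' s = kernel \<phi> \<epsilon> (\<lambda>v. z \<omega> v s) u u'"
  by (simp add: psi_integrand_def kernel_def mass_def)

lemma kernel_bound:
  assumes "0 < \<epsilon>" "\<And>x. \<bar>\<phi> x\<bar> \<le> 1"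
  shows "\<bar>kernel \<phi> \<epsilon> a u u'\<bar> \<le> 1 / \<epsilon>"
proof -
  have "0 \<le> (\<integral>v. (\<phi> (a u - a v))\<^sup>2 \<partial>leb01)" by simp
  then have "\<bar>\<phi> (a u - a u')\<bar> / \<bar>\<epsilon> + (\<integral>v. (\<phi> (a u - a v))\<^sup>2 \<partial>leb01)\<bar> \<le> 1 / \<epsilon>"
    using assms by (intro frac_le) auto
  then show ?thesis by (simp add: kernel_def)
qed

text \<open>Writing \<open>x/A - y/B = (x - y)/A + y (B - A)/(A B)\<close> uses the bound on \<open>y\<close> and the lower bound on both
  denominators.\<close>

lemma fraction_diff_square:
  fixes x y A B \<epsilon> :: real
  assumes e: "0 < \<epsilon>" and A: "\<epsilon> \<le> A" and B: "\<epsilon> \<le> B" and y: "\<bar>y\<bar> \<le> 1"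
  shows "(x / A - y / B)\<^sup>2 \<le> 2 / \<epsilon>\<^sup>2 * (x - y)\<^sup>2 + 2 / \<epsilon> ^ 4 * (A - B)\<^sup>2"
proof -
  have p: "0 < A" "0 < B" using assms by auto
  have eq: "x / A - y / B = (x - y) / A + y * (B - A) / (A * B)" using p by (simp add: field_simps)
  have 1: "((x - y) / A)\<^sup>2 \<le> 1 / \<epsilon>\<^sup>2 * (x - y)\<^sup>2"
  proof -
    have "((x - y) / A)\<^sup>2 = (x - y)\<^sup>2 / A\<^sup>2" by (simp add: power_divide)
    also have "\<dots> \<le> (x - y)\<^sup>2 / \<epsilon>\<^sup>2" using e A by (intro divide_left_mono power_mono) auto
    finally show ?thesis by simp
  qed
  have 2: "(y * (B - A) / (A * B))\<^sup>2 \<le> 1 / \<epsilon> ^ 4 * (A - B)\<^sup>2"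
  proof -
    have "(y * (B - A) / (A * B))\<^sup>2 = (y\<^sup>2 * (A - B)\<^sup>2) / (A * B)\<^sup>2"
      by (simp add: power_divide power_mult_distrib power2_commute[of B A])
    also have "\<dots> \<le> (1 * (A - B)\<^sup>2) / (\<epsilon> * \<epsilon>)\<^sup>2"
    proof (rule frac_le)
      show "y\<^sup>2 * (A - B)\<^sup>2 \<le> 1 * (A - B)\<^sup>2"
        using y by (intro mult_right_mono) (auto simp: abs_square_le_1)
      show "(\<epsilon> * \<epsilon>)\<^sup>2 \<le> (A * B)\<^sup>2" using e A B p by (intro power_mono mult_mono) auto
    qed (use e in auto)
    also have "\<dots> = 1 / \<epsilon> ^ 4 * (A - B)\<^sup>2" by (simp add: power2_eq_square power4_eq_xxxx)
    finally show ?thesis .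
  qed
  have "(x / A - y / B)\<^sup>2 \<le> 2 * ((x - y) / A)\<^sup>2 + 2 * (y * (B - A) / (A * B))\<^sup>2"
    unfolding eq using sum_squares_bound[of "(x - y) / A" "y * (B - A) / (A * B)"] by (simp add: power2_sum)
  also have "\<dots> \<le> 2 * (1 / \<epsilon>\<^sup>2 * (x - y)\<^sup>2) + 2 * (1 / \<epsilon> ^ 4 * (A - B)\<^sup>2)"
    using 1 2 by (intro add_mono mult_left_mono) auto
  finally show ?thesis by simp
qed

text \<open>The numerator contributes through the Lipschitz constant of \<open>\<phi>\<close>. The denominators differ by an
  integral over \<open>v\<close>, whose square is at most the integral of the square; and
  \<open>\<bar>x\<^sup>2 - y\<^sup>2\<bar> \<le> 2 \<bar>x - y\<bar>\<close> on \<open>[-1,1]\<close>.\<close>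

lemma kernel_lipschitz:
  assumes e: "0 < \<epsilon>" and ph: "\<phi> \<in> borel_measurable borel" and b1: "\<And>x. \<bar>\<phi> x\<bar> \<le> 1"
    and L: "0 \<le> L" "\<And>x y. \<bar>\<phi> x - \<phi> y\<bar> \<le> L * \<bar>x - y\<bar>"
    and a: "a \<in> borel_measurable leb01" and b: "b \<in> borel_measurable leb01"
  shows "(\<integral>\<^sup>+u. \<integral>\<^sup>+u'. ennreal ((kernel \<phi> \<epsilon> a u u' - kernel \<phi> \<epsilon> b u u')\<^sup>2) \<partial>leb01 \<partial>leb01)
    \<le> ennreal (8 * L\<^sup>2 / \<epsilon>\<^sup>2 + 32 * L\<^sup>2 / \<epsilon> ^ 4) * sqn leb01 (\<lambda>u. a u - b u)"
proof -
  define d where "d u = ennreal ((a u - b u)\<^sup>2)" for u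
  define S where "S = (\<integral>\<^sup>+u. d u \<partial>leb01)"
  have dm [measurable]: "d \<in> borel_measurable leb01" unfolding d_def[abs_def] using a b by simp
  define m where "m a u = (\<integral>v. (\<phi> (a u - a v))\<^sup>2 \<partial>leb01)" for a :: "real \<Rightarrow> real" and u
  have phi_sq: "(\<phi> (a u - a u') - \<phi> (b u - b u'))\<^sup>2 \<le> 2 * L\<^sup>2 * ((a u - b u)\<^sup>2 + (a u' - b u')\<^sup>2)" for u u'
  proof -
    have "\<bar>\<phi> (a u - a u') - \<phi> (b u - b u')\<bar> \<le> L * \<bar>(a u - a u') - (b u - b u')\<bar>" by (rule L(2))
    then have "\<bar>\<phi> (a u - a u') - \<phi> (b u - b u')\<bar>\<^sup>2 \<le> (L * \<bar>(a u - a u') - (b u - b u')\<bar>)\<^sup>2" by (intro power_mono) auto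
    also have "\<dots> = L\<^sup>2 * ((a u - b u) - (a u' - b u'))\<^sup>2"
      by (simp add: power_mult_distrib) (simp add: algebra_simps)
    also have "\<dots> \<le> L\<^sup>2 * (2 * (a u - b u)\<^sup>2 + 2 * (a u' - b u')\<^sup>2)"
    proof (rule mult_left_mono)
      have "0 \<le> ((a u - b u) + (a u' - b u'))\<^sup>2" by simp
      then show "((a u - b u) - (a u' - b u'))\<^sup>2 \<le> 2 * (a u - b u)\<^sup>2 + 2 * (a u' - b u')\<^sup>2"
        by (simp add: power2_sum power2_diff)
    qed simp
    finally show ?thesis by (simp add: algebra_simps)
  qed
  have mm: "ennreal ((m a u - m b u)\<^sup>2) \<le> ennreal (8 * L\<^sup>2) * (d u + S)" for u
  proof -
    let ?h = "\<lambda>v. (\<phi> (a u - a v))\<^sup>2 - (\<phi> (b u - b v))\<^sup>2"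
    have m1: "(\<lambda>v. (\<phi> (c u - c v))\<^sup>2) \<in> borel_measurable leb01" if "c \<in> borel_measurable leb01" for c
      using measurable_compose[OF borel_measurable_diff[OF borel_measurable_const that] ph] by simp
    have sq1: "(\<phi> x)\<^sup>2 \<le> 1" for x using b1 by (simp add: abs_square_le_1)
    have i: "integrable leb01 (\<lambda>v. (\<phi> (c u - c v))\<^sup>2)" if "c \<in> borel_measurable leb01" for c
      using m1[OF that] sq1 by (intro leb01.integrable_const_bound[of _ 1]) auto
    have "m a u - m b u = (\<integral>v. ?h v \<partial>leb01)"
      unfolding m_def by (rule Bochner_Integration.integral_diff[OF i[OF a] i[OF b], symmetric])
    then have "ennreal ((m a u - m b u)\<^sup>2) \<le> (\<integral>\<^sup>+v. ennreal ((?h v)\<^sup>2) \<partial>leb01)"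
    proof (simp only:, intro square_integral_le[of _ 1] borel_measurable_diff m1 a b)
      fix v
      have "\<bar>p - q\<bar> \<le> 1" if "0 \<le> p" "p \<le> 1" "0 \<le> q" "q \<le> 1" for p q :: real using that by linarith
      then show "\<bar>?h v\<bar> \<le> 1" using sq1 by simp
    qed
    also have "\<dots> \<le> (\<integral>\<^sup>+v. ennreal (8 * L\<^sup>2) * (d u + d v) \<partial>leb01)"
    proof (rule nn_integral_mono)
      fix v
      have "(?h v)\<^sup>2 = (\<phi> (a u - a v) - \<phi> (b u - b v))\<^sup>2 * (\<phi> (a u - a v) + \<phi> (b u - b v))\<^sup>2"
        by (simp add: power_mult_distrib[symmetric] power2_eq_square algebra_simps)
      also have "\<dots> \<le> (2 * L\<^sup>2 * ((a u - b u)\<^sup>2 + (a v - b v)\<^sup>2)) * 2\<^sup>2"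
      proof (intro mult_mono phi_sq)
        have "\<bar>\<phi> (a u - a v) + \<phi> (b u - b v)\<bar> \<le> 2" using b1[of "a u - a v"] b1[of "b u - b v"] by linarith
        then show "(\<phi> (a u - a v) + \<phi> (b u - b v))\<^sup>2 \<le> 2\<^sup>2" by (metis abs_numeral abs_le_square_iff)
      qed auto
      also have "\<dots> = 8 * L\<^sup>2 * ((a u - b u)\<^sup>2 + (a v - b v)\<^sup>2)" by simp
      finally have "ennreal ((?h v)\<^sup>2) \<le> ennreal (8 * L\<^sup>2 * ((a u - b u)\<^sup>2 + (a v - b v)\<^sup>2))" by (rule ennreal_leI)
      also have "\<dots> = ennreal (8 * L\<^sup>2) * (d u + d v)"
        by (subst ennreal_mult) (auto simp: d_def ennreal_plus)
      finally show "ennreal ((?h v)\<^sup>2) \<le> ennreal (8 * L\<^sup>2) * (d u + d v)" .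
    qed
    also have "\<dots> = ennreal (8 * L\<^sup>2) * (d u + S)"
      using leb01.emeasure_space_1 by (simp add: nn_integral_cmult nn_integral_add S_def)
    finally show ?thesis .
  qed
  define c1 where "c1 = 4 * L\<^sup>2 / \<epsilon>\<^sup>2"
  define c2 where "c2 = 16 * L\<^sup>2 / \<epsilon> ^ 4"
  have c: "0 \<le> c1" "0 \<le> c2" by (auto simp: c1_def c2_def)
  have pt: "ennreal ((kernel \<phi> \<epsilon> a u u' - kernel \<phi> \<epsilon> b u u')\<^sup>2) \<le> ennreal c1 * (d u + d u') + ennreal c2 * (d u + S)" for u u'
  proof -
    have "0 \<le> m c u" for c by (simp add: m_def)
    then have "(kernel \<phi> \<epsilon> a u u' - kernel \<phi> \<epsilon> b u u')\<^sup>2 \<le>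
        2 / \<epsilon>\<^sup>2 * (\<phi> (a u - a u') - \<phi> (b u - b u'))\<^sup>2 + 2 / \<epsilon> ^ 4 * ((\<epsilon> + m a u) - (\<epsilon> + m b u))\<^sup>2"
      unfolding kernel_def m_def[symmetric] using e b1 by (intro fraction_diff_square) auto
    also have "\<dots> \<le> 2 / \<epsilon>\<^sup>2 * (2 * L\<^sup>2 * ((a u - b u)\<^sup>2 + (a u' - b u')\<^sup>2)) + 2 / \<epsilon> ^ 4 * (m a u - m b u)\<^sup>2"
      using phi_sq by (intro add_mono mult_left_mono) auto
    also have "\<dots> = c1 * ((a u - b u)\<^sup>2 + (a u' - b u')\<^sup>2) + 2 / \<epsilon> ^ 4 * (m a u - m b u)\<^sup>2"
      by (simp add: c1_def)
    finally have "ennreal ((kernel \<phi> \<epsilon> a u u' - kernel \<phi> \<epsilon> b u u')\<^sup>2) \<le>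
      ennreal (c1 * ((a u - b u)\<^sup>2 + (a u' - b u')\<^sup>2) + 2 / \<epsilon> ^ 4 * (m a u - m b u)\<^sup>2)" by (rule ennreal_leI)
    also have "\<dots> = ennreal (c1 * ((a u - b u)\<^sup>2 + (a u' - b u')\<^sup>2)) + ennreal (2 / \<epsilon> ^ 4 * (m a u - m b u)\<^sup>2)"
      using c by (intro ennreal_plus) auto
    also have "ennreal (c1 * ((a u - b u)\<^sup>2 + (a u' - b u')\<^sup>2)) = ennreal c1 * (d u + d u')"
      using c by (subst ennreal_mult) (auto simp: d_def ennreal_plus)
    also have "ennreal (2 / \<epsilon> ^ 4 * (m a u - m b u)\<^sup>2) = ennreal (2 / \<epsilon> ^ 4) * ennreal ((m a u - m b u)\<^sup>2)"
      by (rule ennreal_mult) auto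
    also have "ennreal c1 * (d u + d u') + ennreal (2 / \<epsilon> ^ 4) * ennreal ((m a u - m b u)\<^sup>2)
      \<le> ennreal c1 * (d u + d u') + ennreal (2 / \<epsilon> ^ 4) * (ennreal (8 * L\<^sup>2) * (d u + S))"
      by (intro add_left_mono mult_left_mono mm) auto
    also have "ennreal (2 / \<epsilon> ^ 4) * (ennreal (8 * L\<^sup>2) * (d u + S)) = ennreal c2 * (d u + S)"
    proof -
      have "ennreal (2 / \<epsilon> ^ 4) * ennreal (8 * L\<^sup>2) = ennreal c2"
        unfolding c2_def by (subst ennreal_mult[symmetric]) auto
      then show ?thesis by (simp only: mult.assoc[symmetric])
    qed
    finally show ?thesis .
  qed
  have "(\<integral>\<^sup>+u. \<integral>\<^sup>+u'. ennreal ((kernel \<phi> \<epsilon> a u u' - kernel \<phi> \<epsilon> b u u')\<^sup>2) \<partial>leb01 \<partial>leb01)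
     \<le> (\<integral>\<^sup>+u. \<integral>\<^sup>+u'. ennreal c1 * (d u + d u') + ennreal c2 * (d u + S) \<partial>leb01 \<partial>leb01)"
    using pt by (intro nn_integral_mono)
  also have "\<dots> = (\<integral>\<^sup>+u. ennreal c1 * (d u + S) + ennreal c2 * (d u + S) \<partial>leb01)"
    using leb01.emeasure_space_1 by (intro nn_integral_cong) (simp add: nn_integral_cmult nn_integral_add S_def)
  also have "\<dots> = ennreal c1 * (S + S) + ennreal c2 * (S + S)"
    using leb01.emeasure_space_1 by (simp add: nn_integral_cmult nn_integral_add S_def)
  also have "\<dots> = ennreal (8 * L\<^sup>2 / \<epsilon>\<^sup>2 + 32 * L\<^sup>2 / \<epsilon> ^ 4) * S"
  proof -
    have "ennreal c1 * (S + S) + ennreal c2 * (S + S) = (ennreal c1 + ennreal c1 + (ennreal c2 + ennreal c2)) * S"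
      by (simp only: distrib_left distrib_right add_ac)
    also have "ennreal c1 + ennreal c1 + (ennreal c2 + ennreal c2) = ennreal ((c1 + c1) + (c2 + c2))"
      by (simp only: ennreal_plus add_nonneg_nonneg c)
    also have "(c1 + c1) + (c2 + c2) = 8 * L\<^sup>2 / \<epsilon>\<^sup>2 + 32 * L\<^sup>2 / \<epsilon> ^ 4" by (simp add: c1_def c2_def)
    finally show ?thesis .
  qed
  finally show ?thesis by (simp add: S_def d_def sqn_def)
qed

section \<open>Picard iteration and the fixed point\<close>

locale psi_setting = sheet_noise P W T for P :: "'a measure" and W T +
  fixes g \<phi> :: "real \<Rightarrow> real" and \<epsilon> L :: real
  assumes g_L2: "g \<in> L2_funs" and eps: "0 < \<epsilon>"
    and phi_measurable: "\<phi> \<in> borel_measurable borel" and phi_bound: "\<And>x. \<bar>\<phi> x\<bar> \<le> 1"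
    and L_nonneg: "0 \<le> L" and phi_lipschitz: "\<And>x y. \<bar>\<phi> x - \<phi> y\<bar> \<le> L * \<bar>x - y\<bar>"
begin

lemma psi_bounded_integrand:
  assumes z: "jointly_progressive T G z"
  shows "bounded_integrand P W T (\<lambda>\<omega> u u' s. psi_integrand \<phi> \<epsilon> z u \<omega> u' s) (1 / \<epsilon>)"
proof
  show "\<bar>psi_integrand \<phi> \<epsilon> z u \<omega> u' s\<bar> \<le> 1 / \<epsilon>" for \<omega> u u' s
    unfolding psi_integrand_kernel using eps phi_bound by (rule kernel_bound)
  fix t assume t: "0 \<le> t" "t \<le> T"
  let ?R = "restrict_space borel {0..t} :: real measure"
  have m: "(\<lambda>x. z (fst (snd x)) (snd (snd x)) (fst x)) \<in> borel_measurable (?R \<Otimes>\<^sub>M (G t \<Otimes>\<^sub>M leb01))"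
    using z t by (auto simp: jointly_progressive_def case_prod_beta')
  have p1: "(\<lambda>x. (fst x, fst (snd x), fst (snd (snd x)))) \<in> measurable (?R \<Otimes>\<^sub>M (G t \<Otimes>\<^sub>M (leb01 \<Otimes>\<^sub>M leb01))) (?R \<Otimes>\<^sub>M (G t \<Otimes>\<^sub>M leb01))"
    and p2: "(\<lambda>x. (fst x, fst (snd x), snd (snd (snd x)))) \<in> measurable (?R \<Otimes>\<^sub>M (G t \<Otimes>\<^sub>M (leb01 \<Otimes>\<^sub>M leb01))) (?R \<Otimes>\<^sub>M (G t \<Otimes>\<^sub>M leb01))"
    and p3: "(\<lambda>x. (fst (fst x), fst (snd (fst x)), snd x)) \<in> measurable ((?R \<Otimes>\<^sub>M (G t \<Otimes>\<^sub>M leb01)) \<Otimes>\<^sub>M leb01) (?R \<Otimes>\<^sub>M (G t \<Otimes>\<^sub>M leb01))"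
    by measurable
  have z1: "(\<lambda>x. z (fst (snd x)) (fst (snd (snd x))) (fst x)) \<in> borel_measurable (?R \<Otimes>\<^sub>M (G t \<Otimes>\<^sub>M (leb01 \<Otimes>\<^sub>M leb01)))"
    using measurable_compose[OF p1 m] by simp
  have z2: "(\<lambda>x. z (fst (snd x)) (snd (snd (snd x))) (fst x)) \<in> borel_measurable (?R \<Otimes>\<^sub>M (G t \<Otimes>\<^sub>M (leb01 \<Otimes>\<^sub>M leb01)))"
    using measurable_compose[OF p2 m] by simp
  have z3: "(\<lambda>x. z (fst (snd (fst x))) (snd x) (fst (fst x))) \<in> borel_measurable ((?R \<Otimes>\<^sub>M (G t \<Otimes>\<^sub>M leb01)) \<Otimes>\<^sub>M leb01)"
    using measurable_compose[OF p3 m] by simp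
  have z4: "(\<lambda>x. z (fst (snd (fst x))) (snd (snd (fst x))) (fst (fst x))) \<in> borel_measurable ((?R \<Otimes>\<^sub>M (G t \<Otimes>\<^sub>M leb01)) \<Otimes>\<^sub>M leb01)"
    by (rule measurable_compose[OF measurable_fst m])
  have sq: "(\<lambda>(x, v). (\<phi> (z (fst (snd x)) (snd (snd x)) (fst x) - z (fst (snd x)) v (fst x)))\<^sup>2) \<in> borel_measurable ((?R \<Otimes>\<^sub>M (G t \<Otimes>\<^sub>M leb01)) \<Otimes>\<^sub>M leb01)"
    using measurable_compose[OF borel_measurable_diff[OF z4 z3] phi_measurable] by (simp add: case_prod_beta')
  have ms: "(\<lambda>x. mass \<phi> z (fst (snd x)) (snd (snd x)) (fst x)) \<in> borel_measurable (?R \<Otimes>\<^sub>M (G t \<Otimes>\<^sub>M leb01))"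
    unfolding mass_def by (rule leb01.borel_measurable_lebesgue_integral[OF sq])
  have ms1: "(\<lambda>x. mass \<phi> z (fst (snd x)) (fst (snd (snd x))) (fst x)) \<in> borel_measurable (?R \<Otimes>\<^sub>M (G t \<Otimes>\<^sub>M (leb01 \<Otimes>\<^sub>M leb01)))"
    using measurable_compose[OF p1 ms] by simp
  have "(\<lambda>x. \<phi> (z (fst (snd x)) (fst (snd (snd x))) (fst x) - z (fst (snd x)) (snd (snd (snd x))) (fst x))
       / (\<epsilon> + mass \<phi> z (fst (snd x)) (fst (snd (snd x))) (fst x))) \<in> borel_measurable (?R \<Otimes>\<^sub>M (G t \<Otimes>\<^sub>M (leb01 \<Otimes>\<^sub>M leb01)))"
    by (intro borel_measurable_divide borel_measurable_add borel_measurable_const ms1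
        measurable_compose[OF borel_measurable_diff[OF z1 z2] phi_measurable])
  then show "(\<lambda>(s, \<omega>, u, u'). psi_integrand \<phi> \<epsilon> z u \<omega> u' s) \<in> borel_measurable (?R \<Otimes>\<^sub>M (G t \<Otimes>\<^sub>M (leb01 \<Otimes>\<^sub>M leb01)))"
    by (simp add: psi_integrand_def case_prod_beta')
qed

text \<open>\<open>y\<close> is a version of \<open>\<psi>(z)\<close>. No continuity of \<open>z\<close> is asked for, so that \<open>\<psi>\<close> can be applied to the
  limit of the Picard iterates before that limit is known to belong to \<open>\<M>\<close>.\<close>

definition psi_value :: "'a field_process \<Rightarrow> 'a field_process \<Rightarrow> bool" where
  "psi_value z y \<longleftrightarrow> jointly_progressive T G y \<and> y \<in> M_processes P T G \<and>
     (\<forall>t\<in>{0..T}. AE u in leb01. has_sheet_integral P T G w (psi_integrand \<phi> \<epsilon> z u) t (\<lambda>\<omega>. y \<omega> u t - g u))"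

lemma psi_value_exists: "jointly_progressive T G z \<Longrightarrow> \<exists>y. psi_value z y"
proof -
  assume "jointly_progressive T G z"
  then interpret bounded_integrand P W T "\<lambda>\<omega> u u' s. psi_integrand \<phi> \<epsilon> z u \<omega> u' s" "1 / \<epsilon>"
    by (rule psi_bounded_integrand)
  obtain y where "jointly_progressive T G y" "y \<in> M_processes P T G"
    "\<And>t. t \<in> {0..T} \<Longrightarrow> AE u in leb01. has_sheet_integral P T G w (\<lambda>\<omega> u' s. psi_integrand \<phi> \<epsilon> z u \<omega> u' s) t (\<lambda>\<omega>. y \<omega> u t - g u)"
    using continuous_integral[OF g_L2] by blast
  then show ?thesis unfolding psi_value_def by auto
qed

definition dist_sq :: "'a field_process \<Rightarrow> 'a field_process \<Rightarrow> real \<Rightarrow> ennreal" where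
  "dist_sq z z' t = sqn PU (\<lambda>q. z (fst q) (snd q) t - z' (fst q) (snd q) t)"

definition psi_lipschitz :: real where
  "psi_lipschitz = 16 * (8 * L\<^sup>2 / \<epsilon>\<^sup>2 + 32 * L\<^sup>2 / \<epsilon> ^ 4) + 1"

lemma psi_lipschitz_pos: "0 < psi_lipschitz"
  using eps by (auto simp: psi_lipschitz_def intro!: add_nonneg_pos add_nonneg_nonneg)

text \<open>For almost every \<open>u\<close> the stability of the sheet integral bounds the mean square distance of the
  values at \<open>u\<close>. Integrating over \<open>u\<close> and exchanging the integrals leaves, for each \<open>(\<omega>,s)\<close>, the
  integral to which the Lipschitz estimate of the kernel applies.\<close>

lemma psi_value_stability:
  assumes z: "jointly_progressive T G z" "jointly_progressive T G z'"
    and y: "psi_value z y" "psi_value z' y'" and t: "0 \<le> t" "t \<le> T"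
  shows "dist_sq y y' t \<le> ennreal psi_lipschitz * (\<integral>\<^sup>+s. dist_sq z z' s \<partial>slab t)"
proof -
  interpret PL: pair_sigma_finite P leb01 by unfold_locales
  interpret PS: pair_sigma_finite P "slab t" by unfold_locales
  interpret PSL: pair_sigma_finite "P \<Otimes>\<^sub>M slab t" leb01 by unfold_locales
  interpret B: bounded_integrand P W T "\<lambda>\<omega> u u' s. psi_integrand \<phi> \<epsilon> z u \<omega> u' s" "1 / \<epsilon>"
    by (rule psi_bounded_integrand[OF z(1)])
  interpret B': bounded_integrand P W T "\<lambda>\<omega> u u' s. psi_integrand \<phi> \<epsilon> z' u \<omega> u' s" "1 / \<epsilon>"
    by (rule psi_bounded_integrand[OF z(2)])
  define H where "H \<omega> u u' s = ennreal ((psi_integrand \<phi> \<epsilon> z u \<omega> u' s - psi_integrand \<phi> \<epsilon> z' u \<omega> u' s)\<^sup>2)" for \<omega> u u' s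
  define J where "J \<omega> s u = (\<integral>\<^sup>+u'. H \<omega> u u' s \<partial>leb01)" for \<omega> s u
  define N where "N \<omega> s = sqn leb01 (\<lambda>u. z \<omega> u s - z' \<omega> u s)" for \<omega> s
  define c where "c = 8 * L\<^sup>2 / \<epsilon>\<^sup>2 + 32 * L\<^sup>2 / \<epsilon> ^ 4"
  have c0: "0 \<le> c" by (simp add: c_def)
  have yp: "jointly_progressive T G y" "jointly_progressive T G y'" using y by (auto simp: psi_value_def)
  have idPG: "(\<lambda>\<omega>. \<omega>) \<in> measurable P (G t)" using t by (intro id_P_G)
  have Hm: "(\<lambda>(x, u'). H (fst (fst x)) (snd x) u' (snd (fst x))) \<in> borel_measurable (((P \<Otimes>\<^sub>M slab t) \<Otimes>\<^sub>M leb01) \<Otimes>\<^sub>M leb01)"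
  proof -
    note [measurable] = idPG
    have "(\<lambda>x. (snd (fst (fst x)), fst (fst (fst x)), snd (fst x), snd x)) \<in> measurable (((P \<Otimes>\<^sub>M slab t) \<Otimes>\<^sub>M leb01) \<Otimes>\<^sub>M leb01)
       (restrict_space borel {0..t} \<Otimes>\<^sub>M (G t \<Otimes>\<^sub>M (leb01 \<Otimes>\<^sub>M leb01)))" by measurable
    from borel_measurable_diff[OF measurable_compose[OF this B.prog[OF t]] measurable_compose[OF this B'.prog[OF t]]]
    show ?thesis by (simp add: H_def case_prod_beta')
  qed
  have Jm: "(\<lambda>(x, u). J (fst x) (snd x) u) \<in> borel_measurable ((P \<Otimes>\<^sub>M slab t) \<Otimes>\<^sub>M leb01)"
    using leb01.borel_measurable_nn_integral[OF Hm] by (simp add: J_def case_prod_beta')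
  have Nm: "(\<lambda>x. N (fst x) (snd x)) \<in> borel_measurable (P \<Otimes>\<^sub>M slab t)"
  proof -
    have "(\<lambda>x. (fst (fst x), snd (fst x), snd x)) \<in> measurable ((P \<Otimes>\<^sub>M slab t) \<Otimes>\<^sub>M leb01) (P \<Otimes>\<^sub>M (slab t \<Otimes>\<^sub>M leb01))" by measurable
    then have q: "(\<lambda>x. (fst (fst x), snd (fst x), snd x)) \<in> measurable ((P \<Otimes>\<^sub>M slab t) \<Otimes>\<^sub>M leb01) (Q t)" by (simp add: Q_def Box_def)
    from borel_measurable_diff[OF measurable_compose[OF q progressive_Q[OF z(1) t]] measurable_compose[OF q progressive_Q[OF z(2) t]]]
    have "(\<lambda>(x, u). ennreal ((z (fst x) u (snd x) - z' (fst x) u (snd x))\<^sup>2)) \<in> borel_measurable ((P \<Otimes>\<^sub>M slab t) \<Otimes>\<^sub>M leb01)"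
      by (simp add: case_prod_beta')
    from leb01.borel_measurable_nn_integral[OF this] show ?thesis by (simp add: N_def sqn_def)
  qed
  have ym: "(\<lambda>q. y (fst q) (snd q) t - y' (fst q) (snd q) t) \<in> borel_measurable PU"
    by (intro borel_measurable_diff progressive_section_PU yp t)
  have "dist_sq y y' t = (\<integral>\<^sup>+u. \<integral>\<^sup>+\<omega>. ennreal ((y \<omega> u t - y' \<omega> u t)\<^sup>2) \<partial>P \<partial>leb01)"
  proof -
    have "(\<lambda>q. ennreal ((y (fst q) (snd q) t - y' (fst q) (snd q) t)\<^sup>2)) \<in> borel_measurable PU" using ym by simp
    from PL.nn_integral_snd[OF this] show ?thesis by (simp add: dist_sq_def sqn_def)
  qed
  also have "\<dots> \<le> (\<integral>\<^sup>+u. 16 * (\<integral>\<^sup>+x. J (fst x) (snd x) u \<partial>(P \<Otimes>\<^sub>M slab t)) \<partial>leb01)"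
  proof (rule nn_integral_mono_AE)
    have "AE u in leb01. has_sheet_integral P T G w (psi_integrand \<phi> \<epsilon> z u) t (\<lambda>\<omega>. y \<omega> u t - g u)"
      "AE u in leb01. has_sheet_integral P T G w (psi_integrand \<phi> \<epsilon> z' u) t (\<lambda>\<omega>. y' \<omega> u t - g u)"
      using y t by (auto simp: psi_value_def)
    then show "AE u in leb01. (\<integral>\<^sup>+\<omega>. ennreal ((y \<omega> u t - y' \<omega> u t)\<^sup>2) \<partial>P) \<le> 16 * (\<integral>\<^sup>+x. J (fst x) (snd x) u \<partial>(P \<Otimes>\<^sub>M slab t))"
      using AE_space
    proof eventually_elim
      case (elim u)
      have pm: "(\<lambda>(\<omega>, s, u'). psi_integrand \<phi> \<epsilon> z u \<omega> u' s) \<in> borel_measurable (Q t)"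
        "(\<lambda>(\<omega>, s, u'). psi_integrand \<phi> \<epsilon> z' u \<omega> u' s) \<in> borel_measurable (Q t)"
        using elim(1,2) t by (auto simp: has_sheet_integral_def intro!: progressive_Q)
      have "(\<integral>\<^sup>+\<omega>. ennreal ((y \<omega> u t - y' \<omega> u t)\<^sup>2) \<partial>P) = sqn P (\<lambda>\<omega>. (y \<omega> u t - g u) - (y' \<omega> u t - g u))"
        by (simp add: sqn_def)
      also have "\<dots> \<le> 16 * sqn (Q t) (\<lambda>(\<omega>, s, u'). psi_integrand \<phi> \<epsilon> z u \<omega> u' s - psi_integrand \<phi> \<epsilon> z' u \<omega> u' s)"
        by (rule has_sheet_integral_stability[OF elim(1,2) t])
      also have "sqn (Q t) (\<lambda>(\<omega>, s, u'). psi_integrand \<phi> \<epsilon> z u \<omega> u' s - psi_integrand \<phi> \<epsilon> z' u \<omega> u' s)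
        = (\<integral>\<^sup>+\<omega>. \<integral>\<^sup>+s. J \<omega> s u \<partial>slab t \<partial>P)"
        using borel_measurable_diff[OF pm] by (subst sqn_Q) (auto simp: J_def H_def case_prod_beta')
      also have "\<dots> = (\<integral>\<^sup>+x. J (fst x) (snd x) u \<partial>(P \<Otimes>\<^sub>M slab t))"
      proof -
        have "(\<lambda>x. J (fst x) (snd x) u) \<in> borel_measurable (P \<Otimes>\<^sub>M slab t)"
          using measurable_compose[OF measurable_Pair2'[of u leb01 "P \<Otimes>\<^sub>M slab t"] Jm] elim(3) by simp
        from slab.nn_integral_fst[OF this] show ?thesis by simp
      qed
      finally show ?case .
    qed
  qed
  also have "\<dots> = 16 * (\<integral>\<^sup>+u. \<integral>\<^sup>+x. J (fst x) (snd x) u \<partial>(P \<Otimes>\<^sub>M slab t) \<partial>leb01)"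
  proof (rule nn_integral_cmult)
    have "(\<lambda>(u, x). J (fst x) (snd x) u) \<in> borel_measurable (leb01 \<Otimes>\<^sub>M (P \<Otimes>\<^sub>M slab t))"
      using measurable_pair_swap[OF Jm] by simp
    then show "(\<lambda>u. \<integral>\<^sup>+x. J (fst x) (snd x) u \<partial>(P \<Otimes>\<^sub>M slab t)) \<in> borel_measurable leb01"
      by (rule sigma_finite_measure.borel_measurable_nn_integral[OF PS.sigma_finite_measure_axioms])
  qed
  also have "(\<integral>\<^sup>+u. \<integral>\<^sup>+x. J (fst x) (snd x) u \<partial>(P \<Otimes>\<^sub>M slab t) \<partial>leb01) = (\<integral>\<^sup>+x. \<integral>\<^sup>+u. J (fst x) (snd x) u \<partial>leb01 \<partial>(P \<Otimes>\<^sub>M slab t))"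
    by (rule PSL.Fubini'[OF Jm])
  also have "\<dots> \<le> (\<integral>\<^sup>+x. ennreal c * N (fst x) (snd x) \<partial>(P \<Otimes>\<^sub>M slab t))"
  proof (rule nn_integral_mono)
    fix x assume "x \<in> space (P \<Otimes>\<^sub>M slab t)"
    then obtain \<omega> s where x: "x = (\<omega>, s)" "\<omega> \<in> space P" "0 \<le> s" "s \<le> T" using t by (auto simp: space_pair_measure)
    have "(\<lambda>u. z \<omega> u s) \<in> borel_measurable leb01" "(\<lambda>u. z' \<omega> u s) \<in> borel_measurable leb01"
      using measurable_compose[OF measurable_Pair1'[OF x(2), of leb01] progressive_section_PU[OF z(1) x(3,4)]]
        measurable_compose[OF measurable_Pair1'[OF x(2), of leb01] progressive_section_PU[OF z(2) x(3,4)]] by auto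
    from kernel_lipschitz[OF eps phi_measurable phi_bound L_nonneg phi_lipschitz this]
    show "(\<integral>\<^sup>+u. J (fst x) (snd x) u \<partial>leb01) \<le> ennreal c * N (fst x) (snd x)"
      by (simp add: x J_def H_def psi_integrand_kernel N_def c_def)
  qed
  also have "\<dots> = ennreal c * (\<integral>\<^sup>+x. N (fst x) (snd x) \<partial>(P \<Otimes>\<^sub>M slab t))" by (rule nn_integral_cmult[OF Nm])
  also have "(\<integral>\<^sup>+x. N (fst x) (snd x) \<partial>(P \<Otimes>\<^sub>M slab t)) = (\<integral>\<^sup>+s. \<integral>\<^sup>+\<omega>. N \<omega> s \<partial>P \<partial>slab t)"
    using PS.nn_integral_snd[OF Nm] by simp
  also have "\<dots> = (\<integral>\<^sup>+s. dist_sq z z' s \<partial>slab t)"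
  proof (rule nn_integral_cong)
    fix s assume "s \<in> space (slab t)"
    then have s: "0 \<le> s" "s \<le> T" using t by auto
    show "(\<integral>\<^sup>+\<omega>. N \<omega> s \<partial>P) = dist_sq z z' s"
      unfolding dist_sq_def N_def
      using sqn_PU[OF borel_measurable_diff[OF progressive_section_PU[OF z(1) s] progressive_section_PU[OF z(2) s]]] by simp
  qed
  finally have "dist_sq y y' t \<le> 16 * (ennreal c * (\<integral>\<^sup>+s. dist_sq z z' s \<partial>slab t))"
    by (simp add: mult_left_mono)
  also have "\<dots> = ennreal (16 * c) * (\<integral>\<^sup>+s. dist_sq z z' s \<partial>slab t)"
    using c0 by (simp add: ennreal_mult mult.assoc)
  also have "\<dots> \<le> ennreal psi_lipschitz * (\<integral>\<^sup>+s. dist_sq z z' s \<partial>slab t)"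
    by (intro mult_right_mono ennreal_leI) (auto simp: psi_lipschitz_def c_def)
  finally show ?thesis .
qed

lemma dist_sq_zero_M_eq:
  assumes "jointly_progressive T G y" "jointly_progressive T G y'" "y \<in> M_processes P T G" "y' \<in> M_processes P T G"
    and z: "\<And>t. 0 \<le> t \<Longrightarrow> t \<le> T \<Longrightarrow> dist_sq y y' t = 0"
  shows "(y, y') \<in> M_eq P T G"
proof (rule M_eqI[OF assms(3,4)])
  interpret PL: pair_sigma_finite P leb01 by unfold_locales
  fix t assume t: "0 \<le> t" "t \<le> T"
  have "(\<lambda>q. y (fst q) (snd q) t - y' (fst q) (snd q) t) \<in> borel_measurable PU"
    by (intro borel_measurable_diff progressive_section_PU assms t)
  then have "AE q in PU. y (fst q) (snd q) t - y' (fst q) (snd q) t = 0"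
    using z[OF t] by (simp only: dist_sq_def sqn_zero_iff)
  from PL.AE_pair[OF this] show "AE \<omega> in P. AE u in leb01. y \<omega> u t = y' \<omega> u t" by simp
qed

lemma M_eq_dist_sq_zero:
  assumes "jointly_progressive T G y" "jointly_progressive T G y'" "(y, y') \<in> M_eq P T G" and t: "0 \<le> t" "t \<le> T"
  shows "dist_sq y y' t = 0"
proof -
  have ae: "AE \<omega> in P. \<forall>t\<in>{0..T}. AE u in leb01. y \<omega> u t = y' \<omega> u t" using assms(3) by (auto simp: M_eq_def)
  have "dist_sq y y' t = (\<integral>\<^sup>+\<omega>. sqn leb01 (\<lambda>u. y \<omega> u t - y' \<omega> u t) \<partial>P)"
    unfolding dist_sq_def
    using sqn_PU[OF borel_measurable_diff[OF progressive_section_PU[OF assms(1) t] progressive_section_PU[OF assms(2) t]]] by simp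
  also have "\<dots> = (\<integral>\<^sup>+\<omega>. 0 \<partial>P)"
  proof (rule nn_integral_cong_AE, use ae in eventually_elim)
    fix \<omega> assume "\<forall>t\<in>{0..T}. AE u in leb01. y \<omega> u t = y' \<omega> u t"
    then have "AE u in leb01. y \<omega> u t = y' \<omega> u t" using t by simp
    then have "AE u in leb01. y \<omega> u t - y' \<omega> u t = 0" by eventually_elim simp
    then have "sqn leb01 (\<lambda>u. y \<omega> u t - y' \<omega> u t) = sqn leb01 (\<lambda>u. 0)" by (rule sqn_cong_AE)
    then show "sqn leb01 (\<lambda>u. y \<omega> u t - y' \<omega> u t) = 0" by (simp add: sqn_def)
  qed
  finally show ?thesis by simp
qed

lemma dist_sq_triangle:
  assumes "jointly_progressive T G x" "jointly_progressive T G y" "jointly_progressive T G z" "0 \<le> t" "t \<le> T"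
  shows "dist_sq x z t \<le> 2 * dist_sq x y t + 2 * dist_sq y z t"
  unfolding dist_sq_def by (intro sqn_triangle progressive_section_PU assms)

lemma dist_sq_bounded:
  assumes "jointly_progressive T G y" "jointly_progressive T G z" "y \<in> M_processes P T G" "z \<in> M_processes P T G"
  obtains B where "B < \<infinity>" "\<And>t. 0 \<le> t \<Longrightarrow> t \<le> T \<Longrightarrow> dist_sq y z t \<le> B"
proof (rule that)
  show "2 * M_norm_sq P T y + 2 * M_norm_sq P T z < \<infinity>"
    using assms(3,4) by (auto simp: M_processes_def ennreal_mult_less_top)
  fix t assume t: "0 \<le> t" "t \<le> T"
  have "dist_sq y z t \<le> 2 * sqn PU (\<lambda>q. y (fst q) (snd q) t) + 2 * sqn PU (\<lambda>q. - z (fst q) (snd q) t)"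
    unfolding dist_sq_def diff_conv_add_uminus
    using progressive_section_PU[OF assms(1) t] progressive_section_PU[OF assms(2) t] by (intro sqn_add) auto
  also have "sqn PU (\<lambda>q. - z (fst q) (snd q) t) = sqn PU (\<lambda>q. z (fst q) (snd q) t)" by (simp add: sqn_def)
  also have "2 * sqn PU (\<lambda>q. y (fst q) (snd q) t) + 2 * sqn PU (\<lambda>q. z (fst q) (snd q) t) \<le> 2 * M_norm_sq P T y + 2 * M_norm_sq P T z"
    using assms t by (intro add_mono mult_left_mono M_norm_bound) auto
  finally show "dist_sq y z t \<le> 2 * M_norm_sq P T y + 2 * M_norm_sq P T z" .
qed

lemma dist_sq_cong:
  assumes "jointly_progressive T G z" "jointly_progressive T G z'" "jointly_progressive T G y" "jointly_progressive T G y'"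
    and zy: "(z, y) \<in> M_eq P T G" "(z', y') \<in> M_eq P T G" and t: "0 \<le> t" "t \<le> T"
  shows "dist_sq z z' t = dist_sq y y' t"
proof -
  have ae: "AE q in PU. a (fst q) (snd q) t = b (fst q) (snd q) t"
    if ab: "jointly_progressive T G a" "jointly_progressive T G b" "(a, b) \<in> M_eq P T G" for a b
  proof -
    have "(\<lambda>q. a (fst q) (snd q) t - b (fst q) (snd q) t) \<in> borel_measurable PU"
      by (intro borel_measurable_diff progressive_section_PU ab t)
    then have "AE q in PU. a (fst q) (snd q) t - b (fst q) (snd q) t = 0"
      using M_eq_dist_sq_zero[OF ab t] by (simp only: dist_sq_def sqn_zero_iff)
    then show ?thesis by eventually_elim simp
  qed
  have "AE q in PU. z (fst q) (snd q) t - z' (fst q) (snd q) t = y (fst q) (snd q) t - y' (fst q) (snd q) t"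
    using ae[OF assms(1,3) zy(1)] ae[OF assms(2,4) zy(2)] by eventually_elim simp
  then show ?thesis unfolding dist_sq_def by (rule sqn_cong_AE)
qed

text \<open>For fixed classes the distance of the values is the distance of the arguments, so the distance is
  bounded by a multiple of its own integral.\<close>

lemma fixed_psi_value_unique:
  assumes z: "jointly_progressive T G z" "psi_value z y" "(z, y) \<in> M_eq P T G"
    and z': "jointly_progressive T G z'" "psi_value z' y'" "(z', y') \<in> M_eq P T G"
  shows "(z, z') \<in> M_eq P T G"
proof (rule dist_sq_zero_M_eq[OF z(1) z'(1)])
  show M: "z \<in> M_processes P T G" "z' \<in> M_processes P T G" using z(3) z'(3) by (auto simp: M_eq_def)
  have yj: "jointly_progressive T G y" "jointly_progressive T G y'" using z(2) z'(2) by (auto simp: psi_value_def)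
  fix t assume t: "0 \<le> t" "t \<le> T"
  obtain B where B: "B < \<infinity>" "\<And>t. 0 \<le> t \<Longrightarrow> t \<le> T \<Longrightarrow> dist_sq z z' t \<le> B"
    using dist_sq_bounded[OF z(1) z'(1) M] by blast
  have self: "dist_sq z z' s \<le> ennreal psi_lipschitz * (\<integral>\<^sup>+r. dist_sq z z' r \<partial>slab s)" if "0 \<le> s" "s \<le> T" for s
    using psi_value_stability[OF z(1) z'(1) z(2) z'(2) that] dist_sq_cong[OF z(1) z'(1) yj z(3) z'(3) that] by simp
  show "dist_sq z z' t = 0"
  proof (rule geometric_zero)
    show "B * ennreal (exp (4 * psi_lipschitz * T)) < \<infinity>" using B(1) by (simp add: ennreal_mult_less_top)
    show "dist_sq z z' t \<le> B * ennreal (exp (4 * psi_lipschitz * T)) * ennreal ((1/4) ^ n)" for n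
      by (rule volterra_iterate[OF psi_lipschitz_pos B(2) self t])
  qed
qed

text \<open>The limit \<open>x\<close> of the Picard iterates is progressive, and \<open>y = \<psi>(x)\<close> agrees with \<open>x\<close> at every time.
  Then \<open>\<psi>(y)\<close> agrees with \<open>\<psi>(x) = y\<close>; unlike \<open>x\<close>, the process \<open>y\<close> has continuous paths.\<close>

lemma fixed_psi_value_exists:
  obtains z y where "jointly_progressive T G z" "z \<in> M_processes P T G" "psi_value z y" "(z, y) \<in> M_eq P T G"
proof -
  define step_out where "step_out z = (SOME y. psi_value z y)" for z
  have step_out: "psi_value z (step_out z)" if "jointly_progressive T G z" for z
    unfolding step_out_def using psi_value_exists[OF that] by (rule someI_ex)
  define z0 :: "'a field_process" where "z0 \<omega> u t = g u + 0" for \<omega> u t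
  define z where "z n = (step_out ^^ n) z0" for n
  have z0: "jointly_progressive T G z0" "z0 \<in> M_processes P T G"
  proof -
    have a: "jointly_progressive T G (\<lambda>_ _ _. 0)" by (simp add: jointly_progressive_def)
    have b: "L2_continuous T (\<lambda>_ _. 0)" by (simp add: L2_continuous_def L2_funs_iff sqn_def L2_norm_def)
    show "jointly_progressive T G z0" "z0 \<in> M_processes P T G"
      unfolding z0_def using path_plus_M_process[of "\<lambda>_ _ _. 0" "\<lambda>_. 0", OF a b _ _ _ g_L2] by (auto simp: sqn_def)
  qed
  have zS: "z (Suc n) = step_out (z n)" for n by (simp add: z_def)
  have zj: "jointly_progressive T G (z n)" for n
  proof (induction n)
    case 0 show ?case by (simp add: z_def z0)
  next
    case (Suc n) then show ?case using step_out[OF Suc] by (simp add: zS psi_value_def)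
  qed
  have zo: "psi_value (z n) (z (Suc n))" for n using step_out[OF zj] by (simp add: zS)
  have z1: "z (Suc 0) \<in> M_processes P T G" using zo[of 0] by (simp add: psi_value_def)
  have "z 0 \<in> M_processes P T G" by (simp add: z_def z0)
  then obtain B where B: "B < \<infinity>" "\<And>t. 0 \<le> t \<Longrightarrow> t \<le> T \<Longrightarrow> dist_sq (z (Suc 0)) (z 0) t \<le> B"
    using dist_sq_bounded[OF zj zj z1] by blast
  define C where "C = B * ennreal (exp (4 * psi_lipschitz * T))"
  have C: "C < \<infinity>" using B(1) by (simp add: C_def ennreal_mult_less_top)
  have inc: "dist_sq (z (Suc n)) (z n) t \<le> C * ennreal ((1/4) ^ n)" if "0 \<le> t" "t \<le> T" for n t
    unfolding C_def
    by (rule volterra_iterate[where h = "\<lambda>n. dist_sq (z (Suc n)) (z n)", OF psi_lipschitz_pos B(2) psi_value_stability[OF zj zj zo zo] that])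
  define x where "x \<omega> u t = flim (\<lambda>n q. z n (fst q) (snd q) t) (\<omega>, u)" for \<omega> u t
  have xj: "jointly_progressive T G x"
    unfolding jointly_progressive_def
  proof
    fix t assume "t \<in> {0..T}"
    then have "(\<lambda>(s, \<omega>, u). z n \<omega> u s) \<in> borel_measurable (restrict_space borel {0..t} \<Otimes>\<^sub>M (G t \<Otimes>\<^sub>M leb01))" for n
      using zj[of n] by (auto simp: jointly_progressive_def)
    then have "flim (\<lambda>n (s, \<omega>, u). z n \<omega> u s) \<in> borel_measurable (restrict_space borel {0..t} \<Otimes>\<^sub>M (G t \<Otimes>\<^sub>M leb01))"
      by (rule flim_measurable)
    also have "flim (\<lambda>n (s, \<omega>, u). z n \<omega> u s) = (\<lambda>(s, \<omega>, u). x \<omega> u s)"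
      by (auto simp: fun_eq_iff flim_def x_def)
    finally show "(\<lambda>(s, \<omega>, u). x \<omega> u s) \<in> borel_measurable (restrict_space borel {0..t} \<Otimes>\<^sub>M (G t \<Otimes>\<^sub>M leb01))" .
  qed
  have lim: "dist_sq (z n) x t \<le> 4 * C * ennreal ((1/4) ^ n)" if t: "0 \<le> t" "t \<le> T" for n t
  proof -
    have "finite_measure PU" by (intro finite_measure_pair_measure) (unfold_locales)
    from fast_cauchy(2)[of PU "\<lambda>n q. z n (fst q) (snd q) t" C, OF this progressive_section_PU[OF zj t] C inc[OF t, unfolded dist_sq_def]]
    show ?thesis by (simp add: dist_sq_def x_def)
  qed
  obtain y where y: "psi_value x y" using psi_value_exists[OF xj] by blast
  then have yj: "jointly_progressive T G y" and yM: "y \<in> M_processes P T G" by (auto simp: psi_value_def)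
  have yx: "dist_sq y x t = 0" if t: "0 \<le> t" "t \<le> T" for t
  proof (rule geometric_zero)
    define D where "D = 2 * (ennreal psi_lipschitz * (4 * C * ennreal T)) + 2 * (4 * C)"
    show "D < \<infinity>" using C by (simp add: D_def ennreal_mult_less_top)
    fix n
    have "dist_sq (z (Suc n)) y t \<le> ennreal psi_lipschitz * (\<integral>\<^sup>+s. dist_sq (z n) x s \<partial>slab t)"
      by (rule psi_value_stability[OF zj xj zo y t])
    also have "\<dots> \<le> ennreal psi_lipschitz * (\<integral>\<^sup>+s. 4 * C * ennreal ((1/4) ^ n) \<partial>slab t)"
      using t lim by (intro mult_left_mono nn_integral_mono) auto
    also have "\<dots> = ennreal psi_lipschitz * (4 * C * ennreal ((1/4) ^ n) * ennreal t)"
      using t by (simp add: emeasure_slab)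
    also have "\<dots> \<le> ennreal psi_lipschitz * (4 * C * ennreal ((1/4) ^ n) * ennreal T)"
      using t by (intro mult_left_mono ennreal_leI) auto
    finally have 1: "dist_sq (z (Suc n)) y t \<le> ennreal psi_lipschitz * (4 * C * ennreal T) * ennreal ((1/4) ^ n)"
      by (simp add: mult_ac)
    have 2: "dist_sq (z (Suc n)) x t \<le> 4 * C * ennreal ((1/4) ^ n)"
      by (rule order_trans[OF lim[OF t]]) (intro mult_left_mono ennreal_leI power_decreasing, auto)
    have "dist_sq y x t \<le> 2 * dist_sq y (z (Suc n)) t + 2 * dist_sq (z (Suc n)) x t"
      by (rule dist_sq_triangle[OF yj zj xj t])
    also have "dist_sq y (z (Suc n)) t = dist_sq (z (Suc n)) y t"
      unfolding dist_sq_def by (rule sqn_minus_commute)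
    also have "2 * dist_sq (z (Suc n)) y t + 2 * dist_sq (z (Suc n)) x t \<le>
        2 * (ennreal psi_lipschitz * (4 * C * ennreal T) * ennreal ((1/4) ^ n)) + 2 * (4 * C * ennreal ((1/4) ^ n))"
      using 1 2 by (intro add_mono mult_left_mono) auto
    also have "\<dots> = D * ennreal ((1/4) ^ n)" by (simp only: D_def distrib_right mult.assoc)
    finally show "dist_sq y x t \<le> D * ennreal ((1/4) ^ n)" .
  qed
  obtain y2 where y2: "psi_value y y2" using psi_value_exists[OF yj] by blast
  have "dist_sq y y2 t = 0" if t: "0 \<le> t" "t \<le> T" for t
  proof -
    have "dist_sq y2 y t \<le> ennreal psi_lipschitz * (\<integral>\<^sup>+s. dist_sq y x s \<partial>slab t)"
      by (rule psi_value_stability[OF yj xj y2 y t])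
    also have "(\<integral>\<^sup>+s. dist_sq y x s \<partial>slab t) = (\<integral>\<^sup>+s. 0 \<partial>slab t)"
      using t yx by (intro nn_integral_cong) auto
    finally show ?thesis unfolding dist_sq_def by (simp add: sqn_minus_commute[of PU "\<lambda>q. y (fst q) (snd q) t"])
  qed
  then have "(y, y2) \<in> M_eq P T G"
    using y2 by (intro dist_sq_zero_M_eq yj yM) (auto simp: psi_value_def)
  with yj yM y2 show thesis by (rule that)
qed

abbreviation "\<Psi> \<equiv> psi P T G w \<phi> \<epsilon> g"

text \<open>The value of \<open>\<psi>\<close> on a class is the full class of any version of the integral, by stability.\<close>

lemma psi_class:
  assumes Z: "Z \<in> M_space P T G" and z: "z \<in> Z" "jointly_progressive T G z" and y: "psi_value z y"
  shows "\<Psi> Z = M_eq P T G `` {y}"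
proof (intro equalityI subsetI)
  fix x assume "x \<in> M_eq P T G `` {y}"
  then have yx: "(y, x) \<in> M_eq P T G" by simp
  show "x \<in> \<Psi> Z"
    unfolding psi_def
    by (intro CollectI bexI[of _ z] exI[of _ y] conjI yx z) (use y in \<open>auto simp: psi_value_def\<close>)
next
  fix x assume "x \<in> \<Psi> Z"
  then obtain z' y' where x: "z' \<in> Z" "jointly_progressive T G z'" "jointly_progressive T G y'" "(y', x) \<in> M_eq P T G"
    "\<forall>t\<in>{0..T}. AE u in leb01. has_sheet_integral P T G w (psi_integrand \<phi> \<epsilon> z' u) t (\<lambda>\<omega>. y' \<omega> u t - g u)"
    unfolding psi_def by blast
  have y'M: "y' \<in> M_processes P T G" using x(4) by (auto simp: M_eq_def)
  have y': "psi_value z' y'" using x y'M by (simp add: psi_value_def)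
  have zz: "(z, z') \<in> M_eq P T G"
    using Z z(1) x(1) unfolding M_space_def by (intro quotient_eq_iff[OF M_eq_equiv, THEN iffD1, OF _ _ _ _ refl]) auto
  have "(y, y') \<in> M_eq P T G"
  proof (rule dist_sq_zero_M_eq)
    fix t assume t: "0 \<le> t" "t \<le> T"
    have "dist_sq y y' t \<le> ennreal psi_lipschitz * (\<integral>\<^sup>+s. dist_sq z z' s \<partial>slab t)"
      by (rule psi_value_stability[OF z(2) x(2) y y' t])
    also have "(\<integral>\<^sup>+s. dist_sq z z' s \<partial>slab t) = (\<integral>\<^sup>+s. 0 \<partial>slab t)"
      using t M_eq_dist_sq_zero[OF z(2) x(2) zz] by (intro nn_integral_cong) auto
    finally show "dist_sq y y' t = 0" by simp
  qed (use y y'M x in \<open>auto simp: psi_value_def\<close>)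
  with x(4) show "x \<in> M_eq P T G `` {y}"
    using M_eq_equiv by (auto simp: equiv_def elim: transE)
qed

lemma class_representative:
  assumes "Z \<in> M_space P T G"
  obtains z where "z \<in> Z" "jointly_progressive T G z" "z \<in> M_processes P T G" "Z = M_eq P T G `` {z}"
proof -
  obtain z0 where z0: "z0 \<in> M_processes P T G" "Z = M_eq P T G `` {z0}"
    using assms unfolding M_space_def by (rule quotientE)
  obtain z where z: "jointly_progressive T G z" "(z, z0) \<in> M_eq P T G"
    using exists_progressive_representative[OF z0(1)] .
  have eq: "M_eq P T G `` {z} = Z" using equiv_class_eq[OF M_eq_equiv z(2)] z0(2) by simp
  have zM: "z \<in> M_processes P T G" using z(2) by (auto simp: M_eq_def)
  then have "z \<in> Z" using equiv_class_self[OF M_eq_equiv zM] eq by simp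
  then show thesis using z(1) zM eq that by blast
qed

lemma psi_maps: "Z \<in> M_space P T G \<Longrightarrow> \<Psi> Z \<in> M_space P T G"
proof -
  assume Z: "Z \<in> M_space P T G"
  obtain z where z: "z \<in> Z" "jointly_progressive T G z" using class_representative[OF Z] by metis
  obtain y where y: "psi_value z y" using psi_value_exists[OF z(2)] by blast
  then show ?thesis
    unfolding psi_class[OF Z z y] M_space_def by (intro quotientI) (simp add: psi_value_def)
qed

theorem psi_unique_fixed_point: "\<exists>!Z. Z \<in> M_space P T G \<and> \<Psi> Z = Z"
proof -
  obtain z y where z: "jointly_progressive T G z" "z \<in> M_processes P T G" "psi_value z y" "(z, y) \<in> M_eq P T G"
    using fixed_psi_value_exists by blast
  define Z where "Z = M_eq P T G `` {z}"
  have ZM: "Z \<in> M_space P T G" unfolding Z_def M_space_def using z(2) by (rule quotientI)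
  have "z \<in> Z" unfolding Z_def by (rule equiv_class_self[OF M_eq_equiv z(2)])
  then have "\<Psi> Z = M_eq P T G `` {y}" using psi_class[OF ZM _ z(1,3)] by blast
  then have fixZ: "\<Psi> Z = Z" unfolding Z_def using equiv_class_eq[OF M_eq_equiv z(4)] by simp
  show ?thesis
  proof (rule ex1I[of _ Z])
    show "Z \<in> M_space P T G \<and> \<Psi> Z = Z" using ZM fixZ by simp
    fix Z' assume Z': "Z' \<in> M_space P T G \<and> \<Psi> Z' = Z'"
    obtain z' where z': "z' \<in> Z'" "jointly_progressive T G z'" "z' \<in> M_processes P T G" "Z' = M_eq P T G `` {z'}"
      using class_representative Z' by blast
    obtain y' where y': "psi_value z' y'" using psi_value_exists[OF z'(2)] by blast
    have "Z' = M_eq P T G `` {y'}" using psi_class[OF _ z'(1,2) y'] Z' by simp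
    then have "(y', z') \<in> M_eq P T G" using z'(1) by simp
    then have "(z', y') \<in> M_eq P T G" using M_eq_equiv by (meson equiv_def symE)
    then have "(z', z) \<in> M_eq P T G" by (rule fixed_psi_value_unique[OF z'(2) y' _ z(1,3,4)])
    then show "Z' = Z" unfolding Z_def z'(4) by (rule equiv_class_eq[OF M_eq_equiv])
  qed
qed

end

text \<open>Where \<open>\<bar>g u\<bar>\<close> exceeds \<open>1\<close>, its square is dominated by the higher power; monotonicity gives
  measurability.\<close>

lemma integrable_powr_imp_L2:
  assumes mono: "mono_on {0..1} g" and p: "p > 2" and i: "integrable leb01 (\<lambda>u. \<bar>g u\<bar> powr p)"
  shows "g \<in> L2_funs"
proof -
  have "g \<in> borel_measurable (restrict_space borel {0..1})" by (rule borel_measurable_mono_on_fnc[OF mono])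
  then have gm: "g \<in> borel_measurable leb01"
    by (subst measurable_cong_sets[of leb01 "restrict_space borel {0..1}"]) (auto simp: sets_restrict_space)
  have "integrable leb01 (\<lambda>u. (g u)\<^sup>2)"
  proof (rule Bochner_Integration.integrable_bound)
    show "integrable leb01 (\<lambda>u. 1 + \<bar>g u\<bar> powr p)" using i by auto
    show "(\<lambda>u. (g u)\<^sup>2) \<in> borel_measurable leb01" using gm by simp
    show "AE u in leb01. norm ((g u)\<^sup>2) \<le> norm (1 + \<bar>g u\<bar> powr p)"
    proof (rule AE_I2)
      fix u
      have "(g u)\<^sup>2 \<le> 1 + \<bar>g u\<bar> powr p"
      proof (cases "\<bar>g u\<bar> \<le> 1")
        case True
        then have "(g u)\<^sup>2 \<le> 1" by (simp add: abs_square_le_1)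
        then show ?thesis by (simp add: add_increasing2)
      next
        case False
        then have "(g u)\<^sup>2 = \<bar>g u\<bar> powr 2" by (simp add: powr_numeral)
        also have "\<dots> \<le> \<bar>g u\<bar> powr p" using False p by (intro powr_mono) auto
        finally show ?thesis by simp
      qed
      then show "norm ((g u)\<^sup>2) \<le> norm (1 + \<bar>g u\<bar> powr p)" by simp
    qed
  qed
  then show ?thesis using gm by (simp add: L2_funs_def)
qed

theorem proposition3p5:
  fixes P :: "'a measure"
    and W :: "(real \<times> real) set \<Rightarrow> 'a \<Rightarrow> real"
    and w :: "real \<Rightarrow> real \<Rightarrow> 'a \<Rightarrow> real"
    and G :: "real \<Rightarrow> 'a measure"
    and g \<phi> :: "real \<Rightarrow> real"
    and T p \<sigma> \<epsilon> :: real
  assumes "prob_space P"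
    and "T > 0"
    and "white_noise P T W"
    and "w = brownian_sheet W"
    and "G = sheet_filtration P w"
    and "right_continuous_filtration T G"
    and "mono_on {0..1} g"
    and "cadlag01 g"
    and "p > 2"
    and "integrable leb01 (\<lambda>u. \<bar>g u\<bar> powr p)"
    and "\<sigma> > 0"
    and "\<epsilon> > 0"
    and "smooth_cutoff \<sigma> \<phi>"
  shows "psi P T G w \<phi> \<epsilon> g \<in> M_space P T G \<rightarrow> M_space P T G
    \<and> (\<exists>!Z. Z \<in> M_space P T G \<and> psi P T G w \<phi> \<epsilon> g Z = Z)"
proof -
  interpret N: sheet_noise P W T
    using assms(1-3) by (simp add: sheet_noise_def sheet_noise_axioms_def)
  obtain L where L: "0 \<le> L" "\<And>x y. \<bar>\<phi> x - \<phi> y\<bar> \<le> L * \<bar>x - y\<bar>"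
    using smooth_cutoff_lipschitz[OF assms(13,11)] by blast
  interpret S: psi_setting P W T g \<phi> \<epsilon> L
  proof
    show "g \<in> L2_funs" using assms(7,9,10) by (rule integrable_powr_imp_L2)
    show "\<phi> \<in> borel_measurable borel"
      using smooth_cutoff_continuous[OF assms(13)] by (rule borel_measurable_continuous_onI)
    show "\<bar>\<phi> x\<bar> \<le> 1" for x using assms(13) by (simp add: smooth_cutoff_def)
  qed (use assms(12) L in auto)
  show ?thesis
    unfolding assms(5) assms(4) using S.psi_maps S.psi_unique_fixed_point by blast
qed

end
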